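(* Let $g\ge 1$ be an integer and $\Gamma_0=\mathrm{Sp}_{2g}(\mathbb{Z})$. For every $\epsilon>0$ there is a constant $C>0$, depending only on $\Gamma_0$ (i.e. on $g$) and $\epsilon$, such that for all integers $k\ge g+1$ and $m\ge 1$ and every Jacobi cusp form $\phi\in J_{k,m}^{\mathrm{cusp}}(\Gamma_0)$ of weight $k$ and index $m$ for $\Gamma_0$ which is $L^2$-normalized, $\langle\phi,\phi\rangle_{\mathrm{Pet}}=1$, one has $$\Vert\phi\Vert_{L^\infty}^2=\sup_{(\tau,z)\in\mathbb{H}_g\times\mathbb{C}^g}\Vert\phi(\tau,z)\Vert_{\mathrm{Pet}}^2\le C\,k^{(3g^2+5g)/4}\,m^{2g^2+5g/2+\epsilon}.$$
   Context: $\mathbb{H}_g=\{\tau=\xi+i\eta : \xi,\eta\in\mathrm{Sym}_g(\mathbb{R}),\ \eta>0\}$ is the Siegel upper half-space; $\mathrm{Sp}_{2g}(\mathbb{R})$ acts on it by $\gamma\tau=(A\tau+B)(C\tau+D)^{-1}$ for $\gamma=\begin{pmatrix}A&B\\C&D\end{pmatrix}$. Elements of $\mathbb{C}^g$ are column vectors $z=x+iy$ with $x,y\in\mathbb{R}^g$. For integers $k,m\ge1$, $J_{k,m}^{\mathrm{cusp}}(\Gamma_0)$ is the complex vector space of holomorphic functions $\phi:\mathbb{H}_g\times\mathbb{C}^g\to\mathbb{C}$ such that: (1) for all $\gamma=\begin{pmatrix}A&B\\C&D\end{pmatrix}\in\Gamma_0$, all $\lambda,\mu\in\mathbb{Z}^g$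 and all $(\tau,z)$, writing $w=z+\tau\lambda+\mu$, $$\phi\big(\gamma\tau,((C\tau+D)^{t})^{-1}w\big)\det(C\tau+D)^{-k}\exp\!\big(2\pi i m(\lambda^t\tau\lambda+2\lambda^tz-w^t(C\tau+D)^{-1}C\,w)\big)=\phi(\tau,z);$$ (2) $\phi$ has a Fourier expansion $\phi(\tau,z)=\sum_{N,r}c(N,r)e^{2\pi i\,\mathrm{Tr}(N\tau)}e^{2\pi i r^tz}$, where $N$ runs over half-integral matrices in $\mathrm{Sym}_g(\mathbb{Q})$ (integral diagonal entries, off-diagonal entries in $\tfrac12\mathbb{Z}$) and $r$ over $\mathbb{Z}^g$, subject to $4mN-rr^t>0$ (positive definite). The pointwise Petersson norm is $$\Vert\phi(\tau,z)\Vert_{\mathrm{Pet}}^2=|\phi(\tau,z)|^2\det(\eta)^k e^{-4\pi m\,y^t\eta^{-1}y},$$ which is invariant under the action of $\Gamma_0\ltimes\mathbb{Z}^{2g}$ on $\mathbb{H}_g\times\mathbb{C}^g$ given by $(\tau,z)\mapsto(\gamma\tau,((C\tau+D)^{t})^{-1}(z+\tau\lambda+\mu))$. The Petersson inner product is $$\langle\phi_1,\phi_2\rangle_{\mathrm{Pet}}=\int_{\mathcal{D}_{\Gamma_0}}\phi_1(\tau,z)\overline{\phi_2(\tau,z)}\,\det(\eta)^{k}e^{-4\pi m\,y^t\eta^{-1}y}\,\frac{\prod_{1\le l\le j\le g}d\xi_{l,j}\,d\eta_{l,j}\,\prod_{n=1}^g dx_n\,dy_n}{\det(\eta)^{g+2}},$$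 where $\mathcal{D}_{\Gamma_0}$ is a fundamental domain for $\Gamma_0\ltimes\mathbb{Z}^{2g}$ acting on $\mathbb{H}_g\times\mathbb{C}^g$. *)

theory Defs
  imports "HOL-Analysis.Analysis"
begin

text \<open>
  The degree \<open>g \<ge> 1\<close> is \<open>CARD('n)\<close> for a finite index type \<open>'n\<close>. Points \<open>(\<tau>, z)\<close> of the
  Siegel--Jacobi space \<open>\<H>\<^sub>g \<times> \<complex>\<^sup>g\<close> are elements of \<open>complex^'n^'n \<times> complex^'n\<close>; functions on the
  space are total functions whose values outside of it are irrelevant.
\<close>

type_synonym 'n jacobi_point = "(complex^'n^'n) \<times> (complex^'n)"

definition map_vector :: "('a \<Rightarrow> 'b) \<Rightarrow> 'a^'n \<Rightarrow> 'b^'n" where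
  "map_vector f v = (\<chi> i. f (v $ i))"

text \<open>The product \<open>v\<^sup>t w\<close> is bilinear; the library's inner product on \<open>complex^'n\<close> is not.\<close>

definition bidot :: "complex^'n \<Rightarrow> complex^'n \<Rightarrow> complex" where
  "bidot v w = (\<Sum>i\<in>UNIV. v $ i * w $ i)"

definition pos_def :: "real^'n^'n \<Rightarrow> bool" where
  "pos_def A \<longleftrightarrow> transpose A = A \<and> (\<forall>v. v \<noteq> 0 \<longrightarrow> v \<bullet> (A *v v) > 0)"

definition siegel_space :: "(complex^'n^'n) set" where
  "siegel_space = {\<tau>. transpose \<tau> = \<tau> \<and> pos_def (map_matrix Im \<tau>)}"

definition siegel_jacobi :: "'n::finite jacobi_point set" where
  "siegel_jacobi = siegel_space \<times> UNIV"

definition blk_A :: "'a^('n+'n)^('n+'n) \<Rightarrow> 'a^'n^'n" where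
  "blk_A M = (\<chi> i j. M $ Inl i $ Inl j)"
definition blk_B :: "'a^('n+'n)^('n+'n) \<Rightarrow> 'a^'n^'n" where
  "blk_B M = (\<chi> i j. M $ Inl i $ Inr j)"
definition blk_C :: "'a^('n+'n)^('n+'n) \<Rightarrow> 'a^'n^'n" where
  "blk_C M = (\<chi> i j. M $ Inr i $ Inl j)"
definition blk_D :: "'a^('n+'n)^('n+'n) \<Rightarrow> 'a^'n^'n" where
  "blk_D M = (\<chi> i j. M $ Inr i $ Inr j)"

definition symplectic_form :: "'a::ring_1^('n::finite+'n)^('n+'n)" where
  "symplectic_form = (\<chi> p q. case (p, q) of
      (Inl i, Inr j) \<Rightarrow> (if i = j then 1 else 0)
    | (Inr i, Inl j) \<Rightarrow> (if i = j then - 1 else 0)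
    | _ \<Rightarrow> 0)"

definition Sp_int :: "(int^('n::finite+'n)^('n+'n)) set" where
  "Sp_int = {M. transpose M ** symplectic_form ** M = symplectic_form}"

abbreviation cmat :: "int^'n^'n \<Rightarrow> complex^'n^'n" where
  "cmat \<equiv> map_matrix of_int"

abbreviation cvec :: "int^'n \<Rightarrow> complex^'n" where
  "cvec \<equiv> map_vector of_int"

definition aut_factor :: "int^('n+'n)^('n+'n) \<Rightarrow> complex^'n^'n \<Rightarrow> complex^'n^'n" where
  "aut_factor M \<tau> = cmat (blk_C M) ** \<tau> + cmat (blk_D M)"

definition siegel_act :: "int^('n+'n)^('n+'n) \<Rightarrow> complex^'n^'n \<Rightarrow> complex^'n^'n" where
  "siegel_act M \<tau> = (cmat (blk_A M) ** \<tau> + cmat (blk_B M)) ** matrix_inv (aut_factor M \<tau>)"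

definition lattice_shift ::
    "int^'n \<Rightarrow> int^'n \<Rightarrow> complex^'n^'n \<Rightarrow> complex^'n \<Rightarrow> complex^'n" where
  "lattice_shift l u \<tau> z = z + \<tau> *v cvec l + cvec u"

definition jacobi_act ::
    "int^('n::finite+'n)^('n+'n) \<Rightarrow> int^'n \<Rightarrow> int^'n \<Rightarrow> 'n jacobi_point \<Rightarrow> 'n jacobi_point" where
  "jacobi_act M l u = (\<lambda>(\<tau>, z).
     (siegel_act M \<tau>,
      matrix_inv (transpose (aut_factor M \<tau>)) *v lattice_shift l u \<tau> z))"

text \<open>
  Holomorphy on the complex manifold \<open>\<H>\<^sub>g \<times> \<complex>\<^sup>g\<close>, which is relatively open in the complex subspace
  \<open>Sym\<^sub>g(\<complex>) \<times> \<complex>\<^sup>g\<close>: Frechet differentiability along this subspace with a complex linear derivative.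
  (Any complex linear map on the subspace extends to the ambient space, so it does no harm to ask
  for complex linearity there.)
\<close>

definition jacobi_scale :: "complex \<Rightarrow> 'n::finite jacobi_point \<Rightarrow> 'n jacobi_point" where
  "jacobi_scale c = (\<lambda>(A, v). (map_matrix ((*) c) A, c *s v))"

definition jacobi_holomorphic :: "('n::finite jacobi_point \<Rightarrow> complex) \<Rightarrow> bool" where
  "jacobi_holomorphic \<phi> \<longleftrightarrow>
     (\<forall>p\<in>siegel_jacobi. \<exists>\<phi>'. (\<phi> has_derivative \<phi>') (at p within siegel_jacobi) \<and>
        (\<forall>c v. \<phi>' (jacobi_scale c v) = c * \<phi>' v))"

definition jacobi_invariant :: "nat \<Rightarrow> nat \<Rightarrow> ('n::finite jacobi_point \<Rightarrow> complex) \<Rightarrow> bool" where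
  "jacobi_invariant k m \<phi> \<longleftrightarrow>
     (\<forall>M\<in>Sp_int. \<forall>l u. \<forall>(\<tau>, z)\<in>siegel_jacobi.
        (let w = lattice_shift l u \<tau> z; J = aut_factor M \<tau> in
         \<phi> (siegel_act M \<tau>, matrix_inv (transpose J) *v w)
           * inverse (det J) ^ k
           * exp (2 * of_real pi * \<i> * of_nat m *
               (bidot (cvec l) (\<tau> *v cvec l) + 2 * bidot (cvec l) z
                 - bidot w ((matrix_inv J ** cmat (blk_C M)) *v w)))
         = \<phi> (\<tau>, z)))"

definition half_integral :: "real^'n^'n \<Rightarrow> bool" where
  "half_integral N \<longleftrightarrow> transpose N = N \<and> (\<forall>i. N $ i $ i \<in> \<int>) \<and> (\<forall>i j. 2 * N $ i $ j \<in> \<int>)"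

definition cusp_indices :: "nat \<Rightarrow> ((real^'n^'n) \<times> (int^'n)) set" where
  "cusp_indices m = {(N, r). half_integral N \<and>
     pos_def (\<chi> i j. 4 * real m * N $ i $ j - of_int (r $ i) * of_int (r $ j))}"

definition has_cusp_expansion :: "nat \<Rightarrow> ('n::finite jacobi_point \<Rightarrow> complex) \<Rightarrow> bool" where
  "has_cusp_expansion m \<phi> \<longleftrightarrow>
     (\<exists>c :: real^'n^'n \<Rightarrow> int^'n \<Rightarrow> complex. \<forall>(\<tau>, z)\<in>siegel_jacobi.
        ((\<lambda>(N, r). c N r * exp (2 * of_real pi * \<i> * trace (map_matrix of_real N ** \<tau>))
                         * exp (2 * of_real pi * \<i> * bidot (cvec r) z))
           has_sum \<phi> (\<tau>, z)) (cusp_indices m))"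

definition jacobi_cusp_forms :: "nat \<Rightarrow> nat \<Rightarrow> ('n::finite jacobi_point \<Rightarrow> complex) set" where
  "jacobi_cusp_forms k m =
     {\<phi>. jacobi_holomorphic \<phi> \<and> jacobi_invariant k m \<phi> \<and> has_cusp_expansion m \<phi>}"

definition petersson_weight :: "nat \<Rightarrow> nat \<Rightarrow> 'n::finite jacobi_point \<Rightarrow> real" where
  "petersson_weight k m = (\<lambda>(\<tau>, z).
     let \<eta> = map_matrix Im \<tau>; y = map_vector Im z in
     det \<eta> ^ k * exp (- 4 * pi * real m * (y \<bullet> (matrix_inv \<eta> *v y))))"

definition petersson_norm_sq ::
    "nat \<Rightarrow> nat \<Rightarrow> ('n::finite jacobi_point \<Rightarrow> complex) \<Rightarrow> 'n jacobi_point \<Rightarrow> real" where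
  "petersson_norm_sq k m \<phi> p = (cmod (\<phi> p))\<^sup>2 * petersson_weight k m p"

text \<open>The supremum is taken in \<open>ennreal\<close>, so that it is meaningful without a boundedness hypothesis.\<close>

definition sup_norm_sq :: "nat \<Rightarrow> nat \<Rightarrow> ('n::finite jacobi_point \<Rightarrow> complex) \<Rightarrow> ennreal" where
  "sup_norm_sq k m \<phi> = (SUP p\<in>siegel_jacobi. ennreal (petersson_norm_sq k m \<phi> p))"

text \<open>
  The measure \<open>\<Prod>\<^bsub>l\<le>j\<^esub> d\<xi>\<^sub>l\<^sub>j d\<eta>\<^sub>l\<^sub>j \<Prod>\<^sub>n dx\<^sub>n dy\<^sub>n\<close> on \<open>Sym\<^sub>g(\<complex>) \<times> \<complex>\<^sup>g\<close>, regarded as a measure on the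
  ambient space. The coordinates of a symmetric matrix, one for each pair \<open>l \<le> j\<close>, are indexed by
  the unordered pairs \<open>{l, j}\<close>, so that no order on the index type is needed.
\<close>

definition sym_coords :: "'n set set" where
  "sym_coords = {{l, j} | l j. True}"

definition coord_measure ::
    "((('n::finite set \<Rightarrow> real) \<times> ('n set \<Rightarrow> real)) \<times> ((real^'n) \<times> (real^'n))) measure" where
  "coord_measure =
     ((\<Pi>\<^sub>M s\<in>sym_coords. lborel) \<Otimes>\<^sub>M (\<Pi>\<^sub>M s\<in>sym_coords. lborel)) \<Otimes>\<^sub>M (lborel \<Otimes>\<^sub>M lborel)"

definition coord_point ::
    "(('n::finite set \<Rightarrow> real) \<times> ('n set \<Rightarrow> real)) \<times> ((real^'n) \<times> (real^'n)) \<Rightarrow> 'n jacobi_point" where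
  "coord_point = (\<lambda>((\<xi>, \<eta>), (x, y)).
     (\<chi> l j. Complex (\<xi> {l, j}) (\<eta> {l, j}), \<chi> n. Complex (x $ n) (y $ n)))"

definition jacobi_lebesgue :: "'n::finite jacobi_point measure" where
  "jacobi_lebesgue = distr coord_measure borel coord_point"

text \<open>Measurability is what makes the \<open>distr\<close> in \<open>jacobi_lebesgue\<close> the actual image measure.\<close>

lemma measurable_coord_point:
  "(coord_point :: _ \<Rightarrow> 'n::finite jacobi_point) \<in> measurable coord_measure borel"
proof -
  let ?M = "coord_measure ::
    ((('n set \<Rightarrow> real) \<times> ('n set \<Rightarrow> real)) \<times> ((real^'n) \<times> (real^'n))) measure"
  have [measurable]: "(\<lambda>p. fst (fst p) {l, j}) \<in> borel_measurable ?M"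
    "(\<lambda>p. snd (fst p) {l, j}) \<in> borel_measurable ?M" for l j :: 'n
  proof -
    have [measurable]: "{l, j} \<in> (sym_coords :: 'n set set)"
      by (auto simp: sym_coords_def)
    show "(\<lambda>p. fst (fst p) {l, j}) \<in> borel_measurable ?M"
      "(\<lambda>p. snd (fst p) {l, j}) \<in> borel_measurable ?M"
      unfolding coord_measure_def by measurable
  qed
  have [measurable]: "(\<lambda>p. fst (snd p)) \<in> borel_measurable ?M"
    "(\<lambda>p. snd (snd p)) \<in> borel_measurable ?M"
    unfolding coord_measure_def by measurable
  have [measurable]: "(\<lambda>p. fst (snd p) $ n) \<in> borel_measurable ?M"
    "(\<lambda>p. snd (snd p) $ n) \<in> borel_measurable ?M" for n :: 'n
    by (auto intro!: borel_measurable_continuous_on[where f = "\<lambda>v. v $ n"] continuous_intros)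
  have "(\<lambda>p. ((\<chi> l j. Complex (fst (fst p) {l, j}) (snd (fst p) {l, j})) :: complex^'n^'n,
      (\<chi> n. Complex (fst (snd p) $ n) (snd (snd p) $ n)) :: complex^'n)) \<in> borel_measurable ?M"
    by (intro borel_measurable_Pair; subst borel_measurable_euclidean_space)
      (auto simp: inner_vec_def inner_complex_def)
  also have "(\<lambda>p. ((\<chi> l j. Complex (fst (fst p) {l, j}) (snd (fst p) {l, j})) :: complex^'n^'n,
      (\<chi> n. Complex (fst (snd p) $ n) (snd (snd p) $ n)) :: complex^'n)) = coord_point"
    by (auto simp: coord_point_def)
  finally show ?thesis .
qed

text \<open>
  A fundamental domain: a Borel set that meets almost every orbit and whose translates under the
  group \<open>Sp\<^sub>2\<^sub>g(\<int>) \<ltimes> \<int>\<^sup>2\<^sup>g\<close> overlap only in null sets. Distinct group elements act by distinct maps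
  (\<open>-1 \<in> Sp\<^sub>2\<^sub>g(\<int>)\<close> acts by \<open>z \<mapsto> -z\<close>), so every element other than the identity is considered. The
  integral of an invariant function does not depend on the choice of such a set.
\<close>

definition jacobi_fundamental_domain :: "'n::finite jacobi_point set \<Rightarrow> bool" where
  "jacobi_fundamental_domain F \<longleftrightarrow>
     F \<in> sets borel \<and> F \<subseteq> siegel_jacobi \<and>
     (AE p in jacobi_lebesgue. p \<in> siegel_jacobi \<longrightarrow>
        (\<exists>M\<in>Sp_int. \<exists>l u. jacobi_act M l u p \<in> F)) \<and>
     (\<forall>M\<in>Sp_int. \<forall>l u. (M, l, u) \<noteq> (mat 1, 0, 0) \<longrightarrow>
        (AE p in jacobi_lebesgue. p \<in> F \<longrightarrow> jacobi_act M l u p \<notin> F))"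

definition petersson_inner ::
    "'n::finite jacobi_point set \<Rightarrow> nat \<Rightarrow> nat \<Rightarrow>
       ('n jacobi_point \<Rightarrow> complex) \<Rightarrow> ('n jacobi_point \<Rightarrow> complex) \<Rightarrow> complex" where
  "petersson_inner F k m \<phi>\<^sub>1 \<phi>\<^sub>2 =
     (LINT p:F|jacobi_lebesgue.
        \<phi>\<^sub>1 p * cnj (\<phi>\<^sub>2 p)
          * of_real (petersson_weight k m p / det (map_matrix Im (fst p)) ^ (CARD('n) + 2)))"

end

theory Submission
  imports Defs "HOL-Complex_Analysis.Conformal_Mappings"
begin

text \<open>
  Write \<open>g\<close> for the degree, \<open>\<eta>\<close> for the imaginary part of \<open>\<tau>\<close> and \<open>f\<close> for the pointwise Petersson norm
  squared. It is invariant (\<open>petersson_norm_sq_invariant\<close>), so the supremum may be sought in any region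
  that meets all orbits. Reduction theory in the style of lattice reduction (\<open>symplectic_reduction\<close>) moves
  \<open>\<tau>\<close> so that \<open>\<eta>\<close> is comparable to a diagonal matrix with entries \<open>d\<^sub>i\<close> that are bounded below and, up to a
  constant, ordered. A cusp form decays where the \<open>d\<^sub>i\<close> are large: a Phragmen-Lindelof argument along a
  complex line, on which all terms of the Fourier expansion decay at a uniform rate, shows that a bound
  for \<open>f\<close> at the points with \<open>d\<^sub>i\<close> at most a constant times \<open>k m\<close> is a bound everywhere (\<open>decay\<close>). These are
  the good points.

  Around a good point \<open>p\<close> there is a polydisc on which \<open>f\<close> is at least a constant times the squared
  modulus of a holomorphic function, which equals \<open>f(p)\<close> at the centre. The radii of the polydisc are of
  order \<open>sqrt (d\<^sub>i d\<^sub>j / k)\<close> in \<open>\<tau>\<close> and \<open>sqrt (d\<^sub>i / m)\<close> in \<open>z\<close>, so in the invariant measure its volume is \<open>k\<close> to the power \<open>- g (g + 1) / 2\<close> times \<open>m\<close> to the power \<open>- g\<close>, up to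
  a constant. The mean value property therefore gives
  \<open>f(p) \<le> C k\<^bsup>g(g+1)/2\<^esup> m\<^sup>g \<integral> f\<close> with the invariant integral over the polydisc (\<open>submean_bound\<close>).

  Mapping the polydisc into a fundamental domain covers each point at most \<open>N\<close> times, so the
  integral is at most \<open>N\<close> times the squared norm 1 (\<open>unfolding_bound\<close>, which needs the Jacobian of the action
  from \<open>jac_derivative\<close>). Here \<open>N\<close> bounds the number of group elements that bring some point of the polydisc
  to a given point; counting the lower rows of symplectic matrices, the translations and the lattice
  vectors (\<open>count_group\<close>, \<open>count_bound\<close>) yields
  \<open>N \<le> C (sqrt k m)\<^bsup>g(g+1)/2\<^esup> k\<^bsup>g/2\<^esup>\<close>.
  Together the power of \<open>k\<close> is \<open>3 g (g + 1) / 4 + g / 2 = (3 g\<^sup>2 + 5 g) / 4\<close>, and the power of \<open>m\<close> is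
  \<open>g + g (g + 1) / 2\<close>, which is less than \<open>2 g\<^sup>2 + 5 g / 2\<close>.
\<close>

section \<open>Triangular decomposition of positive definite matrices\<close>

text \<open>
  The index type carries no order. Triangular matrices and the order of the pivots refer to this
  enumeration of it.
\<close>

definition rk :: "'n::finite \<Rightarrow> nat" where
  "rk = (SOME r. bij_betw r UNIV {..<CARD('n)})"

lemma bij_betw_rk: "bij_betw (rk :: 'n::finite \<Rightarrow> nat) UNIV {..<CARD('n)}"
proof -
  have "\<exists>r. bij_betw (r :: 'n \<Rightarrow> nat) UNIV {..<CARD('n)}"
    using ex_bij_betw_finite_nat[of "UNIV :: 'n set"] by (auto simp: atLeast0LessThan)
  then show ?thesis unfolding rk_def by (rule someI_ex)
qed

lemma rk_eq_iff [simp]: "rk (i::'n::finite) = rk j \<longleftrightarrow> i = j"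
  using bij_betw_rk by (auto simp: bij_betw_def dest: injD)

lemma rk_less_card: "rk (i::'n::finite) < CARD('n)"
  using bij_betw_rk[where 'n='n] by (auto simp: bij_betw_def)

lemma ex_rk: "t < CARD('n::finite) \<Longrightarrow> \<exists>i::'n. rk i = t"
proof -
  assume "t < CARD('n)"
  then have "t \<in> range (rk :: 'n \<Rightarrow> nat)" using bij_betw_rk[where 'n='n] by (simp add: bij_betw_def)
  then show ?thesis by auto
qed

text \<open>
  The triangular and diagonal factors of \<open>Y = P\<^sup>t diag(e) P\<close>, which completes squares:
  the value of the form \<open>Y\<close> at \<open>v\<close> is \<open>\<Sum>\<^sub>i e\<^sub>i ((P v)\<^sub>i)\<^sup>2\<close>, and \<open>(P v)\<^sub>i\<close> is \<open>v\<^sub>i\<close> plus terms of smaller rank.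
\<close>

definition unit_lower :: "real^'n::finite^'n \<Rightarrow> bool" where
  "unit_lower P \<longleftrightarrow> (\<forall>i. P $ i $ i = 1) \<and> (\<forall>i j. rk i < rk j \<longrightarrow> P $ i $ j = 0)"

definition diag :: "('n \<Rightarrow> real) \<Rightarrow> real^'n::finite^'n" where
  "diag d = (\<chi> i j. if i = j then d i else 0)"

abbreviation qf :: "real^'n::finite^'n \<Rightarrow> real^'n \<Rightarrow> real" where
  "qf A v \<equiv> v \<bullet> (A *v v)"

lemma qf_sum: "qf A v = (\<Sum>i\<in>UNIV. \<Sum>j\<in>UNIV. A $ i $ j * v $ i * v $ j)"
  by (simp add: inner_vec_def matrix_vector_mult_def sum_distrib_left algebra_simps)

lemma inner_matrix_transpose: "(A *v v) \<bullet> w = v \<bullet> (transpose A *v w)" for A :: "real^'n::finite^'m::finite"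
  using dot_lmul_matrix[of w A v] unfolding transpose_matrix_vector[symmetric] by (simp only: inner_commute)

lemma qf_congruence: "qf (transpose R ** A ** R) v = qf A (R *v v)"
  unfolding matrix_vector_mul_assoc[symmetric] inner_matrix_transpose ..

lemma diag_mult_vec: "(diag d *v v) $ i = d i * v $ i"
  by (simp add: diag_def matrix_vector_mult_def if_distrib[of "\<lambda>x. x * _"] cong: if_cong)

lemma qf_diag: "qf (diag d) v = (\<Sum>i\<in>UNIV. d i * (v $ i)\<^sup>2)"
  by (simp add: inner_vec_def diag_mult_vec power2_eq_square algebra_simps)

lemma qf_ldl: "qf (transpose P ** diag e ** P) v = (\<Sum>i\<in>UNIV. e i * ((P *v v) $ i)\<^sup>2)"
  by (simp add: qf_congruence qf_diag)

lemma ldl_entry: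
  "(transpose P ** diag e ** P) $ i $ j = (\<Sum>l\<in>UNIV. e l * P $ l $ i * P $ l $ j)"
  by (simp add: matrix_matrix_mult_def transpose_def diag_def if_distrib cong: if_cong)
     (simp add: algebra_simps)

text \<open>
  A permutation that never increases the rank preserves every rank, since the ranks have a fixed
  sum; so only the identity contributes to the determinant.
\<close>

lemma det_unit_lower:
  fixes P :: "real^'n::finite^'n"
  assumes "unit_lower P" shows "det P = 1"
proof -
  have zero: "(\<Prod>i\<in>UNIV. P $ i $ p i) = 0" if p: "p permutes (UNIV::'n set)" and ne: "p \<noteq> id" for p
  proof (rule ccontr)
    assume "(\<Prod>i\<in>UNIV. P $ i $ p i) \<noteq> 0"
    then have le: "rk (p i) \<le> rk i" for i
      using assms unfolding unit_lower_def by (metis (no_types, lifting) UNIV_I finite not_le prod_zero)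
    have eq: "(\<Sum>i\<in>UNIV. rk (p i)) = (\<Sum>i\<in>UNIV. rk (i::'n))"
      using sum.permute[OF p, of rk] by (simp add: o_def)
    have "rk (p i) = rk i" for i :: 'n
    proof (rule ccontr)
      assume "rk (p i) \<noteq> rk i"
      then have "rk (p i) < rk i" using le[of i] by (metis le_neq_implies_less)
      then have "(\<Sum>i\<in>UNIV. rk (p i)) < (\<Sum>i\<in>UNIV. rk (i::'n))"
        using le by (intro sum_strict_mono_ex1) auto
      then show False using eq by simp
    qed
    then have "p = id" by (auto simp: fun_eq_iff)
    then show False using ne by simp
  qed
  have "det P = (\<Sum>p\<in>{id}. of_int (sign p) * (\<Prod>i\<in>UNIV. P $ i $ p i))"
    unfolding det_def
    by (rule sum.mono_neutral_right) (auto simp: zero permutes_id)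
  also have "\<dots> = 1" using assms by (simp add: unit_lower_def sign_id)
  finally show ?thesis .
qed

lemma det_diag: "det (diag d) = (\<Prod>i\<in>UNIV. d i)"
  by (simp add: det_diagonal diag_def)

lemma det_ldl: "unit_lower P \<Longrightarrow> det (transpose P ** diag e ** P) = (\<Prod>i\<in>UNIV. e i)"
  by (simp add: det_mul det_unit_lower det_diag)

text \<open>
  The induction splits off the variable of largest rank by completing its square: the Schur
  complement \<open>a'\<close> is again symmetric, and it is positive because its value at \<open>w\<close> is the value of the
  original form at the extension of \<open>w\<close> that makes the completed square vanish.
\<close>

lemma ldl_aux:
  fixes a :: "'n::finite \<Rightarrow> 'n \<Rightarrow> real"
  assumes "\<And>i j. a i j = a j i"
    and "\<And>w. (\<exists>i. rk i < t \<and> w i \<noteq> 0) \<Longrightarrow> 0 < (\<Sum>i | rk i < t. \<Sum>j | rk j < t. a i j * w i * w j)"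
  shows "\<exists>P e. (\<forall>i. P i i = 1) \<and> (\<forall>i j. rk i < rk j \<longrightarrow> P i j = 0) \<and> (\<forall>i. e i > 0) \<and>
    (\<forall>i j. rk i < t \<longrightarrow> rk j < t \<longrightarrow> a i j = (\<Sum>l | rk l < t. e l * P l i * P l (j::'n)))"
  using assms
proof (induction t arbitrary: a)
  case 0
  show ?case
    by (rule exI[of _ "\<lambda>i j. if i = j then 1 else 0"], rule exI[of _ "\<lambda>_. 1"]) auto
next
  case (Suc t)
  show ?case
  proof (cases "t < CARD('n)")
    case False
    then have "rk i < t" for i :: 'n using rk_less_card[of i] by simp
    then have *: "rk i < Suc t \<longleftrightarrow> rk i < t" for i :: 'n by (metis less_SucI)
    show ?thesis unfolding * using Suc.IH[of a] Suc.prems[unfolded *] by blast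
  next
    case True
    then obtain b :: 'n where b: "rk b = t" using ex_rk by blast
    let ?S = "{i::'n. rk i < t}"
    have S: "{i. rk i < Suc t} = insert b ?S"
      unfolding less_Suc_eq b[symmetric] by auto
    have bS: "b \<notin> ?S" using b by simp
    have ex: "(\<Sum>i | rk i < Suc t. \<Sum>j | rk j < Suc t. a i j * w i * w j) =
      (\<Sum>i\<in>?S. \<Sum>j\<in>?S. a i j * w i * w j) + 2 * w b * (\<Sum>j\<in>?S. a b j * w j) + a b b * (w b)\<^sup>2" for w
    proof -
      have 1: "(\<Sum>i\<in>?S. a i b * w i * w b) = w b * (\<Sum>j\<in>?S. a b j * w j)"
        using Suc.prems(1)[of _ b] by (simp add: sum_distrib_left algebra_simps)
      have 2: "(\<Sum>j\<in>?S. a b j * w b * w j) = w b * (\<Sum>j\<in>?S. a b j * w j)"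
        by (simp add: sum_distrib_left algebra_simps)
      have ins: "(\<Sum>i\<in>insert b ?S. h i) = h b + (\<Sum>i\<in>?S. h i)" for h :: "'n \<Rightarrow> real"
        using bS by simp
      show ?thesis unfolding S ins sum.distrib 1 2
        by (simp add: power2_eq_square algebra_simps)
    qed
    have abb: "a b b > 0"
    proof -
      define w :: "'n \<Rightarrow> real" where "w i = (if i = b then 1 else 0)" for i
      have w0: "w i = 0" if "i \<in> ?S" for i using that bS unfolding w_def by metis
      have wb: "w b = 1" by (simp add: w_def)
      have "0 < (\<Sum>i | rk i < Suc t. \<Sum>j | rk j < Suc t. a i j * w i * w j)"
        by (rule Suc.prems(2)) (use wb b in \<open>auto intro!: exI[of _ b]\<close>)
      also have "(\<Sum>i\<in>?S. \<Sum>j\<in>?S. a i j * w i * w j) = 0"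
        using w0 by (intro sum.neutral ballI) simp
      moreover have "(\<Sum>j\<in>?S. a b j * w j) = 0" using w0 by (intro sum.neutral ballI) simp
      ultimately show ?thesis unfolding ex wb by simp
    qed
    define a' where "a' i j = a i j - a b i * a b j / a b b" for i j
    have "\<exists>P e. (\<forall>i. P i i = 1) \<and> (\<forall>i j. rk i < rk j \<longrightarrow> P i j = 0) \<and> (\<forall>i. e i > 0) \<and>
      (\<forall>i j. rk i < t \<longrightarrow> rk j < t \<longrightarrow> a' i j = (\<Sum>l | rk l < t. e l * P l i * P l (j::'n)))"
    proof (rule Suc.IH)
      show "a' i j = a' j i" for i j using Suc.prems(1)[of i j] by (simp add: a'_def)
      fix w :: "'n \<Rightarrow> real" assume w: "\<exists>i. rk i < t \<and> w i \<noteq> 0"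
      define L where "L = (\<Sum>j\<in>?S. a b j * w j)"
      define w' where "w' i = (if i = b then - L / a b b else w i)" for i
      have w'S: "w' i = w i" if "i \<in> ?S" for i using that bS by (auto simp: w'_def)
      have "0 < (\<Sum>i | rk i < Suc t. \<Sum>j | rk j < Suc t. a i j * w' i * w' j)"
      proof (rule Suc.prems(2))
        from w obtain i where "rk i < t" "w i \<noteq> 0" by blast
        then show "\<exists>i. rk i < Suc t \<and> w' i \<noteq> 0" using w'S[of i] by (intro exI[of _ i]) auto
      qed
      also have "\<dots> = (\<Sum>i\<in>?S. \<Sum>j\<in>?S. a i j * w i * w j) + 2 * w' b * L + a b b * (w' b)\<^sup>2"
        unfolding ex L_def using w'S by (intro arg_cong2[where f="(+)"] sum.cong) auto
      also have "2 * w' b * L + a b b * (w' b)\<^sup>2 = - (L * L / a b b)"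
        using abb by (simp add: w'_def power2_eq_square field_simps)
      then have "(\<Sum>i\<in>?S. \<Sum>j\<in>?S. a i j * w i * w j) + 2 * w' b * L + a b b * (w' b)\<^sup>2
          = (\<Sum>i\<in>?S. \<Sum>j\<in>?S. a i j * w i * w j) - L * L / a b b" by simp
      also have "L * L / a b b = (\<Sum>i\<in>?S. \<Sum>j\<in>?S. a b i * a b j / a b b * w i * w j)"
        unfolding L_def sum_product sum_divide_distrib by (intro sum.cong) auto
      finally show "0 < (\<Sum>i | rk i < t. \<Sum>j | rk j < t. a' i j * w i * w j)"
        by (simp add: a'_def left_diff_distrib sum_subtractf)
    qed
    then obtain P e where P: "\<And>i. P i i = 1" "\<And>i j. rk i < rk j \<Longrightarrow> P i j = 0" "\<And>i. e i > (0::real)"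
      "\<And>i j. rk i < t \<Longrightarrow> rk j < t \<Longrightarrow> a' i j = (\<Sum>l | rk l < t. e l * P l i * P l (j::'n))" by blast
    define P' where "P' i j = (if i = b then (if rk j \<le> t then a b j / a b b else 0) else P i j)" for i j
    define e' where "e' i = (if i = b then a b b else e i)" for i
    have sum: "(\<Sum>l | rk l < Suc t. e' l * P' l i * P' l j)
       = (\<Sum>l\<in>?S. e l * P l i * P l j) + a b i * a b j / a b b"
       if "rk i < Suc t" "rk j < Suc t" for i j
    proof -
      have "(\<Sum>l\<in>?S. e' l * P' l i * P' l j) = (\<Sum>l\<in>?S. e l * P l i * P l j)"
        using bS by (intro sum.cong) (auto simp: e'_def P'_def)
      then show ?thesis unfolding S using bS that abb by (auto simp: e'_def P'_def field_simps)
    qed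
    have "a i j = (\<Sum>l | rk l < Suc t. e' l * P' l i * P' l j)" if "rk i < Suc t" "rk j < Suc t" for i j
    proof -
      have "rk i < t \<or> i = b" "rk j < t \<or> j = b"
        using that unfolding less_Suc_eq b[symmetric] rk_eq_iff by auto
      then consider "i = b" | "j = b" | "rk i < t" "rk j < t" by blast
      then show ?thesis
      proof cases
        case 1
        then have "(\<Sum>l\<in>?S. e l * P l i * P l j) = 0" using b P(2) by (auto intro!: sum.neutral)
        then show ?thesis using 1 sum[OF that] abb by simp
      next
        case 2
        then have "(\<Sum>l\<in>?S. e l * P l i * P l j) = 0" using b P(2) by (auto intro!: sum.neutral)
        then show ?thesis using 2 sum[OF that] abb Suc.prems(1)[of i b] by simp
      next
        case 3
        show ?thesis using P(4)[OF 3] sum[OF that] by (simp add: a'_def)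
      qed
    qed
    moreover have "P' i i = 1" for i using P(1) abb b by (auto simp: P'_def)
    moreover have "P' i j = 0" if "rk i < rk j" for i j using that P(2) b by (auto simp: P'_def)
    moreover have "e' i > 0" for i using P(3) abb by (auto simp: e'_def)
    ultimately show ?thesis by blast
  qed
qed

lemma pos_def_ldl:
  fixes Y :: "real^'n::finite^'n"
  assumes "pos_def Y"
  obtains P e where "unit_lower P" "\<And>i. e i > 0" "Y = transpose P ** diag e ** P"
proof -
  have all: "rk i < CARD('n)" for i :: 'n by (rule rk_less_card)
  have "\<exists>P e. (\<forall>i. P i i = 1) \<and> (\<forall>i j. rk i < rk j \<longrightarrow> P i j = 0) \<and> (\<forall>i. e i > 0) \<and>
    (\<forall>i j. rk i < CARD('n) \<longrightarrow> rk j < CARD('n) \<longrightarrow> Y $ i $ j = (\<Sum>l | rk l < CARD('n). e l * P l i * P l (j::'n)))"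
  proof (rule ldl_aux)
    show "Y $ i $ j = Y $ j $ i" for i j
      using assms unfolding pos_def_def by (metis (no_types, lifting) transpose_def vec_lambda_beta)
    fix w :: "'n \<Rightarrow> real" assume w: "\<exists>i. rk i < CARD('n) \<and> w i \<noteq> 0"
    then have "(\<chi> i. w i) \<noteq> 0" by (auto simp: vec_eq_iff)
    then have "0 < qf Y (\<chi> i. w i)" using assms unfolding pos_def_def by blast
    then show "0 < (\<Sum>i | rk i < CARD('n). \<Sum>j | rk j < CARD('n). Y $ i $ j * w i * w j)"
      by (simp add: qf_sum all)
  qed
  then obtain P :: "'n \<Rightarrow> 'n \<Rightarrow> real" and e :: "'n \<Rightarrow> real" where P: "\<And>i. P i i = 1" "\<And>i j. rk i < rk j \<Longrightarrow> P i j = 0" "\<And>i. e i > 0"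
    "\<And>i j. Y $ i $ j = (\<Sum>l\<in>UNIV. e l * P l i * P l (j::'n))" by (auto simp: all)
  show ?thesis
  proof (rule that[of "\<chi> i j. P i j" e])
    show "unit_lower (\<chi> i j. P i j)" using P by (simp add: unit_lower_def)
    show "Y = transpose (\<chi> i j. P i j) ** diag e ** (\<chi> i j. P i j)"
      by (simp add: vec_eq_iff ldl_entry P(4))
  qed (rule P)
qed

lemma unit_lower_invertible: "unit_lower P \<Longrightarrow> invertible P"
  by (simp add: invertible_det_nz det_unit_lower)

lemma matrix_inv_left [simp]: "invertible A \<Longrightarrow> matrix_inv A ** A = mat 1"
  and matrix_inv_right [simp]: "invertible A \<Longrightarrow> A ** matrix_inv A = mat 1"
  for A :: "'a::semiring_1^'n::finite^'m::finite"
  by (auto simp: matrix_inv_def invertible_def intro: someI2_ex)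

lemma matrix_inv_unique:
  fixes A B :: "'a::semiring_1^'n::finite^'n"
  assumes "A ** B = mat 1" "B ** A = mat 1" shows "matrix_inv A = B"
proof -
  have "invertible A" using assms by (auto simp: invertible_def)
  then have "matrix_inv A ** (A ** B) = B" unfolding matrix_mul_assoc by simp
  then show ?thesis unfolding assms by simp
qed

lemma matrix_inv_unique_field:
  fixes A B :: "'a::field^'n::finite^'n"
  assumes "A ** B = mat 1" shows "matrix_inv A = B"
  using assms matrix_left_right_inverse matrix_inv_unique by blast

lemma invertible_matrix_inv: "invertible (A::'a::field^'n::finite^'n) \<Longrightarrow> invertible (matrix_inv A)"
  using invertible_def matrix_inv_left matrix_inv_right by blast

lemma transpose_matrix_inv:
  "invertible (A::'a::field^'n::finite^'n) \<Longrightarrow> transpose (matrix_inv A) = matrix_inv (transpose A)"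
proof -
  assume "invertible A"
  then have "transpose A ** transpose (matrix_inv A) = mat 1" unfolding matrix_transpose_mul[symmetric] by simp
  then show ?thesis by (rule matrix_inv_unique_field[symmetric])
qed

lemma matrix_inv_mult_vec: "invertible A \<Longrightarrow> matrix_inv A *v (A *v v) = v"
  and mult_matrix_inv_vec: "invertible A \<Longrightarrow> A *v (matrix_inv A *v v) = v"
  for A :: "'a::semiring_1^'n::finite^'n"
  by (simp_all add: matrix_vector_mul_assoc)

lemma det_matrix_inv: "invertible A \<Longrightarrow> det (matrix_inv A) = inverse (det A)" for A :: "'a::field^'n::finite^'n"
proof -
  assume "invertible A"
  then have "det A * det (matrix_inv A) = 1" unfolding det_mul[symmetric] by simp
  then show ?thesis by (rule inverse_unique[symmetric])
qed

lemma pos_defD: "pos_def A \<Longrightarrow> v \<noteq> 0 \<Longrightarrow> qf A v > 0"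
  and pos_def_sym: "pos_def A \<Longrightarrow> transpose A = A"
  by (simp_all add: pos_def_def)

lemma pos_def_nonneg: "pos_def A \<Longrightarrow> qf A v \<ge> 0"
  by (cases "v = 0") (auto simp: less_imp_le pos_defD)

lemma pos_def_invertible: "pos_def A \<Longrightarrow> invertible A"
  unfolding invertible_left_inverse matrix_left_invertible_ker
proof (intro allI impI)
  fix v assume "pos_def A" "A *v v = 0"
  then show "v = 0" using pos_defD[of A v] by (cases "v = 0") auto
qed

lemma pos_def_det_pos: "pos_def A \<Longrightarrow> det A > 0"
  by (erule pos_def_ldl) (simp add: det_ldl prod_pos del: det_transpose)

lemma pos_def_congruence:
  fixes R :: "real^'n::finite^'n"
  assumes "pos_def A" "invertible R" shows "pos_def (transpose R ** A ** R)"
proof -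
  have "R *v v \<noteq> 0" if "v \<noteq> 0" for v
    using that matrix_inv_mult_vec[OF assms(2), of v] by auto
  moreover have "transpose (transpose R ** A ** R) = transpose R ** A ** R"
    using pos_def_sym[OF assms(1)] by (simp add: matrix_transpose_mul matrix_mul_assoc)
  ultimately show ?thesis using pos_defD[OF assms(1)]
    unfolding pos_def_def qf_congruence by blast
qed

lemma pos_def_ldlI: "unit_lower P \<Longrightarrow> (\<And>i. e i > 0) \<Longrightarrow> pos_def (transpose P ** diag e ** P)"
proof (rule pos_def_congruence)
  assume e: "\<And>i. e i > 0"
  have "qf (diag e) v > 0" if "v \<noteq> 0" for v
  proof -
    from that have "\<exists>i. v $ i \<noteq> 0" by (simp add: vec_eq_iff)
    then obtain i where "v $ i \<noteq> 0" by blast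
    then show ?thesis unfolding qf_diag
      by (intro sum_pos2[of _ i]) (auto simp: e less_imp_le)
  qed
  then show "pos_def (diag e)"
    by (auto simp: pos_def_def diag_def transpose_def vec_eq_iff)
qed (rule unit_lower_invertible)

lemma pos_def_inv: assumes "pos_def A" shows "pos_def (matrix_inv A)"
proof -
  have i: "invertible A" using assms by (rule pos_def_invertible)
  have s: "transpose (matrix_inv A) = matrix_inv A"
    using i pos_def_sym[OF assms] by (simp add: transpose_matrix_inv)
  have "matrix_inv A = transpose (matrix_inv A) ** A ** matrix_inv A"
    unfolding s matrix_inv_left[OF i] by simp
  then show ?thesis using pos_def_congruence[OF assms invertible_matrix_inv[OF i]] by (simp only:)
qed

lemma qf_inv: "pos_def A \<Longrightarrow> qf (matrix_inv A) (A *v v) = qf A v"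
  unfolding matrix_inv_mult_vec[OF pos_def_invertible] by (rule inner_commute)

lemma matrix_inv_matrix_inv: "invertible A \<Longrightarrow> matrix_inv (matrix_inv A) = A" for A :: "'a::field^'n::finite^'n"
  by (rule matrix_inv_unique_field) simp


lemma pos_def_sqrt:
  fixes A :: "real^'n::finite^'n"
  assumes "pos_def A"
  obtains R :: "real^'n^'n" where "invertible R" "A = R ** transpose R"
proof -
  obtain P e where P: "unit_lower P" "\<And>i. e i > 0" "A = transpose P ** diag e ** P"
    by (rule pos_def_ldl[OF assms], rule that)
  define s where "s i = sqrt (e i)" for i
  have s: "s i * s i = e i" for i using P(2)[of i] by (simp add: s_def)
  have "diag e = diag s ** transpose (diag s)"
  proof -
    have "(\<Sum>k\<in>UNIV. diag s $ i $ k * diag s $ j $ k) = diag e $ i $ j" for i j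
    proof -
      have "(\<Sum>k\<in>UNIV. diag s $ i $ k * diag s $ j $ k) = (\<Sum>k\<in>UNIV. if k = i then diag e $ i $ j else 0)"
        by (intro sum.cong) (auto simp: diag_def s)
      then show ?thesis by simp
    qed
    then show ?thesis by (simp add: vec_eq_iff matrix_matrix_mult_def transpose_def)
  qed
  then have "A = (transpose P ** diag s) ** transpose (transpose P ** diag s)"
    using P(3) by (simp add: matrix_transpose_mul matrix_mul_assoc)
  moreover have "invertible (transpose P ** diag s)"
    using P(1,2) by (simp add: invertible_det_nz det_mul det_unit_lower det_diag s_def)
      (metis less_irrefl)
  ultimately show ?thesis by (rule that[rotated])
qed

lemma ldl_pivot_le_diag:
  assumes "unit_lower P" "\<And>i. e i > 0"
  shows "e i \<le> (transpose P ** diag e ** P) $ i $ i"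
proof -
  have "e i * P $ i $ i * P $ i $ i \<le> (\<Sum>l\<in>UNIV. e l * P $ l $ i * P $ l $ i)"
    by (rule member_le_sum) (auto simp: assms(2) less_imp_le mult.assoc)
  then show ?thesis using assms(1) by (simp add: ldl_entry unit_lower_def)
qed

text \<open>
  This is the inequality \<open>x \<le> exp (x - 1)\<close> applied to the pivots, each of which is at most the
  corresponding diagonal entry. It bounds the change of the determinant of the imaginary part from
  one side by a trace.
\<close>

lemma det_le_exp_trace:
  fixes X :: "real^'n::finite^'n"
  assumes "pos_def X" shows "det X \<le> exp (trace X - real CARD('n))"
proof -
  obtain P e where P: "unit_lower P" "\<And>i. e i > 0" "X = transpose P ** diag e ** P"
    by (rule pos_def_ldl[OF assms], rule that)
  have "det X = (\<Prod>i\<in>UNIV. e i)" using P by (simp add: det_ldl)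
  also have "\<dots> \<le> (\<Prod>i\<in>UNIV. exp (X $ i $ i - 1))"
  proof (rule prod_mono, safe)
    fix i show "0 \<le> e i" using P(2)[of i] by simp
    have "e i \<le> X $ i $ i" using ldl_pivot_le_diag[OF P(1,2)] P(3) by simp
    also have "\<dots> \<le> exp (X $ i $ i - 1)" using exp_ge_add_one_self[of "X $ i $ i - 1"] by simp
    finally show "e i \<le> exp (X $ i $ i - 1)" .
  qed
  also have "\<dots> = exp (trace X - real CARD('n))"
    by (simp add: exp_sum[symmetric] trace_def sum_subtractf)
  finally show ?thesis .
qed

text \<open>
  Back substitution gives a vector \<open>w\<close> with \<open>P w\<close> the \<open>i\<close>-th unit vector and \<open>w\<^sub>i = 1\<close>. The form
  takes the value \<open>e\<^sub>i\<close> there, and \<open>w\<close> has norm at least 1.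
\<close>

lemma ldl_ge_one:
  assumes "unit_lower P" "\<And>i. e i > 0" "\<And>v. norm v ^ 2 \<le> qf (transpose P ** diag e ** P) v"
  shows "e i \<ge> 1"
proof -
  have inv: "invertible P" using assms(1) by (rule unit_lower_invertible)
  define w where "w = matrix_inv P *v axis i 1"
  have Pw: "P *v w = axis i 1" by (simp add: w_def mult_matrix_inv_vec inv)
  have z: "w $ j = 0" if "rk j < rk i" for j
    using that
  proof (induction "rk j" arbitrary: j rule: less_induct)
    case less
    have "(P *v w) $ j = (\<Sum>l\<in>{j}. P $ j $ l * w $ l)"
      unfolding matrix_vector_mult_def vec_lambda_beta
    proof (rule sum.mono_neutral_right)
      show "\<forall>l\<in>UNIV - {j}. P $ j $ l * w $ l = 0"
      proof
        fix l assume "l \<in> UNIV - {j}"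
        then have "rk j < rk l \<or> rk l < rk j" by (metis Diff_iff insertI1 linorder_neqE_nat rk_eq_iff)
        then show "P $ j $ l * w $ l = 0" using assms(1) less by (auto simp: unit_lower_def)
      qed
    qed auto
    moreover have "(P *v w) $ j = 0" using less.prems unfolding Pw by (auto simp: axis_def)
    ultimately show ?case using assms(1) by (simp add: unit_lower_def)
  qed
  have "(P *v w) $ i = (\<Sum>l\<in>{i}. P $ i $ l * w $ l)"
    unfolding matrix_vector_mult_def vec_lambda_beta
  proof (rule sum.mono_neutral_right)
    show "\<forall>l\<in>UNIV - {i}. P $ i $ l * w $ l = 0"
    proof
      fix l assume "l \<in> UNIV - {i}"
      then have "rk i < rk l \<or> rk l < rk i" by (metis Diff_iff insertI1 linorder_neqE_nat rk_eq_iff)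
      then show "P $ i $ l * w $ l = 0" using assms(1) z by (auto simp: unit_lower_def)
    qed
  qed auto
  then have wi: "w $ i = 1" using Pw assms(1) by (simp add: unit_lower_def)
  have "1 \<le> norm w ^ 2"
    using component_le_norm_cart[of w i] wi by (simp add: one_le_power)
  also have "\<dots> \<le> (\<Sum>j\<in>UNIV. e j * ((P *v w) $ j)\<^sup>2)" using assms(3)[of w] by (simp add: qf_ldl)
  also have "\<dots> = (\<Sum>j\<in>UNIV. if j = i then e i else 0)"
    unfolding Pw by (intro sum.cong) (auto simp: axis_def)
  also have "\<dots> = e i" by simp
  finally show ?thesis .
qed

text \<open>
  After a congruence that carries \<open>c B\<close> to the identity, all pivots of the transformed \<open>A\<close> are
  at least 1.
\<close>

lemma det_mono:
  fixes A B :: "real^'n::finite^'n"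
  assumes B: "pos_def B" and A: "transpose A = A" and c: "c > 0" and le: "\<And>v. c * qf B v \<le> qf A v"
  shows "det A \<ge> c ^ CARD('n) * det B"
proof -
  obtain R :: "real^'n^'n" where R: "invertible R" "c *\<^sub>R B = R ** transpose R"
  proof -
    have "pos_def (c *\<^sub>R B)" using B c
      by (simp add: pos_def_def transpose_scalar flip: scaleR_matrix_vector_assoc)
    then show ?thesis by (rule pos_def_sqrt) (rule that)
  qed
  define T where "T = transpose (matrix_inv R)"
  have Ti: "invertible T" unfolding T_def using R(1) by (intro transpose_invertible invertible_matrix_inv)
  have pA: "pos_def A" unfolding pos_def_def
  proof (intro conjI allI impI A)
    fix v :: "real^'n" assume "v \<noteq> 0"
    then have "0 < c * qf B v" using pos_defD[OF B] c by simp
    then show "0 < qf A v" using le[of v] by linarith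
  qed
  have pX: "pos_def (transpose T ** A ** T)" using pos_def_congruence[OF pA Ti] .
  obtain P e where P: "unit_lower P" "\<And>i. e i > 0" "transpose T ** A ** T = transpose P ** diag e ** P"
    by (rule pos_def_ldl[OF pX], rule that)
  have "e i \<ge> 1" for i
  proof (rule ldl_ge_one[OF P(1,2)])
    fix v
    have "transpose R ** T = transpose (matrix_inv R ** R)" unfolding T_def by (rule matrix_transpose_mul[symmetric])
    then have RT: "transpose R ** T = mat 1" using R(1) by simp
    have "transpose R *v (T *v v) = v" unfolding matrix_vector_mul_assoc RT by simp
    then have "norm v ^ 2 = norm (transpose R *v (T *v v)) ^ 2" by (simp only:)
    also have "\<dots> = qf (c *\<^sub>R B) (T *v v)"
      unfolding R(2) power2_norm_eq_inner inner_matrix_transpose transpose_transpose matrix_vector_mul_assoc[of R "transpose R"] ..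
    also have "\<dots> \<le> qf A (T *v v)" using le unfolding scaleR_matrix_vector_assoc[symmetric] by simp
    finally show "norm v ^ 2 \<le> qf (transpose P ** diag e ** P) v" unfolding P(3)[symmetric] qf_congruence .
  qed
  then have "1 \<le> (\<Prod>i\<in>UNIV. e i)" by (intro prod_ge_1) auto
  also have "\<dots> = det (transpose T ** A ** T)" by (simp add: P(3) det_ldl P(1))
  also have "\<dots> = det A / (det R)\<^sup>2"
    unfolding T_def using R(1) by (simp add: det_mul det_matrix_inv power2_eq_square divide_simps)
  finally have "(det R)\<^sup>2 \<le> det A"
    using R(1) by (simp add: invertible_det_nz divide_simps split: if_splits)
  moreover have "(det R)\<^sup>2 = det (c *\<^sub>R B)" by (simp add: R(2) det_mul power2_eq_square)
  moreover have "det (c *\<^sub>R B) = c ^ CARD('n) * det B"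
  proof -
    have "c *\<^sub>R B = diag (\<lambda>_. c) ** B"
      by (auto simp: vec_eq_iff diag_def matrix_matrix_mult_def if_distrib[of "\<lambda>x. x * _"] cong: if_cong)
    then show ?thesis by (simp add: det_mul det_diag)
  qed
  ultimately show ?thesis by simp
qed

section \<open>The symplectic group and its action\<close>

lemma map_matrix_index [simp]: "map_matrix f A $ i $ j = f (A $ i $ j)"
  by (simp add: map_matrix_def)

lemma map_vector_index [simp]: "map_vector f v $ i = f (v $ i)"
  by (simp add: map_vector_def)

abbreviation cr :: "real^'n^'m \<Rightarrow> complex^'n^'m" where "cr \<equiv> map_matrix complex_of_real"
abbreviation cj :: "complex^'n^'m \<Rightarrow> complex^'n^'m" where "cj \<equiv> map_matrix cnj"

lemma map_matrix_transpose: "map_matrix f (transpose A) = transpose (map_matrix f A)"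
  by (simp add: vec_eq_iff transpose_def)

lemma cmat_mult: "cmat (A ** B) = cmat A ** cmat (B :: int^'n::finite^'n)"
  by (simp add: vec_eq_iff matrix_matrix_mult_def)

lemma cr_mult: "cr (A ** B) = cr A ** cr (B :: real^'k::finite^'n::finite)"
  by (simp add: vec_eq_iff matrix_matrix_mult_def)

lemma cj_mult: "cj (A ** B) = cj A ** cj (B :: complex^'k::finite^'n::finite)"
  by (simp add: vec_eq_iff matrix_matrix_mult_def)

lemma cr_mat1 [simp]: "cr (mat 1) = mat 1" and cmat_mat1 [simp]: "cmat (mat 1) = mat 1"
  and cj_mat1 [simp]: "cj (mat 1) = mat 1"
  by (simp_all add: vec_eq_iff mat_def)

lemma cj_cmat [simp]: "cj (cmat A) = cmat A" and cj_cr [simp]: "cj (cr R) = cr R"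
  and cj_cj [simp]: "cj (cj S) = S"
  by (simp_all add: vec_eq_iff)

lemma cj_add: "cj (A + B) = cj A + cj B" by (simp add: vec_eq_iff)

lemma cmat_add: "cmat (A + B) = cmat A + cmat B" and cmat_diff: "cmat (A - B) = cmat A - cmat B"
  by (simp_all add: vec_eq_iff)

lemma transpose_add: "transpose (A + B) = transpose A + transpose B"
  and transpose_diff: "transpose (A - B) = transpose A - transpose B"
  and transpose_uminus: "transpose (- A) = - transpose A"
  for A :: "'a::ab_group_add^'n^'m"
  by (simp_all add: vec_eq_iff transpose_def)

lemma matrix_diff_ldistrib: "A ** (B - C) = A ** B - A ** C"
  and matrix_add_rdistrib: "(A' + B') ** C' = A' ** C' + B' ** C'"
  and matrix_diff_rdistrib: "(A' - B') ** C' = A' ** C' - B' ** C'"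
  and matrix_uminus_left: "(- A') ** C' = - (A' ** C')"
  and matrix_uminus_right: "A ** (- B) = - (A ** B)"
  for A :: "'a::comm_ring_1^'n::finite^'m" and A' B' :: "'a::comm_ring_1^'k::finite^'l"
  by (simp_all add: vec_eq_iff matrix_matrix_mult_def algebra_simps sum.distrib sum_subtractf sum_negf)

lemma transpose_mult_vec: "(transpose A *v x) $ i = (\<Sum>j\<in>UNIV. A $ j $ i * x $ j)"
  for A :: "'a::comm_semiring_1^'n::finite^'m::finite"
  by (simp only: matrix_vector_mult_def transpose_def vec_lambda_beta)

lemma sum_UNIV_Plus: "(\<Sum>p\<in>(UNIV :: ('n::finite + 'n) set). f p) = (\<Sum>a\<in>UNIV. f (Inl a)) + (\<Sum>a\<in>UNIV. f (Inr a))"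
proof -
  have "(\<Sum>p\<in>(UNIV :: ('n + 'n) set). f p) = (\<Sum>p\<in>Inl ` UNIV \<union> Inr ` UNIV. f p)"
    by (rule sum.cong) (auto simp: UNIV_sum)
  also have "\<dots> = (\<Sum>p\<in>range Inl. f p) + (\<Sum>p\<in>range Inr. f p)"
    by (intro sum.union_disjoint) auto
  also have "\<dots> = (\<Sum>a\<in>UNIV. f (Inl a)) + (\<Sum>a\<in>UNIV. f (Inr a))"
    by (simp add: sum.reindex)
  finally show ?thesis .
qed

lemma blk_mult:
  "blk_A (M ** M') = blk_A M ** blk_A M' + blk_B M ** blk_C M'"
  "blk_B (M ** M') = blk_A M ** blk_B M' + blk_B M ** blk_D M'"
  "blk_C (M ** M') = blk_C M ** blk_A M' + blk_D M ** blk_C M'"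
  "blk_D (M ** M') = blk_C M ** blk_B M' + blk_D M ** blk_D M'"
  for M M' :: "int^('n::finite+'n)^('n+'n)"
  by (simp_all add: vec_eq_iff blk_A_def blk_B_def blk_C_def blk_D_def matrix_matrix_mult_def sum_UNIV_Plus)

lemma blk_eqI:
  assumes "blk_A M = blk_A M'" "blk_B M = blk_B M'" "blk_C M = blk_C M'" "blk_D M = blk_D M'"
  shows "M = M'"
proof -
  have "M $ p $ q = M' $ p $ q" for p q
    using assms by (cases p; cases q) (simp_all add: vec_eq_iff blk_A_def blk_B_def blk_C_def blk_D_def)
  then show ?thesis by (simp add: vec_eq_iff)
qed

definition mkblk :: "'a^'n^'n \<Rightarrow> 'a^'n^'n \<Rightarrow> 'a^'n^'n \<Rightarrow> 'a^'n^'n \<Rightarrow> 'a^('n+'n)^('n+'n)" where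
  "mkblk A B C D = (\<chi> p q. case (p, q) of (Inl i, Inl j) \<Rightarrow> A $ i $ j | (Inl i, Inr j) \<Rightarrow> B $ i $ j
     | (Inr i, Inl j) \<Rightarrow> C $ i $ j | (Inr i, Inr j) \<Rightarrow> D $ i $ j)"

lemma blk_mkblk [simp]: "blk_A (mkblk A B C D) = A" "blk_B (mkblk A B C D) = B"
  "blk_C (mkblk A B C D) = C" "blk_D (mkblk A B C D) = D"
  by (simp_all add: vec_eq_iff blk_A_def blk_B_def blk_C_def blk_D_def mkblk_def)

lemma blk_mat1: "blk_A (mat 1) = mat 1" "blk_B (mat 1) = 0" "blk_C (mat 1) = 0" "blk_D (mat 1) = mat 1"
  by (simp_all add: vec_eq_iff blk_A_def blk_B_def blk_C_def blk_D_def mat_def)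

lemma symplectic_entry:
  "(transpose M ** symplectic_form ** M) $ p $ q
     = (\<Sum>a\<in>UNIV. M $ Inl a $ p * M $ Inr a $ q - M $ Inr a $ p * M $ Inl a $ q)"
  for M :: "int^('n::finite+'n)^('n+'n)"
proof -
  have "(transpose M ** symplectic_form ** M) $ p $ q
      = (\<Sum>r\<in>UNIV. \<Sum>s\<in>UNIV. M $ s $ p * symplectic_form $ s $ r * M $ r $ q)"
    by (simp add: matrix_matrix_mult_def transpose_def sum_distrib_right)
  also have "\<dots> = (\<Sum>a\<in>UNIV. \<Sum>b\<in>UNIV. if b = a then - (M $ Inr b $ p * M $ Inl a $ q) else 0)
      + (\<Sum>a\<in>UNIV. \<Sum>b\<in>UNIV. if b = a then M $ Inl b $ p * M $ Inr a $ q else 0)"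
    unfolding sum_UNIV_Plus
    by (intro arg_cong2[where f="(+)"] sum.cong refl)
      (simp_all add: symplectic_form_def if_distrib[of "\<lambda>x. _ * x"] if_distrib[of "\<lambda>x. x * _"] cong: if_cong)
  finally show ?thesis by (simp add: sum_subtractf sum_negf)
qed

lemma Sp_int_iff:
  "M \<in> Sp_int \<longleftrightarrow> transpose (blk_A M) ** blk_C M = transpose (blk_C M) ** blk_A M
     \<and> transpose (blk_B M) ** blk_D M = transpose (blk_D M) ** blk_B M
     \<and> transpose (blk_A M) ** blk_D M - transpose (blk_C M) ** blk_B M = mat 1"
  (is "_ \<longleftrightarrow> ?R") for M :: "int^('n::finite+'n)^('n+'n)"
proof -
  define f where "f p q = (\<Sum>a\<in>UNIV. M $ Inl a $ p * M $ Inr a $ q - M $ Inr a $ p * M $ Inl a $ q)" for p q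
  have anti: "f p q = - f q p" for p q by (simp add: f_def sum_negf[symmetric] algebra_simps)
  have M: "M \<in> Sp_int \<longleftrightarrow> (\<forall>p q. f p q = symplectic_form $ p $ q)"
    unfolding Sp_int_def by (simp only: mem_Collect_eq vec_eq_iff symplectic_entry f_def)
  have R: "?R \<longleftrightarrow> (\<forall>i j. f (Inl i) (Inl j) = 0) \<and> (\<forall>i j. f (Inr i) (Inr j) = 0)
     \<and> (\<forall>i j. f (Inl i) (Inr j) = (if i = j then 1 else 0))"
    by (simp add: vec_eq_iff f_def matrix_matrix_mult_def transpose_def blk_A_def blk_B_def blk_C_def
       blk_D_def mat_def sum_subtractf)
  show ?thesis unfolding M R
  proof safe
    fix p q
    assume h: "\<forall>i j. f (Inl i) (Inl j) = 0" "\<forall>i j. f (Inr i) (Inr j) = 0"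
      "\<forall>i j. f (Inl i) (Inr j) = (if i = j then 1 else 0)"
    then have "f (Inr i) (Inl j) = (if i = j then -1 else 0)" for i j
      using anti[of "Inr i" "Inl j"] by auto
    then show "f p q = symplectic_form $ p $ q"
      using h by (cases p; cases q) (simp_all add: symplectic_form_def)
  qed (simp_all add: symplectic_form_def)
qed

lemma Sp_int_mult: "M \<in> Sp_int \<Longrightarrow> M' \<in> Sp_int \<Longrightarrow> M ** M' \<in> Sp_int"
proof -
  assume M: "M \<in> Sp_int" "M' \<in> Sp_int"
  have "transpose (M ** M') ** symplectic_form ** (M ** M') = transpose M' ** (transpose M ** symplectic_form ** M) ** M'"
    by (simp add: matrix_transpose_mul matrix_mul_assoc)
  also have "\<dots> = symplectic_form" using M by (simp add: Sp_int_def)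
  finally show ?thesis by (simp add: Sp_int_def)
qed

lemma Sp_int_one: "mat 1 \<in> Sp_int"
  by (simp add: Sp_int_def)

lemma int_matrix_left_right_inverse:
  fixes A B :: "int^'n::finite^'n"
  assumes "A ** B = mat 1" shows "B ** A = mat 1"
proof -
  have "cmat A ** cmat B = mat 1" by (simp flip: cmat_mult add: assms)
  then have "cmat B ** cmat A = mat 1" by (simp add: matrix_left_right_inverse)
  then have "cmat (B ** A) = cmat (mat 1)" by (simp add: cmat_mult)
  then have "complex_of_int ((B ** A) $ i $ j) = complex_of_int (mat 1 $ i $ j)" for i j
    by (metis map_matrix_index)
  then show ?thesis by (simp add: vec_eq_iff)
qed

lemma Sp_int_inverse:
  assumes "M \<in> Sp_int"
  obtains M' where "M' \<in> Sp_int" "M' ** M = mat 1" "M ** M' = mat 1"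
proof -
  let ?A = "blk_A M" and ?B = "blk_B M" and ?C = "blk_C M" and ?D = "blk_D M"
  define M' where "M' = mkblk (transpose ?D) (- transpose ?B) (- transpose ?C) (transpose ?A)"
  have r: "transpose ?A ** ?C = transpose ?C ** ?A" "transpose ?B ** ?D = transpose ?D ** ?B"
    "transpose ?A ** ?D - transpose ?C ** ?B = mat 1"
    using assms by (simp_all add: Sp_int_iff)
  have r': "transpose ?D ** ?A - transpose ?B ** ?C = mat 1"
    using arg_cong[OF r(3), of transpose] by (simp add: transpose_diff matrix_transpose_mul)
  have 1: "M' ** M = mat 1"
    by (rule blk_eqI) (use r r' in \<open>simp_all add: blk_mult M'_def blk_mat1 matrix_uminus_left add.commute[of "- _"]\<close>)
  then have 2: "M ** M' = mat 1" by (rule int_matrix_left_right_inverse)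
  have "transpose M' ** symplectic_form ** M' = transpose M' ** (transpose M ** symplectic_form ** M) ** M'"
    using assms by (simp add: Sp_int_def)
  also have "\<dots> = transpose (M ** M') ** symplectic_form ** (M ** M')"
    by (simp add: matrix_transpose_mul matrix_mul_assoc)
  also have "\<dots> = symplectic_form" by (simp add: 2)
  finally have "M' \<in> Sp_int" by (simp add: Sp_int_def)
  then show ?thesis using 1 2 by (rule that)
qed

definition siegel_num :: "int^('n+'n)^('n+'n) \<Rightarrow> complex^'n^'n \<Rightarrow> complex^'n^'n::finite" where
  "siegel_num M \<tau> = cmat (blk_A M) ** \<tau> + cmat (blk_B M)"

lemma siegel_act_alt: "siegel_act M \<tau> = siegel_num M \<tau> ** matrix_inv (aut_factor M \<tau>)"
  by (simp add: siegel_act_def siegel_num_def)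

lemma cj_aut_factor: "cj (aut_factor M \<tau>) = aut_factor M (cj \<tau>)"
  and cj_siegel_num: "cj (siegel_num M \<tau>) = siegel_num M (cj \<tau>)"
  by (simp_all add: aut_factor_def siegel_num_def cj_add cj_mult)

text \<open>
  The symplectic relations, applied to the columns \<open>(A\<tau> + B, C\<tau> + D)\<close> and \<open>(A\<sigma> + B, C\<sigma> + D)\<close>. The
  conjugate \<open>\<sigma>\<close> of \<open>\<tau>\<close> yields the behaviour of the imaginary part.
\<close>

lemma num_aut_rel:
  fixes \<sigma> \<tau> :: "complex^'n::finite^'n"
  assumes M: "M \<in> Sp_int" and s: "transpose \<sigma> = \<sigma>"
  shows "transpose (siegel_num M \<sigma>) ** aut_factor M \<tau> - transpose (aut_factor M \<sigma>) ** siegel_num M \<tau> = \<sigma> - \<tau>"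
proof -
  let ?A = "cmat (blk_A M)" and ?B = "cmat (blk_B M)" and ?C = "cmat (blk_C M)" and ?D = "cmat (blk_D M)"
  have r0: "transpose (blk_A M) ** blk_C M = transpose (blk_C M) ** blk_A M" "transpose (blk_B M) ** blk_D M = transpose (blk_D M) ** blk_B M"
    "transpose (blk_A M) ** blk_D M - transpose (blk_C M) ** blk_B M = mat 1"
    using M by (simp_all add: Sp_int_iff)
  have r1: "transpose ?A ** ?C = transpose ?C ** ?A"
    and r2: "transpose ?B ** ?D = transpose ?D ** ?B"
    and r3: "transpose ?A ** ?D - transpose ?C ** ?B = mat 1"
    using arg_cong[OF r0(1), of cmat] arg_cong[OF r0(2), of cmat] arg_cong[OF r0(3), of cmat]
    by (simp_all add: cmat_mult cmat_diff map_matrix_transpose)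
  have r4: "transpose ?B ** ?C - transpose ?D ** ?A = - mat 1"
    using arg_cong[OF r3, of "\<lambda>x. - transpose x"] by (simp add: transpose_diff matrix_transpose_mul)
  have "transpose (siegel_num M \<sigma>) ** aut_factor M \<tau> - transpose (aut_factor M \<sigma>) ** siegel_num M \<tau>
    = \<sigma> ** (transpose ?A ** ?C - transpose ?C ** ?A) ** \<tau> + \<sigma> ** (transpose ?A ** ?D - transpose ?C ** ?B)
      + (transpose ?B ** ?C - transpose ?D ** ?A) ** \<tau> + (transpose ?B ** ?D - transpose ?D ** ?B)"
    by (simp add: siegel_num_def aut_factor_def transpose_add matrix_transpose_mul s matrix_add_ldistrib
      matrix_add_rdistrib matrix_diff_ldistrib matrix_diff_rdistrib matrix_mul_assoc algebra_simps)
  also have "\<dots> = \<sigma> - \<tau>" unfolding r1 r2 r3 r4 by (simp add: matrix_uminus_left)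
  finally show ?thesis .
qed

abbreviation re_mat :: "complex^'n^'m \<Rightarrow> real^'n^'m" where "re_mat \<equiv> map_matrix Re"
abbreviation im_mat :: "complex^'n^'m \<Rightarrow> real^'n^'m" where "im_mat \<equiv> map_matrix Im"
abbreviation re_vec :: "complex^'n \<Rightarrow> real^'n" where "re_vec \<equiv> map_vector Re"
abbreviation im_vec :: "complex^'n \<Rightarrow> real^'n" where "im_vec \<equiv> map_vector Im"
abbreviation cv :: "real^'n \<Rightarrow> complex^'n" where "cv \<equiv> map_vector complex_of_real"
abbreviation cjv :: "complex^'n \<Rightarrow> complex^'n" where "cjv \<equiv> map_vector cnj"

lemma bidot_diff_right: "bidot w (u - v) = bidot w u - bidot w v"
  and bidot_zero [simp]: "bidot 0 w = 0" "bidot w 0 = 0"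
  and bidot_commute: "bidot u w = bidot w u"
  by (simp_all add: bidot_def sum.distrib algebra_simps sum_subtractf)

lemma bidot_mult_left: "bidot (A *v u) w = bidot u (transpose A *v w)"
proof -
  have "bidot (A *v u) w = (\<Sum>i\<in>UNIV. \<Sum>j\<in>UNIV. A $ i $ j * u $ j * w $ i)"
    by (simp add: bidot_def matrix_vector_mult_def sum_distrib_right)
  also have "\<dots> = (\<Sum>j\<in>UNIV. \<Sum>i\<in>UNIV. A $ i $ j * u $ j * w $ i)" by (rule sum.swap)
  also have "\<dots> = bidot u (transpose A *v w)"
    unfolding bidot_def transpose_mult_vec sum_distrib_left by (intro sum.cong refl) simp
  finally show ?thesis .
qed

lemma bidot_mult_right: "bidot u (A *v w) = bidot (transpose A *v u) w"
  by (simp add: bidot_mult_left del: transpose_matrix_vector)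

text \<open>
  For a real symmetric matrix the Hermitian form is real; it splits into the values at the real and
  the imaginary part of the vector.
\<close>

lemma hermitian_form:
  assumes "transpose E = E"
  shows "bidot (cjv v) (cr E *v v) = of_real (qf E (re_vec v) + qf E (im_vec v))"
proof -
  have E: "E $ i $ j = E $ j $ i" for i j using assms by (metis (no_types, lifting) transpose_def vec_lambda_beta)
  have "bidot (cjv v) (cr E *v v) = (\<Sum>i\<in>UNIV. \<Sum>j\<in>UNIV. of_real (E $ i $ j) * (cnj (v $ i) * v $ j))"
    by (simp add: bidot_def matrix_vector_mult_def sum_distrib_left algebra_simps)
  also have "\<dots> = (\<Sum>i\<in>UNIV. \<Sum>j\<in>UNIV. of_real (E $ i $ j * (Re (v $ i) * Re (v $ j) + Im (v $ i) * Im (v $ j))))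
      + \<i> * ((\<Sum>i\<in>UNIV. \<Sum>j\<in>UNIV. of_real (E $ i $ j * (Re (v $ i) * Im (v $ j))))
             - (\<Sum>i\<in>UNIV. \<Sum>j\<in>UNIV. of_real (E $ i $ j * (Im (v $ i) * Re (v $ j)))))"
    unfolding sum_subtractf[symmetric] sum_distrib_left sum.distrib[symmetric]
    by (intro sum.cong refl) (simp add: complex_eq_iff algebra_simps)
  also have "(\<Sum>i\<in>UNIV. \<Sum>j\<in>UNIV. complex_of_real (E $ i $ j * (Im (v $ i) * Re (v $ j))))
      = (\<Sum>i\<in>UNIV. \<Sum>j\<in>UNIV. of_real (E $ i $ j * (Re (v $ i) * Im (v $ j))))"
    by (subst sum.swap) (intro sum.cong refl, simp add: E mult.commute)
  finally show ?thesis
    by (simp add: qf_sum sum.distrib algebra_simps)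
qed

lemma siegelD:
  assumes "\<tau> \<in> siegel_space"
  shows "transpose \<tau> = \<tau>" "pos_def (im_mat \<tau>)" "transpose (cj \<tau>) = cj \<tau>"
  using assms by (auto simp: siegel_space_def simp flip: map_matrix_transpose)

lemma cj_minus_self: "cj \<tau> - \<tau> = map_matrix ((*) (-2 * \<i>)) (cr (im_mat \<tau>))"
  by (simp add: vec_eq_iff complex_eq_iff)

lemma scale_mult: "map_matrix ((*) c) A ** B = map_matrix ((*) c) (A ** B)"
  and mult_scale: "A ** map_matrix ((*) c) B = map_matrix ((*) c) (A ** B)"
  and scale_mult_vec: "map_matrix ((*) c) A *v v = c *s (A *v v)"
  for A :: "complex^'n::finite^'m"
  by (simp_all add: vec_eq_iff matrix_matrix_mult_def matrix_vector_mult_def sum_distrib_left algebra_simps)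

lemma scale_eq_iff: "c \<noteq> 0 \<Longrightarrow> map_matrix ((*) c) A = map_matrix ((*) c) B \<longleftrightarrow> A = (B :: complex^'n^'m)"
  by (simp add: vec_eq_iff)

lemma bidot_scale: "bidot w (c *s v) = c * bidot w v"
  by (simp add: bidot_def sum_distrib_left algebra_simps)

text \<open>
  If \<open>(C\<tau> + D) v = 0\<close>, pairing the relation for \<open>\<sigma> = cnj \<tau>\<close> with \<open>v\<close> and its conjugate makes the
  Hermitian form of \<open>Im \<tau>\<close> vanish at \<open>v\<close>.
\<close>

lemma aut_factor_invertible:
  assumes M: "M \<in> Sp_int" and \<tau>: "\<tau> \<in> siegel_space"
  shows "invertible (aut_factor M \<tau>)"
  unfolding invertible_left_inverse matrix_left_invertible_ker
proof (intro allI impI)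
  fix v assume v: "aut_factor M \<tau> *v v = 0"
  let ?E = "im_mat \<tau>"
  have "cjv (aut_factor M \<tau> *v v) = aut_factor M (cj \<tau>) *v cjv v"
    unfolding cj_aut_factor[symmetric] by (simp add: vec_eq_iff matrix_vector_mult_def)
  then have cv: "aut_factor M (cj \<tau>) *v cjv v = 0" unfolding v by (simp add: vec_eq_iff)
  have "bidot (cjv v) ((cj \<tau> - \<tau>) *v v)
     = bidot (siegel_num M (cj \<tau>) *v cjv v) (aut_factor M \<tau> *v v)
       - bidot (aut_factor M (cj \<tau>) *v cjv v) (siegel_num M \<tau> *v v)"
    unfolding num_aut_rel[OF M siegelD(3)[OF \<tau>], of \<tau>, symmetric] matrix_vector_mult_diff_rdistrib
      bidot_diff_right matrix_vector_mul_assoc[symmetric] bidot_mult_left ..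
  also have "\<dots> = 0" unfolding v cv by simp
  finally have "- 2 * \<i> * bidot (cjv v) (cr ?E *v v) = 0"
    unfolding cj_minus_self scale_mult_vec bidot_scale .
  then have "complex_of_real (qf ?E (re_vec v) + qf ?E (im_vec v)) = 0"
    unfolding hermitian_form[OF pos_def_sym[OF siegelD(2)[OF \<tau>]]] by simp
  then have "qf ?E (re_vec v) + qf ?E (im_vec v) = 0" unfolding of_real_eq_0_iff .
  then have "qf ?E (re_vec v) = 0" "qf ?E (im_vec v) = 0"
    using pos_def_nonneg[OF siegelD(2)[OF \<tau>], of "re_vec v"] pos_def_nonneg[OF siegelD(2)[OF \<tau>], of "im_vec v"] by linarith+
  then have "re_vec v = 0" "im_vec v = 0"
    using pos_defD[OF siegelD(2)[OF \<tau>]] by (metis less_irrefl)+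
  then show "v = 0" by (simp add: vec_eq_iff complex_eq_iff)
qed

lemma siegel_act_mult_aut:
  "M \<in> Sp_int \<Longrightarrow> \<tau> \<in> siegel_space \<Longrightarrow> siegel_act M \<tau> ** aut_factor M \<tau> = siegel_num M \<tau>"
  unfolding siegel_act_alt matrix_mul_assoc[symmetric]
  by (simp add: aut_factor_invertible)

lemma invertible_transpose: "invertible (transpose A)" if "invertible A" for A :: "'a::field^'n::finite^'n"
  using that unfolding invertible_def by (metis matrix_transpose_mul transpose_mat)

lemma matrix_cancel_left: "invertible A \<Longrightarrow> A ** B = A ** C \<longleftrightarrow> B = C"
  and matrix_cancel_right: "invertible A \<Longrightarrow> B ** A = C ** A \<longleftrightarrow> B = C"
  for A B C :: "'a::field^'n::finite^'n"
proof -
  assume A: "invertible A"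
  show "A ** B = A ** C \<longleftrightarrow> B = C"
  proof
    assume "A ** B = A ** C"
    then have "matrix_inv A ** (A ** B) = matrix_inv A ** (A ** C)" by simp
    then show "B = C" unfolding matrix_mul_assoc by (simp add: A)
  qed simp
  show "B ** A = C ** A \<longleftrightarrow> B = C"
  proof
    assume "B ** A = C ** A"
    then have "(B ** A) ** matrix_inv A = (C ** A) ** matrix_inv A" by simp
    then show "B = C" unfolding matrix_mul_assoc[symmetric] by (simp add: A)
  qed simp
qed

lemma siegel_act_sym:
  assumes M: "M \<in> Sp_int" and \<tau>: "\<tau> \<in> siegel_space"
  shows "transpose (siegel_act M \<tau>) = siegel_act M \<tau>"
proof -
  let ?J = "aut_factor M \<tau>" and ?H = "siegel_num M \<tau>" and ?T = "siegel_act M \<tau>"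
  have J: "invertible ?J" using assms by (rule aut_factor_invertible)
  have H: "?H = ?T ** ?J" using siegel_act_mult_aut[OF assms] ..
  have "transpose ?H ** ?J = transpose ?J ** ?H"
    using num_aut_rel[OF M siegelD(1)[OF \<tau>], of \<tau>] by simp
  then have "transpose ?J ** (transpose ?T ** ?J) = transpose ?J ** (?T ** ?J)"
    unfolding H matrix_transpose_mul by (simp add: matrix_mul_assoc)
  then show ?thesis using J by (simp add: matrix_cancel_left matrix_cancel_right invertible_transpose)
qed

lemma im_siegel_act:
  assumes M: "M \<in> Sp_int" and \<tau>: "\<tau> \<in> siegel_space"
  shows "transpose (cj (aut_factor M \<tau>)) ** cr (im_mat (siegel_act M \<tau>)) ** aut_factor M \<tau> = cr (im_mat \<tau>)"
proof -
  let ?J = "aut_factor M \<tau>" and ?H = "siegel_num M \<tau>" and ?T = "siegel_act M \<tau>"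
  have H: "?H = ?T ** ?J" using siegel_act_mult_aut[OF assms] ..
  have T: "transpose (cj ?T) = cj ?T" using siegel_act_sym[OF assms] by (simp flip: map_matrix_transpose)
  have "transpose (cj ?H) ** ?J - transpose (cj ?J) ** ?H = cj \<tau> - \<tau>"
    unfolding cj_siegel_num cj_aut_factor by (rule num_aut_rel[OF M siegelD(3)[OF \<tau>]])
  also have "transpose (cj ?H) ** ?J - transpose (cj ?J) ** ?H = transpose (cj ?J) ** (cj ?T - ?T) ** ?J"
    unfolding H cj_mult matrix_transpose_mul T matrix_diff_ldistrib matrix_diff_rdistrib matrix_mul_assoc ..
  finally have "map_matrix ((*) (-2*\<i>)) (transpose (cj ?J) ** cr (im_mat ?T) ** ?J) = map_matrix ((*) (-2*\<i>)) (cr (im_mat \<tau>))"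
    unfolding cj_minus_self mult_scale scale_mult .
  then show ?thesis by (subst (asm) scale_eq_iff) simp_all
qed

lemma siegel_act_in:
  assumes M: "M \<in> Sp_int" and \<tau>: "\<tau> \<in> siegel_space"
  shows "siegel_act M \<tau> \<in> siegel_space"
proof -
  let ?J = "aut_factor M \<tau>" and ?T = "siegel_act M \<tau>"
  have J: "invertible ?J" using assms by (rule aut_factor_invertible)
  have sE: "transpose (im_mat ?T) = im_mat ?T"
    using siegel_act_sym[OF assms] by (simp flip: map_matrix_transpose)
  have "qf (im_mat ?T) v > 0" if "v \<noteq> 0" for v
  proof -
    define u where "u = matrix_inv ?J *v cv v"
    have Ju: "?J *v u = cv v" unfolding u_def by (rule mult_matrix_inv_vec[OF J])
    have "cjv (?J *v u) = cj ?J *v cjv u" by (simp add: vec_eq_iff matrix_vector_mult_def)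
    then have cJu: "cj ?J *v cjv u = cv v" unfolding Ju by (simp add: vec_eq_iff)
    have cvv: "cjv (cv v) = cv v" "re_vec (cv v) = v" "im_vec (cv v) = 0" by (simp_all add: vec_eq_iff)
    have "of_real (qf (im_mat ?T) v) = bidot (cv v) (cr (im_mat ?T) *v cv v)"
      using hermitian_form[OF sE, of "cv v"] unfolding cvv by simp
    also have "\<dots> = bidot (cjv u) (cr (im_mat \<tau>) *v u)"
      unfolding im_siegel_act[OF assms, symmetric] matrix_vector_mul_assoc[symmetric] Ju
      unfolding bidot_mult_right transpose_transpose cJu ..
    also have "\<dots> = of_real (qf (im_mat \<tau>) (re_vec u) + qf (im_mat \<tau>) (im_vec u))"
      by (rule hermitian_form[OF pos_def_sym[OF siegelD(2)[OF \<tau>]]])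
    finally have eq: "qf (im_mat ?T) v = qf (im_mat \<tau>) (re_vec u) + qf (im_mat \<tau>) (im_vec u)"
      unfolding of_real_eq_iff .
    have "u \<noteq> 0"
    proof
      assume "u = 0"
      then have "cv v = 0" using Ju by simp
      then show False using that by (simp add: vec_eq_iff)
    qed
    then have "re_vec u \<noteq> 0 \<or> im_vec u \<noteq> 0" by (auto simp: vec_eq_iff complex_eq_iff)
    then show ?thesis unfolding eq
      using pos_defD[OF siegelD(2)[OF \<tau>]] pos_def_nonneg[OF siegelD(2)[OF \<tau>]]
      by (metis add_pos_nonneg add_nonneg_pos)
  qed
  then show ?thesis using siegel_act_sym[OF assms] sE by (simp add: siegel_space_def pos_def_def)
qed

lemma aut_factor_mult:
  assumes "M' \<in> Sp_int" "\<tau> \<in> siegel_space"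
  shows "aut_factor (M ** M') \<tau> = aut_factor M (siegel_act M' \<tau>) ** aut_factor M' \<tau>"
    "siegel_num (M ** M') \<tau> = siegel_num M (siegel_act M' \<tau>) ** aut_factor M' \<tau>"
proof -
  have H: "siegel_act M' \<tau> ** aut_factor M' \<tau> = siegel_num M' \<tau>" by (rule siegel_act_mult_aut[OF assms])
  have H': "X ** siegel_act M' \<tau> ** aut_factor M' \<tau> = X ** siegel_num M' \<tau>" for X
    unfolding matrix_mul_assoc[symmetric] H ..
  show "aut_factor (M ** M') \<tau> = aut_factor M (siegel_act M' \<tau>) ** aut_factor M' \<tau>"
    unfolding aut_factor_def[of M] matrix_add_rdistrib H'
    by (simp add: aut_factor_def siegel_num_def blk_mult cmat_add cmat_mult matrix_add_ldistrib matrix_add_rdistrib matrix_mul_assoc algebra_simps)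
  show "siegel_num (M ** M') \<tau> = siegel_num M (siegel_act M' \<tau>) ** aut_factor M' \<tau>"
    unfolding siegel_num_def[of M] matrix_add_rdistrib H'
    by (simp add: aut_factor_def siegel_num_def blk_mult cmat_add cmat_mult matrix_add_ldistrib matrix_add_rdistrib matrix_mul_assoc algebra_simps)
qed

lemma siegel_act_mult:
  assumes "M \<in> Sp_int" "M' \<in> Sp_int" "\<tau> \<in> siegel_space"
  shows "siegel_act (M ** M') \<tau> = siegel_act M (siegel_act M' \<tau>)"
proof -
  have \<tau>': "siegel_act M' \<tau> \<in> siegel_space" using assms(2,3) by (rule siegel_act_in)
  have "siegel_act (M ** M') \<tau> ** aut_factor (M ** M') \<tau> = siegel_num (M ** M') \<tau>"
    by (rule siegel_act_mult_aut[OF Sp_int_mult[OF assms(1,2)] assms(3)])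
  also have "\<dots> = siegel_act M (siegel_act M' \<tau>) ** aut_factor (M ** M') \<tau>"
    unfolding aut_factor_mult[OF assms(2,3)] siegel_act_mult_aut[OF assms(1) \<tau>', symmetric]
    by (simp add: matrix_mul_assoc)
  finally show ?thesis
    using aut_factor_invertible[OF Sp_int_mult[OF assms(1,2)] assms(3)] by (simp add: matrix_cancel_right)
qed

lemma siegel_act_one: "\<tau> \<in> siegel_space \<Longrightarrow> siegel_act (mat 1) \<tau> = \<tau>" for \<tau> :: "complex^'n::finite^'n"
proof -
  have z: "cmat (0 :: int^'n^'n) = 0" by (simp add: vec_eq_iff)
  have "matrix_inv (mat 1) = (mat 1 :: complex^'n^'n)" by (rule matrix_inv_unique) (rule matrix_mul_lid)+
  then show "\<tau> \<in> siegel_space \<Longrightarrow> siegel_act (mat 1) \<tau> = \<tau>"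
    by (simp add: siegel_act_def aut_factor_def blk_mat1 z)
qed

lemma det_cr: "det (cr A) = of_real (det A)"
  by (simp add: det_def)

lemma det_cj: "det (cj A) = cnj (det A)"
  by (simp add: det_def)

lemma det_im_siegel_act:
  assumes "M \<in> Sp_int" "\<tau> \<in> siegel_space"
  shows "(cmod (det (aut_factor M \<tau>)))\<^sup>2 * det (im_mat (siegel_act M \<tau>)) = det (im_mat \<tau>)"
proof -
  let ?d = "det (aut_factor M \<tau>)"
  have "cnj ?d * of_real (det (im_mat (siegel_act M \<tau>))) * ?d = of_real (det (im_mat \<tau>))"
    using arg_cong[OF im_siegel_act[OF assms], of det] by (simp only: det_mul det_transpose det_cr det_cj)
  then have "of_real ((cmod ?d)\<^sup>2 * det (im_mat (siegel_act M \<tau>))) = complex_of_real (det (im_mat \<tau>))"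
    by (simp add: complex_norm_square[unfolded of_real_power] mult_ac)
  then show ?thesis unfolding of_real_eq_iff .
qed

lemma cr_matrix_inv: "invertible A \<Longrightarrow> cr (matrix_inv A) = matrix_inv (cr A)" for A :: "real^'n::finite^'n"
proof -
  assume "invertible A"
  then have "cr A ** cr (matrix_inv A) = mat 1" unfolding cr_mult[symmetric] by simp
  then show ?thesis by (rule matrix_inv_unique_field[symmetric])
qed

text \<open>
  The inverse imaginary part of \<open>M\<tau>\<close> is the matrix whose form at \<open>w\<close> is a positive form in
  \<open>(C\<^sup>t w, D\<^sup>t w)\<close>. Reduction theory and the counting of group elements both work with the lower rows
  \<open>(C, D)\<close> through this formula.
\<close>

lemma qf_inv_im_siegel_act:
  assumes M: "M \<in> Sp_int" and \<tau>: "\<tau> \<in> siegel_space"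
  defines "X \<equiv> im_mat \<tau>"
  shows "qf (matrix_inv (im_mat (siegel_act M \<tau>))) w =
    qf X (transpose (map_matrix of_int (blk_C M)) *v w)
    + qf (matrix_inv X) (re_mat \<tau> *v (transpose (map_matrix of_int (blk_C M)) *v w)
         + transpose (map_matrix of_int (blk_D M)) *v w)"
proof -
  let ?J = "aut_factor M \<tau>" and ?T = "siegel_act M \<tau>"
  let ?c = "transpose (map_matrix of_int (blk_C M)) *v w" and ?d = "transpose (map_matrix of_int (blk_D M)) *v w"
  have J: "invertible ?J" using M \<tau> by (rule aut_factor_invertible)
  have cJ: "invertible (transpose (cj ?J))"
    using J unfolding invertible_det_nz by (simp add: det_cj)
  have pX: "pos_def X" unfolding X_def using siegelD(2)[OF \<tau>] .
  have pT: "pos_def (im_mat ?T)" using siegelD(2)[OF siegel_act_in[OF M \<tau>]] .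
  have "matrix_inv (cr (im_mat ?T)) = ?J ** matrix_inv (cr X) ** transpose (cj ?J)"
  proof (rule matrix_inv_unique_field)
    have iX: "invertible (cr X)" using pos_def_det_pos[OF pX] by (simp add: invertible_det_nz det_cr)
    have "transpose (cj ?J) ** (cr (im_mat ?T) ** (?J ** matrix_inv (cr X) ** transpose (cj ?J)))
      = (transpose (cj ?J) ** cr (im_mat ?T) ** ?J) ** matrix_inv (cr X) ** transpose (cj ?J)"
      by (simp add: matrix_mul_assoc)
    also have "\<dots> = transpose (cj ?J) ** mat 1"
      unfolding im_siegel_act[OF M \<tau>] X_def[symmetric] by (simp add: iX)
    finally show "cr (im_mat ?T) ** (?J ** matrix_inv (cr X) ** transpose (cj ?J)) = mat 1"
      using matrix_cancel_left[OF cJ] by blast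
  qed
  then have inv: "cr (matrix_inv (im_mat ?T)) = ?J ** cr (matrix_inv X) ** transpose (cj ?J)"
    by (simp add: cr_matrix_inv pos_def_invertible pX pT)
  define u where "u = transpose (cj ?J) *v cv w"
  have cu: "transpose ?J *v cv w = cjv u"
    unfolding u_def by (simp add: vec_eq_iff transpose_mult_vec del: transpose_matrix_vector)
  have cvv: "cjv (cv w) = cv w" "re_vec (cv w) = w" "im_vec (cv w) = 0" by (simp_all add: vec_eq_iff)
  have "of_real (qf (matrix_inv (im_mat ?T)) w) = bidot (cv w) (cr (matrix_inv (im_mat ?T)) *v cv w)"
    using hermitian_form[OF pos_def_sym[OF pos_def_inv[OF pT]], of "cv w"] unfolding cvv by simp
  also have "\<dots> = bidot (cjv u) (cr (matrix_inv X) *v u)"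
    unfolding inv matrix_vector_mul_assoc[symmetric] u_def[symmetric]
    unfolding bidot_mult_right[of "cv w" ?J] cu ..
  also have "\<dots> = of_real (qf (matrix_inv X) (re_vec u) + qf (matrix_inv X) (im_vec u))"
    by (rule hermitian_form[OF pos_def_sym[OF pos_def_inv[OF pX]]])
  finally have eq: "qf (matrix_inv (im_mat ?T)) w = qf (matrix_inv X) (re_vec u) + qf (matrix_inv X) (im_vec u)"
    unfolding of_real_eq_iff .
  have "u = cj \<tau> *v cv ?c + cv ?d"
  proof -
    have "transpose (cj ?J) = cj \<tau> ** transpose (cmat (blk_C M)) + transpose (cmat (blk_D M))"
      unfolding cj_aut_factor unfolding aut_factor_def by (simp only: transpose_add matrix_transpose_mul siegelD(3)[OF \<tau>])
    moreover have "transpose (cmat E) *v cv w = cv (transpose (map_matrix of_int E) *v w)" for E :: "int^'a^'a"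
      by (simp add: vec_eq_iff transpose_mult_vec del: transpose_matrix_vector)
    ultimately show ?thesis unfolding u_def by (simp only: matrix_vector_mult_add_rdistrib matrix_vector_mul_assoc[symmetric])
  qed
  then have "re_vec u = re_mat \<tau> *v ?c + ?d" "im_vec u = (-1) *\<^sub>R (X *v ?c)"
    by (simp_all add: vec_eq_iff X_def matrix_vector_mult_def sum_negf del: transpose_matrix_vector)
  moreover have "qf (matrix_inv X) ((-1) *\<^sub>R (X *v ?c)) = qf X ?c"
    unfolding matrix_vector_mult_scaleR using qf_inv[OF pX, of ?c] by simp
  ultimately show ?thesis unfolding eq by simp
qed

section \<open>Symplectic reduction\<close>

abbreviation ri :: "int^'n^'m \<Rightarrow> real^'n^'m" where "ri \<equiv> map_matrix real_of_int"

lemma ri_mult: "ri (A ** B) = ri A ** ri B" for A :: "int^'n::finite^'n"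
  by (simp add: vec_eq_iff matrix_matrix_mult_def)

lemma ri_mat1 [simp]: "ri (mat 1) = mat 1"
  by (simp add: vec_eq_iff mat_def)

text \<open>
  Polarization.
\<close>

lemma sym_qf_eq:
  fixes A B :: "real^'n::finite^'n"
  assumes "transpose A = A" "transpose B = B" "\<And>v. qf A v = qf B v" shows "A = B"
proof -
  have half: "b = (x - a - c) / 2" if "x = a + b + b + c" for a b c x :: real using that by simp
  have pol: "u \<bullet> (C *v v) = (qf C (u + v) - qf C u - qf C v) / 2" if "transpose C = C"
    for C :: "real^'n^'n" and u v
  proof -
    have "(C *v u) \<bullet> v = u \<bullet> (C *v v)"
      using inner_matrix_transpose[of C u v] unfolding that .
    then have 1: "v \<bullet> (C *v u) = u \<bullet> (C *v v)" by (simp only: inner_commute)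
    have "qf C (u + v) = qf C u + u \<bullet> (C *v v) + v \<bullet> (C *v u) + qf C v"
      unfolding matrix_vector_right_distrib inner_add_left inner_add_right by simp
    then have 2: "qf C (u + v) = qf C u + u \<bullet> (C *v v) + u \<bullet> (C *v v) + qf C v" unfolding 1 .
    show ?thesis by (rule half[OF 2])
  qed
  have "A $ i $ j = B $ i $ j" for i j
  proof -
    have "axis i 1 \<bullet> (A *v axis j 1) = axis i 1 \<bullet> (B *v axis j 1)"
      using pol[OF assms(1), of "axis i 1" "axis j 1"] pol[OF assms(2), of "axis i 1" "axis j 1"]
      by (simp only: assms(3))
    then show ?thesis by (simp add: inner_axis' matrix_vector_mult_basis column_def)
  qed
  then show ?thesis by (simp add: vec_eq_iff)
qed

lemma ldl_eqI:
  assumes "pos_def Y" "\<And>v. qf Y v = (\<Sum>i\<in>UNIV. e i * ((P *v v) $ i)\<^sup>2)"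
  shows "Y = transpose P ** diag e ** P"
proof (rule sym_qf_eq)
  show "transpose Y = Y" using assms(1) by (rule pos_def_sym)
  have "transpose (diag e) = diag e" by (simp add: vec_eq_iff transpose_def diag_def)
  then show "transpose (transpose P ** diag e ** P) = transpose P ** diag e ** P"
    by (simp add: matrix_transpose_mul matrix_mul_assoc)
  show "qf Y v = qf (transpose P ** diag e ** P) v" for v unfolding assms(2) qf_ldl ..
qed

text \<open>
  Recursion along the ranks, for systems of equations in which the \<open>i\<close>-th unknown is determined by
  those of smaller rank.
\<close>

lemma triangular_recursion:
  fixes F :: "'n::finite \<Rightarrow> ('n \<Rightarrow> 'b) \<Rightarrow> 'b"
  assumes "\<And>i u u'. (\<And>l. rk l < rk i \<Longrightarrow> u l = u' l) \<Longrightarrow> F i u = F i u'"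
  shows "\<exists>u. \<forall>i. u i = F i u"
proof -
  have "\<exists>u. \<forall>i. rk i < t \<longrightarrow> u i = F i u" for t
  proof (induction t)
    case (Suc t)
    then obtain u where u: "\<And>i. rk i < t \<Longrightarrow> u i = F i u" by blast
    define u' where "u' i = (if rk i = t then F i u else u i)" for i
    have "u' i = F i u'" if "rk i < Suc t" for i
    proof -
      have eq: "F i u' = F i u" by (rule assms) (use that in \<open>auto simp: u'_def\<close>)
      show ?thesis unfolding eq using u[of i] that by (auto simp: u'_def)
    qed
    then show ?case by blast
  qed simp
  from this[of "CARD('n)"] show ?thesis by (simp only: rk_less_card simp_thms)
qed

lemma unit_lower_mult_vec:
  assumes "unit_lower P" shows "(P *v v) $ i = v $ i + (\<Sum>l | rk l < rk i. P $ i $ l * v $ l)"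
proof -
  have "(P *v v) $ i = (\<Sum>l\<in>insert i {l. rk l < rk i}. P $ i $ l * v $ l)"
    unfolding matrix_vector_mult_def vec_lambda_beta
  proof (rule sum.mono_neutral_right)
    show "\<forall>l\<in>UNIV - insert i {l. rk l < rk i}. P $ i $ l * v $ l = 0"
    proof
      fix l assume "l \<in> UNIV - insert i {l. rk l < rk i}"
      then have "rk i < rk l" by (metis (no_types, lifting) DiffD2 insertI1 insertI2 linorder_neqE_nat mem_Collect_eq rk_eq_iff)
      then show "P $ i $ l * v $ l = 0" using assms by (simp add: unit_lower_def)
    qed
  qed auto
  then show ?thesis using assms by (simp add: unit_lower_def)
qed

lemma unit_lower_mult: "unit_lower P \<Longrightarrow> unit_lower Q \<Longrightarrow> unit_lower (P ** Q)"
proof -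
  assume P: "unit_lower P" and Q: "unit_lower Q"
  have col: "(P ** Q) $ i $ j = (P *v column j Q) $ i" for i j
    by (simp add: matrix_matrix_mult_def matrix_vector_mult_def column_def)
  have "(P ** Q) $ i $ j = Q $ i $ j" if "rk i \<le> rk j" for i j
    unfolding col unit_lower_mult_vec[OF P] using Q that
    by (simp add: column_def unit_lower_def)
  then show ?thesis using Q by (simp add: unit_lower_def)
qed

lemma integral_unit_lower_inverse:
  fixes W :: "int^'n::finite^'n"
  assumes "unit_lower (ri W)" obtains Z where "Z ** W = mat 1" "W ** Z = mat 1"
proof -
  have "\<exists>z :: 'n \<Rightarrow> int. \<forall>i. z i = (if i = k then 1 else 0) - (\<Sum>l | rk l < rk i. W $ i $ l * z l)" for k
    by (rule triangular_recursion[of "\<lambda>i z. (if i = k then 1 else 0) - (\<Sum>l | rk l < rk i. W $ i $ l * z l)"])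
      (auto intro!: arg_cong2[where f="(-)"] sum.cong)
  then have "\<exists>z. \<forall>k i. z k i = (if i = k then 1 else 0) - (\<Sum>l | rk l < rk i. W $ i $ l * z k l)"
    by (rule choice[OF allI])
  then obtain z where z: "\<forall>k i. z k i = (if i = k then 1 else 0) - (\<Sum>l | rk l < rk i. W $ i $ l * z k l)"
    by (elim exE)
  define Z :: "int^'n^'n" where "Z = (\<chi> i k. z k i)"
  have "ri W ** ri Z = mat 1"
  proof -
    have "(ri W ** ri Z) $ i $ k = (ri W *v column k (ri Z)) $ i" for i k
      by (simp add: matrix_matrix_mult_def matrix_vector_mult_def column_def)
    also have "\<dots> i k = real_of_int (z k i + (\<Sum>l | rk l < rk i. W $ i $ l * z k l))" for i k
      unfolding unit_lower_mult_vec[OF assms] by (simp add: column_def Z_def)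
    also have "\<dots> i k = (mat 1 :: real^'n^'n) $ i $ k" for i k
      using z[rule_format, of k i] by (simp add: mat_def)
    finally show ?thesis by (simp add: vec_eq_iff)
  qed
  then have "real_of_int ((W ** Z) $ i $ j) = real_of_int (mat 1 $ i $ j)" for i j
    unfolding ri_mult[symmetric] ri_mat1[symmetric] by (metis map_matrix_index)
  then have "W ** Z = mat 1" by (simp add: vec_eq_iff)
  then show ?thesis using that int_matrix_left_right_inverse by blast
qed

text \<open>
  The form is the square of the norm of an invertible linear image of the vector.
\<close>

lemma pos_def_lower_bound:
  fixes A :: "real^'n::finite^'n"
  assumes "pos_def A" obtains c where "c > 0" "\<And>v. c * (norm v)\<^sup>2 \<le> qf A v"
proof -
  obtain R :: "real^'n^'n" where R: "invertible R" "A = R ** transpose R"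
    using pos_def_sqrt[OF assms] .
  obtain K where K: "K > 0" "\<And>x. norm (transpose (matrix_inv R) *v x) \<le> norm x * K"
    using bounded_linear.pos_bounded[OF matrix_vector_mul_bounded_linear] by blast
  have "(1 / K\<^sup>2) * (norm v)\<^sup>2 \<le> qf A v" for v
  proof -
    have "transpose (matrix_inv R) ** transpose R = mat 1"
      unfolding matrix_transpose_mul[symmetric] using R(1) by simp
    then have "norm v \<le> norm (transpose R *v v) * K"
      using K(2)[of "transpose R *v v"] unfolding matrix_vector_mul_assoc by simp
    then have "(norm v)\<^sup>2 \<le> (norm (transpose R *v v) * K)\<^sup>2" by (intro power_mono) auto
    also have "\<dots> = K\<^sup>2 * (norm (transpose R *v v))\<^sup>2" by (simp add: power_mult_distrib)
    also have "(norm (transpose R *v v))\<^sup>2 = qf A v"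
      unfolding R(2) power2_norm_eq_inner inner_matrix_transpose transpose_transpose matrix_vector_mul_assoc ..
    finally show ?thesis using K(1) by (simp add: field_simps)
  qed
  then show ?thesis using K(1) by (intro that[of "1 / K\<^sup>2"]) auto
qed

text \<open>
  A representative \<open>M \<tau>\<close> of the orbit of \<open>\<tau>\<close> together with the triangular decomposition of
  \<open>(Im (M \<tau>))\<^sup>-\<^sup>1\<close>.
\<close>

definition has_ldl :: "complex^'n^'n \<Rightarrow> int^('n+'n)^('n+'n) \<Rightarrow> real^'n^'n \<Rightarrow> ('n::finite \<Rightarrow> real) \<Rightarrow> bool" where
  "has_ldl \<tau> M P e \<longleftrightarrow> M \<in> Sp_int \<and> unit_lower P \<and> (\<forall>i. e i > 0) \<and>
     matrix_inv (im_mat (siegel_act M \<tau>)) = transpose P ** diag e ** P"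

text \<open>
  The potential of the lattice reduction algorithm of Lenstra, Lenstra and Lovasz: the product, over
  all \<open>j\<close>, of the determinants of the form on the coordinates of rank at least \<open>j\<close>.
\<close>

definition potential :: "('n::finite \<Rightarrow> real) \<Rightarrow> real" where
  "potential e = (\<Prod>i\<in>UNIV. e i ^ (rk i + 1))"

lemma potential_alt: "potential e = (\<Prod>j<CARD('n). \<Prod>i | j \<le> rk i. e i)" for e :: "'n::finite \<Rightarrow> real"
proof -
  have "(\<Prod>j<CARD('n). \<Prod>i | j \<le> rk i. e i) = (\<Prod>j<CARD('n). \<Prod>i\<in>UNIV. if j \<le> rk i then e i else 1)"
    by (intro prod.cong refl prod.mono_neutral_cong_left) auto
  also have "\<dots> = (\<Prod>i\<in>UNIV. \<Prod>j<CARD('n). if j \<le> rk i then e i else 1)" by (rule prod.swap)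
  also have "\<dots> = (\<Prod>i\<in>UNIV. e i ^ (rk i + 1))"
  proof (rule prod.cong[OF refl])
    fix i :: 'n
    have "{..<CARD('n)} \<inter> {j. j \<le> rk i} = {..rk i}" using rk_less_card[of i] by auto
    then show "(\<Prod>j<CARD('n). if j \<le> rk i then e i else 1) = e i ^ (rk i + 1)"
      by (simp add: prod.If_cases)
  qed
  finally show ?thesis by (simp add: potential_def)
qed

text \<open>
  For fixed \<open>\<tau>\<close> this form in the pair \<open>(c, d)\<close> is positive definite, so its values at nonzero integral
  pairs are bounded away from 0.
\<close>

lemma lattice_form_lower_bound:
  fixes \<tau> :: "complex^'n::finite^'n"
  assumes \<tau>: "\<tau> \<in> siegel_space"
  obtains l where "l > 0" "\<And>c d. l * ((norm c)\<^sup>2 + (norm d)\<^sup>2)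
     \<le> qf (im_mat \<tau>) c + qf (matrix_inv (im_mat \<tau>)) (re_mat \<tau> *v c + d)"
proof -
  obtain l1 where l1: "l1 > 0" "\<And>v. l1 * (norm v)\<^sup>2 \<le> qf (im_mat \<tau>) v"
    by (rule pos_def_lower_bound[OF siegelD(2)[OF \<tau>]], rule that)
  obtain l2 where l2: "l2 > 0" "\<And>v. l2 * (norm v)\<^sup>2 \<le> qf (matrix_inv (im_mat \<tau>)) v"
    by (rule pos_def_lower_bound[OF pos_def_inv[OF siegelD(2)[OF \<tau>]]], rule that)
  obtain K where K: "K > 0" "\<And>x. norm (re_mat \<tau> *v x) \<le> norm x * K"
    using bounded_linear.pos_bounded[OF matrix_vector_mul_bounded_linear] by blast
  define L where "L = (1 + 2 * K\<^sup>2) / l1 + 2 / l2"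
  have "1 + 2 * K\<^sup>2 > 0" by (simp add: add_pos_nonneg)
  then have "(1 + 2 * K\<^sup>2) / l1 > 0" "2 / l2 > 0" using l1(1) l2(1) by (auto intro: divide_pos_pos)
  then have L: "L > 0" unfolding L_def by linarith
  have "(1 / L) * ((norm c)\<^sup>2 + (norm d)\<^sup>2)
     \<le> qf (im_mat \<tau>) c + qf (matrix_inv (im_mat \<tau>)) (re_mat \<tau> *v c + d)" (is "_ \<le> ?q1 + ?q2") for c d
  proof -
    let ?x = "re_mat \<tau> *v c"
    have "norm d \<le> norm (?x + d) + norm ?x" using norm_triangle_ineq4[of "?x + d" ?x] by simp
    also have "\<dots> \<le> norm (?x + d) + norm c * K" using K(2)[of c] by simp
    finally have "(norm d)\<^sup>2 \<le> (norm (?x + d) + norm c * K)\<^sup>2" by (intro power_mono) auto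
    also have "\<dots> \<le> 2 * (norm (?x + d))\<^sup>2 + 2 * (norm c * K)\<^sup>2"
      using sum_squares_bound[of "norm (?x + d)" "norm c * K"] by (simp add: power2_sum)
    finally have 1: "(norm c)\<^sup>2 + (norm d)\<^sup>2 \<le> (1 + 2 * K\<^sup>2) * (norm c)\<^sup>2 + 2 * (norm (?x + d))\<^sup>2"
      by (simp add: power_mult_distrib algebra_simps)
    have 2: "(1 + 2 * K\<^sup>2) * (norm c)\<^sup>2 \<le> (1 + 2 * K\<^sup>2) / l1 * ?q1"
      using mult_left_mono[OF l1(2)[of c], of "(1 + 2 * K\<^sup>2) / l1"] l1(1) by simp
    have 3: "2 * (norm (?x + d))\<^sup>2 \<le> 2 / l2 * ?q2"
      using mult_left_mono[OF l2(2)[of "?x + d"], of "2 / l2"] l2(1) by simp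
    have q: "?q1 \<ge> 0" "?q2 \<ge> 0"
      using pos_def_nonneg[OF siegelD(2)[OF \<tau>]] pos_def_nonneg[OF pos_def_inv[OF siegelD(2)[OF \<tau>]]] by auto
    have "(1 + 2 * K\<^sup>2) / l1 * ?q1 \<le> L * ?q1" "2 / l2 * ?q2 \<le> L * ?q2"
      using q \<open>(1 + 2 * K\<^sup>2) / l1 > 0\<close> \<open>2 / l2 > 0\<close> by (intro mult_right_mono; simp add: L_def)+
    then have "(norm c)\<^sup>2 + (norm d)\<^sup>2 \<le> L * (?q1 + ?q2)" using 1 2 3 by (simp add: algebra_simps)
    then show ?thesis using L by (simp add: field_simps)
  qed
  then show ?thesis using L by (intro that[of "1 / L"]) auto
qed

lemma det_of_int: "det (ri A) = of_int (det A)"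
  by (simp add: det_def)

text \<open>
  The product of pivots is the determinant of the form on the coordinate subspace spanned by the
  indices of rank at least \<open>j\<close>. On that subspace the form dominates \<open>l\<close> times the integral Gram
  matrix \<open>C C\<^sup>t + D D\<^sup>t\<close>, which is positive definite because the lower rows of a symplectic matrix are
  independent; an integral positive definite matrix has determinant at least 1.
\<close>

lemma pivot_product_lower_bound:
  fixes \<tau> :: "complex^'n::finite^'n"
  assumes \<tau>: "\<tau> \<in> siegel_space"
    and l: "0 < l" "l \<le> 1" "\<And>c d. l * ((norm c)\<^sup>2 + (norm d)\<^sup>2)
     \<le> qf (im_mat \<tau>) c + qf (matrix_inv (im_mat \<tau>)) (re_mat \<tau> *v c + d)"
    and h: "has_ldl \<tau> M P e"
  shows "l ^ CARD('n) \<le> (\<Prod>i | j \<le> rk i. e i)"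
proof -
  have M: "M \<in> Sp_int" and P: "unit_lower P" and e: "\<And>i. e i > 0"
    and Y: "matrix_inv (im_mat (siegel_act M \<tau>)) = transpose P ** diag e ** P"
    using h by (auto simp: has_ldl_def)
  let ?Y = "matrix_inv (im_mat (siegel_act M \<tau>))"
  have pY: "pos_def ?Y" by (rule pos_def_inv[OF siegelD(2)[OF siegel_act_in[OF M \<tau>]]])
  define cut :: "real^'n \<Rightarrow> real^'n" where "cut v = (\<chi> i. if j \<le> rk i then v $ i else 0)" for v
  define tail :: "real^'n \<Rightarrow> real" where "tail v = (\<Sum>i | \<not> j \<le> rk i. (v $ i)\<^sup>2)" for v
  define P' :: "real^'n^'n" where "P' = (\<chi> a b. if j \<le> rk a \<and> j \<le> rk b then P $ a $ b else mat 1 $ a $ b)"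
  define e' where "e' i = (if j \<le> rk i then e i else 1)" for i
  define A where "A = transpose P' ** diag e' ** P'"
  have P': "unit_lower P'" using P by (auto simp: unit_lower_def P'_def mat_def)
  have e': "e' i > 0" for i using e by (simp add: e'_def)
  have detA: "det A = (\<Prod>i | j \<le> rk i. e i)"
    unfolding A_def det_ldl[OF P'] e'_def by (simp add: prod.If_cases)
  have pA: "pos_def A" unfolding A_def using P' e' by (rule pos_def_ldlI)
  have P'v: "(P' *v v) $ i = (if j \<le> rk i then (P *v cut v) $ i else v $ i)" for v i
    by (auto simp: matrix_vector_mult_def P'_def cut_def mat_def if_distrib[of "\<lambda>x. x * _"]
          if_distrib[of "\<lambda>x. _ * x"] cong: if_cong intro!: sum.cong)
  have cut0: "(P *v cut v) $ i = 0" if "\<not> j \<le> rk i" for v i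
    unfolding unit_lower_mult_vec[OF P] using that by (auto simp: cut_def intro!: sum.neutral)
  have qA: "qf A v = qf ?Y (cut v) + tail v" for v
  proof -
    have "qf A v = (\<Sum>i\<in>UNIV. if j \<le> rk i then e i * ((P *v cut v) $ i)\<^sup>2 else (v $ i)\<^sup>2)"
      unfolding A_def qf_ldl by (intro sum.cong) (auto simp: e'_def P'v)
    also have "\<dots> = (\<Sum>i | j \<le> rk i. e i * ((P *v cut v) $ i)\<^sup>2) + tail v"
      by (simp add: sum.If_cases tail_def Compl_eq)
    also have "(\<Sum>i | j \<le> rk i. e i * ((P *v cut v) $ i)\<^sup>2) = (\<Sum>i\<in>UNIV. e i * ((P *v cut v) $ i)\<^sup>2)"
      by (rule sum.mono_neutral_left) (auto simp: cut0)
    finally show ?thesis by (simp only: Y qf_ldl)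
  qed
  define C where "C = blk_C M" define D where "D = blk_D M"
  define G :: "int^'n^'n" where "G = C ** transpose C + D ** transpose D"
  define B :: "int^'n^'n" where "B = (\<chi> a b. if j \<le> rk a \<and> j \<le> rk b then G $ a $ b else mat 1 $ a $ b)"
  have Gsym: "G $ a $ b = G $ b $ a" for a b
    by (simp add: G_def matrix_matrix_mult_def transpose_def mult.commute)
  have Bsym: "transpose (ri B) = ri B" using Gsym by (simp add: vec_eq_iff transpose_def B_def mat_def)
  have qB: "qf (ri B) v = (norm (transpose (ri C) *v cut v))\<^sup>2 + (norm (transpose (ri D) *v cut v))\<^sup>2 + tail v" for v
  proof -
    have Bv: "(ri B *v v) $ i = (if j \<le> rk i then (ri G *v cut v) $ i else v $ i)" for i
      by (auto simp: matrix_vector_mult_def B_def cut_def mat_def if_distrib[of "\<lambda>x. x * _"]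
          if_distrib[of "\<lambda>x. _ * x"] if_distrib[of real_of_int] cong: if_cong intro!: sum.cong)
    have "qf (ri B) v = (\<Sum>i\<in>UNIV. if j \<le> rk i then cut v $ i * (ri G *v cut v) $ i else (v $ i)\<^sup>2)"
      unfolding inner_vec_def Bv by (intro sum.cong) (auto simp: cut_def power2_eq_square)
    also have "\<dots> = (\<Sum>i | j \<le> rk i. cut v $ i * (ri G *v cut v) $ i) + tail v"
      by (simp add: sum.If_cases tail_def Compl_eq)
    also have "(\<Sum>i | j \<le> rk i. cut v $ i * (ri G *v cut v) $ i) = qf (ri G) (cut v)"
      unfolding inner_vec_def inner_real_def by (rule sum.mono_neutral_left) (auto simp: cut_def)
    also have "ri G = ri C ** transpose (ri C) + ri D ** transpose (ri D)"
      by (simp add: G_def vec_eq_iff matrix_matrix_mult_def transpose_def)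
    finally show ?thesis
      unfolding power2_norm_eq_inner inner_matrix_transpose transpose_transpose matrix_vector_mult_add_rdistrib
        matrix_vector_mul_assoc[symmetric] inner_add_right .
  qed
  have qY: "qf ?Y w = qf (im_mat \<tau>) (transpose (ri C) *v w) + qf (matrix_inv (im_mat \<tau>)) (re_mat \<tau> *v (transpose (ri C) *v w) + transpose (ri D) *v w)" for w
    unfolding C_def D_def by (rule qf_inv_im_siegel_act[OF M \<tau>])
  have le: "l * qf (ri B) v \<le> qf A v" for v
  proof -
    have "tail v \<ge> 0" unfolding tail_def by (intro sum_nonneg) auto
    then have "l * tail v \<le> tail v" using l(1,2) by (simp add: mult_left_le_one_le)
    then show ?thesis unfolding qB qA qY
      using l(3)[of "transpose (ri C) *v cut v" "transpose (ri D) *v cut v"] by (simp add: algebra_simps del: transpose_matrix_vector)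
  qed
  have pB: "pos_def (ri B)" unfolding pos_def_def
  proof (intro conjI allI impI Bsym)
    fix v :: "real^'n" assume v: "v \<noteq> 0"
    have t0: "tail v \<ge> 0" unfolding tail_def by (intro sum_nonneg) auto
    have ge: "qf (ri B) v \<ge> 0" unfolding qB using t0 by simp
    have "qf (ri B) v \<noteq> 0"
    proof
      assume "qf (ri B) v = 0"
      then have "(norm (transpose (ri C) *v cut v))\<^sup>2 + (norm (transpose (ri D) *v cut v))\<^sup>2 + tail v = 0" unfolding qB .
      then have "(norm (transpose (ri C) *v cut v))\<^sup>2 = 0" "(norm (transpose (ri D) *v cut v))\<^sup>2 = 0" and t: "tail v = 0"
        using t0 by (smt (verit) zero_le_power2)+
      then have "transpose (ri C) *v cut v = 0" "transpose (ri D) *v cut v = 0" by (simp_all del: transpose_matrix_vector)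
      then have "qf A v = 0" unfolding qA qY t by simp
      then show False using pos_defD[OF pA v] by simp
    qed
    then show "0 < qf (ri B) v" using ge by linarith
  qed
  have "0 < det (ri B)" using pB by (rule pos_def_det_pos)
  then have "1 \<le> det (ri B)" unfolding det_of_int by simp
  then have "l ^ CARD('n) * 1 \<le> l ^ CARD('n) * det (ri B)" using l(1) by (intro mult_left_mono) auto
  also have "\<dots> \<le> det A" by (rule det_mono[OF pB pos_def_sym[OF pA] l(1) le])
  finally show ?thesis unfolding detA by simp
qed

lemma potential_lower_bound:
  fixes \<tau> :: "complex^'n::finite^'n"
  assumes \<tau>: "\<tau> \<in> siegel_space"
  obtains c where "c > 0" "\<And>M P e. has_ldl \<tau> M P e \<Longrightarrow> c \<le> potential e"
proof -
  obtain l where l: "l > 0" "\<And>c d. l * ((norm c)\<^sup>2 + (norm d)\<^sup>2)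
     \<le> qf (im_mat \<tau>) c + qf (matrix_inv (im_mat \<tau>)) (re_mat \<tau> *v c + d)"
    by (rule lattice_form_lower_bound[OF \<tau>], rule that)
  define m where "m = min l 1"
  have m: "0 < m" "m \<le> 1" "m \<le> l" using l(1) by (auto simp: m_def)
  have m': "m * ((norm c)\<^sup>2 + (norm d)\<^sup>2)
     \<le> qf (im_mat \<tau>) c + qf (matrix_inv (im_mat \<tau>)) (re_mat \<tau> *v c + d)" for c d
    by (rule order_trans[OF mult_right_mono[OF m(3)] l(2)]) simp
  show ?thesis
  proof (rule that)
    show "0 < (m ^ CARD('n)) ^ CARD('n)" using m by simp
    fix M P e assume h: "has_ldl \<tau> M P e"
    have "(\<Prod>j<CARD('n). m ^ CARD('n)) \<le> potential e"
      unfolding potential_alt using pivot_product_lower_bound[OF \<tau> m(1,2) m' h] m(1)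
      by (intro prod_mono) auto
    then show "(m ^ CARD('n)) ^ CARD('n) \<le> potential e" by simp
  qed
qed

text \<open>
  The potentials on an orbit have a positive infimum, and some representative comes within the factor
  \<open>4/3\<close> of it. The slack replaces an argument that the minimum is attained, and it is small enough
  for the two bounds on the pivots below.
\<close>

lemma near_minimal_potential:
  fixes \<tau> :: "complex^'n::finite^'n"
  assumes \<tau>: "\<tau> \<in> siegel_space"
  obtains M P e where "has_ldl \<tau> M P e"
    "\<And>M' P' e'. has_ldl \<tau> M' P' e' \<Longrightarrow> 3 / 4 * potential e \<le> potential e'"
proof -
  obtain c where c: "c > 0" "\<And>M P e. has_ldl \<tau> M P e \<Longrightarrow> c \<le> potential e"
    by (rule potential_lower_bound[OF \<tau>], rule that)
  define S where "S = {potential e | M P e. has_ldl \<tau> M P e}"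
  have "S \<noteq> {}"
  proof -
    have "pos_def (matrix_inv (im_mat (siegel_act (mat 1) \<tau>)))"
      by (rule pos_def_inv[OF siegelD(2)[OF siegel_act_in[OF Sp_int_one \<tau>]]])
    then obtain P e where "unit_lower P" "\<And>i. e i > 0"
      "matrix_inv (im_mat (siegel_act (mat 1) \<tau>)) = transpose P ** diag e ** P"
      using pos_def_ldl by blast
    then have "has_ldl \<tau> (mat 1) P e" by (simp add: has_ldl_def Sp_int_one)
    then show ?thesis by (auto simp: S_def)
  qed
  have bdd: "bdd_below S" using c(2) by (auto simp: S_def intro!: bdd_belowI[of _ c])
  have I: "Inf S \<ge> c" using \<open>S \<noteq> {}\<close> c(2) by (auto simp: S_def intro!: cInf_greatest)
  then have "Inf S < 4 / 3 * Inf S" using c(1) by simp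
  then obtain x where x: "x \<in> S" "x < 4 / 3 * Inf S" using \<open>S \<noteq> {}\<close> bdd by (meson cInf_less_iff)
  then obtain M P e where h: "has_ldl \<tau> M P e" "x = potential e" by (auto simp: S_def)
  show ?thesis
  proof (rule that[OF h(1)])
    fix M' P' e' assume "has_ldl \<tau> M' P' e'"
    then have "Inf S \<le> potential e'" using bdd by (intro cInf_lower) (auto simp: S_def)
    then show "3 / 4 * potential e \<le> potential e'" using x(2) h(2) by simp
  qed
qed

text \<open>
  To pass from \<open>M\<close> to \<open>N M\<close> it suffices to decompose the form that the lower rows of \<open>N\<close> produce.
\<close>

lemma has_ldl_move:
  fixes \<tau> :: "complex^'n::finite^'n"
  assumes \<tau>: "\<tau> \<in> siegel_space" and h: "has_ldl \<tau> M P e" and N: "N \<in> Sp_int"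
    and P': "unit_lower P'" and e': "\<And>i. e' i > 0"
    and eq: "\<And>w. (\<Sum>i\<in>UNIV. e' i * ((P' *v w) $ i)\<^sup>2) =
      qf (im_mat (siegel_act M \<tau>)) (transpose (ri (blk_C N)) *v w)
      + (\<Sum>i\<in>UNIV. e i * ((P *v (re_mat (siegel_act M \<tau>) *v (transpose (ri (blk_C N)) *v w) + transpose (ri (blk_D N)) *v w)) $ i)\<^sup>2)"
  shows "has_ldl \<tau> (N ** M) P' e'"
proof -
  have M: "M \<in> Sp_int" and Y: "matrix_inv (im_mat (siegel_act M \<tau>)) = transpose P ** diag e ** P"
    using h by (auto simp: has_ldl_def)
  have T: "siegel_act M \<tau> \<in> siegel_space" using M \<tau> by (rule siegel_act_in)
  have "matrix_inv (im_mat (siegel_act N (siegel_act M \<tau>))) = transpose P' ** diag e' ** P'"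
  proof (rule ldl_eqI)
    show "pos_def (matrix_inv (im_mat (siegel_act N (siegel_act M \<tau>))))"
      by (rule pos_def_inv[OF siegelD(2)[OF siegel_act_in[OF N T]]])
    show "qf (matrix_inv (im_mat (siegel_act N (siegel_act M \<tau>)))) v = (\<Sum>i\<in>UNIV. e' i * ((P' *v v) $ i)\<^sup>2)" for v
      unfolding qf_inv_im_siegel_act[OF N T] Y qf_ldl eq ..
  qed
  then show ?thesis using Sp_int_mult[OF N M] P' e' siegel_act_mult[OF N M \<tau>] by (simp add: has_ldl_def)
qed

text \<open>
  The element \<open>diag (W\<^sup>-\<^sup>1, W\<^sup>t)\<close> of the symplectic group substitutes \<open>W w\<close> for \<open>w\<close> in the form.
\<close>

lemma has_ldl_unimodular:
  fixes \<tau> :: "complex^'n::finite^'n"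
  assumes \<tau>: "\<tau> \<in> siegel_space" and h: "has_ldl \<tau> M P e" and W: "Z ** W = mat 1"
    and P': "unit_lower P'" and e': "\<And>i. e' i > 0"
    and eq: "\<And>w. (\<Sum>i\<in>UNIV. e' i * ((P' *v w) $ i)\<^sup>2) = (\<Sum>i\<in>UNIV. e i * ((P *v (ri W *v w)) $ i)\<^sup>2)"
  shows "\<exists>M'. has_ldl \<tau> M' P' e'"
proof -
  define N where "N = mkblk Z 0 0 (transpose W)"
  have "transpose Z ** transpose W = mat 1"
    unfolding matrix_transpose_mul[symmetric] int_matrix_left_right_inverse[OF W] by simp
  moreover have t0: "transpose (0 :: int^'n^'n) = 0" by (simp add: vec_eq_iff transpose_def)
  moreover have z0: "A ** (0 :: int^'n^'n) = 0" "0 ** A = 0" for A :: "int^'n^'n"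
    by (simp_all add: vec_eq_iff matrix_matrix_mult_def)
  ultimately have N: "N \<in> Sp_int" by (simp add: Sp_int_iff N_def)
  have CN: "transpose (ri (blk_C N)) = 0" by (simp add: N_def vec_eq_iff transpose_def)
  have DN: "transpose (ri (blk_D N)) = ri W" by (simp add: N_def vec_eq_iff transpose_def)
  have "has_ldl \<tau> (N ** M) P' e'"
    by (rule has_ldl_move[OF \<tau> h N P' e']) (unfold CN DN, simp add: eq)
  then show ?thesis by blast
qed

text \<open>
  An integral unit triangular substitution rounds away the entries of \<open>P\<close>, one rank after the other,
  without a change of the pivots.
\<close>

lemma size_reduction:
  fixes \<tau> :: "complex^'n::finite^'n"
  assumes \<tau>: "\<tau> \<in> siegel_space" and h: "has_ldl \<tau> M P e"
  obtains M' P' where "has_ldl \<tau> M' P' e" "\<And>i j. i \<noteq> j \<Longrightarrow> \<bar>P' $ i $ j\<bar> \<le> 1 / 2"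
proof -
  have P: "unit_lower P" and e: "\<And>i. e i > 0" using h by (auto simp: has_ldl_def)
  define F :: "'n \<Rightarrow> 'n \<Rightarrow> ('n \<Rightarrow> int) \<Rightarrow> int" where "F j i u = (if rk i < rk j then 0 else if i = j then 1
      else - round (\<Sum>l | rk l < rk i. P $ i $ l * of_int (u l)))" for j i :: 'n and u :: "'n \<Rightarrow> int"
  have "\<exists>u :: 'n \<Rightarrow> int. \<forall>i. u i = F j i u" for j
  proof (rule triangular_recursion[of "F j"])
    fix i :: 'n and u u' :: "'n \<Rightarrow> int" assume "\<And>l. rk l < rk i \<Longrightarrow> u l = u' l"
    then have "(\<Sum>l | rk l < rk i. P $ i $ l * of_int (u l)) = (\<Sum>l | rk l < rk i. P $ i $ l * of_int (u' l))"
      by (intro sum.cong) auto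
    then show "F j i u = F j i u'" by (simp only: F_def)
  qed
  then have "\<exists>u. \<forall>j i. u j i = F j i (u j)" by (rule choice[OF allI])
  then obtain u where u: "\<forall>j i. u j i = F j i (u j)" by (elim exE)
  define W :: "int^'n^'n" where "W = (\<chi> i j. u j i)"
  have W: "unit_lower (ri W)" unfolding unit_lower_def W_def using u by (auto simp: F_def)
  then obtain Z where Z: "Z ** W = mat 1" using integral_unit_lower_inverse by blast
  define P' where "P' = P ** ri W"
  have P': "unit_lower P'" unfolding P'_def using P W by (rule unit_lower_mult)
  have small: "\<bar>P' $ i $ j\<bar> \<le> 1 / 2" if "i \<noteq> j" for i j
  proof (cases "rk i < rk j")
    case True then show ?thesis using P' by (simp add: unit_lower_def)
  next
    case False
    define s where "s = (\<Sum>l | rk l < rk i. P $ i $ l * of_int (u j l))"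
    have "P' $ i $ j = (P *v column j (ri W)) $ i"
      unfolding P'_def by (simp add: matrix_matrix_mult_def matrix_vector_mult_def column_def)
    also have "\<dots> = of_int (u j i) + s"
      unfolding unit_lower_mult_vec[OF P] s_def by (simp add: column_def W_def)
    also have "of_int (u j i) = - real_of_int (round s)"
      using u[rule_format, of j i] False that unfolding s_def F_def by simp
    finally show ?thesis using of_int_round_abs_le[of s] by linarith
  qed
  have "\<exists>M'. has_ldl \<tau> M' P' e"
    by (rule has_ldl_unimodular[OF \<tau> h Z P' e]) (simp add: P'_def matrix_vector_mul_assoc)
  then show ?thesis using small that by blast
qed

text \<open>
  In the coordinate \<open>a\<close> of rank 0 the situation is that of the modular group acting on the upper half
  plane: \<open>1 / e a\<close> is the imaginary part of the diagonal entry of \<open>M \<tau>\<close>. The embedded inversion, after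
  a translation that makes the real part \<open>y\<close> of the entry at most \<open>1/2\<close>, multiplies the pivot and the
  potential by \<open>1 / (e a)\<^sup>2 + y\<^sup>2\<close>. This factor is at least \<open>3/4\<close> by near minimality.
\<close>

lemma first_pivot_bound:
  fixes \<tau> :: "complex^'n::finite^'n"
  assumes \<tau>: "\<tau> \<in> siegel_space" and h: "has_ldl \<tau> M P e" and a: "rk a = 0"
    and min: "\<And>M' P' e'. has_ldl \<tau> M' P' e' \<Longrightarrow> 3 / 4 * potential e \<le> potential e'"
  shows "e a \<le> 2"
proof -
  have M: "M \<in> Sp_int" and P: "unit_lower P" and e: "\<And>i. e i > 0"
    and Y: "matrix_inv (im_mat (siegel_act M \<tau>)) = transpose P ** diag e ** P"
    using h by (auto simp: has_ldl_def)
  let ?T = "siegel_act M \<tau>"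
  define X where "X = im_mat ?T"
  have pX: "pos_def X" unfolding X_def using siegelD(2)[OF siegel_act_in[OF M \<tau>]] .
  have Pa: "(P *v v) $ a = v $ a" for v unfolding unit_lower_mult_vec[OF P] a by simp
  have Xaa: "X $ a $ a = 1 / e a"
  proof -
    have iP: "invertible P" using P by (rule unit_lower_invertible)
    define x where "x = matrix_inv P *v ((1 / e a) *\<^sub>R axis a 1)"
    have Px: "P *v x = (1 / e a) *\<^sub>R axis a 1" unfolding x_def by (rule mult_matrix_inv_vec[OF iP])
    have "matrix_inv X *v x = transpose P *v (diag e *v (P *v x))"
      unfolding X_def Y by (simp only: matrix_vector_mul_assoc matrix_mul_assoc)
    also have "diag e *v (P *v x) = axis a 1"
      unfolding Px using e[of a] by (simp add: vec_eq_iff diag_mult_vec axis_def) 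
    also have "transpose P *v axis a 1 = axis a 1"
    proof -
      have "P $ a $ i = (if i = a then 1 else 0)" for i
        using P a unfolding unit_lower_def by (metis gr0I rk_eq_iff)
      moreover have "(transpose P *v axis a 1) $ i = P $ a $ i" for i
      proof -
        have "(transpose P *v axis a 1) $ i = (\<Sum>j\<in>UNIV. if j = a then P $ a $ i else 0)"
          unfolding transpose_mult_vec by (intro sum.cong) (auto simp: axis_def)
        then show ?thesis by simp
      qed
      ultimately show ?thesis by (simp add: vec_eq_iff axis_def del: transpose_matrix_vector)
    qed
    finally have "X *v axis a 1 = X *v (matrix_inv X *v x)" by simp
    also have "\<dots> = x" by (rule mult_matrix_inv_vec[OF pos_def_invertible[OF pX]])
    finally have "X $ a $ a = x $ a" by (simp add: matrix_vector_mult_basis column_def vec_eq_iff)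
    also have "\<dots> = 1 / e a" using Pa[of x] unfolding Px by simp
    finally show ?thesis .
  qed
  define n where "n = - round (re_mat ?T $ a $ a)"
  define y where "y = re_mat ?T $ a $ a + of_int n"
  have y: "y\<^sup>2 \<le> 1 / 4"
  proof -
    have "\<bar>y\<bar> \<le> 1 / 2" using of_int_round_abs_le[of "re_mat ?T $ a $ a"] unfolding y_def n_def of_int_minus by linarith
    then have "\<bar>y\<bar>\<^sup>2 \<le> (1 / 2)\<^sup>2" by (intro power_mono) auto
    then show ?thesis by (simp add: power2_eq_square)
  qed
  define E :: "int^'n^'n" where "E = (\<chi> i j. if i = a \<and> j = a then 1 else 0)"
  \<comment> \<open>the translation by \<open>n\<close> followed by the inversion, both embedded in the coordinate \<open>a\<close>\<close>
  define N where "N = mkblk (mat 1 - E) (- E) E (mat 1 - E + (\<chi> i j. n * E $ i $ j))"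
  have EE: "E ** E = E"
  proof -
    have "(\<Sum>k\<in>UNIV. (if i = a \<and> k = a then 1 else 0) * (if k = a \<and> j = a then 1 else 0))
      = (\<Sum>k\<in>UNIV. if k = a then (if i = a \<and> j = a then 1 else 0) else (0::int))" for i j
      by (intro sum.cong) auto
    then show ?thesis by (simp add: vec_eq_iff E_def matrix_matrix_mult_def)
  qed
  have nE: "(\<chi> i j. n * E $ i $ j) = mat n ** E"
    by (simp add: vec_eq_iff matrix_matrix_mult_def mat_def if_distrib[of "\<lambda>x. x * _"] cong: if_cong)
  have tE: "transpose E = E" by (auto simp: E_def transpose_def vec_eq_iff)
  have En: "E ** (mat n ** E) = mat n ** E" "transpose (mat n ** E) = mat n ** E" "(mat n ** E) ** E = mat n ** E"
  proof -
    show "(mat n ** E) ** E = mat n ** E" by (simp add: matrix_mul_assoc[symmetric] EE)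
    have c: "E ** mat n = mat n ** E"
      by (simp add: vec_eq_iff matrix_matrix_mult_def mat_def if_distrib[of "\<lambda>x. x * _"] if_distrib[of "\<lambda>x. _ * x"] cong: if_cong)
    show "E ** (mat n ** E) = mat n ** E" by (simp only: matrix_mul_assoc c) (simp add: matrix_mul_assoc[symmetric] EE)
    show "transpose (mat n ** E) = mat n ** E" by (simp add: matrix_transpose_mul tE c)
  qed
  have N: "N \<in> Sp_int" unfolding Sp_int_iff N_def nE blk_mkblk
    by (simp add: transpose_add transpose_diff transpose_uminus tE EE En matrix_add_ldistrib matrix_add_rdistrib
       matrix_diff_ldistrib matrix_diff_rdistrib matrix_uminus_left matrix_uminus_right)
  have CN: "(transpose (ri (blk_C N)) *v w) = w $ a *\<^sub>R axis a 1" for w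
  proof -
    have "(\<Sum>j\<in>UNIV. real_of_int (if j = a \<and> i = a then 1 else 0) * w $ j) = (\<Sum>j\<in>UNIV. if j = a then (if i = a then w $ a else 0) else 0)" for i
      by (intro sum.cong) auto
    then show ?thesis unfolding N_def by (simp add: vec_eq_iff transpose_mult_vec E_def axis_def del: transpose_matrix_vector)
  qed
  define t where "t = re_mat ?T *v axis a 1 + (of_int n - 1) *\<^sub>R axis a 1"
  have DN: "(transpose (ri (blk_D N)) *v w) = w + ((of_int n - 1) * w $ a) *\<^sub>R axis a 1" for w
  proof -
    have "(\<Sum>j\<in>UNIV. real_of_int (mat 1 $ j $ i - (if j = a \<and> i = a then 1 else 0) + n * (if j = a \<and> i = a then 1 else 0)) * w $ j)
       = (\<Sum>j\<in>UNIV. (if j = i then w $ i else 0) + (if j = a then (if i = a then (of_int n - 1) * w $ a else 0) else 0))" for i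
      by (intro sum.cong) (auto simp: mat_def algebra_simps)
    then show ?thesis unfolding N_def by (simp add: vec_eq_iff transpose_mult_vec E_def axis_def sum.distrib del: transpose_matrix_vector)
  qed
  define P' :: "real^'n^'n" where "P' = (\<chi> i j. if i = a then P $ a $ j else P $ i $ j + (if j = a then (P *v t) $ i else 0))"
  define e' where "e' i = (if i = a then e a * (1 / (e a)\<^sup>2 + y\<^sup>2) else e i)" for i
  have P': "unit_lower P'" using P a unfolding unit_lower_def P'_def by auto
  have e': "e' i > 0" for i using e[of a] e[of i] by (auto simp: e'_def intro!: mult_pos_pos add_pos_nonneg)
  have P'w: "(P' *v w) $ i = (if i = a then w $ a else (P *v (w + w $ a *\<^sub>R t)) $ i)" for w i
  proof (cases "i = a")
    case True
    have "(P' *v w) $ a = (P *v w) $ a" by (simp add: P'_def matrix_vector_mult_def)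
    then show ?thesis using True Pa by simp
  next
    case False
    have "P' $ i $ j * w $ j = P $ i $ j * w $ j + (if j = a then (P *v t) $ i * w $ a else 0)" for j
      using False by (simp add: P'_def algebra_simps)
    then have "(P' *v w) $ i = (\<Sum>j\<in>UNIV. P $ i $ j * w $ j + (if j = a then (P *v t) $ i * w $ a else 0))"
      by (simp add: matrix_vector_mult_def[of P'])
    also have "\<dots> = (P *v w) $ i + w $ a * (P *v t) $ i"
      by (simp add: sum.distrib matrix_vector_mult_def)
    finally show ?thesis using False by (simp add: matrix_vector_right_distrib matrix_vector_mult_scaleR)
  qed
  have "has_ldl \<tau> (N ** M) P' e'"
  proof (rule has_ldl_move[OF \<tau> h N P' e'])
    fix w
    have arg: "re_mat ?T *v (w $ a *\<^sub>R axis a 1) + (w + ((of_int n - 1) * w $ a) *\<^sub>R axis a 1) = w + w $ a *\<^sub>R t"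
      by (simp add: t_def matrix_vector_mult_scaleR scaleR_add_right algebra_simps)
    have qa: "qf X (w $ a *\<^sub>R axis a 1) = (w $ a)\<^sup>2 * (1 / e a)"
      using Xaa by (simp add: matrix_vector_mult_scaleR matrix_vector_mult_basis inner_axis' column_def power2_eq_square)
    have ta: "t $ a = y - 1"
      by (simp add: t_def y_def matrix_vector_mult_basis column_def)
    have split: "(\<Sum>i\<in>UNIV. f i) = f a + (\<Sum>i\<in>UNIV - {a}. f i)" for f :: "'n \<Rightarrow> real" by (simp add: sum.remove)
    have "(\<Sum>i\<in>UNIV. e' i * ((P' *v w) $ i)\<^sup>2)
      = e a * (1 / (e a)\<^sup>2 + y\<^sup>2) * (w $ a)\<^sup>2 + (\<Sum>i\<in>UNIV - {a}. e i * ((P *v (w + w $ a *\<^sub>R t)) $ i)\<^sup>2)"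
      unfolding split by (simp add: e'_def P'w)
    also have "e a * (1 / (e a)\<^sup>2 + y\<^sup>2) * (w $ a)\<^sup>2 = (w $ a)\<^sup>2 * (1 / e a) + e a * ((P *v (w + w $ a *\<^sub>R t)) $ a)\<^sup>2"
    proof -
      have "(w + w $ a *\<^sub>R t) $ a = w $ a * y"
        unfolding vector_add_component vector_scaleR_component ta by (simp add: algebra_simps)
      then show ?thesis unfolding Pa using e[of a] by (simp add: power2_eq_square field_simps)
    qed
    finally have "(\<Sum>i\<in>UNIV. e' i * ((P' *v w) $ i)\<^sup>2) = (w $ a)\<^sup>2 * (1 / e a) + (\<Sum>i\<in>UNIV. e i * ((P *v (w + w $ a *\<^sub>R t)) $ i)\<^sup>2)"
      unfolding split[of "\<lambda>i. e i * ((P *v (w + w $ a *\<^sub>R t)) $ i)\<^sup>2"] by simp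
    then show "(\<Sum>i\<in>UNIV. e' i * ((P' *v w) $ i)\<^sup>2) =
      qf (im_mat ?T) (transpose (ri (blk_C N)) *v w)
      + (\<Sum>i\<in>UNIV. e i * ((P *v (re_mat ?T *v (transpose (ri (blk_C N)) *v w) + transpose (ri (blk_D N)) *v w)) $ i)\<^sup>2)"
      unfolding CN DN arg qa[unfolded X_def] .
  qed
  then have "3 / 4 * potential e \<le> potential e'" by (rule min)
  moreover have "potential e' = (1 / (e a)\<^sup>2 + y\<^sup>2) * potential e"
  proof -
    have split: "(\<Prod>i\<in>UNIV. f i) = f a * (\<Prod>i\<in>UNIV - {a}. f i)" for f :: "'n \<Rightarrow> real" by (simp add: prod.remove)
    show ?thesis unfolding potential_def split by (simp add: e'_def a mult_ac)
  qed
  moreover have "potential e > 0" unfolding potential_def using e by (intro prod_pos) simp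
  ultimately have "3 / 4 \<le> 1 / (e a)\<^sup>2 + y\<^sup>2" by simp
  then have "1 / 2 \<le> 1 / (e a)\<^sup>2" using y by linarith
  then have "(e a)\<^sup>2 \<le> 2" using e[of a] by (simp add: field_simps)
  also have "\<dots> \<le> 2\<^sup>2" by simp
  finally show ?thesis by (rule power2_le_imp_le) simp
qed

text \<open>
  The exchange step of lattice reduction: swapping two neighbouring coordinates replaces the pivot
  \<open>e b\<close> by \<open>E = e a + n\<^sup>2 e b\<close> with \<open>n = P b a\<close>, keeps the product of the two pivots, and so multiplies the
  potential by \<open>E / e b\<close>.
\<close>

lemma adjacent_pivot_bound:
  fixes \<tau> :: "complex^'n::finite^'n"
  assumes \<tau>: "\<tau> \<in> siegel_space" and h: "has_ldl \<tau> M P e" and ab: "rk b = Suc (rk a)"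
    and sm: "\<bar>P $ b $ a\<bar> \<le> 1 / 2"
    and min: "\<And>M' P' e'. has_ldl \<tau> M' P' e' \<Longrightarrow> 3 / 4 * potential e \<le> potential e'"
  shows "e b \<le> 2 * e a"
proof -
  have P: "unit_lower P" and e: "\<And>i. e i > 0" using h by (auto simp: has_ldl_def)
  have ne: "a \<noteq> b" using ab by auto
  define s where "s i = (if i = a then b else if i = b then a else i)" for i
  have ss: "s (s i) = i" for i by (simp add: s_def)
  have bs: "bij s" by (rule o_bij[of s s]) (auto simp: ss fun_eq_iff)
  define W :: "int^'n^'n" where "W = (\<chi> i j. if s i = j then 1 else 0)"
  have Ww: "(ri W *v w) $ i = w $ s i" for w i
    by (simp add: W_def matrix_vector_mult_def if_distrib[of "\<lambda>x. x * _"] if_distrib[of real_of_int] cong: if_cong)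
  have WW: "W ** W = mat 1"
  proof -
    have "(W ** W) $ i $ j = (\<Sum>k\<in>UNIV. if k = s i then (if s k = j then 1 else 0) else 0)" for i j
      unfolding matrix_matrix_mult_def W_def vec_lambda_beta by (intro sum.cong) auto
    then show ?thesis by (simp add: vec_eq_iff mat_def ss)
  qed
  define n where "n = P $ b $ a"
  define E where "E = e a + n\<^sup>2 * e b"
  have E: "E > 0" unfolding E_def using e[of a] e[of b] by (simp add: add_pos_nonneg less_imp_le)
  define P' :: "real^'n^'n" where "P' = (\<chi> i j. if i = a then P $ b $ s j - n * P $ a $ s j
     else if i = b then (e a * P $ a $ s j + n * e b * P $ b $ s j) / E else P $ i $ s j)"
  define e' where "e' i = (if i = a then e a * e b / E else if i = b then E else e i)" for i
  have e': "e' i > 0" for i using e E by (simp add: e'_def)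
  have sj: "(P *v (ri W *v w)) $ i = (\<Sum>j\<in>UNIV. P $ i $ s j * w $ j)" for w i
  proof -
    have "(P *v (ri W *v w)) $ i = (\<Sum>j\<in>UNIV. P $ i $ j * w $ s j)"
      by (simp add: matrix_vector_mult_def[of P] Ww)
    also have "\<dots> = (\<Sum>j\<in>UNIV. P $ i $ s j * w $ s (s j))"
      using sum.reindex_bij_betw[OF bs, of "\<lambda>j. P $ i $ j * w $ s j"] by simp
    finally show ?thesis by (simp add: ss)
  qed
  have P'w: "(P' *v w) $ i = (if i = a then (P *v (ri W *v w)) $ b - n * (P *v (ri W *v w)) $ a
     else if i = b then (e a * (P *v (ri W *v w)) $ a + n * e b * (P *v (ri W *v w)) $ b) / E
     else (P *v (ri W *v w)) $ i)" for w i
  proof -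
    have "(P' *v w) $ i = (\<Sum>j\<in>UNIV. P' $ i $ j * w $ j)" by (simp add: matrix_vector_mult_def)
    moreover have "P' $ i $ j * w $ j = (if i = a then P $ b $ s j * w $ j - n * (P $ a $ s j * w $ j)
      else if i = b then (e a * (P $ a $ s j * w $ j) + n * e b * (P $ b $ s j * w $ j)) / E
      else P $ i $ s j * w $ j)" for j by (simp add: P'_def algebra_simps)
    ultimately show ?thesis unfolding sj
      by (simp add: sum_distrib_left sum_subtractf sum.distrib flip: sum_divide_distrib)
  qed
  have Pz: "P $ i $ j = 0" if "rk i < rk j" for i j using P that by (simp add: unit_lower_def)
  have Pd: "P $ i $ i = 1" for i using P by (simp add: unit_lower_def)
  have P': "unit_lower P'" unfolding unit_lower_def
  proof (intro conjI allI impI)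
    fix i
    have "P $ a $ b = 0" by (rule Pz) (simp add: ab)
    moreover have "(e a * 1 + n * e b * n) / E = 1" using E by (simp add: E_def power2_eq_square algebra_simps)
    ultimately show "P' $ i $ i = 1" using ne by (auto simp: P'_def s_def Pd simp flip: n_def)
  next
    fix i j :: 'n assume lt: "rk i < rk j"
    have "P $ i $ s j = 0" if "i \<noteq> a" "i \<noteq> b"
    proof (rule Pz)
      have "rk i \<noteq> rk a" using that by simp
      then show "rk i < rk (s j)" using lt ab that by (auto simp: s_def less_Suc_eq)
    qed
    moreover have "P $ b $ s j - n * P $ a $ s j = 0" if "i = a"
    proof (cases "j = b")
      case True then show ?thesis using ne by (simp add: s_def Pd n_def)
    next
      case False
      then have "rk j \<noteq> rk b" by simp
      then have "rk b < rk j" "rk a < rk j" "s j = j" using lt that ab False by (auto simp: s_def)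
      then show ?thesis by (simp add: Pz)
    qed
    moreover have "P $ a $ s j = 0" "P $ b $ s j = 0" if "i = b"
    proof -
      have "s j = j" "rk a < rk j" "rk b < rk j" using lt that ab by (auto simp: s_def)
      then show "P $ a $ s j = 0" "P $ b $ s j = 0" by (simp_all add: Pz)
    qed
    ultimately show "P' $ i $ j = 0" by (auto simp: P'_def)
  qed
  have split: "(\<Sum>i\<in>UNIV. f i) = f a + f b + (\<Sum>i\<in>UNIV - {a, b}. f i)" for f :: "'n \<Rightarrow> real"
    using ne by (simp add: sum.remove[of _ a] sum.remove[of _ b] insert_commute[of a b] Diff_insert[symmetric] ) 
  have "\<exists>M'. has_ldl \<tau> M' P' e'"
  proof (rule has_ldl_unimodular[OF \<tau> h WW P' e'])
    fix w
    let ?s = "ri W *v w"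
    define x where "x = (P *v ?s) $ a" define z where "z = (P *v ?s) $ b"
    have "e a * e b / E * (z - n * x)\<^sup>2 + E * ((e a * x + n * e b * z) / E)\<^sup>2 = e a * x\<^sup>2 + e b * z\<^sup>2"
    proof -
      have "e a * e b * (z - n * x)\<^sup>2 + (e a * x + n * e b * z)\<^sup>2 = E * (e a * x\<^sup>2 + e b * z\<^sup>2)"
        unfolding E_def by (simp add: power2_eq_square algebra_simps)
      moreover have "e a * e b / E * (z - n * x)\<^sup>2 + E * ((e a * x + n * e b * z) / E)\<^sup>2
        = (e a * e b * (z - n * x)\<^sup>2 + (e a * x + n * e b * z)\<^sup>2) / E"
      proof -
        have H: "E * (r / E)\<^sup>2 = r\<^sup>2 / E" for r using E by (simp add: power2_eq_square)
        show ?thesis unfolding H by (simp add: add_divide_distrib)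
      qed
      ultimately show ?thesis using E by simp
    qed
    moreover have "(\<Sum>i\<in>UNIV - {a, b}. e' i * ((P' *v w) $ i)\<^sup>2) = (\<Sum>i\<in>UNIV - {a, b}. e i * ((P *v ?s) $ i)\<^sup>2)"
      by (intro sum.cong) (auto simp: e'_def P'w)
    ultimately show "(\<Sum>i\<in>UNIV. e' i * ((P' *v w) $ i)\<^sup>2) = (\<Sum>i\<in>UNIV. e i * ((P *v ?s) $ i)\<^sup>2)"
      unfolding split using ne by (simp add: e'_def P'w x_def z_def)
  qed
  then have le: "3 / 4 * potential e \<le> potential e'" using min by blast
  have "potential e' = E / e b * potential e"
  proof -
    have split': "(\<Prod>i\<in>UNIV. f i) = f a * f b * (\<Prod>i\<in>UNIV - {a, b}. f i)" for f :: "'n \<Rightarrow> real"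
    proof -
      have "(\<Prod>i\<in>UNIV. f i) = f a * (\<Prod>i\<in>UNIV - {a}. f i)" by (simp add: prod.remove)
      also have "(\<Prod>i\<in>UNIV - {a}. f i) = f b * (\<Prod>i\<in>UNIV - {a} - {b}. f i)" using ne by (intro prod.remove) auto
      also have "UNIV - {a} - {b} = UNIV - {a, b}" by auto
      finally show ?thesis by (simp add: mult.assoc)
    qed
    have "(\<Prod>i\<in>UNIV - {a, b}. e' i ^ (rk i + 1)) = (\<Prod>i\<in>UNIV - {a, b}. e i ^ (rk i + 1))"
      by (intro prod.cong) (auto simp: e'_def)
    moreover have "(e a * e b / E) ^ (rk a + 1) * E ^ (rk b + 1) = E / e b * (e a ^ (rk a + 1) * e b ^ (rk b + 1))"
      using E e[of b] unfolding ab by (simp add: power_divide power_mult_distrib field_simps)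
    ultimately show ?thesis unfolding potential_def split' using ne by (simp add: e'_def mult_ac)
  qed
  moreover have "potential e > 0" unfolding potential_def using e by (intro prod_pos) simp
  ultimately have "3 / 4 \<le> E / e b" using le mult_right_le_imp_le[of "3 / 4" "potential e" "E / e b"] by (simp only:)
  then have "3 / 4 * e b \<le> e a + n\<^sup>2 * e b" unfolding E_def using e[of b] by (simp add: field_simps)
  moreover have "n\<^sup>2 * e b \<le> 1 / 4 * e b"
  proof -
    have "\<bar>n\<bar>\<^sup>2 \<le> (1 / 2)\<^sup>2" using sm unfolding n_def by (intro power_mono) auto
    then have "n\<^sup>2 \<le> 1 / 4" by (simp add: power2_eq_square)
    then show ?thesis using e[of b] by (intro mult_right_mono) auto
  qed
  ultimately show ?thesis by linarith
qed

text \<open>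
  The constants are far from optimal, but they depend on the degree only. The bound on the pivots of
  \<open>(Im (M \<tau>))\<^sup>-\<^sup>1\<close> says that \<open>Im (M \<tau>)\<close> is bounded below.
\<close>

theorem symplectic_reduction:
  fixes \<tau> :: "complex^'n::finite^'n"
  assumes \<tau>: "\<tau> \<in> siegel_space"
  obtains M P e where "M \<in> Sp_int" "unit_lower P" "\<And>i. e i > 0"
    "matrix_inv (im_mat (siegel_act M \<tau>)) = transpose P ** diag e ** P"
    "\<And>i j. \<bar>P $ i $ j\<bar> \<le> 1" "\<And>a b. rk a \<le> rk b \<Longrightarrow> e b \<le> 2 ^ CARD('n) * e a" "\<And>i. e i \<le> 2 ^ (CARD('n) + 1)"
proof -
  obtain M0 P0 e where h0: "has_ldl \<tau> M0 P0 e"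
    and min: "\<And>M' P' e'. has_ldl \<tau> M' P' e' \<Longrightarrow> 3 / 4 * potential e \<le> potential e'"
    using near_minimal_potential[OF \<tau>] by blast
  obtain M P where h: "has_ldl \<tau> M P e" and sm: "\<And>i j. i \<noteq> j \<Longrightarrow> \<bar>P $ i $ j\<bar> \<le> 1 / 2"
    using size_reduction[OF \<tau> h0] by blast
  have P: "unit_lower P" and e: "\<And>i. e i > 0" using h by (auto simp: has_ldl_def)
  have step: "e b \<le> 2 * e a" if "rk b = Suc (rk a)" for a b
  proof -
    have "b \<noteq> a" using that by auto
    then show ?thesis by (intro adjacent_pivot_bound[OF \<tau> h that sm min])
  qed
  have mono: "e b \<le> 2 ^ d * e a" if "rk b = rk a + d" for a b d
    using that
  proof (induction d arbitrary: b)
    case 0 then show ?case by simp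
  next
    case (Suc d)
    have "rk a + d < CARD('n)" using Suc.prems rk_less_card[of b] by simp
    then obtain c :: 'n where c: "rk c = rk a + d" using ex_rk by blast
    have "e b \<le> 2 * e c" by (rule step) (simp add: Suc.prems c)
    also have "\<dots> \<le> 2 * (2 ^ d * e a)" using Suc.IH[OF c] by simp
    finally show ?case by simp
  qed
  have mono': "e b \<le> 2 ^ CARD('n) * e a" if "rk a \<le> rk b" for a b
  proof -
    have "e b \<le> 2 ^ (rk b - rk a) * e a" by (rule mono) (use that in simp)
    also have "\<dots> \<le> 2 ^ CARD('n) * e a"
      using rk_less_card[of b] e[of a] by (intro mult_right_mono power_increasing) auto
    finally show ?thesis .
  qed
  obtain a :: 'n where a: "rk a = 0" using ex_rk[of 0] by auto
  have "e i \<le> 2 ^ (CARD('n) + 1)" for i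
  proof -
    have "e i \<le> 2 ^ CARD('n) * e a" by (rule mono') (simp add: a)
    also have "\<dots> \<le> 2 ^ CARD('n) * 2" using first_pivot_bound[OF \<tau> h a min] by simp
    finally show ?thesis by simp
  qed
  moreover have "\<bar>P $ i $ j\<bar> \<le> 1" for i j
    using sm[of i j] P by (cases "i = j") (auto simp: unit_lower_def)
  ultimately show ?thesis using h mono' by (intro that[of M P e]) (auto simp: has_ldl_def)
qed

section \<open>Real coordinates on the symmetric matrices\<close>

type_synonym 'n label = "('n set + 'n set) + ('n + 'n)"

definition coord_labels :: "'n::finite label set" where
  "coord_labels = Inl ` (Inl ` sym_coords \<union> Inr ` sym_coords) \<union> range Inr"

lemma coord_labels_nonempty: "0 < card (coord_labels :: 'n::finite label set)"
  by (simp add: card_gt_0_iff coord_labels_def)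

text \<open>
  The index type of the real coordinates of a symmetric matrix and a vector. It is ordered, as the
  change of variables formula on \<open>real^'m\<close> demands of its index type.
\<close>

typedef ('n::finite) jidx = "{..<card (coord_labels :: 'n label set)}"
  using coord_labels_nonempty by blast

instantiation jidx :: (finite) wellorder
begin
definition "less_eq_jidx (x :: 'a jidx) (y :: 'a jidx) \<longleftrightarrow> Rep_jidx x \<le> Rep_jidx y"
definition "less_jidx (x :: 'a jidx) (y :: 'a jidx) \<longleftrightarrow> Rep_jidx x < Rep_jidx y"
instance
proof
  fix P and a :: "'a jidx"
  assume step: "\<And>x. (\<And>y. y < x \<Longrightarrow> P y) \<Longrightarrow> P (x :: 'a jidx)"
  show "P a"
    by (induction "Rep_jidx a" arbitrary: a rule: less_induct) (rule step, simp add: less_jidx_def)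
qed (auto simp: less_eq_jidx_def less_jidx_def Rep_jidx_inject)
end

instance jidx :: (finite) finite
proof
  have "(UNIV :: 'a jidx set) = Abs_jidx ` {..<card (coord_labels :: 'a label set)}"
    by (metis UNIV_eq_I image_eqI Rep_jidx Rep_jidx_inverse)
  then show "finite (UNIV :: 'a jidx set)" by (metis finite_imageI finite_lessThan)
qed

text \<open>
  The numbering of the coordinates, and its inverse \<open>lab\<close>.
\<close>

definition pos :: "'n::finite label \<Rightarrow> 'n jidx" where
  "pos = (SOME h. bij_betw h coord_labels UNIV)"

lemma bij_pos: "bij_betw (pos :: 'n::finite label \<Rightarrow> 'n jidx) coord_labels UNIV"
proof -
  have "card (UNIV :: 'n jidx set) = card (coord_labels :: 'n label set)"
    using type_definition.card[OF type_definition_jidx] by simp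
  then have "\<exists>h. bij_betw h (coord_labels :: 'n label set) (UNIV :: 'n jidx set)"
    by (intro finite_same_card_bij) (simp_all)
  then show ?thesis unfolding pos_def by (rule someI_ex)
qed

definition lab :: "'n::finite jidx \<Rightarrow> 'n label" where "lab = inv_into coord_labels pos"

lemma lab_in: "lab c \<in> coord_labels" and pos_lab [simp]: "pos (lab c) = c" for c :: "'n::finite jidx"
proof -
  have "c \<in> (pos :: 'n label \<Rightarrow> _) ` coord_labels" using bij_betw_imp_surj_on[OF bij_pos[where 'n='n]] by (simp only: UNIV_I)
  then show "lab c \<in> coord_labels" "pos (lab c) = c"
    unfolding lab_def by (rule inv_into_into, rule f_inv_into_f)
qed

lemma lab_pos: "L \<in> coord_labels \<Longrightarrow> lab (pos L) = L"
  unfolding lab_def by (rule inv_into_f_f[OF bij_betw_imp_inj_on[OF bij_pos]])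

lemma bij_lab: "bij_betw (lab :: 'n::finite jidx \<Rightarrow> _) UNIV coord_labels"
  by (rule bij_betw_byWitness[where f' = pos]) (auto simp: lab_pos lab_in)

lemma in_sym_coords [simp]: "{l, j} \<in> sym_coords"
  by (auto simp: sym_coords_def)

lemma in_coord_labels [simp]: "Inl (Inl s) \<in> coord_labels \<longleftrightarrow> s \<in> sym_coords"
  "Inl (Inr s) \<in> coord_labels \<longleftrightarrow> s \<in> sym_coords" "Inr t \<in> coord_labels"
  by (auto simp: coord_labels_def)

lemma prod_coord_labels:
  "(\<Prod>L\<in>(coord_labels :: 'n::finite label set). f L) =
    (\<Prod>s\<in>sym_coords. f (Inl (Inl s))) * (\<Prod>s\<in>sym_coords. f (Inl (Inr s)))
     * ((\<Prod>n\<in>UNIV. f (Inr (Inl n))) * (\<Prod>n\<in>UNIV. f (Inr (Inr n))))"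
proof -
  have "(\<Prod>L\<in>(coord_labels :: 'n label set). f L)
    = (\<Prod>L\<in>Inl ` (Inl ` sym_coords \<union> Inr ` sym_coords). f L) * (\<Prod>L\<in>range Inr. f L)"
    unfolding coord_labels_def by (intro prod.union_disjoint) auto
  also have "(\<Prod>L\<in>range (Inr :: _ \<Rightarrow> 'n label). f L) = (\<Prod>t\<in>UNIV. f (Inr t))" by (simp add: prod.reindex)
  also have "\<dots> = (\<Prod>t\<in>range Inl \<union> range Inr. f (Inr t))" by (intro prod.cong) (auto simp: UNIV_sum)
  also have "\<dots> = (\<Prod>t\<in>range Inl. f (Inr t)) * (\<Prod>t\<in>range Inr. f (Inr t))" by (intro prod.union_disjoint) auto
  also have "(\<Prod>L\<in>Inl ` (Inl ` sym_coords \<union> Inr ` sym_coords). f L)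
    = (\<Prod>L\<in>Inl ` sym_coords \<union> Inr ` sym_coords. f (Inl L))"
    by (simp add: prod.reindex)
  also have "\<dots> = (\<Prod>L\<in>Inl ` sym_coords. f (Inl L)) * (\<Prod>L\<in>Inr ` sym_coords. f (Inl L))"
    by (intro prod.union_disjoint) auto
  finally show ?thesis by (simp add: prod.reindex)
qed

lemma prod_jidx:
  "(\<Prod>c\<in>(UNIV :: 'n::finite jidx set). f (lab c)) =
    (\<Prod>s\<in>sym_coords. f (Inl (Inl s))) * (\<Prod>s\<in>sym_coords. f (Inl (Inr s)))
     * ((\<Prod>n\<in>UNIV. f (Inr (Inl n))) * (\<Prod>n\<in>UNIV. f (Inr (Inr n))))"
  unfolding prod_coord_labels[symmetric] by (rule prod.reindex_bij_betw[OF bij_lab])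

text \<open>
  The linear isomorphism of the real coordinate space onto \<open>Sym\<^sub>g(\<complex>) \<times> \<complex>\<^sup>g\<close>; \<open>kinv\<close> below inverts it.
\<close>

definition kap :: "real^('n::finite jidx) \<Rightarrow> 'n jacobi_point" where
  "kap v = ((\<chi> l j. Complex (v $ pos (Inl (Inl {l, j}))) (v $ pos (Inl (Inr {l, j})))),
            (\<chi> n. Complex (v $ pos (Inr (Inl n))) (v $ pos (Inr (Inr n)))))"

text \<open>
  A symmetric function of two indices as a function of the unordered pair.
\<close>

definition ent :: "('n \<Rightarrow> 'n \<Rightarrow> 'a) \<Rightarrow> 'n set \<Rightarrow> 'a" where
  "ent S s = (case (SOME p. s = {fst p, snd p}) of (l, j) \<Rightarrow> S l j)"

lemma ent_eq:
  assumes "\<And>l j. S l j = S j l" shows "ent S {l, j} = S l j"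
proof -
  define p where "p = (SOME p. {l, j} = {fst p, snd p})"
  have "{l, j} = {fst p, snd p}" unfolding p_def by (rule someI[of _ "(l, j)"]) simp
  then have "S (fst p) (snd p) = S l j" using assms by (auto simp: doubleton_eq_iff)
  then show ?thesis by (simp add: ent_def p_def[symmetric] case_prod_beta)
qed

definition kinv :: "'n::finite jacobi_point \<Rightarrow> real^('n jidx)" where
  "kinv p = (\<chi> c. case lab c of Inl (Inl s) \<Rightarrow> Re (ent (\<lambda>l j. fst p $ l $ j) s)
     | Inl (Inr s) \<Rightarrow> Im (ent (\<lambda>l j. fst p $ l $ j) s)
     | Inr (Inl n) \<Rightarrow> Re (snd p $ n) | Inr (Inr n) \<Rightarrow> Im (snd p $ n))"

definition symsp :: "'n::finite jacobi_point set" where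
  "symsp = {p. transpose (fst p) = fst p}"

lemma transpose_sym_index: "transpose A = A \<Longrightarrow> A $ i $ j = A $ j $ i"
  by (metis (no_types, lifting) transpose_def vec_lambda_beta)

lemma kap_in [simp]: "kap v \<in> symsp"
  by (simp add: kap_def symsp_def transpose_def vec_eq_iff insert_commute)

lemma kap_kinv: assumes "p \<in> symsp" shows "kap (kinv p) = p"
proof -
  have "ent (\<lambda>l j. fst p $ l $ j) {l, j} = fst p $ l $ j" for l j
    using assms by (intro ent_eq) (auto simp: symsp_def intro: transpose_sym_index)
  then show ?thesis
    by (cases p) (simp add: kap_def kinv_def lab_pos vec_eq_iff complex_eq_iff)
qed

lemma kinv_kap [simp]: "kinv (kap v) = v"
proof -
  have e: "ent (\<lambda>l j. fst (kap v) $ l $ j) {l, j} = fst (kap v) $ l $ j" for l j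
    by (intro ent_eq) (simp add: kap_def insert_commute)
  have "kinv (kap v) $ c = v $ c" for c
  proof -
    have "lab c \<in> coord_labels" by (rule lab_in)
    then consider s where "s \<in> sym_coords" "lab c = Inl (Inl s)" | s where "s \<in> sym_coords" "lab c = Inl (Inr s)"
      | n where "lab c = Inr (Inl n)" | n where "lab c = Inr (Inr n)"
      by (auto simp: coord_labels_def) (metis sum.exhaust)
    then show ?thesis
    proof cases
      case 1
      then obtain l j where "s = {l, j}" by (auto simp: sym_coords_def)
      then have "kinv (kap v) $ c = Re (fst (kap v) $ l $ j)" using 1 e[of l j] by (simp add: kinv_def)
      then show ?thesis using \<open>s = {l, j}\<close> 1 pos_lab[of c] by (simp add: kap_def)
    next
      case 2
      then obtain l j where "s = {l, j}" by (auto simp: sym_coords_def)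
      then have "kinv (kap v) $ c = Im (fst (kap v) $ l $ j)" using 2 e[of l j] by (simp add: kinv_def)
      then show ?thesis using \<open>s = {l, j}\<close> 2 pos_lab[of c] by (simp add: kap_def)
    next
      case 3 then show ?thesis using pos_lab[of c] by (simp add: kinv_def kap_def)
    next
      case 4 then show ?thesis using pos_lab[of c] by (simp add: kinv_def kap_def)
    qed
  qed
  then show ?thesis by (simp add: vec_eq_iff)
qed

lemma linear_kinv: "linear kinv"
  by (rule linearI) (auto simp: kinv_def ent_def vec_eq_iff case_prod_beta split: sum.splits)

lemma kap_inj: "kap u = kap v \<longleftrightarrow> u = v"
  by (metis kinv_kap)

lemma linear_kap: "linear kap"
  by (rule linearI) (simp_all add: kap_def vec_eq_iff complex_eq_iff)

lemma bounded_linear_kap: "bounded_linear kap"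
  using linear_kap by (simp add: linear_linear)

lemma continuous_kap: "continuous_on S kap"
  by (rule linear_continuous_on[OF bounded_linear_kap])

lemma measurable_kap [measurable]: "kap \<in> borel_measurable borel"
  by (rule borel_measurable_continuous_onI[OF continuous_kap])

definition coord_vec :: "(('n::finite set \<Rightarrow> real) \<times> ('n set \<Rightarrow> real)) \<times> ((real^'n) \<times> (real^'n)) \<Rightarrow> real^('n jidx)" where
  "coord_vec = (\<lambda>((\<xi>, \<eta>), (x, y)). \<chi> c. case lab c of Inl (Inl s) \<Rightarrow> \<xi> s | Inl (Inr s) \<Rightarrow> \<eta> s
     | Inr (Inl n) \<Rightarrow> x $ n | Inr (Inr n) \<Rightarrow> y $ n)"

lemma coord_point_eq: "coord_point q = kap (coord_vec q)"
  by (cases q rule: prod.exhaust; cases "fst q"; cases "snd q")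
     (auto simp: coord_point_def coord_vec_def kap_def lab_pos vec_eq_iff split: prod.splits)

lemma measurable_coord_vec [measurable]:
  "(coord_vec :: _ \<Rightarrow> real^('n::finite jidx)) \<in> borel_measurable coord_measure"
proof (subst borel_measurable_euclidean_space, rule ballI)
  let ?M = "coord_measure ::
    ((('n set \<Rightarrow> real) \<times> ('n set \<Rightarrow> real)) \<times> ((real^'n) \<times> (real^'n))) measure"
  fix b :: "real^('n jidx)" assume "b \<in> Basis"
  then obtain c where b: "b = axis c 1" by (auto simp: Basis_vec_def)
  have s: "(\<lambda>p. fst (fst p) s) \<in> borel_measurable ?M" "(\<lambda>p. snd (fst p) s) \<in> borel_measurable ?M"
    if [measurable]: "s \<in> sym_coords" for s
    unfolding coord_measure_def by measurable
  have xy: "(\<lambda>p. fst (snd p) $ n) \<in> borel_measurable ?M"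
    "(\<lambda>p. snd (snd p) $ n) \<in> borel_measurable ?M" for n :: 'n
  proof -
    have [measurable]: "(\<lambda>p. fst (snd p)) \<in> borel_measurable ?M"
      "(\<lambda>p. snd (snd p)) \<in> borel_measurable ?M"
      unfolding coord_measure_def by measurable
    have [measurable]: "(\<lambda>v :: real^'n. v $ n) \<in> borel_measurable borel"
      by (intro borel_measurable_continuous_onI continuous_intros)
    show "(\<lambda>p. fst (snd p) $ n) \<in> borel_measurable ?M"
      "(\<lambda>p. snd (snd p) $ n) \<in> borel_measurable ?M" by measurable
  qed
  have "lab c \<in> coord_labels" by (rule lab_in)
  then consider s where "s \<in> sym_coords" "lab c = Inl (Inl s)" | s where "s \<in> sym_coords" "lab c = Inl (Inr s)"
    | n where "lab c = Inr (Inl n)" | n where "lab c = Inr (Inr n)"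
    by (auto simp: coord_labels_def) (metis sum.exhaust)
  then show "(\<lambda>p. coord_vec p \<bullet> b) \<in> borel_measurable ?M"
    using s xy unfolding b by cases (simp_all add: inner_axis coord_vec_def case_prod_beta)
qed

lemma distr_coord_vec: "distr coord_measure borel coord_vec = (lborel :: (real^('n::finite jidx)) measure)"
proof (rule lborel_eqI[symmetric])
  let ?I = "sym_coords :: 'n set set"
  fix l u :: "real^('n jidx)" assume le: "\<And>b. b \<in> Basis \<Longrightarrow> l \<bullet> b \<le> u \<bullet> b"
  have le': "l $ c \<le> u $ c" for c 
  proof -
    have "axis c (1 :: real) \<in> Basis" by (auto simp: Basis_vec_def)
    from le[OF this] show ?thesis by (simp add: inner_axis)
  qed
  interpret product_sigma_finite "\<lambda>_ :: 'n set. lborel :: real measure" by standard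
  have fin: "finite ?I" by simp
  interpret P: finite_product_sigma_finite "\<lambda>_ :: 'n set. lborel :: real measure" ?I by standard (rule fin)
  interpret PP: pair_sigma_finite "\<Pi>\<^sub>M s\<in>?I. (lborel :: real measure)" "\<Pi>\<^sub>M s\<in>?I. (lborel :: real measure)" ..
  have Q: "sigma_finite_measure ((lborel :: (real^'n) measure) \<Otimes>\<^sub>M (lborel :: (real^'n) measure))"
    unfolding lborel_prod by (rule sigma_finite_lborel)
  define J where "J k = (\<lambda>s :: 'n set. {l $ pos (Inl (k s)) <..< u $ pos (Inl (k s))})" for k :: "'n set \<Rightarrow> 'n set + 'n set"
  define Bx where "Bx k = box (\<chi> n. l $ pos (Inr (k n))) ((\<chi> n. u $ pos (Inr (k n))) :: real^'n)" for k :: "'n \<Rightarrow> 'n + 'n"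
  have pre: "coord_vec -` box l u \<inter> space coord_measure
     = (Pi\<^sub>E ?I (J Inl) \<times> Pi\<^sub>E ?I (J Inr)) \<times> (Bx Inl \<times> Bx Inr)" (is "?L = ?R")
  proof (rule set_eqI)
    fix q :: "(('n set \<Rightarrow> real) \<times> ('n set \<Rightarrow> real)) \<times> ((real^'n) \<times> (real^'n))"
    obtain \<xi> \<eta> x y where q: "q = ((\<xi>, \<eta>), (x, y))" by (metis prod.exhaust)
    have sp: "q \<in> space coord_measure \<longleftrightarrow> \<xi> \<in> extensional ?I \<and> \<eta> \<in> extensional ?I"
      by (simp add: q coord_measure_def space_pair_measure space_PiM PiE_def)
    have "coord_vec q \<in> box l u \<longleftrightarrow> (\<forall>c. l $ c < coord_vec q $ c \<and> coord_vec q $ c < u $ c)"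
      by (simp add: mem_box_cart)
    also have "\<dots> \<longleftrightarrow> (\<forall>L\<in>coord_labels. l $ pos L < coord_vec q $ pos L \<and> coord_vec q $ pos L < u $ pos L)"
      by (metis lab_in pos_lab)
    also have "\<dots> \<longleftrightarrow> (\<forall>s\<in>?I. \<xi> s \<in> J Inl s) \<and> (\<forall>s\<in>?I. \<eta> s \<in> J Inr s) \<and> x \<in> Bx Inl \<and> y \<in> Bx Inr"
      unfolding coord_labels_def ball_Un ball_simps
      by (simp add: q coord_vec_def lab_pos J_def Bx_def mem_box_cart split_sum_all)
    finally show "q \<in> ?L \<longleftrightarrow> q \<in> ?R"
      unfolding vimage_eq Int_iff sp by (auto simp: q PiE_def)
  qed
  have eJ: "emeasure (\<Pi>\<^sub>M s\<in>?I. lborel) (Pi\<^sub>E ?I (J k)) = ennreal (\<Prod>s\<in>?I. u $ pos (Inl (k s)) - l $ pos (Inl (k s)))" for k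
  proof -
    have "emeasure (\<Pi>\<^sub>M s\<in>?I. lborel) (Pi\<^sub>E ?I (J k)) = (\<Prod>s\<in>?I. emeasure lborel (J k s))"
      by (rule emeasure_PiM[OF fin]) (simp add: J_def)
    also have "\<dots> = (\<Prod>s\<in>?I. ennreal (u $ pos (Inl (k s)) - l $ pos (Inl (k s))))"
      using le' by (simp add: J_def)
    finally show ?thesis using le' by (simp add: prod_ennreal)
  qed
  have eB: "emeasure lborel (Bx k) = ennreal (\<Prod>n\<in>UNIV. u $ pos (Inr (k n)) - l $ pos (Inr (k n)))" for k
  proof -
    have "emeasure lborel (Bx k) = ennreal (\<Prod>b\<in>Basis. ((\<chi> n. u $ pos (Inr (k n))) - (\<chi> n. l $ pos (Inr (k n)))) \<bullet> (b :: real^'n))"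
      unfolding Bx_def using le' by (subst emeasure_lborel_box) (auto simp: Basis_vec_def inner_axis)
    also have "(\<Prod>b\<in>Basis. ((\<chi> n. u $ pos (Inr (k n))) - (\<chi> n. l $ pos (Inr (k n)))) \<bullet> (b :: real^'n))
      = (\<Prod>n\<in>UNIV. u $ pos (Inr (k n)) - l $ pos (Inr (k n)))"
    proof -
      have B: "(Basis :: (real^'n) set) = (\<lambda>n. axis n 1) ` UNIV" by (auto simp: Basis_vec_def)
      have "inj (\<lambda>n. axis n 1 :: real^'n)" by (auto simp: inj_on_def axis_eq_axis)
      then show ?thesis unfolding B by (subst prod.reindex) (simp_all add: inner_axis)
    qed
    finally show ?thesis .
  qed
  have sJ: "Pi\<^sub>E ?I (J k) \<in> sets (\<Pi>\<^sub>M s\<in>?I. lborel)" for k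
    by (rule sets_PiM_I_finite[OF fin]) (simp add: J_def)
  have sB: "Bx k \<in> sets lborel" for k by (simp add: Bx_def)
  have nn: "0 \<le> (\<Prod>s\<in>A. u $ f s - l $ f s)" for A f using le' by (intro prod_nonneg) simp
  have "emeasure (distr coord_measure borel coord_vec) (box l u)
     = emeasure coord_measure ((Pi\<^sub>E ?I (J Inl) \<times> Pi\<^sub>E ?I (J Inr)) \<times> (Bx Inl \<times> Bx Inr))"
    by (subst emeasure_distr) (simp_all add: pre)
  also have "\<dots> = emeasure ((\<Pi>\<^sub>M s\<in>?I. lborel) \<Otimes>\<^sub>M (\<Pi>\<^sub>M s\<in>?I. lborel)) (Pi\<^sub>E ?I (J Inl) \<times> Pi\<^sub>E ?I (J Inr))
     * emeasure (lborel \<Otimes>\<^sub>M lborel) (Bx Inl \<times> Bx Inr)"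
    unfolding coord_measure_def using sJ sB by (intro sigma_finite_measure.emeasure_pair_measure_Times[OF Q]) (auto intro: pair_measureI)
  also have "\<dots> = ennreal ((\<Prod>s\<in>?I. u $ pos (Inl (Inl s)) - l $ pos (Inl (Inl s))) * (\<Prod>s\<in>?I. u $ pos (Inl (Inr s)) - l $ pos (Inl (Inr s)))
     * ((\<Prod>n\<in>UNIV. u $ pos (Inr (Inl n)) - l $ pos (Inr (Inl n))) * (\<Prod>n\<in>UNIV. u $ pos (Inr (Inr n)) - l $ pos (Inr (Inr n)))))"
    using sJ sB by (simp add: P.emeasure_pair_measure_Times lborel.emeasure_pair_measure_Times eJ eB
       ennreal_mult[symmetric] nn mult_nonneg_nonneg)
  also have "\<dots> = ennreal (\<Prod>c\<in>UNIV. u $ pos (lab c) - l $ pos (lab c))"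
    unfolding prod_jidx[of "\<lambda>L. u $ pos L - l $ pos L"] ..
  also have "(\<Prod>c\<in>UNIV. u $ pos (lab c) - l $ pos (lab c)) = (\<Prod>b\<in>Basis. (u - l) \<bullet> b)"
  proof -
    have B: "(Basis :: (real^('n jidx)) set) = (\<lambda>n. axis n 1) ` UNIV" by (auto simp: Basis_vec_def)
    have "inj (\<lambda>n. axis n 1 :: real^('n jidx))" by (auto simp: inj_on_def axis_eq_axis)
    then show ?thesis unfolding B by (subst prod.reindex) (simp_all add: inner_axis)
  qed
  finally show "emeasure (distr coord_measure borel coord_vec) (box l u) = ennreal (\<Prod>b\<in>Basis. (u - l) \<bullet> b)" .
qed simp

text \<open>
  From here on the invariant integral lives on \<open>real^('n jidx)\<close>, where the change of variables
  formula is available.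
\<close>

lemma jacobi_lebesgue_eq: "jacobi_lebesgue = distr (lborel :: (real^('n::finite jidx)) measure) borel kap"
  unfolding jacobi_lebesgue_def distr_coord_vec[symmetric]
  by (subst distr_distr) (simp_all add: comp_def coord_point_eq[abs_def])

section \<open>Jacobian determinants of linear maps\<close>

definition sym_linear :: "('n::finite jacobi_point \<Rightarrow> 'n jacobi_point) \<Rightarrow> bool" where
  "sym_linear T \<longleftrightarrow> linear T \<and> (\<forall>p\<in>symsp. T p \<in> symsp)"

text \<open>
  A map of the space of symmetric pairs, written in real coordinates.
\<close>

definition kconj :: "('n::finite jacobi_point \<Rightarrow> 'n jacobi_point) \<Rightarrow> real^('n jidx) \<Rightarrow> real^('n jidx)" where
  "kconj T v = kinv (T (kap v))"

text \<open>
  The absolute real Jacobian of a linear map on the space of symmetric pairs.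
\<close>

definition jac :: "('n::finite jacobi_point \<Rightarrow> 'n jacobi_point) \<Rightarrow> real" where
  "jac T = \<bar>det (matrix (kconj T))\<bar>"

lemma kap_kconj: "sym_linear T \<Longrightarrow> kap (kconj T v) = T (kap v)"
  by (simp add: kconj_def sym_linear_def kap_kinv)

lemma linear_kconj: assumes "sym_linear T" shows "linear (kconj T)"
proof (rule linearI)
  have T: "linear T" using assms by (simp add: sym_linear_def)
  show "kconj T (u + v) = kconj T u + kconj T v" for u v
    unfolding kap_inj[symmetric] linear_add[OF linear_kap] kap_kconj[OF assms] linear_add[OF T] ..
  show "kconj T (c *\<^sub>R v) = c *\<^sub>R kconj T v" for c v
    unfolding kap_inj[symmetric] linear_scale[OF linear_kap] kap_kconj[OF assms] linear_scale[OF T] ..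
qed

lemma kconj_comp: "sym_linear T \<Longrightarrow> sym_linear T' \<Longrightarrow> kconj (T \<circ> T') = kconj T \<circ> kconj T'"
  by (rule ext) (simp add: kconj_def[of T] kap_kconj, simp add: kconj_def)

lemma sym_linear_comp: "sym_linear T \<Longrightarrow> sym_linear T' \<Longrightarrow> sym_linear (T \<circ> T')"
  by (auto simp: sym_linear_def intro: linear_compose)

lemma jac_comp: "sym_linear T \<Longrightarrow> sym_linear T' \<Longrightarrow> jac (T \<circ> T') = jac T * jac T'"
  unfolding jac_def by (simp add: kconj_comp matrix_compose linear_kconj det_mul abs_mult)

lemma jac_id: "jac (\<lambda>x. x) = 1"
proof -
  have "kconj (\<lambda>x. x) = (id :: real^('a jidx) \<Rightarrow> _)" by (simp add: kconj_def fun_eq_iff)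
  then show ?thesis by (simp add: jac_def matrix_id_mat_1)
qed

lemma jac_nonneg: "jac T \<ge> 0" by (simp add: jac_def)

text \<open>
  An isometry maps the unit ball onto itself, and the ball has positive finite volume.
\<close>

lemma jac_isometry:
  fixes T :: "'a::finite jacobi_point \<Rightarrow> _"
  assumes T: "sym_linear T" and iso: "\<And>p. p \<in> symsp \<Longrightarrow> norm (T p) = norm p"
  shows "jac T = 1"
proof -
  define B :: "(real^('a jidx)) set" where "B = {v. norm (kap v) \<le> 1}"
  have inj: "inj (kap :: real^('a jidx) \<Rightarrow> _)" by (simp add: inj_on_def kap_inj)
  obtain b where b: "b > 0" "\<And>v. b * norm v \<le> norm (kap v :: 'a jacobi_point)"
    by (rule linear_inj_bounded_below_pos[OF linear_kap inj], rule that)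
  have "B \<subseteq> cball 0 (1 / b)"
  proof
    fix v assume "v \<in> B"
    then have "b * norm v \<le> 1" using b(2)[of v] by (simp add: B_def)
    then show "v \<in> cball 0 (1 / b)" using b(1) by (simp add: field_simps)
  qed
  then have bB: "bounded B" using bounded_subset bounded_cball by blast
  have "closed (kap -` cball 0 1)" by (rule closed_vimage) (simp_all add: continuous_kap)
  then have cB: "closed B" by (simp add: B_def vimage_def)
  have B: "B \<in> lmeasurable" using bB cB by (simp add: lmeasurable_compact compact_eq_bounded_closed)
  obtain K where K: "K > 0" "\<And>v. norm (kap v :: 'a jacobi_point) \<le> norm v * K"
    using bounded_linear.pos_bounded[OF bounded_linear_kap] by blast
  have "ball 0 (1 / K) \<subseteq> B"
  proof
    fix v :: "real^('a jidx)" assume "v \<in> ball 0 (1 / K)"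
    then have "norm v * K \<le> 1" using K(1) by (simp add: field_simps)
    then show "v \<in> B" using K(2)[of v] by (simp add: B_def)
  qed
  then have "measure lebesgue (ball 0 (1 / K) :: (real^('a jidx)) set) \<le> measure lebesgue B"
    using B by (intro measure_mono_fmeasurable) auto
  moreover have "0 < measure lebesgue (ball 0 (1 / K) :: (real^('a jidx)) set)"
    using K(1) content_ball_pos[of "1 / K" "0 :: real^('a jidx)"] by simp
  ultimately have mB: "0 < measure lebesgue B" by linarith
  have linT: "linear (kconj T)" using T by (rule linear_kconj)
  have nT: "norm (kap (kconj T v)) = norm (kap v)" for v unfolding kap_kconj[OF T] by (rule iso) simp
  have "inj (kconj T)" unfolding linear_injective_0[OF linT]
  proof (intro allI impI)
    fix v assume "kconj T v = 0"
    then have "norm (kap (kconj T v)) = 0" using linear_0[OF linear_kap] by simp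
    then have "norm (kap v) = 0" unfolding nT .
    then have "b * norm v \<le> 0" using b(2)[of v] by linarith
    then show "v = 0" using b(1) by (simp add: mult_le_0_iff)
  qed
  then have sur: "surj (kconj T)" using linear_injective_imp_surjective[OF linT] by simp
  have "kconj T ` B = B"
  proof
    show "kconj T ` B \<subseteq> B" using nT by (auto simp: B_def)
    show "B \<subseteq> kconj T ` B"
    proof
      fix v assume v: "v \<in> B"
      obtain u where "v = kconj T u" using sur by (metis surjD)
      then show "v \<in> kconj T ` B" using v nT[of u] by (auto simp: B_def)
    qed
  qed
  then have "measure lebesgue B = jac T * measure lebesgue B"
    using measure_linear_image[OF linT B] by (simp add: jac_def)
  then show ?thesis using mB by simp
qed

text \<open>
  For \<open>P = (C\<tau> + D)\<^sup>-\<^sup>t\<close> this is the derivative of the group action at \<open>(\<tau>, z)\<close>, up to a shear.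
\<close>

definition act :: "complex^'n^'n \<Rightarrow> 'n::finite jacobi_point \<Rightarrow> 'n jacobi_point" where
  "act P = (\<lambda>(S, Z). (P ** S ** transpose P, P *v Z))"

lemma matrix_mult_scaleR: "A ** (c *\<^sub>R B) = c *\<^sub>R (A ** B)" "(c *\<^sub>R A) ** B = c *\<^sub>R (A ** B)"
  "A *v (c *\<^sub>R v) = c *\<^sub>R (A *v v)"
  for A B :: "complex^'n::finite^'n"
  by (simp_all add: vec_eq_iff matrix_matrix_mult_def matrix_vector_mult_def scaleR_sum_right)

lemma sym_linear_act: "sym_linear (act P)"
  unfolding sym_linear_def
proof
  show "linear (act P)"
    by (rule linearI) (auto simp: act_def matrix_add_ldistrib matrix_add_rdistrib matrix_vector_right_distrib
       matrix_mult_scaleR split: prod.splits)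
  show "\<forall>p\<in>symsp. act P p \<in> symsp"
    by (auto simp: symsp_def act_def matrix_transpose_mul matrix_mul_assoc split: prod.splits)
qed

lemma act_mult: "act (P ** Q) = act P \<circ> act Q"
  by (auto simp: act_def fun_eq_iff matrix_transpose_mul matrix_mul_assoc matrix_vector_mul_assoc)

lemma jac_act_mult: "jac (act (P ** Q)) = jac (act P) * jac (act Q)"
  unfolding act_mult by (rule jac_comp[OF sym_linear_act sym_linear_act])

lemma act_one: "act (mat 1) = (\<lambda>x. x)"
  by (auto simp: act_def fun_eq_iff)

text \<open>
  A transposition squares to the identity. A transvection \<open>E c\<close> is conjugate to \<open>E (2 c)\<close>, which is its
  square, so its value is idempotent and nonzero.
\<close>

lemma multiplicative_elementary:
  fixes f :: "real^'n::finite^'n \<Rightarrow> real"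
  assumes mult: "\<And>A B. f (A ** B) = f A * f B" and one: "f (mat 1) = 1" and nn: "\<And>A. f A \<ge> 0"
    and mn: "m \<noteq> (n :: 'n)"
  shows "f (\<chi> i j. mat 1 $ i $ Transposition.transpose m n j) = 1"
    and "f (\<chi> i j. of_bool (i = m \<and> j = n \<or> i = j)) = 1"
proof -
  define s where "s = Transposition.transpose m n"
  define W :: "real^'n^'n" where "W = (\<chi> i j. mat 1 $ i $ s j)"
  have "(W ** W) $ i $ j = mat 1 $ i $ j" for i j
  proof -
    have "(W ** W) $ i $ j = (\<Sum>k\<in>UNIV. if k = s j then (if i = s k then 1 else 0) else 0)"
      unfolding matrix_matrix_mult_def W_def mat_def vec_lambda_beta by (intro sum.cong) auto
    then show ?thesis by (simp add: s_def mat_def)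
  qed
  then have "W ** W = mat 1" by (simp add: vec_eq_iff)
  then have "f W * f W = 1" using mult[of W W] one by simp
  then have "f W = 1" using nn[of W] by (metis abs_of_nonneg abs_square_eq_1 power2_eq_square)
  then show "f (\<chi> i j. mat 1 $ i $ Transposition.transpose m n j) = 1" by (simp add: W_def s_def)
  define E where "E c = ((\<chi> i j. (if i = j then 1 else 0) + (if i = m \<and> j = n then c else 0)) :: real^'n^'n)" for c
  define D :: "real \<Rightarrow> real^'n^'n" where "D c = diag (\<lambda>i. if i = m then c else 1)" for c
  have DE: "(D a ** X) $ i $ j = (if i = m then a else 1) * X $ i $ j"
    and ED: "(X ** D a) $ i $ j = X $ i $ j * (if j = m then a else 1)" for a X i j
    by (simp_all add: D_def diag_def matrix_matrix_mult_def if_distrib[of "\<lambda>x. x * _"] if_distrib[of "\<lambda>x. _ * x"] cong: if_cong)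
  have "D 2 ** E 1 ** D (1/2) = E 2"
    using mn by (simp add: vec_eq_iff DE ED) (simp add: E_def)
  then have "f (E 2) = f (D 2) * f (E 1) * f (D (1/2))" by (metis mult)
  also have "\<dots> = f (D 2 ** D (1/2)) * f (E 1)" unfolding mult by simp
  also have "D 2 ** D (1/2) = mat 1" by (simp add: vec_eq_iff DE) (simp add: D_def diag_def mat_def)
  finally have 1: "f (E 2) = f (E 1)" by (simp add: one)
  have EE: "E a ** E b = E (a + b)" for a b
  proof -
    have "(E a ** E b) $ i $ j = E (a + b) $ i $ j" for i j
    proof -
      have "(E a ** E b) $ i $ j = (\<Sum>k\<in>UNIV. (if k = i then (if i = j then 1 else 0) + (if i = m \<and> j = n then b else 0) else 0)
        + (if k = n then (if i = m then a else 0) * ((if n = j then 1 else 0) + (if n = m \<and> j = n then b else 0)) else 0))"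
        unfolding matrix_matrix_mult_def E_def vec_lambda_beta using mn by (intro sum.cong) auto
      also have "\<dots> = E (a + b) $ i $ j" using mn by (auto simp: sum.distrib E_def algebra_simps)
      finally show ?thesis .
    qed
    then show ?thesis by (simp add: vec_eq_iff)
  qed
  have "f (E 1) * f (E 1) = f (E 1)" unfolding mult[symmetric] EE using 1 by simp
  moreover have "f (E 1) \<noteq> 0"
  proof
    assume "f (E 1) = 0"
    then have "f (E 1 ** E (-1)) = 0" unfolding mult by simp
    moreover have "E 0 = mat 1" by (simp add: E_def mat_def vec_eq_iff)
    ultimately show False unfolding EE using one by simp
  qed
  ultimately have "f (E 1) = 1" by simp
  moreover have "E 1 = (\<chi> i j. of_bool (i = m \<and> j = n \<or> i = j))" using mn by (auto simp: E_def vec_eq_iff)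
  ultimately show "f (\<chi> i j. of_bool (i = m \<and> j = n \<or> i = j)) = 1" by simp
qed

lemma bij_sym_coords:
  "bij_betw (\<lambda>(l, j). {l, j}) {(l, j). rk (l :: 'n::finite) \<le> rk (j :: 'n)} sym_coords"
  unfolding bij_betw_def
proof
  show "inj_on (\<lambda>(l, j). {l, j}) {(l, j). rk (l :: 'n) \<le> rk (j :: 'n)}"
  proof (rule inj_onI, clarify)
    fix l j l' j' :: 'n assume "rk l \<le> rk j" "rk l' \<le> rk j'" "{l, j} = {l', j'}"
    then show "l = l' \<and> j = j'" by (auto simp: doubleton_eq_iff)
  qed
  show "(\<lambda>(l, j). {l, j}) ` {(l, j). rk (l :: 'n) \<le> rk (j :: 'n)} = sym_coords"
  proof (intro equalityI subsetI)
    fix s :: "'n set" assume "s \<in> sym_coords"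
    then obtain l j where s: "s = {l, j}" by (auto simp: sym_coords_def)
    show "s \<in> (\<lambda>(l, j). {l, j}) ` {(l, j). rk (l :: 'n) \<le> rk (j :: 'n)}"
    proof (cases "rk l \<le> rk j")
      case True then show ?thesis using s by (intro image_eqI[of _ _ "(l, j)"]) auto
    next
      case False then show ?thesis using s by (intro image_eqI[of _ _ "(j, l)"]) (auto simp: insert_commute)
    qed
  qed auto
qed

lemma prod_sym_coords:
  fixes F :: "'n::finite \<Rightarrow> 'n \<Rightarrow> real"
  assumes "\<And>l j. F l j = F j l"
  shows "(\<Prod>s\<in>sym_coords. ent F s) = (\<Prod>l\<in>UNIV. \<Prod>j | rk l \<le> rk j. F l j)"
proof -
  have "(\<Prod>s\<in>sym_coords. ent F s) = (\<Prod>p\<in>{(l, j). rk l \<le> rk j}. ent F (case p of (l, j) \<Rightarrow> {l, j}))"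
    by (rule prod.reindex_bij_betw[OF bij_sym_coords, symmetric])
  also have "\<dots> = (\<Prod>(l, j)\<in>Sigma UNIV (\<lambda>l. {j. rk l \<le> rk j}). F l j)"
    using assms by (intro prod.cong) (auto simp: ent_eq)
  also have "\<dots> = (\<Prod>l\<in>UNIV. \<Prod>j | rk l \<le> rk j. F l j)" by (rule prod.Sigma[symmetric]) auto
  finally show ?thesis .
qed

lemma prod_sym_coords_product:
  fixes d :: "'n::finite \<Rightarrow> real"
  shows "(\<Prod>s\<in>sym_coords. ent (\<lambda>l j. d l * d j) s) = (\<Prod>i\<in>UNIV. d i) ^ (CARD('n) + 1)"
proof -
  have "(\<Prod>s\<in>sym_coords. ent (\<lambda>l j. d l * d j) s) = (\<Prod>l\<in>(UNIV :: 'n set). \<Prod>j | rk l \<le> rk j. d l * d j)"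
    by (rule prod_sym_coords) simp
  also have "\<dots> = (\<Prod>l\<in>UNIV. d l ^ card {j::'n. rk l \<le> rk j}) * (\<Prod>l\<in>(UNIV :: 'n set). \<Prod>j | rk l \<le> rk j. d j)"
    by (simp add: prod.distrib)
  also have "(\<Prod>l\<in>(UNIV :: 'n set). \<Prod>j | rk l \<le> rk j. d j) = (\<Prod>l\<in>(UNIV :: 'n set). \<Prod>j\<in>UNIV. if rk l \<le> rk j then d j else 1)"
    by (intro prod.cong refl prod.mono_neutral_cong_left) auto
  also have "\<dots> = (\<Prod>j\<in>UNIV. \<Prod>l\<in>(UNIV :: 'n set). if rk l \<le> rk j then d j else 1)" by (rule prod.swap)
  also have "\<dots> = (\<Prod>j\<in>UNIV. d j ^ card {l::'n. rk l \<le> rk j})" by (simp add: prod.If_cases)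
  also have "(\<Prod>l\<in>UNIV. d l ^ card {j::'n. rk l \<le> rk j}) * (\<Prod>j\<in>UNIV. d j ^ card {l::'n. rk l \<le> rk j})
    = (\<Prod>l\<in>UNIV. d l ^ (CARD('n) + 1))"
    unfolding prod.distrib[symmetric] power_add[symmetric]
  proof (intro prod.cong refl arg_cong2[where f=power])
    fix l :: 'n
    have "card {j::'n. rk l \<le> rk j} + card {j::'n. rk j \<le> rk l} = card ({j::'n. rk l \<le> rk j} \<union> {j::'n. rk j \<le> rk l}) + card ({j::'n. rk l \<le> rk j} \<inter> {j::'n. rk j \<le> rk l})"
      by (rule card_Un_Int) auto
    also have "{j::'n. rk l \<le> rk j} \<union> {j::'n. rk j \<le> rk l} = UNIV" by auto
    also have "{j::'n. rk l \<le> rk j} \<inter> {j::'n. rk j \<le> rk l} = {l}" by auto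
    finally show "card {j::'n. rk l \<le> rk j} + card {j::'n. rk j \<le> rk l} = CARD('n) + 1" by simp
  qed
  finally show ?thesis by (simp only: prod_power_distrib)
qed

lemma jac_act_diag: "jac (act (cr (diag d))) = \<bar>\<Prod>i\<in>UNIV. d i\<bar> ^ (2 * (CARD('n) + 2))" for d :: "'n::finite \<Rightarrow> real"
proof -
  define fac where "fac L = (case L of Inl (Inl s) \<Rightarrow> ent (\<lambda>l j. d l * d j) s | Inl (Inr s) \<Rightarrow> ent (\<lambda>l j. d l * d j) s
    | Inr (Inl n) \<Rightarrow> d n | Inr (Inr n) \<Rightarrow> d n)" for L :: "'n label"
  have e: "ent (\<lambda>l j. d l * d j) {l, j} = d l * d j" for l j by (rule ent_eq) simp
  have "kconj (act (cr (diag d))) v = (\<chi> c. fac (lab c) * v $ c)" for v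
    unfolding kap_inj[symmetric] kap_kconj[OF sym_linear_act]
  proof -
    have "(cr (diag d) ** S ** transpose (cr (diag d))) $ l $ j = of_real (d l * d j) * S $ l $ j" for S l j
      by (simp add: matrix_matrix_mult_def diag_def transpose_def if_distrib[of complex_of_real] if_distrib[of "\<lambda>x. x * _"]
         if_distrib[of "\<lambda>x. _ * x"] cong: if_cong)
    moreover have "(cr (diag d) *v Z) $ n = of_real (d n) * Z $ n" for Z n
      by (simp add: matrix_vector_mult_def diag_def if_distrib[of complex_of_real] if_distrib[of "\<lambda>x. x * _"] cong: if_cong)
    ultimately show "act (cr (diag d)) (kap v) = kap (\<chi> c. fac (lab c) * v $ c)"
      by (simp add: act_def kap_def vec_eq_iff lab_pos fac_def e complex_eq_iff)
  qed
  then have "matrix (kconj (act (cr (diag d)))) $ i $ j = (if i = j then fac (lab i) else 0)" for i j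
    by (simp add: matrix_def axis_def)
  then have "det (matrix (kconj (act (cr (diag d))))) = (\<Prod>c\<in>UNIV. fac (lab c))"
    by (subst det_diagonal) auto
  also have "\<dots> = (\<Prod>i\<in>UNIV. d i) ^ (2 * (CARD('n) + 2))"
    unfolding prod_jidx by (simp add: fac_def prod_sym_coords_product power_add[symmetric] mult_2 power2_eq_square)
  finally show ?thesis by (simp only: jac_def power_abs)
qed

text \<open>
  Both sides are multiplicative in \<open>R\<close>, so that elementary matrices suffice. The diagonal ones produce
  the exponent: \<open>2 (g + 1)\<close> from the symmetric matrix and 2 from the vector.
\<close>

lemma jac_act_real: "jac (act (cr R)) = \<bar>det R\<bar> ^ (2 * (CARD('n) + 2))" for R :: "real^'n::finite^'n"
proof (induction R rule: induct_matrix_elementary_alt)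
  case (1 A B)
  then show ?case by (simp add: cr_mult jac_act_mult det_mul abs_mult power_mult_distrib)
next
  case (2 A i)
  have "\<not> invertible (matrix (kconj (act (cr A))))"
  proof
    assume inv: "invertible (matrix (kconj (act (cr A))))"
    define q where "q = kinv (0 :: complex^'n^'n, axis i 1 :: complex^'n)"
    have q: "kap q = (0, axis i 1)" unfolding q_def by (rule kap_kinv) (simp add: symsp_def transpose_def vec_eq_iff)
    have "matrix (kconj (act (cr A))) *v (matrix_inv (matrix (kconj (act (cr A)))) *v q) = q"
      by (rule mult_matrix_inv_vec[OF inv])
    then have "kconj (act (cr A)) (matrix_inv (matrix (kconj (act (cr A)))) *v q) = q"
      using linear_kconj[OF sym_linear_act] by (metis matrix_vector_mul(2))
    then obtain u where "act (cr A) (kap u) = (0, axis i 1)" using q kap_kconj[OF sym_linear_act] by metis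
    then have "(cr A *v snd (kap u)) $ i = 1" by (auto simp: act_def split: prod.splits)
    moreover have "(cr A *v x) $ i = 0" for x
      using 2 by (simp add: matrix_vector_mult_def row_def vec_eq_iff)
    ultimately show False by simp
  qed
  then have "jac (act (cr A)) = 0" by (simp add: jac_def invertible_det_nz)
  then show ?case using det_zero_row[OF 2] by simp
next
  case (3 A)
  then have "A = diag (\<lambda>i. A $ i $ i)" by (simp add: diag_def vec_eq_iff)
  then show ?case using jac_act_diag[of "\<lambda>i. A $ i $ i"] det_diag[of "\<lambda>i. A $ i $ i"] by simp
next
  case (4 m n)
  show ?case
    using multiplicative_elementary(1)[of "\<lambda>A. jac (act (cr A))" m n] multiplicative_elementary(1)[of "\<lambda>A. \<bar>det A\<bar>" m n] 4
    by (simp add: cr_mult jac_act_mult jac_nonneg act_one jac_id det_mul abs_mult)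
next
  case (5 m n)
  show ?case
    using multiplicative_elementary(2)[of "\<lambda>A. jac (act (cr A))" m n] multiplicative_elementary(2)[of "\<lambda>A. \<bar>det A\<bar>" m n] 5
    by (simp add: cr_mult jac_act_mult jac_nonneg act_one jac_id det_mul abs_mult)
qed

lemma norm_cvec_sq: "complex_of_real ((norm x)\<^sup>2) = bidot (cjv x) x" for x :: "complex^'n::finite"
proof -
  have "(norm x)\<^sup>2 = (\<Sum>i\<in>UNIV. (cmod (x $ i))\<^sup>2)"
    by (simp add: norm_vec_def L2_set_def sum_nonneg)
  then show ?thesis by (simp add: bidot_def complex_norm_square mult.commute del: of_real_power)
qed

lemma norm_cmat_sq: "(norm S)\<^sup>2 = (\<Sum>i\<in>UNIV. \<Sum>j\<in>UNIV. (cmod (S $ i $ j))\<^sup>2)" for S :: "complex^'n::finite^'n"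
  by (simp add: norm_vec_def L2_set_def sum_nonneg)

lemma norm_cmat_transpose: "norm (transpose S) = norm S" for S :: "complex^'n::finite^'n"
proof -
  have "(norm (transpose S))\<^sup>2 = (norm S)\<^sup>2"
    unfolding norm_cmat_sq by (subst sum.swap) (simp add: transpose_def)
  then show ?thesis by simp
qed

lemma norm_cmat_columns: "(norm S)\<^sup>2 = (\<Sum>j\<in>UNIV. (norm (column j S))\<^sup>2)" for S :: "complex^'n::finite^'n"
  unfolding norm_cmat_sq by (subst sum.swap) (simp add: norm_vec_def L2_set_def sum_nonneg column_def)

lemma jac_act_unitary:
  fixes U :: "complex^'n::finite^'n"
  assumes U: "U ** transpose (cj U) = mat 1"
  shows "jac (act U) = 1"
proof (rule jac_isometry[OF sym_linear_act])
  have "transpose (cj U) ** U = mat 1" using U by (simp add: matrix_left_right_inverse)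
  then have U': "transpose U ** cj U = mat 1"
    using matrix_transpose_mul[of "transpose (cj U)" U] by simp
  have vec: "norm (U *v x) = norm x" for x
  proof -
    have "cjv (U *v x) = cj U *v cjv x" by (simp add: vec_eq_iff matrix_vector_mult_def)
    then have "complex_of_real ((norm (U *v x))\<^sup>2) = bidot (cjv x) x"
      unfolding norm_cvec_sq
      by (simp only: bidot_mult_right matrix_vector_mul_assoc U' matrix_vector_mul_lid)
    then have "complex_of_real ((norm (U *v x))\<^sup>2) = complex_of_real ((norm x)\<^sup>2)" unfolding norm_cvec_sq[of x] .
    then have "(norm (U *v x))\<^sup>2 = (norm x)\<^sup>2" unfolding of_real_eq_iff .
    then show ?thesis by simp
  qed
  have mat: "norm (U ** S) = norm S" for S :: "complex^'n^'n"
  proof -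
    have col: "column j (U ** S) = U *v column j S" for j
      by (simp add: vec_eq_iff column_def matrix_matrix_mult_def matrix_vector_mult_def)
    have "(norm (U ** S))\<^sup>2 = (norm S)\<^sup>2" unfolding norm_cmat_columns col vec ..
    then show ?thesis by simp
  qed
  fix p :: "'n jacobi_point"
  have "norm (U ** fst p ** transpose U) = norm (U ** transpose (U ** fst p))"
    by (subst norm_cmat_transpose[symmetric]) (simp add: matrix_transpose_mul)
  then have "norm (U ** fst p ** transpose U) = norm (fst p)" by (simp add: mat norm_cmat_transpose)
  then show "norm (act U p) = norm p" by (cases p) (simp add: act_def norm_prod_def vec)
qed

text \<open>
  Scaling the second component by 2 conjugates a shear into its square, as for transvections.
\<close>

lemma jac_shear:
  assumes l: "linear l" shows "jac (\<lambda>(S, Z). (S, Z + l S)) = 1"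
proof -
  define sh where "sh c = (\<lambda>(S, Z). (S, Z + c *\<^sub>R l S))" for c
  define D where "D c = (\<lambda>(S, Z). (S :: complex^'a^'a, c *\<^sub>R (Z :: complex^'a)))" for c
  have sl: "sym_linear (sh c)" for c
    unfolding sym_linear_def
    by (auto simp: sh_def symsp_def linear_add[OF l] linear_scale[OF l] algebra_simps intro!: linearI)
  have dl: "sym_linear (D c)" for c
    unfolding sym_linear_def by (auto simp: D_def symsp_def algebra_simps intro!: linearI)
  have "sh 2 = D 2 \<circ> (sh 1 \<circ> D (1/2))" by (auto simp: sh_def D_def fun_eq_iff scaleR_add_right)
  then have "jac (sh 2) = jac (D 2) * (jac (sh 1) * jac (D (1/2)))"
    by (simp add: jac_comp sl dl sym_linear_comp)
  also have "\<dots> = jac (D 2 \<circ> D (1/2)) * jac (sh 1)" by (simp add: jac_comp sl dl)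
  also have "D 2 \<circ> D (1/2) = (\<lambda>x. x)" by (auto simp: D_def fun_eq_iff)
  finally have "jac (sh 2) = jac (sh 1)" by (simp add: jac_id)
  moreover have add: "sh a \<circ> sh b = sh (a + b)" for a b by (auto simp: sh_def fun_eq_iff scaleR_add_left)
  ultimately have "jac (sh 1) * jac (sh 1) = jac (sh 1)"
    using jac_comp[OF sl[of 1] sl[of 1]] by simp
  moreover have "jac (sh 1) * jac (sh (-1)) = 1"
    unfolding jac_comp[OF sl sl, symmetric] add by (simp add: sh_def jac_id case_prod_unfold)
  ultimately have "jac (sh 1) = 1" by auto
  then show ?thesis by (simp add: sh_def)
qed

section \<open>The invariant measure\<close>

lemma bounded_bilinear_matrix_mult:
  "bounded_bilinear ((**) :: complex^'n::finite^'n \<Rightarrow> complex^'n^'n \<Rightarrow> complex^'n^'n)"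
  unfolding bilinear_conv_bounded_bilinear[symmetric] bilinear_def
  by (auto intro!: linearI simp: matrix_add_ldistrib matrix_add_rdistrib matrix_mult_scaleR)

lemma scaleR_matrix_vector: "(c *\<^sub>R A) *v v = c *\<^sub>R (A *v v)" for A :: "complex^'n::finite^'n"
  by (simp add: vec_eq_iff matrix_vector_mult_def scaleR_sum_right)

lemma bounded_bilinear_matrix_vector:
  "bounded_bilinear ((*v) :: complex^'n::finite^'n \<Rightarrow> complex^'n \<Rightarrow> complex^'n)"
  unfolding bilinear_conv_bounded_bilinear[symmetric] bilinear_def
  by (auto intro!: linearI simp: matrix_vector_right_distrib matrix_vector_mult_add_rdistrib matrix_mult_scaleR
     scaleR_matrix_vector)

lemma bounded_linear_transpose: "bounded_linear (transpose :: complex^'n::finite^'n \<Rightarrow> complex^'n^'n)"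
  unfolding linear_conv_bounded_linear[symmetric]
  by (rule linearI) (simp_all add: vec_eq_iff transpose_def)

lemma bounded_linear_kinv: "bounded_linear kinv"
  using linear_kinv by (simp add: linear_linear)

lemma isCont_det: "isCont (det :: complex^'n::finite^'n \<Rightarrow> complex) A"
  unfolding det_def[abs_def] by (intro continuous_intros)

text \<open>
  From \<open>Y\<^sup>-\<^sup>1 - A\<^sup>-\<^sup>1 = - Y\<^sup>-\<^sup>1 (Y - A) A\<^sup>-\<^sup>1\<close>, once \<open>Y\<^sup>-\<^sup>1\<close> is bounded near \<open>A\<close>.
\<close>

lemma has_derivative_matrix_inv:
  fixes A :: "complex^'n::finite^'n"
  assumes A: "invertible A"
  shows "(matrix_inv has_derivative (\<lambda>H. - (matrix_inv A ** H ** matrix_inv A))) (at A within S)"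
proof -
  let ?X = "matrix_inv A"
  have "\<exists>K>0. \<forall>(P :: complex^'n^'n) (Q :: complex^'n^'n). norm (P ** Q) \<le> norm P * norm Q * K"
    by (rule bounded_bilinear.pos_bounded[OF bounded_bilinear_matrix_mult])
  then obtain K where K: "K > 0" and Kle: "\<forall>(P :: complex^'n^'n) (Q :: complex^'n^'n). norm (P ** Q) \<le> norm P * norm Q * K"
    by (elim exE conjE) (rule that)
  have K3: "norm (P ** Q ** R) \<le> K\<^sup>2 * norm P * norm Q * norm R" for P Q R :: "complex^'n^'n"
  proof -
    have "norm (P ** Q ** R) \<le> norm (P ** Q) * norm R * K" by (rule Kle[rule_format])
    also have "\<dots> \<le> (norm P * norm Q * K) * norm R * K"
      using K by (intro mult_right_mono Kle[rule_format]) auto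
    finally show ?thesis by (simp add: power2_eq_square mult_ac)
  qed
  have "((\<lambda>Y. det Y) \<longlongrightarrow> det A) (at A)" using isCont_det[of A] by (simp add: isCont_def)
  moreover have "det A \<noteq> 0" using A by (simp add: invertible_det_nz)
  ultimately have "\<forall>\<^sub>F Y in at A. det Y \<noteq> 0" by (rule tendsto_imp_eventually_ne)
  then obtain e1 where e1: "e1 > 0" "\<And>Y. Y \<noteq> A \<Longrightarrow> dist Y A < e1 \<Longrightarrow> invertible Y"
    unfolding eventually_at by (auto simp: invertible_det_nz)
  define e2 where "e2 = 1 / (2 * K\<^sup>2 * (norm ?X + 1))"
  have nX: "norm ?X + 1 > 0" by (simp add: add_nonneg_pos)
  have half: "K\<^sup>2 * (1 / (2 * K\<^sup>2 * u) * u) = 1 / 2" if "u > 0" for u using K that by simp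
  have e2: "e2 > 0" unfolding e2_def using K nX by (intro divide_pos_pos mult_pos_pos) auto
  define C where "C = K\<^sup>2 * (2 * K\<^sup>2 * norm ?X * norm ?X) * norm ?X"
  show ?thesis
  proof (rule has_derivativeI_sandwich[where e = "min e1 e2" and H = "\<lambda>Y. C * norm (Y - A)"])
    show "0 < min e1 e2" using e1 e2 by simp
    show "bounded_linear (\<lambda>H. - (?X ** H ** ?X))"
      by (intro bounded_linear_minus
        bounded_linear_compose[OF bounded_bilinear.bounded_linear_left[OF bounded_bilinear_matrix_mult]
          bounded_bilinear.bounded_linear_right[OF bounded_bilinear_matrix_mult]])
    show "((\<lambda>Y. C * norm (Y - A)) \<longlongrightarrow> 0) (at A within S)"
      by (rule tendsto_eq_intros | simp)+
    fix Y assume "Y \<noteq> A" and d: "dist Y A < min e1 e2"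
    then have Y: "invertible Y" using e1 by simp
    let ?Y = "matrix_inv Y"
    have diff: "?Y - ?X = - (?Y ** (Y - A) ** ?X)"
      using A Y by (simp add: matrix_diff_ldistrib matrix_diff_rdistrib matrix_mul_assoc[symmetric])
    have n: "norm (Y - A) < e2" using d by (simp add: dist_norm)
    have "norm ?Y \<le> norm ?X + norm (?Y - ?X)" by (rule norm_triangle_sub)
    also have "norm (?Y - ?X) \<le> K\<^sup>2 * norm ?Y * norm (Y - A) * norm ?X"
      unfolding diff norm_minus_cancel by (rule K3)
    also have "K\<^sup>2 * norm ?Y * norm (Y - A) * norm ?X = norm ?Y * (K\<^sup>2 * (norm (Y - A) * norm ?X))" by simp
    also have "\<dots> \<le> norm ?Y * (K\<^sup>2 * (e2 * (norm ?X + 1)))"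
      using n e2 by (intro mult_left_mono mult_mono) auto
    also have "K\<^sup>2 * (e2 * (norm ?X + 1)) = 1 / 2" unfolding e2_def using half[OF nX] .
    finally have nY: "norm ?Y \<le> 2 * norm ?X" by simp
    have nd: "norm (?Y - ?X) \<le> 2 * K\<^sup>2 * norm ?X * norm ?X * norm (Y - A)"
    proof -
      have "norm (?Y - ?X) \<le> K\<^sup>2 * norm ?Y * norm (Y - A) * norm ?X"
        unfolding diff norm_minus_cancel by (rule K3)
      also have "\<dots> \<le> K\<^sup>2 * (2 * norm ?X) * norm (Y - A) * norm ?X"
        using nY by (intro mult_right_mono mult_left_mono) auto
      finally show ?thesis by (simp add: mult_ac)
    qed
    have "?Y - ?X - - (?X ** (Y - A) ** ?X) = (?X - ?Y) ** (Y - A) ** ?X"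
      unfolding diff by (simp add: matrix_diff_rdistrib)
    then have "norm (?Y - ?X - - (?X ** (Y - A) ** ?X)) \<le> K\<^sup>2 * norm (?X - ?Y) * norm (Y - A) * norm ?X"
      using K3 by simp
    also have "\<dots> \<le> K\<^sup>2 * (2 * K\<^sup>2 * norm ?X * norm ?X * norm (Y - A)) * norm (Y - A) * norm ?X"
      using nd by (intro mult_right_mono mult_left_mono) (auto simp: norm_minus_commute)
    also have "\<dots> = (C * norm (Y - A)) * norm (Y - A)" by (simp add: C_def mult_ac)
    finally show "norm (?Y - ?X - - (?X ** (Y - A) ** ?X)) / norm (Y - A) \<le> C * norm (Y - A)"
      using \<open>Y \<noteq> A\<close> by (simp add: divide_le_eq)
  qed
qed

definition coord_siegel :: "(real^('n::finite jidx)) set" where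
  "coord_siegel = {v. kap v \<in> siegel_jacobi}"

lemma siegel_jacobi_symsp: "p \<in> siegel_jacobi \<Longrightarrow> p \<in> symsp"
  by (auto simp: siegel_jacobi_def siegel_space_def symsp_def)

lemma jacobi_act_in: "M \<in> Sp_int \<Longrightarrow> p \<in> siegel_jacobi \<Longrightarrow> jacobi_act M l u p \<in> siegel_jacobi"
  by (auto simp: siegel_jacobi_def jacobi_act_def siegel_act_in)

lemma matrix_inv_transpose_aut:
  assumes "M \<in> Sp_int" "\<tau> \<in> siegel_space"
  shows "matrix_inv (transpose (aut_factor M \<tau>)) = transpose (matrix_inv (aut_factor M \<tau>))"
  by (rule transpose_matrix_inv[OF aut_factor_invertible[OF assms], symmetric])

lemma jacobi_act_inj:
  assumes M: "M \<in> Sp_int" and p: "p \<in> siegel_jacobi" and q: "q \<in> siegel_jacobi"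
    and eq: "jacobi_act M l u p = jacobi_act M l u q"
  shows "p = q"
proof -
  obtain \<tau> z \<sigma> w where pq: "p = (\<tau>, z)" "q = (\<sigma>, w)" by (metis prod.exhaust)
  have \<tau>: "\<tau> \<in> siegel_space" and \<sigma>: "\<sigma> \<in> siegel_space" using p q by (auto simp: pq siegel_jacobi_def)
  obtain M' where M': "M' \<in> Sp_int" "M' ** M = mat 1" using Sp_int_inverse[OF M] by blast
  have "siegel_act M \<tau> = siegel_act M \<sigma>" using eq by (simp add: pq jacobi_act_def)
  then have "siegel_act (M' ** M) \<tau> = siegel_act (M' ** M) \<sigma>"
    by (simp only: siegel_act_mult[OF M'(1) M \<tau>] siegel_act_mult[OF M'(1) M \<sigma>])
  then have ts: "\<tau> = \<sigma>" by (simp only: M'(2) siegel_act_one[OF \<tau>] siegel_act_one[OF \<sigma>])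
  have inv: "invertible (transpose (aut_factor M \<tau>))"
    by (rule invertible_transpose[OF aut_factor_invertible[OF M \<tau>]])
  have "matrix_inv (transpose (aut_factor M \<tau>)) *v lattice_shift l u \<tau> z = matrix_inv (transpose (aut_factor M \<tau>)) *v lattice_shift l u \<tau> w"
    using eq by (simp add: pq jacobi_act_def ts)
  then have "lattice_shift l u \<tau> z = lattice_shift l u \<tau> w"
    by (metis mult_matrix_inv_vec[OF inv])
  then show ?thesis by (simp add: pq ts lattice_shift_def)
qed

text \<open>
  The derivative of the vector component along \<open>\<tau>\<close>, before \<open>(C\<tau> + D)\<^sup>-\<^sup>t\<close> is applied.
\<close>

definition act_shear :: "int^('n+'n)^('n+'n) \<Rightarrow> int^'n \<Rightarrow> int^'n \<Rightarrow> 'n jacobi_point \<Rightarrow> complex^'n^'n \<Rightarrow> complex^'n::finite" where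
  "act_shear M l u p S = S *v cvec l - transpose (cmat (blk_C M) ** S) *v
     (matrix_inv (transpose (aut_factor M (fst p))) *v lattice_shift l u (fst p) (snd p))"

lemma linear_act_shear: "linear (act_shear M l u p)"
  by (rule linearI) (simp_all only: act_shear_def matrix_vector_mult_add_rdistrib matrix_add_ldistrib transpose_add
    matrix_mult_scaleR scaleR_matrix_vector scaleR_diff_right linear_scale[OF bounded_linear.linear[OF bounded_linear_transpose]],
    simp_all)

lemma has_derivative_jacobi_act:
  assumes M: "M \<in> Sp_int" and p: "p \<in> siegel_jacobi"
  defines "P \<equiv> matrix_inv (transpose (aut_factor M (fst p)))"
  shows "(jacobi_act M l u has_derivative (act P \<circ> (\<lambda>(S, Z). (S, Z + act_shear M l u p S)))) (at p)"
proof -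
  let ?A = "cmat (blk_A M)" and ?B = "cmat (blk_B M)" and ?C = "cmat (blk_C M)" and ?D = "cmat (blk_D M)"
  define \<tau> z where "\<tau> = fst p" and "z = snd p"
  have pp: "p = (\<tau>, z)" by (simp add: \<tau>_def z_def)
  have \<tau>: "\<tau> \<in> siegel_space" using p by (auto simp: pp siegel_jacobi_def)
  let ?J = "aut_factor M \<tau>"
  have J: "invertible ?J" by (rule aut_factor_invertible[OF M \<tau>])
  have Jt: "invertible (transpose ?J)" using J by (rule invertible_transpose)
  note mm = bounded_bilinear.FDERIV[OF bounded_bilinear_matrix_mult]
  note mv = bounded_bilinear.FDERIV[OF bounded_bilinear_matrix_vector]
  have d1: "(fst has_derivative fst) (at p)" "(snd has_derivative snd) (at p)"
    by (auto intro: has_derivative_fst has_derivative_snd has_derivative_ident)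
  have dJ: "((\<lambda>q. aut_factor M (fst q)) has_derivative (\<lambda>h. ?C ** fst h)) (at p)"
    unfolding aut_factor_def
    by (rule has_derivative_eq_rhs[OF has_derivative_add[OF mm[OF has_derivative_const d1(1)] has_derivative_const]])
      (simp add: fun_eq_iff)
  have dH: "((\<lambda>q. siegel_num M (fst q)) has_derivative (\<lambda>h. ?A ** fst h)) (at p)"
    unfolding siegel_num_def
    by (rule has_derivative_eq_rhs[OF has_derivative_add[OF mm[OF has_derivative_const d1(1)] has_derivative_const]])
      (simp add: fun_eq_iff)
  have dI: "((\<lambda>q. matrix_inv (aut_factor M (fst q))) has_derivative
      (\<lambda>h. - (matrix_inv ?J ** (?C ** fst h) ** matrix_inv ?J))) (at p)"
    using has_derivative_compose[OF dJ has_derivative_matrix_inv[of "aut_factor M (fst p)"]] J by (simp add: pp)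
  have dJt: "((\<lambda>q. transpose (aut_factor M (fst q))) has_derivative (\<lambda>h. transpose (?C ** fst h))) (at p)"
    by (rule bounded_linear.has_derivative[OF bounded_linear_transpose dJ])
  have dIt: "((\<lambda>q. matrix_inv (transpose (aut_factor M (fst q)))) has_derivative
      (\<lambda>h. - (matrix_inv (transpose ?J) ** transpose (?C ** fst h) ** matrix_inv (transpose ?J)))) (at p)"
    using has_derivative_compose[OF dJt has_derivative_matrix_inv[of "transpose (aut_factor M (fst p))"]] Jt by (simp add: pp)
  have dL: "((\<lambda>q. lattice_shift l u (fst q) (snd q)) has_derivative (\<lambda>h. snd h + fst h *v cvec l)) (at p)"
    unfolding lattice_shift_def
    by (rule has_derivative_eq_rhs[OF has_derivative_add[OF has_derivative_add[OF d1(2) mv[OF d1(1) has_derivative_const]] has_derivative_const]])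
      (simp add: fun_eq_iff)
  have "((\<lambda>q. (siegel_num M (fst q) ** matrix_inv (aut_factor M (fst q)),
       matrix_inv (transpose (aut_factor M (fst q))) *v lattice_shift l u (fst q) (snd q))) has_derivative
     (\<lambda>h. (siegel_num M (fst p) ** - (matrix_inv ?J ** (?C ** fst h) ** matrix_inv ?J) + (?A ** fst h) ** matrix_inv (aut_factor M (fst p)),
        matrix_inv (transpose (aut_factor M (fst p))) *v (snd h + fst h *v cvec l)
         + - (matrix_inv (transpose ?J) ** transpose (?C ** fst h) ** matrix_inv (transpose ?J)) *v lattice_shift l u (fst p) (snd p)))) (at p)"
    by (intro has_derivative_Pair mm[OF dH dI] mv[OF dIt dL])
  also have "(\<lambda>q. (siegel_num M (fst q) ** matrix_inv (aut_factor M (fst q)),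
       matrix_inv (transpose (aut_factor M (fst q))) *v lattice_shift l u (fst q) (snd q))) = jacobi_act M l u"
    by (auto simp: jacobi_act_def siegel_act_alt fun_eq_iff)
  also have "(\<lambda>h. (siegel_num M (fst p) ** - (matrix_inv ?J ** (?C ** fst h) ** matrix_inv ?J) + (?A ** fst h) ** matrix_inv (aut_factor M (fst p)),
        matrix_inv (transpose (aut_factor M (fst p))) *v (snd h + fst h *v cvec l)
         + - (matrix_inv (transpose ?J) ** transpose (?C ** fst h) ** matrix_inv (transpose ?J)) *v lattice_shift l u (fst p) (snd p)))
     = act P \<circ> (\<lambda>(S, Z). (S, Z + act_shear M l u p S))"
  proof (rule ext, clarify)
    fix S :: "complex^'a^'a" and Z :: "complex^'a"
    have P: "P = matrix_inv (transpose ?J)" by (simp add: P_def pp)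
    have Pt: "transpose P = matrix_inv ?J" unfolding P matrix_inv_transpose_aut[OF M \<tau>] by simp
    have key: "?A - siegel_num M \<tau> ** matrix_inv ?J ** ?C = P"
    proof -
      let ?T = "siegel_act M \<tau>"
      have "transpose ?J ** ?T = transpose (siegel_num M \<tau>)"
        using siegel_act_mult_aut[OF M \<tau>] siegel_act_sym[OF M \<tau>] by (metis matrix_transpose_mul)
      then have "transpose ?J ** (?A - ?T ** ?C) = transpose ?J ** ?A - transpose (siegel_num M \<tau>) ** ?C"
        by (simp add: matrix_diff_ldistrib matrix_mul_assoc)
      also have "\<dots> = mat 1"
      proof -
        have r0: "transpose (blk_A M) ** blk_C M = transpose (blk_C M) ** blk_A M"
          "transpose (blk_A M) ** blk_D M - transpose (blk_C M) ** blk_B M = mat 1"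
          using M by (simp_all add: Sp_int_iff)
        have r1: "transpose ?A ** ?C = transpose ?C ** ?A"
          and r3: "transpose ?A ** ?D - transpose ?C ** ?B = mat 1"
          using arg_cong[OF r0(1), of cmat] arg_cong[OF r0(2), of cmat]
          by (simp_all add: cmat_mult cmat_diff map_matrix_transpose)
        have r4: "transpose ?D ** ?A - transpose ?B ** ?C = mat 1"
          using arg_cong[OF r3, of transpose] by (simp add: transpose_diff matrix_transpose_mul)
        have r5: "\<tau> ** transpose ?A ** ?C = \<tau> ** transpose ?C ** ?A"
          unfolding matrix_mul_assoc[symmetric] r1 ..
        have "transpose ?J ** ?A - transpose (siegel_num M \<tau>) ** ?C = \<tau> ** transpose ?C ** ?A - \<tau> ** transpose ?A ** ?C + (transpose ?D ** ?A - transpose ?B ** ?C)"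
          by (simp add: aut_factor_def siegel_num_def transpose_add matrix_transpose_mul matrix_add_rdistrib siegelD(1)[OF \<tau>] algebra_simps)
        then show ?thesis unfolding r4 r5 by simp
      qed
      finally have "P = ?A - ?T ** ?C" unfolding P by (rule matrix_inv_unique_field)
      then show ?thesis by (simp add: siegel_act_alt)
    qed
    have 1: "siegel_num M (fst p) ** - (matrix_inv ?J ** (?C ** S) ** matrix_inv ?J) + (?A ** S) ** matrix_inv (aut_factor M (fst p))
       = P ** S ** transpose P"
      unfolding Pt unfolding key[symmetric]
      by (simp add: pp matrix_diff_rdistrib matrix_uminus_right matrix_mul_assoc)
    have 2: "matrix_inv (transpose (aut_factor M (fst p))) *v (Z + S *v cvec l)
         + - (matrix_inv (transpose ?J) ** transpose (?C ** S) ** matrix_inv (transpose ?J)) *v lattice_shift l u (fst p) (snd p)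
       = P *v (Z + act_shear M l u p S)"
    proof -
      have m: "(- X) *v w = - (X *v w)" for X :: "complex^'a^'a" and w by (simp add: vec_eq_iff matrix_vector_mult_def sum_negf)
      show ?thesis unfolding m act_shear_def P_def[symmetric] P[symmetric]
        by (simp only: matrix_vector_right_distrib matrix_vector_mult_diff_distrib matrix_vector_mul_assoc matrix_mul_assoc) simp
    qed
    show "(siegel_num M (fst p) ** - (matrix_inv ?J ** (?C ** fst (S, Z)) ** matrix_inv ?J) + (?A ** fst (S, Z)) ** matrix_inv (aut_factor M (fst p)),
        matrix_inv (transpose (aut_factor M (fst p))) *v (snd (S, Z) + fst (S, Z) *v cvec l)
         + - (matrix_inv (transpose ?J) ** transpose (?C ** fst (S, Z)) ** matrix_inv (transpose ?J)) *v lattice_shift l u (fst p) (snd p))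
       = (act P \<circ> (\<lambda>(S, Z). (S, Z + act_shear M l u p S))) (S, Z)"
      unfolding fst_conv snd_conv 1 2 by (simp add: act_def)
  qed
  finally show ?thesis .
qed

text \<open>
  With square roots \<open>R\<close>, \<open>R'\<close> of the imaginary parts of \<open>\<tau>\<close> and \<open>M\<tau>\<close>, the matrix
  \<open>U = R'\<^sup>-\<^sup>1 (C\<tau> + D)\<^sup>-\<^sup>t R\<close> is unitary by the transformation law of the imaginary part. Thus the Jacobian
  is that of \<open>R' R\<^sup>-\<^sup>1\<close>.
\<close>

lemma jac_derivative:
  fixes p :: "'n::finite jacobi_point"
  assumes M: "M \<in> Sp_int" and p: "p \<in> siegel_jacobi"
  shows "jac (act (matrix_inv (transpose (aut_factor M (fst p)))) \<circ> (\<lambda>(S, Z). (S, Z + act_shear M l u p S)))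
    = (det (im_mat (siegel_act M (fst p))) / det (im_mat (fst p))) ^ (CARD('n) + 2)"
proof -
  define \<tau> where "\<tau> = fst p"
  have \<tau>: "\<tau> \<in> siegel_space" using p by (auto simp: \<tau>_def siegel_jacobi_def)
  let ?J = "aut_factor M \<tau>" and ?X = "im_mat \<tau>" and ?X' = "im_mat (siegel_act M \<tau>)"
  define P where "P = matrix_inv (transpose ?J)"
  have J: "invertible ?J" by (rule aut_factor_invertible[OF M \<tau>])
  have pX: "pos_def ?X" using siegelD(2)[OF \<tau>] .
  have pX': "pos_def ?X'" using siegelD(2)[OF siegel_act_in[OF M \<tau>]] .
  obtain R :: "real^'n^'n" where R: "invertible R" "?X = R ** transpose R" using pos_def_sqrt[OF pX] .
  obtain R' :: "real^'n^'n" where R': "invertible R'" "?X' = R' ** transpose R'" using pos_def_sqrt[OF pX'] .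
  have cinv: "cr (matrix_inv R') ** cr R' = mat 1" "cr R' ** cr (matrix_inv R') = mat 1"
    "cr R ** cr (matrix_inv R) = mat 1"
    unfolding cr_mult[symmetric] using R(1) R'(1) by simp_all
  define U where "U = cr (matrix_inv R') ** P ** cr R"
  have PXP: "P ** cr ?X ** transpose (cj P) = cr ?X'"
  proof -
    have e: "transpose ?J ** cr ?X' ** cj ?J = cr ?X"
      using arg_cong[OF im_siegel_act[OF M \<tau>], of cj] by (simp add: cj_mult map_matrix_transpose)
    have PJ: "P ** transpose ?J = mat 1" unfolding P_def using invertible_transpose[OF J] by simp
    have "transpose (P ** transpose ?J) = mat 1" using PJ by simp
    then have JP: "?J ** transpose P = mat 1" by (simp add: matrix_transpose_mul)
    have cJ: "cj ?J ** transpose (cj P) = mat 1"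
      using arg_cong[OF JP, of cj] by (simp add: cj_mult map_matrix_transpose)
    have "P ** cr ?X ** transpose (cj P) = (P ** transpose ?J) ** cr ?X' ** (cj ?J ** transpose (cj P))"
      unfolding e[symmetric] by (simp add: matrix_mul_assoc)
    then show ?thesis unfolding PJ cJ by simp
  qed
  have "U ** transpose (cj U) = cr (matrix_inv R') ** (P ** cr ?X ** transpose (cj P)) ** transpose (cr (matrix_inv R'))"
    unfolding U_def cj_mult matrix_transpose_mul cj_cr R(2) cr_mult map_matrix_transpose by (simp add: matrix_mul_assoc)
  also have "\<dots> = (cr (matrix_inv R') ** cr R') ** transpose (cr (matrix_inv R') ** cr R')"
    unfolding PXP R'(2) cr_mult map_matrix_transpose matrix_transpose_mul by (simp add: matrix_mul_assoc)
  also have "\<dots> = mat 1" unfolding cinv by simp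
  finally have U: "U ** transpose (cj U) = mat 1" .
  have "cr R' ** U ** cr (matrix_inv R) = (cr R' ** cr (matrix_inv R')) ** P ** (cr R ** cr (matrix_inv R))"
    unfolding U_def by (simp add: matrix_mul_assoc)
  then have P: "P = cr R' ** U ** cr (matrix_inv R)" unfolding cinv by simp
  let ?e = "2 * (CARD('n) + 2)"
  have "jac (act P) = \<bar>det R'\<bar> ^ ?e * \<bar>det (matrix_inv R)\<bar> ^ ?e"
    unfolding P jac_act_mult jac_act_real jac_act_unitary[OF U] by simp
  also have "\<dots> = ((det R')\<^sup>2 / (det R)\<^sup>2) ^ (CARD('n) + 2)"
    unfolding det_matrix_inv[OF R(1)] power_mult by (simp add: power_divide power_inverse divide_inverse power_mult_distrib)
  also have "(det R')\<^sup>2 = det ?X'" unfolding R'(2) det_mul by (simp add: power2_eq_square)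
  also have "(det R)\<^sup>2 = det ?X" unfolding R(2) det_mul by (simp add: power2_eq_square)
  finally have jP: "jac (act P) = (det ?X' / det ?X) ^ (CARD('n) + 2)" .
  let ?sh = "\<lambda>(S, Z). (S, Z + act_shear M l u p S)"
  have "sym_linear ?sh"
    unfolding sym_linear_def
    by (auto simp: symsp_def linear_add[OF linear_act_shear] linear_scale[OF linear_act_shear] algebra_simps intro!: linearI)
  then have "jac (act P \<circ> ?sh) = jac (act P) * jac ?sh" by (rule jac_comp[OF sym_linear_act])
  then show ?thesis using jP jac_shear[OF linear_act_shear[of M l u p]] by (simp add: P_def \<tau>_def)
qed

lemma has_derivative_kconj_act:
  assumes M: "M \<in> Sp_int" and v: "v \<in> coord_siegel"
  shows "(kconj (jacobi_act M l u) has_derivative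
    kconj (act (matrix_inv (transpose (aut_factor M (fst (kap v))))) \<circ> (\<lambda>(S, Z). (S, Z + act_shear M l u (kap v) S)))) (at v within E)"
proof -
  have "kap v \<in> siegel_jacobi" using v by (simp add: coord_siegel_def)
  from has_derivative_jacobi_act[OF M this, of l u]
  have "((\<lambda>v. jacobi_act M l u (kap v)) has_derivative (\<lambda>w. (act (matrix_inv (transpose (aut_factor M (fst (kap v))))) \<circ> (\<lambda>(S, Z). (S, Z + act_shear M l u (kap v) S))) (kap w))) (at v within E)"
    by (rule has_derivative_compose[OF bounded_linear_imp_has_derivative[OF bounded_linear_kap]])
  then have "((\<lambda>v. kinv (jacobi_act M l u (kap v))) has_derivative (\<lambda>w. kinv ((act (matrix_inv (transpose (aut_factor M (fst (kap v))))) \<circ> (\<lambda>(S, Z). (S, Z + act_shear M l u (kap v) S))) (kap w)))) (at v within E)"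
    by (rule bounded_linear.has_derivative[OF bounded_linear_kinv])
  then show ?thesis by (simp only: kconj_def[abs_def])
qed

text \<open>
  The hypothesis on \<open>h\<close> says that \<open>h\<close> times the determinant of the imaginary part to the power
  \<open>g + 2\<close> is invariant, as for the integrand of the Petersson product.
\<close>

lemma change_of_variables_jacobi:
  fixes h :: "real^('n::finite jidx) \<Rightarrow> real"
  assumes M: "M \<in> Sp_int" and E: "E \<in> sets lebesgue" "E \<subseteq> coord_siegel"
    and h: "\<And>v. v \<in> E \<Longrightarrow> h v = (det (im_mat (siegel_act M (fst (kap v)))) / det (im_mat (fst (kap v)))) ^ (CARD('n) + 2) * h (kconj (jacobi_act M l u) v)"
    and int: "h absolutely_integrable_on (kconj (jacobi_act M l u) ` E)"
  shows "h absolutely_integrable_on E \<and> integral E h = integral (kconj (jacobi_act M l u) ` E) h"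
proof -
  let ?G = "kconj (jacobi_act M l u)"
  define g' where "g' v = kconj (act (matrix_inv (transpose (aut_factor M (fst (kap v))))) \<circ> (\<lambda>(S, Z). (S, Z + act_shear M l u (kap v) S)))" for v :: "real^('n jidx)"
  have der: "(?G has_derivative g' v) (at v within E)" if "v \<in> E" for v
    unfolding g'_def by (rule has_derivative_kconj_act[OF M]) (use that E(2) in blast)
  have inj: "inj_on ?G E"
  proof (rule inj_onI)
    fix v w assume vw: "v \<in> E" "w \<in> E" and eq: "?G v = ?G w"
    have in': "kap v \<in> siegel_jacobi" "kap w \<in> siegel_jacobi" using vw E(2) by (auto simp: coord_siegel_def)
    have "kap (?G v) = kap (?G w)" using eq by simp
    then have "jacobi_act M l u (kap v) = jacobi_act M l u (kap w)"
      by (simp add: kconj_def kap_kinv siegel_jacobi_symsp jacobi_act_in M in')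
    then have "kap v = kap w" by (rule jacobi_act_inj[OF M in'])
    then show "v = w" by (simp add: kap_inj)
  qed
  have det: "\<bar>det (matrix (g' v))\<bar> * h (?G v) = h v" if "v \<in> E" for v
  proof -
    have "kap v \<in> siegel_jacobi" using that E(2) by (auto simp: coord_siegel_def)
    from jac_derivative[OF M this, of l u] show ?thesis using h[OF that] by (simp add: jac_def g'_def)
  qed
  have "(\<lambda>x. vec (h x) :: real^1) absolutely_integrable_on (?G ` E) \<and> integral (?G ` E) (\<lambda>x. vec (h x) :: real^1) = vec (integral (?G ` E) h)"
    using int unfolding absolutely_integrable_on_1_iff
    by (simp add: integral_on_1_eq)
  then have "(\<lambda>x. \<bar>det (matrix (g' x))\<bar> *\<^sub>R (vec (h (?G x)) :: real^1)) absolutely_integrable_on E \<and>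
     integral E (\<lambda>x. \<bar>det (matrix (g' x))\<bar> *\<^sub>R (vec (h (?G x)) :: real^1)) = vec (integral (?G ` E) h)"
    using has_absolute_integral_change_of_variables[OF E(1) der inj, of "\<lambda>x. vec (h x) :: real^1"] by blast
  then have 1: "(\<lambda>x. (\<bar>det (matrix (g' x))\<bar> *\<^sub>R (vec (h (?G x)) :: real^1)) $ 1) absolutely_integrable_on E"
     and 2: "vec (integral E (\<lambda>x. (\<bar>det (matrix (g' x))\<bar> *\<^sub>R (vec (h (?G x)) :: real^1)) $ 1)) = (vec (integral (?G ` E) h) :: real^1)"
    unfolding absolutely_integrable_on_1_iff integral_on_1_eq[of E] by blast+
  have c: "(\<bar>det (matrix (g' x))\<bar> *\<^sub>R (vec (h (?G x)) :: real^1)) $ 1 = \<bar>det (matrix (g' x))\<bar> * h (?G x)" for x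
    by (simp only: vector_scaleR_component vec_component real_scaleR_def)
  have *: "(\<lambda>x. \<bar>det (matrix (g' x))\<bar> * h (?G x)) absolutely_integrable_on E"
     "integral E (\<lambda>x. \<bar>det (matrix (g' x))\<bar> * h (?G x)) = integral (?G ` E) h"
    using 1 2 unfolding c vec_inj by blast+
  have "h absolutely_integrable_on E"
    by (rule absolutely_integrable_spike[OF *(1) negligible_empty]) (rule det[symmetric], blast)
  moreover have "integral E h = integral E (\<lambda>x. \<bar>det (matrix (g' x))\<bar> * h (?G x))"
    by (rule integral_cong) (rule det[symmetric])
  ultimately show ?thesis using *(2) by (simp only:)
qed

section \<open>Invariance of the Petersson norm\<close>

lemma cv_mult: "cv (A *v v) = cr A *v cv v" for A :: "real^'n::finite^'m"
  by (simp add: vec_eq_iff matrix_vector_mult_def)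

lemma im_vec_affine: "im_vec (\<tau> *v cv p + cv q) = im_mat \<tau> *v p"
  and re_vec_affine: "re_vec (\<tau> *v cv p + cv q) = re_mat \<tau> *v p + q"
  for \<tau> :: "complex^'n::finite^'n"
  by (simp_all add: vec_eq_iff matrix_vector_mult_def)

lemma Im_bidot_cv: "Im (bidot (cv p) w) = p \<bullet> im_vec w"
  by (simp add: bidot_def inner_vec_def)

lemma cmat_cr: "cmat A = cr (ri A)" by (simp add: vec_eq_iff)

text \<open>
  Write \<open>w = \<tau> p + q\<close> with real \<open>p\<close>, \<open>q\<close>. The action replaces \<open>(p, q)\<close> by \<open>(D p - C q, A q - B p)\<close>, and the
  form \<open>y\<^sup>t \<eta>\<^sup>-\<^sup>1 y\<close> of the imaginary part becomes the form \<open>\<eta>\<close> at \<open>p\<close>.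
\<close>

lemma petersson_exponent:
  fixes w :: "complex^'n::finite"
  assumes M: "M \<in> Sp_int" and \<tau>: "\<tau> \<in> siegel_space"
  defines "J \<equiv> aut_factor M \<tau>"
  shows "qf (matrix_inv (im_mat (siegel_act M \<tau>))) (im_vec (matrix_inv (transpose J) *v w))
    = qf (matrix_inv (im_mat \<tau>)) (im_vec w) - Im (bidot w ((matrix_inv J ** cmat (blk_C M)) *v w))"
proof -
  let ?A = "cmat (blk_A M)" and ?B = "cmat (blk_B M)" and ?C = "cmat (blk_C M)" and ?D = "cmat (blk_D M)"
  let ?X = "im_mat \<tau>" and ?T = "siegel_act M \<tau>"
  have J: "invertible J" unfolding J_def by (rule aut_factor_invertible[OF M \<tau>])
  have Jt: "invertible (transpose J)" using J by (rule invertible_transpose)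
  have pX: "pos_def ?X" using siegelD(2)[OF \<tau>] .
  have pT: "pos_def (im_mat ?T)" using siegelD(2)[OF siegel_act_in[OF M \<tau>]] .
  \<comment> \<open>the real coordinates of \<open>w = \<tau> p + q\<close>\<close>
  define p where "p = matrix_inv ?X *v im_vec w"
  define q where "q = re_vec w - re_mat \<tau> *v p"
  have Xp: "?X *v p = im_vec w" unfolding p_def by (rule mult_matrix_inv_vec[OF pos_def_invertible[OF pX]])
  have w: "w = \<tau> *v cv p + cv q"
  proof -
    have "im_vec (\<tau> *v cv p + cv q) = im_vec w" "re_vec (\<tau> *v cv p + cv q) = re_vec w"
      unfolding im_vec_affine re_vec_affine Xp by (simp_all add: q_def)
    then show ?thesis by (simp add: vec_eq_iff complex_eq_iff)
  qed
  define a where "a = ri (blk_D M) *v p - ri (blk_C M) *v q"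
  define b where "b = ri (blk_A M) *v q - ri (blk_B M) *v p"
  have ca: "cv a = ?D *v cv p - ?C *v cv q" and cb: "cv b = ?A *v cv q - ?B *v cv p"
    unfolding a_def b_def cmat_cr cv_mult[symmetric] by (simp_all add: vec_eq_iff)
  have r0: "transpose (blk_A M) ** blk_C M = transpose (blk_C M) ** blk_A M" "transpose (blk_B M) ** blk_D M = transpose (blk_D M) ** blk_B M"
    "transpose (blk_A M) ** blk_D M - transpose (blk_C M) ** blk_B M = mat 1"
    using M by (simp_all add: Sp_int_iff)
  have r1: "transpose ?A ** ?C = transpose ?C ** ?A"
    and r2: "transpose ?B ** ?D = transpose ?D ** ?B"
    and r3: "transpose ?A ** ?D - transpose ?C ** ?B = mat 1"
    using arg_cong[OF r0(1), of cmat] arg_cong[OF r0(2), of cmat] arg_cong[OF r0(3), of cmat]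
    by (simp_all add: cmat_mult cmat_diff map_matrix_transpose)
  have r4: "transpose ?D ** ?A - transpose ?B ** ?C = mat 1"
    using arg_cong[OF r3, of transpose] by (simp add: transpose_diff matrix_transpose_mul)
  have z': "matrix_inv (transpose J) *v w = ?T *v cv a + cv b"
  proof -
    have H: "transpose J ** ?T = transpose (siegel_num M \<tau>)"
      unfolding J_def siegel_act_mult_aut[OF M \<tau>, symmetric] matrix_transpose_mul siegel_act_sym[OF M \<tau>] ..
    have 1: "transpose ?A *v cv a + transpose ?C *v cv b = cv p"
    proof -
      have "transpose ?A *v cv a + transpose ?C *v cv b
        = (transpose ?A ** ?D - transpose ?C ** ?B) *v cv p + (transpose ?C ** ?A - transpose ?A ** ?C) *v cv q"
        unfolding ca cb matrix_vector_mult_diff_distrib matrix_vector_mult_diff_rdistrib matrix_vector_mul_assoc by simp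
      then show ?thesis unfolding r1 r3 by simp
    qed
    have 2: "transpose ?B *v cv a + transpose ?D *v cv b = cv q"
    proof -
      have "transpose ?B *v cv a + transpose ?D *v cv b
        = (transpose ?B ** ?D - transpose ?D ** ?B) *v cv p + (transpose ?D ** ?A - transpose ?B ** ?C) *v cv q"
        unfolding ca cb matrix_vector_mult_diff_distrib matrix_vector_mult_diff_rdistrib matrix_vector_mul_assoc by simp
      then show ?thesis unfolding r2 r4 by simp
    qed
    have "transpose J *v (?T *v cv a + cv b) = transpose (siegel_num M \<tau>) *v cv a + transpose J *v cv b"
      unfolding matrix_vector_right_distrib matrix_vector_mul_assoc H ..
    also have "\<dots> = \<tau> *v (transpose ?A *v cv a + transpose ?C *v cv b) + (transpose ?B *v cv a + transpose ?D *v cv b)"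
      unfolding siegel_num_def J_def aut_factor_def transpose_add matrix_transpose_mul siegelD(1)[OF \<tau>]
        matrix_vector_mult_add_rdistrib matrix_vector_right_distrib matrix_vector_mul_assoc by simp
    also have "\<dots> = w" unfolding 1 2 w[symmetric] ..
    finally show ?thesis using matrix_inv_mult_vec[OF Jt] by metis
  qed
  have "im_vec (matrix_inv (transpose J) *v w) = im_mat ?T *v a" unfolding z' by (rule im_vec_affine)
  then have "qf (matrix_inv (im_mat ?T)) (im_vec (matrix_inv (transpose J) *v w)) = a \<bullet> im_vec (matrix_inv (transpose J) *v w)"
    using qf_inv[OF pT, of a] by simp
  also have "\<dots> = Im (bidot (cv a) (matrix_inv (transpose J) *v w))" by (rule Im_bidot_cv[symmetric])
  also have "bidot (cv a) (matrix_inv (transpose J) *v w) = bidot (matrix_inv J *v cv a) w"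
    unfolding bidot_mult_left transpose_matrix_inv[OF J] ..
  also have "matrix_inv J *v cv a = cv p - (matrix_inv J ** ?C) *v w"
  proof -
    have "cv a = J *v cv p - ?C *v w"
      unfolding ca J_def aut_factor_def w matrix_vector_mult_add_rdistrib matrix_vector_right_distrib matrix_vector_mul_assoc by simp
    then show ?thesis
      by (simp add: matrix_vector_mult_diff_distrib matrix_vector_mul_assoc matrix_inv_left[OF J])
  qed
  also have "bidot (cv p - (matrix_inv J ** ?C) *v w) w = bidot (cv p) w - bidot w ((matrix_inv J ** ?C) *v w)"
    by (simp add: bidot_diff_right bidot_commute[of _ w])
  also have "Im (bidot (cv p) w - bidot w ((matrix_inv J ** ?C) *v w)) = p \<bullet> im_vec w - Im (bidot w ((matrix_inv J ** ?C) *v w))"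
    by (simp add: Im_bidot_cv)
  also have "p \<bullet> im_vec w = qf (matrix_inv ?X) (im_vec w)" unfolding p_def by (rule inner_commute)
  finally show ?thesis .
qed

lemma petersson_norm_sq_invariant:
  fixes \<phi> :: "'n::finite jacobi_point \<Rightarrow> complex"
  assumes inv: "jacobi_invariant k m \<phi>" and M: "M \<in> Sp_int" and p: "p \<in> siegel_jacobi"
  shows "petersson_norm_sq k m \<phi> (jacobi_act M l u p) = petersson_norm_sq k m \<phi> p"
proof -
  obtain \<tau> z where pp: "p = (\<tau>, z)" by (cases p)
  have \<tau>: "\<tau> \<in> siegel_space" using p by (auto simp: pp siegel_jacobi_def)
  define J where "J = aut_factor M \<tau>"
  define w where "w = lattice_shift l u \<tau> z"
  let ?X = "im_mat \<tau>" and ?X' = "im_mat (siegel_act M \<tau>)"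
  define s where "s = bidot (cvec l) (\<tau> *v cvec l) + 2 * bidot (cvec l) z"
  define t where "t = bidot w ((matrix_inv J ** cmat (blk_C M)) *v w)"
  have pX: "pos_def ?X" using siegelD(2)[OF \<tau>] .
  have act: "jacobi_act M l u p = (siegel_act M \<tau>, matrix_inv (transpose J) *v w)"
    by (simp add: pp jacobi_act_def J_def w_def)
  define \<psi> where "\<psi> = \<phi> (jacobi_act M l u p)"
  have "\<psi> * inverse (det J) ^ k * exp (2 * of_real pi * \<i> * of_nat m * (s - t)) = \<phi> p"
  proof -
    have "case (\<tau>, z) of (\<tau>, z) \<Rightarrow> (let w = lattice_shift l u \<tau> z; J = aut_factor M \<tau> in
         \<phi> (siegel_act M \<tau>, matrix_inv (transpose J) *v w)
           * inverse (det J) ^ k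
           * exp (2 * of_real pi * \<i> * of_nat m *
               (bidot (cvec l) (\<tau> *v cvec l) + 2 * bidot (cvec l) z
                 - bidot w ((matrix_inv J ** cmat (blk_C M)) *v w)))
         = \<phi> (\<tau>, z))"
      using inv M p unfolding jacobi_invariant_def pp by blast
    then have "\<phi> (siegel_act M \<tau>, matrix_inv (transpose J) *v w) * inverse (det J) ^ k
           * exp (2 * of_real pi * \<i> * of_nat m * (s - t)) = \<phi> (\<tau>, z)"
      unfolding s_def t_def Let_def prod.case J_def[symmetric] w_def[symmetric] .
    then show ?thesis unfolding \<psi>_def act[symmetric] pp[symmetric] .
  qed
  then have "cmod (\<phi> p) = cmod \<psi> * inverse (cmod (det J)) ^ k * exp (- 2 * pi * real m * (Im s - Im t))"
    by (simp add: norm_mult norm_power norm_inverse flip: \<open>_ = \<phi> p\<close>)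
  then have \<phi>: "(cmod (\<phi> p))\<^sup>2 = (cmod \<psi>)\<^sup>2 * inverse ((cmod (det J))\<^sup>2) ^ k * exp (- 4 * pi * real m * (Im s - Im t))"
    by (simp add: power_mult_distrib exp_double[symmetric] power2_eq_square[of "exp _"] exp_add[symmetric] power_inverse
        power_mult[symmetric] mult.commute[of 2 k])
  have Jnz: "(cmod (det J))\<^sup>2 \<noteq> 0"
    using aut_factor_invertible[OF M \<tau>] unfolding J_def by (simp add: invertible_det_nz)
  have dX: "(cmod (det J))\<^sup>2 * det ?X' = det ?X" unfolding J_def by (rule det_im_siegel_act[OF M \<tau>])
  let ?l = "map_vector of_int l :: real^'n"
  have cl: "cvec l = cv ?l" by (simp add: vec_eq_iff)
  have imw: "im_vec w = im_vec z + ?X *v ?l"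
    unfolding w_def lattice_shift_def by (simp add: vec_eq_iff matrix_vector_mult_def)
  have Ims: "Im s = qf ?X ?l + 2 * (?l \<bullet> im_vec z)"
  proof -
    have "im_vec (\<tau> *v cv ?l) = ?X *v ?l" by (simp add: vec_eq_iff matrix_vector_mult_def)
    then show ?thesis unfolding s_def cl by (simp add: Im_bidot_cv)
  qed
  have key: "qf (matrix_inv ?X) (im_vec w) = qf (matrix_inv ?X) (im_vec z) + Im s"
  proof -
    have iX: "matrix_inv ?X *v (?X *v ?l) = ?l" by (rule matrix_inv_mult_vec[OF pos_def_invertible[OF pX]])
    have "(?X *v ?l) \<bullet> (matrix_inv ?X *v im_vec z) = ?l \<bullet> im_vec z"
      unfolding inner_matrix_transpose pos_def_sym[OF pX] mult_matrix_inv_vec[OF pos_def_invertible[OF pX]] ..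
    then show ?thesis unfolding imw Ims matrix_vector_right_distrib inner_add_left inner_add_right iX
      by (simp add: inner_commute)
  qed
  have W': "petersson_weight k m (jacobi_act M l u p) = det ?X' ^ k * exp (- 4 * pi * real m * (qf (matrix_inv ?X) (im_vec z) + Im s - Im t))"
    unfolding act petersson_weight_def Let_def prod.case key[symmetric] t_def J_def
    using petersson_exponent[OF M \<tau>, of w] by simp
  have W: "petersson_weight k m p = ((cmod (det J))\<^sup>2 * det ?X') ^ k * exp (- 4 * pi * real m * (qf (matrix_inv ?X) (im_vec z)))"
    unfolding dX by (simp add: pp petersson_weight_def Let_def)
  have e: "exp (- 4 * pi * real m * (Im s - Im t)) * exp (- 4 * pi * real m * qf (matrix_inv ?X) (im_vec z))
    = exp (- 4 * pi * real m * (qf (matrix_inv ?X) (im_vec z) + Im s - Im t))"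
    unfolding exp_add[symmetric] by (simp add: algebra_simps)
  have "petersson_norm_sq k m \<phi> p = (cmod \<psi>)\<^sup>2 * (inverse ((cmod (det J))\<^sup>2) ^ k * ((cmod (det J))\<^sup>2) ^ k) * det ?X' ^ k
     * (exp (- 4 * pi * real m * (Im s - Im t)) * exp (- 4 * pi * real m * qf (matrix_inv ?X) (im_vec z)))"
    unfolding petersson_norm_sq_def \<phi> W by (simp only: power_mult_distrib mult_ac)
  also have "inverse ((cmod (det J))\<^sup>2) ^ k * ((cmod (det J))\<^sup>2) ^ k = 1"
    using Jnz by (simp add: power_mult_distrib[symmetric])
  finally show ?thesis unfolding e petersson_norm_sq_def W' \<psi>_def by (simp only: mult_ac mult_1_left)
qed

lemma petersson_weight_pos: "p \<in> siegel_jacobi \<Longrightarrow> petersson_weight k m p > 0"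
  by (auto simp: siegel_jacobi_def petersson_weight_def Let_def intro!: mult_pos_pos zero_less_power pos_def_det_pos dest: siegelD)

section \<open>Comparison of quadratic forms with diagonal ones\<close>

text \<open>
  Comparability of a form with a diagonal one up to a constant. It turns estimates for matrices
  into estimates for the numbers \<open>d i\<close>.
\<close>

definition comparable :: "real \<Rightarrow> ('n::finite \<Rightarrow> real) \<Rightarrow> real^'n^'n \<Rightarrow> bool" where
  "comparable K d A \<longleftrightarrow> (\<forall>v. (\<Sum>i\<in>UNIV. d i * (v $ i)\<^sup>2) \<le> K * qf A v \<and> qf A v \<le> K * (\<Sum>i\<in>UNIV. d i * (v $ i)\<^sup>2))"

lemma comparable_mono:
  assumes "comparable K d A" "K \<le> K'" "\<And>i. d i \<ge> 0" "\<And>v. qf A v \<ge> 0"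
  shows "comparable K' d A"
proof -
  have "K * qf A v \<le> K' * qf A v" "K * (\<Sum>i\<in>UNIV. d i * (v $ i)\<^sup>2) \<le> K' * (\<Sum>i\<in>UNIV. d i * (v $ i)\<^sup>2)" for v
    using assms by (auto intro!: mult_right_mono sum_nonneg)
  then show ?thesis using assms(1) unfolding comparable_def by (meson order_trans)
qed

text \<open>
  The upper bound is the Cauchy inequality. For the lower bound, solve the triangular system for
  \<open>v\<close>: by induction on the rank, each \<open>sqrt (e i) \<bar>v i\<bar>\<close> is bounded by the square root of the form. The
  pivots must not increase much with the rank here.
\<close>

lemma ldl_comparable:
  fixes P :: "real^'n::finite^'n"
  assumes P: "unit_lower P" "\<And>i j. \<bar>P $ i $ j\<bar> \<le> 1" and e: "\<And>i. e i > 0"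
    and B: "B \<ge> 1" "\<And>a b. rk a \<le> rk b \<Longrightarrow> e b \<le> B * e a"
  shows "comparable (real CARD('n) * (1 + real CARD('n) * B) ^ (2 * CARD('n)) + (real CARD('n))\<^sup>2 * B) e (transpose P ** diag e ** P)"
  unfolding comparable_def
proof (intro allI conjI)
  let ?g = "real CARD('n)" and ?A = "transpose P ** diag e ** P"
  let ?K = "?g * (1 + ?g * B) ^ (2 * CARD('n)) + ?g\<^sup>2 * B"
  fix v :: "real^'n"
  have B0: "B \<ge> 0" using B(1) by simp
  have n: "(\<Sum>i\<in>UNIV. e i * (v $ i)\<^sup>2) \<ge> 0" using e by (intro sum_nonneg) (simp add: less_imp_le)
  have A: "qf ?A v \<ge> 0" unfolding qf_ldl using e by (intro sum_nonneg) (simp add: less_imp_le)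
  have "qf ?A v \<le> (\<Sum>i\<in>(UNIV::'n set). ?g * B * (\<Sum>l\<in>UNIV. e l * (v $ l)\<^sup>2))"
    unfolding qf_ldl
  proof (rule sum_mono)
    fix i :: 'n
    have "((P *v v) $ i)\<^sup>2 \<le> ?g * (\<Sum>l\<in>UNIV. (P $ i $ l * v $ l)\<^sup>2)"
      using sum_squared_le_sum_of_squares[of "\<lambda>l. P $ i $ l * v $ l" "UNIV :: 'n set"] by (simp add: matrix_vector_mult_def mult.commute)
    then have "e i * ((P *v v) $ i)\<^sup>2 \<le> e i * (?g * (\<Sum>l\<in>UNIV. (P $ i $ l * v $ l)\<^sup>2))"
      using e[of i] by simp
    also have "\<dots> = ?g * (\<Sum>l\<in>UNIV. e i * (P $ i $ l * v $ l)\<^sup>2)" by (simp add: sum_distrib_left mult_ac)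
    also have "\<dots> \<le> ?g * (\<Sum>l\<in>UNIV. B * (e l * (v $ l)\<^sup>2))"
    proof (intro mult_left_mono sum_mono)
      fix l :: 'n
      show "e i * (P $ i $ l * v $ l)\<^sup>2 \<le> B * (e l * (v $ l)\<^sup>2)"
      proof (cases "rk i < rk l")
        case True then show ?thesis using P(1) B(1) e[of l] by (simp add: unit_lower_def)
      next
        case False
        have "\<bar>P $ i $ l\<bar>\<^sup>2 \<le> 1\<^sup>2" using P(2)[of i l] by (intro power_mono) auto
        then have "(P $ i $ l * v $ l)\<^sup>2 \<le> (v $ l)\<^sup>2" by (simp add: power_mult_distrib mult_left_le_one_le)
        then have "e i * (P $ i $ l * v $ l)\<^sup>2 \<le> (B * e l) * (v $ l)\<^sup>2"
          using B(2)[of l i] False e[of i] by (intro mult_mono) auto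
        then show ?thesis by (simp add: mult_ac)
      qed
    qed simp
    finally show "e i * ((P *v v) $ i)\<^sup>2 \<le> ?g * B * (\<Sum>l\<in>UNIV. e l * (v $ l)\<^sup>2)"
      by (simp add: sum_distrib_left[symmetric] mult_ac)
  qed
  also have "\<dots> = ?g\<^sup>2 * B * (\<Sum>l\<in>UNIV. e l * (v $ l)\<^sup>2)" by (simp add: power2_eq_square)
  also have "\<dots> \<le> ?K * (\<Sum>l\<in>UNIV. e l * (v $ l)\<^sup>2)" using n B0 by (intro mult_right_mono) auto
  finally show "qf ?A v \<le> ?K * (\<Sum>i\<in>UNIV. e i * (v $ i)\<^sup>2)" .
  define S where "S = qf ?A v"
  define t where "t i = sqrt (e i) * \<bar>v $ i\<bar>" for i
  have bound: "t i \<le> sqrt S * (1 + ?g * B) ^ rk i" for i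
  proof (induction "rk i" arbitrary: i rule: less_induct)
    case less
    define u where "u = (P *v v) $ i"
    have "e i * u\<^sup>2 \<le> S" unfolding S_def qf_ldl u_def
      by (rule member_le_sum) (auto simp: e less_imp_le)
    then have u: "sqrt (e i) * \<bar>u\<bar> \<le> sqrt S"
      using real_sqrt_le_mono[of "e i * u\<^sup>2" S] by (simp add: real_sqrt_mult)
    have "v $ i = u - (\<Sum>l | rk l < rk i. P $ i $ l * v $ l)"
      unfolding u_def unit_lower_mult_vec[OF P(1)] by simp
    then have "\<bar>v $ i\<bar> \<le> \<bar>u\<bar> + (\<Sum>l | rk l < rk i. \<bar>P $ i $ l * v $ l\<bar>)"
      using abs_triangle_ineq4[of u "\<Sum>l | rk l < rk i. P $ i $ l * v $ l"] sum_abs[of "\<lambda>l. P $ i $ l * v $ l" "{l. rk l < rk i}"] by linarith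
    also have "(\<Sum>l | rk l < rk i. \<bar>P $ i $ l * v $ l\<bar>) \<le> (\<Sum>l | rk l < rk i. \<bar>v $ l\<bar>)"
      using P(2) by (intro sum_mono) (simp add: abs_mult mult_left_le_one_le)
    finally have "t i \<le> sqrt (e i) * (\<bar>u\<bar> + (\<Sum>l | rk l < rk i. \<bar>v $ l\<bar>))"
      unfolding t_def using e[of i] by (intro mult_left_mono) auto
    also have "\<dots> = sqrt (e i) * \<bar>u\<bar> + (\<Sum>l | rk l < rk i. sqrt (e i) * \<bar>v $ l\<bar>)"
      by (simp add: distrib_left sum_distrib_left)
    also have "\<dots> \<le> sqrt S + (\<Sum>l | rk (l :: 'n) < rk i. B * (sqrt S * (1 + ?g * B) ^ (rk i - 1)))"
    proof (intro add_mono u sum_mono)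
      fix l :: 'n assume l: "l \<in> {l. rk l < rk i}"
      have "sqrt (e i) \<le> sqrt (B * e l)" using B(2)[of l i] l by simp
      also have "\<dots> \<le> B * sqrt (e l)"
      proof -
        have "sqrt B \<le> B" using B(1) by (simp add: sqrt_le_D real_le_lsqrt power2_eq_square)
        then show ?thesis using e[of l] by (simp add: real_sqrt_mult mult_right_mono)
      qed
      finally have "sqrt (e i) * \<bar>v $ l\<bar> \<le> B * t l" unfolding t_def mult.assoc[symmetric] by (intro mult_right_mono) auto
      also have "t l \<le> sqrt S * (1 + ?g * B) ^ rk l" using less[of l] l by simp
      also have "\<dots> \<le> sqrt S * (1 + ?g * B) ^ (rk i - 1)"
        using l B0 A unfolding S_def by (intro mult_left_mono power_increasing) auto
      finally show "sqrt (e i) * \<bar>v $ l\<bar> \<le> B * (sqrt S * (1 + ?g * B) ^ (rk i - 1))" using B0 by (simp add: mult_left_mono)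
    qed
    also have "\<dots> \<le> sqrt S * (1 + ?g * B) ^ rk i"
    proof (cases "rk i")
      case 0 then show ?thesis by simp
    next
      case (Suc r)
      have "real (card {l :: 'n. rk l < rk i}) \<le> ?g" by (simp add: card_mono)
      then have "real (card {l :: 'n. rk l < rk i}) * (B * (sqrt S * (1 + ?g * B) ^ r)) \<le> ?g * (B * (sqrt S * (1 + ?g * B) ^ r))"
        using B0 A unfolding S_def by (intro mult_right_mono) auto
      moreover have "sqrt S \<le> sqrt S * (1 + ?g * B) ^ r"
        using A B0 one_le_power[of "1 + ?g * B" r] unfolding S_def by (simp add: mult_le_cancel_left1)
      ultimately have "sqrt S + real (card {l :: 'n. rk l < rk i}) * (B * (sqrt S * (1 + ?g * B) ^ r)) \<le> sqrt S * (1 + ?g * B) ^ Suc r"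
        by (simp add: algebra_simps)
      then show ?thesis using Suc by simp
    qed
    finally show ?case .
  qed
  have "(\<Sum>i\<in>UNIV. e i * (v $ i)\<^sup>2) \<le> (\<Sum>i\<in>(UNIV::'n set). S * (1 + ?g * B) ^ (2 * CARD('n)))"
  proof (rule sum_mono)
    fix i :: 'n
    have "e i * (v $ i)\<^sup>2 = (t i)\<^sup>2" using e[of i] by (simp add: t_def power_mult_distrib)
    also have "\<dots> \<le> (sqrt S * (1 + ?g * B) ^ rk i)\<^sup>2"
      using bound[of i] e[of i] by (intro power_mono) (auto simp: t_def)
    also have "\<dots> = S * (1 + ?g * B) ^ (2 * rk i)" using A by (simp add: S_def power_mult_distrib power_mult[symmetric] mult.commute)
    also have "\<dots> \<le> S * (1 + ?g * B) ^ (2 * CARD('n))"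
      using A B0 rk_less_card[of i] unfolding S_def by (intro mult_left_mono power_increasing) auto
    finally show "e i * (v $ i)\<^sup>2 \<le> S * (1 + ?g * B) ^ (2 * CARD('n))" .
  qed
  also have "\<dots> = ?g * (1 + ?g * B) ^ (2 * CARD('n)) * S" by simp
  also have "\<dots> \<le> ?K * S" using A B0 unfolding S_def by (intro mult_right_mono) auto
  finally show "(\<Sum>i\<in>UNIV. e i * (v $ i)\<^sup>2) \<le> ?K * qf ?A v" unfolding S_def .
qed

text \<open>
  The two halves of comparability exchange their roles under duality.
\<close>

lemma comparable_inverse:
  fixes A :: "real^'n::finite^'n"
  assumes A: "pos_def A" and d: "\<And>i. d i > 0" and c: "comparable K d A" and K: "K > 0"
  shows "comparable K (\<lambda>i. 1 / d i) (matrix_inv A)"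
  unfolding comparable_def
proof (intro allI conjI)
  fix w :: "real^'n"
  define x where "x = matrix_inv A *v w"
  define W where "W = (\<Sum>i\<in>UNIV. 1 / d i * (w $ i)\<^sup>2)"
  have Ax: "A *v x = w" unfolding x_def by (rule mult_matrix_inv_vec[OF pos_def_invertible[OF A]])
  have q: "qf (matrix_inv A) w = qf A x" using qf_inv[OF A, of x] unfolding Ax .
  have cx: "(\<Sum>i\<in>UNIV. d i * (x $ i)\<^sup>2) \<le> K * qf A x" using c by (simp add: comparable_def)
  have "qf A x = (\<Sum>i\<in>UNIV. x $ i * w $ i)" unfolding Ax by (simp add: inner_vec_def)
  also have "\<dots> \<le> (\<Sum>i\<in>UNIV. K / 2 * (1 / d i * (w $ i)\<^sup>2) + 1 / (2 * K) * (d i * (x $ i)\<^sup>2))"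
  proof (rule sum_mono)
    fix i
    have "0 \<le> (K * w $ i - d i * x $ i)\<^sup>2 / (2 * K * d i)" using K d[of i] by simp
    also have "\<dots> = K / 2 * (1 / d i * (w $ i)\<^sup>2) + 1 / (2 * K) * (d i * (x $ i)\<^sup>2) - x $ i * w $ i"
      using K d[of i] by (simp add: field_simps power2_eq_square)
    finally show "x $ i * w $ i \<le> K / 2 * (1 / d i * (w $ i)\<^sup>2) + 1 / (2 * K) * (d i * (x $ i)\<^sup>2)" by simp
  qed
  also have "\<dots> = K / 2 * W + 1 / (2 * K) * (\<Sum>i\<in>UNIV. d i * (x $ i)\<^sup>2)"
    by (simp only: sum.distrib sum_distrib_left[symmetric] W_def)
  also have "\<dots> \<le> K / 2 * W + 1 / (2 * K) * (K * qf A x)" using cx K by (intro add_left_mono mult_left_mono) auto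
  finally have "qf A x \<le> K / 2 * W + qf A x / 2" using K by simp
  then show "qf (matrix_inv A) w \<le> K * (\<Sum>i\<in>UNIV. 1 / d i * (w $ i)\<^sup>2)" unfolding q W_def by simp
  define y :: "real^'n" where "y = (\<chi> i. w $ i / d i)"
  have wy: "w \<bullet> y = W" by (simp add: inner_vec_def y_def W_def power2_eq_square)
  have dy: "(\<Sum>i\<in>UNIV. d i * (y $ i)\<^sup>2) = W"
    unfolding W_def using d by (intro sum.cong) (auto simp: y_def power2_eq_square field_simps less_imp_neq[symmetric])
  have cy: "qf A y \<le> K * W" using c unfolding comparable_def dy[symmetric] by blast
  have "0 \<le> qf A (x - (1 / K) *\<^sub>R y)" by (rule pos_def_nonneg[OF A])
  also have "\<dots> = qf A x - 2 * (1 / K) * (y \<bullet> (A *v x)) + (1 / K)\<^sup>2 * qf A y"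
  proof -
    have "x \<bullet> (A *v y) = y \<bullet> (A *v x)"
      using inner_matrix_transpose[of A x y] unfolding pos_def_sym[OF A] by (simp add: inner_commute)
    then show ?thesis
      by (simp add: matrix_vector_mult_diff_distrib matrix_vector_mult_scaleR inner_diff_left inner_diff_right power2_eq_square algebra_simps)
  qed
  also have "\<dots> \<le> qf A x - 2 * (1 / K) * W + (1 / K)\<^sup>2 * (K * W)"
    unfolding Ax using cy wy by (intro add_mono mult_left_mono) (auto simp: inner_commute)
  also have "\<dots> = qf A x - W / K" using K by (simp add: power2_eq_square field_simps)
  finally show "(\<Sum>i\<in>UNIV. 1 / d i * (w $ i)\<^sup>2) \<le> K * qf (matrix_inv A) w"
    unfolding q W_def[symmetric] using K by (simp add: field_simps)
qed

lemma comparable_entry: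
  fixes A :: "real^'n::finite^'n"
  assumes A: "pos_def A" and d: "\<And>i. d i > 0" and c: "comparable K d A"
  shows "\<bar>A $ i $ j\<bar> \<le> K * sqrt (d i) * sqrt (d j)"
proof -
  define x where "x = (1 / sqrt (d i)) *\<^sub>R (axis i 1 :: real^'n)"
  define y where "y = (1 / sqrt (d j)) *\<^sub>R (axis j 1 :: real^'n)"
  have "x \<bullet> (A *v y) = A $ i $ j / (sqrt (d i) * sqrt (d j))"
    by (simp add: x_def y_def matrix_vector_mult_scaleR matrix_vector_mult_basis inner_axis' column_def)
  moreover have "y \<bullet> (A *v x) = x \<bullet> (A *v y)"
    using inner_matrix_transpose[of A y x] unfolding pos_def_sym[OF A] by (simp add: inner_commute)
  moreover have D: "(\<Sum>l\<in>UNIV. d l * ((s *\<^sub>R x + y) $ l)\<^sup>2) \<le> 4" if "s\<^sup>2 = 1" for s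
  proof -
    have sx: "(\<Sum>l\<in>UNIV. d l * (x $ l)\<^sup>2) = 1" and sy: "(\<Sum>l\<in>UNIV. d l * (y $ l)\<^sup>2) = 1"
    proof -
      have "(\<Sum>l\<in>UNIV. d l * (x $ l)\<^sup>2) = (\<Sum>l\<in>UNIV. if l = i then 1 else 0)"
        using d by (intro sum.cong) (auto simp: x_def axis_def power_divide less_imp_le less_imp_neq[symmetric])
      then show "(\<Sum>l\<in>UNIV. d l * (x $ l)\<^sup>2) = 1" by simp
      have "(\<Sum>l\<in>UNIV. d l * (y $ l)\<^sup>2) = (\<Sum>l\<in>UNIV. if l = j then 1 else 0)"
        using d by (intro sum.cong) (auto simp: y_def axis_def power_divide less_imp_le less_imp_neq[symmetric])
      then show "(\<Sum>l\<in>UNIV. d l * (y $ l)\<^sup>2) = 1" by simp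
    qed
    have "(\<Sum>l\<in>UNIV. d l * ((s *\<^sub>R x + y) $ l)\<^sup>2) \<le> (\<Sum>l\<in>UNIV. 2 * (d l * (x $ l)\<^sup>2) + 2 * (d l * (y $ l)\<^sup>2))"
    proof (rule sum_mono)
      fix l
      have "(s * x $ l + y $ l)\<^sup>2 \<le> 2 * (s * x $ l)\<^sup>2 + 2 * (y $ l)\<^sup>2"
        using sum_squares_bound[of "s * x $ l" "y $ l"] by (simp add: power2_sum)
      also have "(s * x $ l)\<^sup>2 = (x $ l)\<^sup>2" using that by (simp add: power_mult_distrib)
      finally have "d l * (s * x $ l + y $ l)\<^sup>2 \<le> d l * (2 * (x $ l)\<^sup>2 + 2 * (y $ l)\<^sup>2)" using d[of l] by simp
      then show "d l * ((s *\<^sub>R x + y) $ l)\<^sup>2 \<le> 2 * (d l * (x $ l)\<^sup>2) + 2 * (d l * (y $ l)\<^sup>2)" by (simp add: algebra_simps)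
    qed
    also have "\<dots> = 4" unfolding sum.distrib sum_distrib_left[symmetric] sx sy by simp
    finally show ?thesis .
  qed
  have K0: "K \<ge> 0"
  proof -
    have "0 < (\<Sum>l\<in>UNIV. d l * (axis i 1 $ l)\<^sup>2)" using d[of i]
      by (intro sum_pos2[of _ i]) (auto simp: axis_def less_imp_le[OF d])
    also have "\<dots> \<le> K * qf A (axis i 1)" using c by (simp add: comparable_def)
    finally show ?thesis using pos_def_nonneg[OF A, of "axis i 1"] by (metis less_le_not_le linear mult_nonpos_nonneg)
  qed
  have U: "qf A (s *\<^sub>R x + y) \<le> K * 4" if "s\<^sup>2 = 1" for s
    using c D[OF that] K0 unfolding comparable_def by (meson mult_left_mono order_trans)
  have ex: "qf A (s *\<^sub>R x + y) = s\<^sup>2 * qf A x + qf A y + 2 * s * (x \<bullet> (A *v y))" for s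
    using \<open>y \<bullet> (A *v x) = x \<bullet> (A *v y)\<close>
    by (simp add: matrix_vector_right_distrib matrix_vector_mult_scaleR inner_add_left inner_add_right power2_eq_square algebra_simps)
  have "4 * (x \<bullet> (A *v y)) = qf A (1 *\<^sub>R x + y) - qf A ((-1) *\<^sub>R x + y)" unfolding ex by simp
  then have "\<bar>x \<bullet> (A *v y)\<bar> \<le> K"
    using U[of 1] U[of "-1"] pos_def_nonneg[OF A, of "1 *\<^sub>R x + y"] pos_def_nonneg[OF A, of "(-1) *\<^sub>R x + y"] by simp
  then show ?thesis using d[of i] d[of j] \<open>x \<bullet> (A *v y) = _\<close> by (simp add: field_simps abs_mult)
qed

lemma pos_def_diag: "(\<And>i. d i > 0) \<Longrightarrow> pos_def (diag d)"
proof -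
  assume d: "\<And>i. d i > 0"
  have "unit_lower (mat 1 :: real^'a^'a)" by (simp add: unit_lower_def mat_def)
  from pos_def_ldlI[OF this d] show ?thesis by simp
qed

lemma comparable_det:
  fixes A :: "real^'n::finite^'n"
  assumes A: "pos_def A" and d: "\<And>i. d i > 0" and c: "comparable K d A" and K: "K > 0"
  shows "det A \<le> K ^ CARD('n) * (\<Prod>i\<in>UNIV. d i)" "(\<Prod>i\<in>UNIV. d i) \<le> K ^ CARD('n) * det A"
proof -
  have "(1 / K) ^ CARD('n) * det A \<le> det (diag d)"
  proof (rule det_mono[OF A pos_def_sym[OF pos_def_diag[OF d]]])
    show "1 / K * qf A v \<le> qf (diag d) v" for v
      using c K unfolding comparable_def qf_diag by (simp add: field_simps)
  qed (use K in simp)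
  then show "det A \<le> K ^ CARD('n) * (\<Prod>i\<in>UNIV. d i)" using K by (simp add: det_diag power_divide field_simps)
  have "(1 / K) ^ CARD('n) * det (diag d) \<le> det A"
  proof (rule det_mono[OF pos_def_diag[OF d] pos_def_sym[OF A]])
    show "1 / K * qf (diag d) v \<le> qf A v" for v
      using c K unfolding comparable_def qf_diag by (simp add: field_simps)
  qed (use K in simp)
  then show "(\<Prod>i\<in>UNIV. d i) \<le> K ^ CARD('n) * det A" using K by (simp add: det_diag power_divide field_simps)
qed

section \<open>Holomorphy along complex lines and a maximum principle\<close>

lemma jacobi_scale_add: "jacobi_scale (a + b) v = jacobi_scale a v + jacobi_scale b v"
  by (cases v) (simp add: jacobi_scale_def vec_eq_iff algebra_simps)

lemma jacobi_scale_scaleR: "jacobi_scale (r *\<^sub>R a) v = r *\<^sub>R jacobi_scale a v"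
  by (cases v) (simp add: jacobi_scale_def vec_eq_iff)

lemma bounded_linear_jacobi_scale: "bounded_linear (\<lambda>c. jacobi_scale c v)"
  unfolding linear_conv_bounded_linear[symmetric]
  by (rule linearI) (simp_all add: jacobi_scale_add jacobi_scale_scaleR)

text \<open>
  The derivative of a holomorphic function is complex linear, so its restriction to a complex line
  is a holomorphic function of one variable.
\<close>

lemma line_holomorphic:
  assumes hol: "jacobi_holomorphic \<phi>" and U: "\<And>c. c \<in> U \<Longrightarrow> p + jacobi_scale c v \<in> siegel_jacobi"
  shows "(\<lambda>c. \<phi> (p + jacobi_scale c v)) holomorphic_on U"
  unfolding holomorphic_on_def field_differentiable_def
proof
  fix c assume c: "c \<in> U"
  obtain \<phi>' where d: "(\<phi> has_derivative \<phi>') (at (p + jacobi_scale c v) within siegel_jacobi)"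
    and l: "\<And>c v. \<phi>' (jacobi_scale c v) = c * \<phi>' v"
    using hol U[OF c] unfolding jacobi_holomorphic_def by blast
  have a: "((\<lambda>c. p + jacobi_scale c v) has_derivative (\<lambda>h. jacobi_scale h v)) (at c within U)"
    by (rule has_derivative_eq_rhs[OF has_derivative_add[OF has_derivative_const
          bounded_linear_imp_has_derivative[OF bounded_linear_jacobi_scale]]]) simp
  have "((\<lambda>c. \<phi> (p + jacobi_scale c v)) has_derivative (\<lambda>h. \<phi>' (jacobi_scale h v))) (at c within U)"
  proof (rule has_derivative_in_compose[OF a])
    show "(\<phi> has_derivative \<phi>') (at (p + jacobi_scale c v) within (\<lambda>c. p + jacobi_scale c v) ` U)"
      by (rule has_derivative_subset[OF d]) (use U in blast)
  qed
  then have "((\<lambda>c. \<phi> (p + jacobi_scale c v)) has_field_derivative \<phi>' v) (at c within U)"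
    unfolding has_field_derivative_def by (rule has_derivative_eq_rhs) (simp add: fun_eq_iff l)
  then show "\<exists>f'. ((\<lambda>c. \<phi> (p + jacobi_scale c v)) has_field_derivative f') (at c within U)" by blast
qed

text \<open>
  The Phragmen-Lindelof argument: divide by \<open>1 - \<i> e s\<close>, which is large far away and has modulus at
  least 1 on the half-plane, apply the maximum principle to a large box, and let \<open>e\<close> tend to 0.
\<close>

lemma half_plane_maximum:
  assumes hol: "h holomorphic_on {s. Im s \<ge> 0}" and B: "\<And>s. Im s \<ge> 0 \<Longrightarrow> norm (h s) \<le> B"
    and b: "\<And>x :: real. norm (h (of_real x)) \<le> b"
  shows "norm (h \<i>) \<le> b"
proof -
  have b0: "b \<ge> 0" using b[of 0] norm_ge_zero order_trans by blast
  have B0: "B \<ge> 0" using order_trans[OF norm_ge_zero B[of 0]] by simp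
  have main: "norm (h \<i>) \<le> (b + e) * (1 + e)" if e: "e > 0" for e
  proof -
    define G where "G s = h s / (1 - \<i> * of_real e * s)" for s
    have den: "norm (1 - \<i> * of_real e * s) \<ge> 1 + e * Im s" "norm (1 - \<i> * of_real e * s) \<ge> e * \<bar>Re s\<bar>" for s
    proof -
      have "Re (1 - \<i> * of_real e * s) = 1 + e * Im s" "Im (1 - \<i> * of_real e * s) = - (e * Re s)" by simp_all
      then show "norm (1 - \<i> * of_real e * s) \<ge> 1 + e * Im s" "norm (1 - \<i> * of_real e * s) \<ge> e * \<bar>Re s\<bar>"
        using complex_Re_le_cmod[of "1 - \<i> * of_real e * s"] abs_Im_le_cmod[of "1 - \<i> * of_real e * s"] e
        by (auto simp: abs_mult)
    qed
    \<comment> \<open>the box must be so large that \<open>B / (e R) \<le> e\<close> on its distant sides\<close>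
  define R where "R = B / (e * e) + 2"
    have R: "R \<ge> 2" unfolding R_def using B0 by simp
    have eR: "B \<le> e * (e * R)" unfolding R_def using e by (simp add: field_simps)
    define Q where "Q = box (Complex (- R) 0) (Complex R R)"
    have cl: "closure Q \<subseteq> cbox (Complex (- R) 0) (Complex R R)" unfolding Q_def by (intro closure_minimal box_subset_cbox closed_cbox)
    have up: "Im s \<ge> 0" if "s \<in> closure Q" for s using that cl by (auto simp: in_cbox_complex_iff)
    have holG: "G holomorphic_on {s. Im s \<ge> 0}" unfolding G_def
    proof (intro holomorphic_intros hol)
      fix s assume "s \<in> {s. Im s \<ge> 0}"
      then have "1 + e * Im s > 0" using e by (simp add: add_pos_nonneg)
      then show "1 - \<i> * of_real e * s \<noteq> 0" using den(1)[of s] by auto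
    qed
    have "norm (G \<i>) \<le> b + e"
    proof (rule maximum_modulus_frontier[of G Q])
      show "G holomorphic_on interior Q"
        by (rule holomorphic_on_subset[OF holG]) (use up closure_subset interior_subset in blast)
      show "continuous_on (closure Q) G"
        by (rule holomorphic_on_imp_continuous_on[OF holomorphic_on_subset[OF holG]]) (use up in blast)
      show "bounded Q" by (simp add: Q_def bounded_box)
      show "\<i> \<in> Q" using R by (simp add: Q_def in_box_complex_iff)
      fix s assume s: "s \<in> frontier Q"
      then have c: "s \<in> closure Q" and n: "s \<notin> Q" by (simp_all add: frontier_def Q_def interior_open open_box)
      have im: "Im s \<ge> 0" using up c by blast
      show "norm (G s) \<le> b + e"
      proof (cases "Im s = 0")
        case True
        then have "s = of_real (Re s)" by (simp add: complex_eq_iff)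
        then have "norm (h s) \<le> b" using b[of "Re s"] by simp
        moreover have "norm (1 - \<i> * of_real e * s) \<ge> 1" using den(1)[of s] True by simp
        ultimately have "norm (G s) \<le> b / 1" unfolding G_def norm_divide using b0 by (intro frac_le) auto
        then show ?thesis using e by simp
      next
        case False
        have "\<bar>Re s\<bar> \<ge> R \<or> Im s \<ge> R"
          using n im False by (auto simp: Q_def in_box_complex_iff not_less)
        then have d: "norm (1 - \<i> * of_real e * s) \<ge> e * R"
        proof
          assume "\<bar>Re s\<bar> \<ge> R"
          then have "e * R \<le> e * \<bar>Re s\<bar>" using e by simp
          then show ?thesis using den(2)[of s] by simp
        next
          assume "Im s \<ge> R"
          then have "e * R \<le> e * Im s" using e by simp
          then show ?thesis using den(1)[of s] by simp
        qed
        have "norm (G s) \<le> B / (e * R)" unfolding G_def norm_divide using B[OF im] d e R B0 by (intro frac_le) auto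
        also have "\<dots> \<le> e" using eR e R by (simp add: divide_le_eq)
        finally show ?thesis using b0 by simp
      qed
    qed
    moreover have "norm (h \<i>) = norm (G \<i>) * (1 + e)"
    proof -
      have "1 - \<i> * of_real e * \<i> = of_real (1 + e)" by (simp add: complex_eq_iff)
      then have "norm (1 - \<i> * of_real e * \<i>) = 1 + e" using e by (simp only: norm_of_real)
      then show ?thesis using e by (simp add: G_def norm_divide)
    qed
    ultimately show ?thesis using e by (simp add: mult_right_mono)
  qed
  have "((\<lambda>e. (b + e) * (1 + e)) \<longlongrightarrow> (b + 0) * (1 + 0)) (at_right 0)" by (intro tendsto_intros)
  then have "((\<lambda>e. (b + e) * (1 + e)) \<longlongrightarrow> b) (at_right 0)" by simp
  moreover have "\<forall>\<^sub>F e in at_right 0. norm (h \<i>) \<le> (b + e) * (1 + e)"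
    using main by (auto simp: eventually_at_right_less eventually_at_filter intro: eventually_mono)
  ultimately show ?thesis by (intro tendsto_lowerbound) auto
qed

section \<open>Decay towards the cusps\<close>

lemma trace_congruence_diag:
  fixes T Q :: "real^'n::finite^'n"
  shows "trace (T ** (Q ** diag \<delta> ** transpose Q)) = (\<Sum>j\<in>UNIV. \<delta> j * qf T (column j Q))"
proof -
  have D: "(Q ** diag \<delta> ** transpose Q) $ k $ i = (\<Sum>j\<in>UNIV. \<delta> j * Q $ k $ j * Q $ i $ j)" for k i
    using ldl_entry[of "transpose Q" \<delta> k i] by (simp add: transpose_def)
  have "trace (T ** (Q ** diag \<delta> ** transpose Q)) = (\<Sum>i\<in>UNIV. \<Sum>k\<in>UNIV. T $ i $ k * (\<Sum>j\<in>UNIV. \<delta> j * Q $ k $ j * Q $ i $ j))"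
    unfolding trace_def matrix_matrix_mult_def[of T] vec_lambda_beta D ..
  also have "\<dots> = (\<Sum>i\<in>UNIV. \<Sum>k\<in>UNIV. \<Sum>j\<in>UNIV. \<delta> j * (T $ i $ k * Q $ i $ j * Q $ k $ j))"
    unfolding sum_distrib_left by (intro sum.cong refl) (simp add: mult_ac)
  also have "\<dots> = (\<Sum>j\<in>UNIV. \<Sum>i\<in>UNIV. \<Sum>k\<in>UNIV. \<delta> j * (T $ i $ k * Q $ i $ j * Q $ k $ j))"
  proof -
    have "(\<Sum>i\<in>UNIV. \<Sum>k\<in>UNIV. \<Sum>j\<in>UNIV. f i k j) = (\<Sum>j\<in>UNIV. \<Sum>i\<in>UNIV. \<Sum>k\<in>UNIV. f i k j)" for f :: "'n \<Rightarrow> 'n \<Rightarrow> 'n \<Rightarrow> real"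
    proof -
      have "(\<Sum>i\<in>UNIV. \<Sum>k\<in>UNIV. \<Sum>j\<in>UNIV. f i k j) = (\<Sum>i\<in>UNIV. \<Sum>j\<in>UNIV. \<Sum>k\<in>UNIV. f i k j)"
        by (intro sum.cong refl sum.swap)
      then show ?thesis using sum.swap[of "\<lambda>i j. \<Sum>k\<in>UNIV. f i k j" UNIV UNIV] by simp
    qed
    then show ?thesis .
  qed
  finally show ?thesis by (simp add: qf_sum column_def sum_distrib_left)
qed

lemma qf_gram:
  fixes Q :: "real^'n::finite^'n"
  shows "qf (Q ** diag d ** transpose Q) v = (\<Sum>i\<in>UNIV. d i * ((transpose Q *v v) $ i)\<^sup>2)"
  using qf_ldl[where P = "transpose Q" and e = d and v = v] by (simp only: transpose_transpose)

text \<open>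
  Put \<open>T = 4 m N - r r\<^sup>t\<close>, which is positive definite with integral diagonal entries. Completing the square
  bounds the frequency below by the trace of \<open>T \<Delta> / (4 m)\<close>, and this trace is at least
  \<open>\<delta> L\<close> times the diagonal entry of \<open>T\<close> at \<open>L\<close>, which is at least 1.
\<close>

lemma cusp_index_frequency:
  fixes N :: "real^'n::finite^'n" and r :: "int^'n"
  assumes Nr: "(N, r) \<in> cusp_indices m" and m: "m \<ge> 1"
    and \<delta>: "\<And>j. \<delta> j \<ge> 0" and L: "column L Q = axis L 1"
  defines "\<Delta> \<equiv> Q ** diag \<delta> ** transpose Q"
  shows "\<delta> L / (4 * real m) \<le> trace (N ** \<Delta>) + map_vector of_int r \<bullet> (\<Delta> *v a) + real m * qf \<Delta> a"
proof -
  let ?r = "map_vector of_int r :: real^'n"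
  define T where "T = (\<chi> i j. 4 * real m * N $ i $ j - of_int (r $ i) * of_int (r $ j))"
  have N: "half_integral N" and T: "pos_def T" using Nr by (auto simp: cusp_indices_def T_def)
  have TLL: "T $ L $ L \<ge> 1"
  proof -
    have "0 < qf T (axis L 1)" by (rule pos_defD[OF T]) (simp add: axis_eq_0_iff)
    then have pos: "0 < T $ L $ L" by (simp add: inner_axis' matrix_vector_mult_basis column_def)
    have "N $ L $ L \<in> \<int>" using N by (simp add: half_integral_def)
    then have "T $ L $ L \<in> \<int>" by (simp add: T_def Ints_mult Ints_diff)
    then obtain n :: int where "T $ L $ L = of_int n" by (auto elim: Ints_cases)
    then show ?thesis using pos by simp
  qed
  have "\<delta> L * 1 \<le> \<delta> L * qf T (column L Q)"
    unfolding L using TLL \<delta>[of L] by (intro mult_left_mono) (simp_all add: inner_axis' matrix_vector_mult_basis column_def)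
  also have "\<dots> \<le> (\<Sum>j\<in>UNIV. \<delta> j * qf T (column j Q))"
    by (rule member_le_sum) (use \<delta> pos_def_nonneg[OF T] in auto)
  also have "\<dots> = trace (T ** \<Delta>)" unfolding \<Delta>_def by (rule trace_congruence_diag[symmetric])
  also have "\<dots> = 4 * real m * trace (N ** \<Delta>) - qf \<Delta> ?r"
  proof -
    have "trace (T ** \<Delta>) = (\<Sum>i\<in>UNIV. \<Sum>k\<in>UNIV. 4 * real m * (N $ i $ k * \<Delta> $ k $ i) - \<Delta> $ k $ i * ?r $ k * ?r $ i)"
      unfolding trace_def matrix_matrix_mult_def vec_lambda_beta
      by (intro sum.cong refl) (simp add: T_def algebra_simps)
    also have "\<dots> = 4 * real m * trace (N ** \<Delta>) - (\<Sum>i\<in>UNIV. \<Sum>k\<in>UNIV. \<Delta> $ k $ i * ?r $ k * ?r $ i)"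
      by (simp add: trace_def matrix_matrix_mult_def sum_subtractf sum_distrib_left)
    also have "(\<Sum>i\<in>UNIV. \<Sum>k\<in>UNIV. \<Delta> $ k $ i * ?r $ k * ?r $ i) = qf \<Delta> ?r"
      unfolding qf_sum by (rule sum.swap)
    finally show ?thesis .
  qed
  finally have 1: "\<delta> L \<le> 4 * real m * trace (N ** \<Delta>) - qf \<Delta> ?r" by simp
  have sym: "transpose \<Delta> = \<Delta>"
  proof -
    have "transpose (diag \<delta>) = diag \<delta>" by (simp add: vec_eq_iff transpose_def diag_def)
    then show ?thesis by (simp add: \<Delta>_def matrix_transpose_mul matrix_mul_assoc)
  qed
  have "0 \<le> qf \<Delta> (?r + (2 * real m) *\<^sub>R a)" unfolding \<Delta>_def qf_gram using \<delta> by (intro sum_nonneg) simp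
  also have "\<dots> = qf \<Delta> ?r + 4 * real m * (?r \<bullet> (\<Delta> *v a)) + 4 * (real m)\<^sup>2 * qf \<Delta> a"
  proof -
    have "a \<bullet> (\<Delta> *v ?r) = ?r \<bullet> (\<Delta> *v a)"
      using inner_matrix_transpose[of \<Delta> a ?r] unfolding sym by (simp only: inner_commute)
    then show ?thesis
      by (simp add: matrix_vector_right_distrib matrix_vector_mult_scaleR inner_add_left inner_add_right power2_eq_square algebra_simps)
  qed
  finally have "\<delta> L \<le> 4 * real m * (trace (N ** \<Delta>) + ?r \<bullet> (\<Delta> *v a) + real m * qf \<Delta> a)"
    using 1 by (simp add: algebra_simps power2_eq_square)
  then show ?thesis using m by (simp add: field_simps)
qed

lemma trace_im:
  fixes N :: "real^'n::finite^'n" and \<tau> :: "complex^'n^'n"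
  shows "Im (trace (cr N ** \<tau>)) = trace (N ** im_mat \<tau>)"
  by (simp add: trace_def matrix_matrix_mult_def)

lemma pos_def_gram:
  fixes Q :: "real^'n::finite^'n"
  assumes "invertible Q" "\<And>i. d i > 0" shows "pos_def (Q ** diag d ** transpose Q)"
  using pos_def_congruence[OF pos_def_diag[OF assms(2)] transpose_invertible[OF assms(1)]] by (simp only: transpose_transpose)

text \<open>
  The points \<open>pt s\<close> for \<open>s\<close> in the upper half-plane start at points with imaginary part
  \<open>Q diag(d') Q\<^sup>t\<close> for real \<open>s\<close> and reach \<open>(\<tau>, z)\<close> at \<open>s = \<i>\<close>. By the bound on the frequencies, every term of
  the Fourier expansion decays at least like \<open>exp (- 2 \<pi> (\<omega> - m \<Delta>(a)) Im s)\<close> along this line, with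
  \<open>\<omega> = (d L - d' L) / (4 m)\<close>. So the form divided by that exponential is bounded and is controlled by its
  values on the real line. The factor \<open>exp (- 4 \<pi> \<omega>)\<close> gained in the square beats the growth of the
  determinant by the assumption on \<open>u\<close>.
\<close>

lemma decay_along_line:
  fixes \<phi> :: "'n::finite jacobi_point \<Rightarrow> complex"
  assumes \<phi>: "\<phi> \<in> jacobi_cusp_forms k m" and m: "m \<ge> 1"
    and p: "(\<tau>, z) \<in> siegel_jacobi" and Q: "invertible Q" "column L Q = axis L 1"
    and X: "im_mat \<tau> = Q ** diag d ** transpose Q" and d: "\<And>j. 0 < d' j" "\<And>j. d' j \<le> d j"
    and u: "\<And>j. d j \<le> u * d' j" "u ^ (CARD('n) * k) * exp (- pi * (d L - d' L) / real m) \<le> 1"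
    and B: "\<And>q. q \<in> siegel_jacobi \<Longrightarrow> im_mat (fst q) = Q ** diag d' ** transpose Q \<Longrightarrow> petersson_norm_sq k m \<phi> q \<le> B"
  shows "petersson_norm_sq k m \<phi> (\<tau>, z) \<le> B"
proof -
  have hol: "jacobi_holomorphic \<phi>" and exp: "has_cusp_expansion m \<phi>" using \<phi> by (auto simp: jacobi_cusp_forms_def)
  have \<tau>: "\<tau> \<in> siegel_space" using p by (simp add: siegel_jacobi_def)
  let ?X = "im_mat \<tau>" and ?y = "im_vec z"
  define X' where "X' = Q ** diag d' ** transpose Q"
  define \<delta> where "\<delta> j = d j - d' j" for j
  define \<Delta> where "\<Delta> = Q ** diag \<delta> ** transpose Q"
  define a where "a = matrix_inv ?X *v ?y"
  define v where "v = (cr \<Delta>, cv (\<Delta> *v a))"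
  \<comment> \<open>the increment of \<open>z\<close> is \<open>\<Delta> a\<close>, so that \<open>\<eta>\<^sup>-\<^sup>1 y = a\<close> stays constant along the line\<close>
  define p0 where "p0 = (\<tau>, z) - jacobi_scale \<i> v"
  define pt where "pt s = p0 + jacobi_scale s v" for s
  define \<omega> where "\<omega> = \<delta> L / (4 * real m)"
  define \<beta> where "\<beta> = real m * qf \<Delta> a - \<omega>"
  have pX: "pos_def ?X" using siegelD(2)[OF \<tau>] .
  have \<delta>0: "\<delta> j \<ge> 0" for j using d(2)[of j] by (simp add: \<delta>_def)
  have gram_add: "Q ** diag f ** transpose Q + Q ** diag g ** transpose Q = Q ** diag (\<lambda>j. f j + g j) ** transpose Q" for f g
  proof -
    have "diag (\<lambda>j. f j + g j) = diag f + diag g" by (simp add: vec_eq_iff diag_def)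
    then show ?thesis by (simp add: matrix_add_ldistrib matrix_add_rdistrib)
  qed
  have gram_scale: "c *\<^sub>R (Q ** diag f ** transpose Q) = Q ** diag (\<lambda>j. c * f j) ** transpose Q" for c f
  proof -
    have "diag (\<lambda>j. c * f j) = c *\<^sub>R diag f" by (simp add: vec_eq_iff diag_def)
    moreover have "Q ** (c *\<^sub>R R) = c *\<^sub>R (Q ** R)" "(c *\<^sub>R R) ** S = c *\<^sub>R (R ** S)" for R S :: "real^'n^'n"
      by (simp_all add: vec_eq_iff matrix_matrix_mult_def sum_distrib_left mult_ac)
    ultimately show ?thesis by simp
  qed
  have XX: "?X = X' + \<Delta>" unfolding X X'_def \<Delta>_def gram_add by (simp add: \<delta>_def)
  have pX': "pos_def X'" unfolding X'_def by (rule pos_def_gram[OF Q(1) d(1)])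
  have ya: "?y = ?X *v a" unfolding a_def by (rule mult_matrix_inv_vec[OF pos_def_invertible[OF pX], symmetric])
  have pti: "pt \<i> = (\<tau>, z)" by (simp add: pt_def p0_def)
  have sc: "fst (pt s) = \<tau> + map_matrix ((*) (s - \<i>)) (cr \<Delta>)" "snd (pt s) = z + (s - \<i>) *s cv (\<Delta> *v a)" for s
    by (simp_all add: pt_def p0_def v_def jacobi_scale_def vec_eq_iff algebra_simps)
  have imf: "im_mat (fst (pt s)) = X' + Im s *\<^sub>R \<Delta>" for s
    unfolding sc using arg_cong[OF XX, of "\<lambda>A. A $ _ $ _"] by (simp add: vec_eq_iff algebra_simps)
  have ims: "im_vec (snd (pt s)) = X' *v a + Im s *\<^sub>R (\<Delta> *v a)" for s
  proof -
    have "im_vec (snd (pt s)) = ?y + (Im s - 1) *\<^sub>R (\<Delta> *v a)" unfolding sc by (simp add: vec_eq_iff algebra_simps)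
    then show ?thesis unfolding ya XX by (simp add: matrix_vector_mult_add_rdistrib algebra_simps)
  qed
  have pt_in: "pt s \<in> siegel_jacobi" if s: "Im s \<ge> 0" for s
  proof -
    have "pos_def (X' + Im s *\<^sub>R \<Delta>)"
      unfolding X'_def \<Delta>_def gram_scale gram_add using d(1) \<delta>0 s by (intro pos_def_gram Q(1)) (simp add: add_pos_nonneg)
    moreover have "transpose (fst (pt s)) = fst (pt s)"
    proof -
      have "\<Delta> $ i $ j = \<Delta> $ j $ i" for i j
        unfolding \<Delta>_def using ldl_entry[of "transpose Q" \<delta>] by (simp add: mult_ac)
      then show ?thesis unfolding sc using transpose_sym_index[OF siegelD(1)[OF \<tau>]] by (simp add: vec_eq_iff transpose_def)
    qed
    ultimately have "fst (pt s) \<in> siegel_space" unfolding siegel_space_def by (simp add: imf)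
    then show ?thesis unfolding siegel_jacobi_def by (simp add: mem_Times_iff)
  qed
  obtain c where c: "\<And>\<tau> z. (\<tau>, z) \<in> siegel_jacobi \<Longrightarrow>
     ((\<lambda>(N, r). c N r * exp (2 * of_real pi * \<i> * trace (cr N ** \<tau>)) * exp (2 * of_real pi * \<i> * bidot (cvec r) z))
           has_sum \<phi> (\<tau>, z)) (cusp_indices m)"
    using exp unfolding has_cusp_expansion_def by blast
  define t where "t s = (\<lambda>(N, r). c N r * exp (2 * of_real pi * \<i> * trace (cr N ** fst (pt s))) * exp (2 * of_real pi * \<i> * bidot (cvec r) (snd (pt s))))" for s
  have sum: "(t s has_sum \<phi> (pt s)) (cusp_indices m)" if "Im s \<ge> 0" for s
    using c[of "fst (pt s)" "snd (pt s)"] pt_in[OF that] by (simp add: t_def)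
  have abs: "(\<lambda>\<nu>. norm (t s \<nu>)) summable_on cusp_indices m" if "Im s \<ge> 0" for s
    using sum[OF that] summable_on_iff_abs_summable_on_complex[of "t s" "cusp_indices m"] has_sum_imp_summable by blast
  have norm_t: "norm (t s (N, r)) = norm (c N r) * exp (- 2 * pi * (trace (N ** X') + map_vector of_int r \<bullet> (X' *v a)))
     * exp (- 2 * pi * Im s * (trace (N ** \<Delta>) + map_vector of_int r \<bullet> (\<Delta> *v a)))" for s N r
  proof -
    have cr: "cvec r = cv (map_vector of_int r)" by (simp add: vec_eq_iff)
    have tr: "trace (N ** (X' + Im s *\<^sub>R \<Delta>)) = trace (N ** X') + Im s * trace (N ** \<Delta>)"
      by (simp add: trace_def matrix_matrix_mult_def algebra_simps sum.distrib sum_distrib_left)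
    show ?thesis unfolding t_def prod.case norm_mult mult.assoc norm_exp_eq_Re cr
      by (simp add: trace_im imf Im_bidot_cv ims tr exp_add[symmetric] inner_add_right algebra_simps)
  qed
  define h where "h s = \<phi> (pt s) * exp (2 * of_real pi * \<i> * of_real \<beta> * s)" for s
  have nh: "norm (h s) = norm (\<phi> (pt s)) * exp (- 2 * pi * \<beta> * Im s)" for s
    by (simp add: h_def norm_mult)
  have "norm (h \<i>) \<le> sqrt (B / (det X' ^ k * exp (- 4 * pi * real m * qf X' a)))"
  proof (rule half_plane_maximum)
    have "(\<lambda>s. \<phi> (pt s)) holomorphic_on {s. Im s \<ge> 0}"
      unfolding pt_def by (rule line_holomorphic[OF hol]) (use pt_in in \<open>simp add: pt_def\<close>)
    then show "h holomorphic_on {s. Im s \<ge> 0}" unfolding h_def by (intro holomorphic_intros)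
    show "norm (h s) \<le> (\<Sum>\<^sub>\<infinity>\<nu>\<in>cusp_indices m. norm (t 0 \<nu>))" if s: "Im s \<ge> 0" for s
    proof -
      have "norm (\<phi> (pt s)) = norm (\<Sum>\<^sub>\<infinity>\<nu>\<in>cusp_indices m. t s \<nu>)" using sum[OF s] by (simp add: infsumI)
      also have "\<dots> \<le> (\<Sum>\<^sub>\<infinity>\<nu>\<in>cusp_indices m. norm (t s \<nu>))" by (rule norm_infsum_bound[OF abs[OF s]])
      finally have "norm (h s) \<le> (\<Sum>\<^sub>\<infinity>\<nu>\<in>cusp_indices m. norm (t s \<nu>)) * exp (- 2 * pi * \<beta> * Im s)"
        unfolding nh by (intro mult_right_mono) auto
      also have "\<dots> = (\<Sum>\<^sub>\<infinity>\<nu>\<in>cusp_indices m. norm (t s \<nu>) * exp (- 2 * pi * \<beta> * Im s))"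
        by (rule infsum_cmult_left'[symmetric])
      also have "\<dots> \<le> (\<Sum>\<^sub>\<infinity>\<nu>\<in>cusp_indices m. norm (t 0 \<nu>))"
      proof (rule infsum_mono)
        show "(\<lambda>\<nu>. norm (t s \<nu>) * exp (- 2 * pi * \<beta> * Im s)) summable_on cusp_indices m"
          by (intro summable_on_cmult_left abs s)
        show "(\<lambda>\<nu>. norm (t 0 \<nu>)) summable_on cusp_indices m" by (intro abs) simp
        fix \<nu> :: "(real^'n^'n) \<times> (int^'n)" assume \<nu>: "\<nu> \<in> cusp_indices m"
        obtain N :: "real^'n^'n" and r :: "int^'n" where Nr: "\<nu> = (N, r)" by (cases \<nu>)
        let ?w = "trace (N ** \<Delta>) + map_vector of_int r \<bullet> (\<Delta> *v a)"
        have "0 \<le> ?w + \<beta>" unfolding \<beta>_def \<omega>_def \<Delta>_def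
          using cusp_index_frequency[OF \<nu>[unfolded Nr] m, where \<delta> = \<delta> and Q = Q and L = L and a = a, OF \<delta>0 Q(2)] by simp
        then have "0 \<le> 2 * pi * Im s * (?w + \<beta>)" using s by simp
        then have "exp (- 2 * pi * Im s * ?w) * exp (- 2 * pi * \<beta> * Im s) \<le> 1"
          unfolding exp_add[symmetric] by (simp add: algebra_simps)
        then have "norm (c N r) * exp (- 2 * pi * (trace (N ** X') + map_vector of_int r \<bullet> (X' *v a)))
           * (exp (- 2 * pi * Im s * ?w) * exp (- 2 * pi * \<beta> * Im s))
          \<le> norm (c N r) * exp (- 2 * pi * (trace (N ** X') + map_vector of_int r \<bullet> (X' *v a))) * 1"
          by (intro mult_left_mono) auto
        then show "norm (t s \<nu>) * exp (- 2 * pi * \<beta> * Im s) \<le> norm (t 0 \<nu>)"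
          unfolding Nr norm_t by (simp add: mult.assoc)
      qed
      finally show ?thesis .
    qed
    show "norm (h (of_real x)) \<le> sqrt (B / (det X' ^ k * exp (- 4 * pi * real m * qf X' a)))" for x
    proof -
      let ?q = "pt (of_real x)"
      have q: "?q \<in> siegel_jacobi" by (rule pt_in) simp
      have imq: "im_mat (fst ?q) = X'" and yq: "im_vec (snd ?q) = X' *v a" by (simp_all add: imf ims)
      have W: "petersson_weight k m ?q = det X' ^ k * exp (- 4 * pi * real m * qf X' a)"
        unfolding petersson_weight_def by (simp add: case_prod_beta Let_def imq yq qf_inv[OF pX'])
      have "petersson_norm_sq k m \<phi> ?q \<le> B" by (rule B[OF q]) (simp only: imq X'_def)
      then have "(norm (\<phi> ?q))\<^sup>2 \<le> B / (det X' ^ k * exp (- 4 * pi * real m * qf X' a))"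
        unfolding petersson_norm_sq_def W using pos_def_det_pos[OF pX'] by (simp add: pos_le_divide_eq)
      then have "norm (\<phi> ?q) \<le> sqrt (B / (det X' ^ k * exp (- 4 * pi * real m * qf X' a)))"
        by (rule real_le_rsqrt)
      then show ?thesis unfolding nh by simp
    qed
  qed
  then have hB: "(norm (h \<i>))\<^sup>2 \<le> B / (det X' ^ k * exp (- 4 * pi * real m * qf X' a))"
  proof -
    assume le: "norm (h \<i>) \<le> sqrt (B / (det X' ^ k * exp (- 4 * pi * real m * qf X' a)))"
    then have "0 \<le> sqrt (B / (det X' ^ k * exp (- 4 * pi * real m * qf X' a)))" using norm_ge_zero order_trans by blast
    then have "0 \<le> B / (det X' ^ k * exp (- 4 * pi * real m * qf X' a))" by simp
    then show ?thesis using power_mono[OF le, of 2] by simp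
  qed
  define W' where "W' = det X' ^ k * exp (- 4 * pi * real m * qf X' a)"
  have W'0: "W' > 0" unfolding W'_def using pos_def_det_pos[OF pX'] by simp
  have B0: "B \<ge> 0"
  proof -
    have "0 \<le> B / W'" using hB zero_le_power2[of "norm (h \<i>)"] unfolding W'_def by linarith
    then show ?thesis using W'0 by (simp add: zero_le_divide_iff)
  qed
  have qfX: "qf ?X a = qf X' a + qf \<Delta> a" unfolding XX by (simp add: matrix_vector_mult_add_rdistrib inner_add_right)
  have W: "petersson_weight k m (\<tau>, z) = det ?X ^ k * exp (- 4 * pi * real m * qf ?X a)"
    unfolding petersson_weight_def Let_def prod.case ya qf_inv[OF pX] ..
  have hi: "(norm (h \<i>))\<^sup>2 = (norm (\<phi> (\<tau>, z)))\<^sup>2 * exp (- 4 * pi * \<beta>)"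
    unfolding nh pti by (simp add: power_mult_distrib exp_double[symmetric])
  have "petersson_norm_sq k m \<phi> (\<tau>, z) = (norm (h \<i>))\<^sup>2 * (det ?X ^ k * exp (- 4 * pi * real m * qf X' a)) * exp (- 4 * pi * \<omega>)"
  proof -
    have "exp (- 4 * pi * real m * qf ?X a) = exp (- 4 * pi * \<beta>) * exp (- 4 * pi * real m * qf X' a) * exp (- 4 * pi * \<omega>)"
      unfolding exp_add[symmetric] qfX \<beta>_def by (simp add: algebra_simps)
    then show ?thesis unfolding petersson_norm_sq_def W hi by (simp add: mult_ac)
  qed
  also have "\<dots> \<le> (B / W') * (det ?X ^ k * exp (- 4 * pi * real m * qf X' a)) * exp (- 4 * pi * \<omega>)"
    using hB pos_def_det_pos[OF pX] unfolding W'_def by (intro mult_right_mono) auto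
  also have "\<dots> = B * ((det ?X / det X') ^ k * exp (- 4 * pi * \<omega>))"
    unfolding W'_def using pos_def_det_pos[OF pX'] by (simp add: power_divide)
  also have "\<dots> \<le> B * 1"
  proof (intro mult_left_mono B0)
    have "det ?X / det X' = (\<Prod>j\<in>UNIV. d j / d' j)"
      unfolding X X'_def det_mul det_diag det_transpose using Q(1)
      by (simp add: invertible_det_nz prod_dividef)
    also have "\<dots> \<le> (\<Prod>j\<in>(UNIV :: 'n set). u)"
      using u(1) d by (intro prod_mono) (auto simp: divide_le_eq less_imp_le intro!: divide_nonneg_pos order_trans[OF less_imp_le[OF d(1)] d(2)])
    finally have "det ?X / det X' \<le> u ^ CARD('n)" by simp
    then have "(det ?X / det X') ^ k \<le> (u ^ CARD('n)) ^ k"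
      using pos_def_det_pos[OF pX] pos_def_det_pos[OF pX'] by (intro power_mono) auto
    then have "(det ?X / det X') ^ k * exp (- 4 * pi * \<omega>) \<le> u ^ (CARD('n) * k) * exp (- 4 * pi * \<omega>)"
      unfolding power_mult by (intro mult_right_mono) auto
    moreover have "- 4 * pi * \<omega> = - pi * (d L - d' L) / real m" unfolding \<omega>_def \<delta>_def using m by (simp add: field_simps)
    ultimately show "(det ?X / det X') ^ k * exp (- 4 * pi * \<omega>) \<le> 1" using u(2) by (simp only:)
  qed
  finally show ?thesis by simp
qed

text \<open>
  The points to which the estimate reduces: the imaginary part is comparable to a diagonal matrix
  with entries bounded below by a constant, bounded above by a constant times \<open>k m\<close>, and increasing with
  the rank up to a constant.
\<close>

definition good :: "real \<Rightarrow> nat \<Rightarrow> nat \<Rightarrow> 'n::finite jacobi_point \<Rightarrow> bool" where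
  "good K k m p \<longleftrightarrow> p \<in> siegel_jacobi \<and> (\<exists>d. (\<forall>i. 0 < d i \<and> 1 \<le> K * d i \<and> d i \<le> K * real k * real m)
     \<and> (\<forall>a b. rk a \<le> rk b \<longrightarrow> d a \<le> K * d b) \<and> comparable K d (im_mat (fst p)))"

text \<open>
  After symplectic reduction, the entries \<open>d i = 1 / e i\<close> beyond the threshold \<open>x = g k m / \<pi>\<close> are cut off, those
  other than the last at a constant multiple of \<open>x\<close>, which keeps their order up to a constant. The threshold is the point where
  the growth of the determinant to the power \<open>k\<close> loses against the exponential decay of cusp forms.
\<close>

lemma decay:
  obtains K :: real where "K \<ge> 1"
    "\<And>k m (\<phi> :: 'n::finite jacobi_point \<Rightarrow> complex) B p. \<lbrakk>k \<ge> 1; m \<ge> 1; \<phi> \<in> jacobi_cusp_forms k m;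
       \<forall>q. good K k m q \<longrightarrow> petersson_norm_sq k m \<phi> q \<le> B; p \<in> siegel_jacobi\<rbrakk> \<Longrightarrow> petersson_norm_sq k m \<phi> p \<le> B"
proof -
  let ?g = "CARD('n)"
  define A :: real where "A = 2 ^ ?g"
  define K0 where "K0 = real ?g * (1 + real ?g * A) ^ (2 * ?g) + (real ?g)\<^sup>2 * A"
  define K where "K = K0 + 4 * A * real ?g"
  have A1: "A \<ge> 1" by (simp add: A_def)
  have g1: "real ?g \<ge> 1" by (simp add: Suc_le_eq)
  have K0: "K0 \<ge> 0" unfolding K0_def using A1 by simp
  have Ag: "A * real ?g \<ge> A" using A1 g1 by simp
  have KK: "K \<ge> 1" "K \<ge> 4" "K \<ge> A" "K \<ge> 2 * A" "K \<ge> A * real ?g" "K0 \<le> K" unfolding K_def using K0 Ag A1 by linarith+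
  show ?thesis
  proof (rule that[of K])
    show "K \<ge> 1" by (rule KK)
    fix k m and \<phi> :: "'n jacobi_point \<Rightarrow> complex" and B :: real and p :: "'n jacobi_point"
    assume k: "k \<ge> 1" and m: "m \<ge> 1" and \<phi>: "\<phi> \<in> jacobi_cusp_forms k m"
      and B': "\<forall>q. good K k m q \<longrightarrow> petersson_norm_sq k m \<phi> q \<le> B" and p: "p \<in> siegel_jacobi"
    obtain \<tau> :: "complex^'n^'n" and z :: "complex^'n" where pp: "p = (\<tau>, z)" by (cases p)
    have \<tau>: "\<tau> \<in> siegel_space" using p by (simp add: pp siegel_jacobi_def)
    obtain M :: "int^('n+'n)^('n+'n)" and P :: "real^'n^'n" and e :: "'n \<Rightarrow> real" where M: "M \<in> Sp_int" and P: "unit_lower P" and e: "\<And>i. e i > 0"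
      and Y: "matrix_inv (im_mat (siegel_act M \<tau>)) = transpose P ** diag e ** P"
      and P1: "\<And>i j. \<bar>P $ i $ j\<bar> \<le> 1" and eo: "\<And>a b. rk a \<le> rk b \<Longrightarrow> e b \<le> 2 ^ ?g * e a"
      and eu: "\<And>i. e i \<le> 2 ^ (?g + 1)"
      by (rule symplectic_reduction[OF \<tau>], rule that)
    define q where "q = jacobi_act M 0 0 p"
    have q: "q \<in> siegel_jacobi" unfolding q_def by (rule jacobi_act_in[OF M p])
    have fq: "petersson_norm_sq k m \<phi> q = petersson_norm_sq k m \<phi> p"
      unfolding q_def using \<phi> by (intro petersson_norm_sq_invariant M p) (simp add: jacobi_cusp_forms_def)
    have q1: "fst q = siegel_act M \<tau>" by (simp add: q_def pp jacobi_act_def)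
    let ?X = "im_mat (fst q)"
    have pX: "pos_def ?X" using q by (auto simp: siegel_jacobi_def dest: siegelD)
    have iP: "invertible P" by (rule unit_lower_invertible[OF P])
    define Q where "Q = matrix_inv P"
    have iQ: "invertible Q" unfolding Q_def by (rule invertible_matrix_inv[OF iP])
    have inv: "matrix_inv (transpose P ** diag f ** P) = Q ** diag (\<lambda>i. 1 / f i) ** transpose Q" if "\<And>i. f i > 0" for f
    proof (rule matrix_inv_unique_field)
      have "diag f ** diag (\<lambda>i. 1 / f i) = mat 1"
      proof -
        have "(diag f ** diag (\<lambda>i. 1 / f i)) $ i $ j = (\<Sum>l\<in>UNIV. if l = i then (if i = j then 1 else 0) else 0)" for i j
          unfolding matrix_matrix_mult_def vec_lambda_beta using that[of i] by (intro sum.cong) (auto simp: diag_def)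
        then show ?thesis by (simp add: vec_eq_iff mat_def)
      qed
      moreover have "P ** Q = mat 1" "transpose P ** transpose Q = mat 1"
        unfolding Q_def matrix_transpose_mul[symmetric] using iP by simp_all
      ultimately have *: "transpose P ** (diag f ** ((P ** Q) ** diag (\<lambda>i. 1 / f i))) ** transpose Q = mat 1" by simp
      then show "transpose P ** diag f ** P ** (Q ** diag (\<lambda>i. 1 / f i) ** transpose Q) = mat 1"
        by (simp only: matrix_mul_assoc)
    qed
    define d where "d i = 1 / e i" for i
    have d0: "d i > 0" for i using e by (simp add: d_def)
    have X: "?X = Q ** diag d ** transpose Q"
    proof -
      have "?X = matrix_inv (matrix_inv ?X)" by (rule matrix_inv_matrix_inv[OF pos_def_invertible[OF pX], symmetric])
      then show ?thesis unfolding q1 Y inv[OF e] d_def .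
    qed
    have do: "d a \<le> A * d b" if "rk a \<le> rk b" for a b
      using eo[OF that] e[of a] e[of b] unfolding d_def A_def by (simp add: field_simps)
    obtain L :: 'n where L: "rk L = ?g - 1" using ex_rk[of "?g - 1", where 'n = 'n] by auto
    have rL: "rk j \<le> rk L" for j :: 'n using rk_less_card[of j] L by simp
    have QL: "column L Q = axis L 1"
    proof -
      have "P *v axis L 1 = axis L 1"
      proof -
        have "P $ i $ L = (if i = L then 1 else 0)" for i
          using P rL[of i] unfolding unit_lower_def by (metis le_neq_implies_less rk_eq_iff)
        then have "column L P = axis L 1" by (simp add: column_def vec_eq_iff axis_def)
        then show ?thesis by (simp only: matrix_vector_mult_basis)
      qed
      then have "Q *v axis L 1 = axis L 1" unfolding Q_def using matrix_inv_mult_vec[OF iP] by metis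
      then show ?thesis by (simp add: matrix_vector_mult_basis)
    qed
    define x where "x = real ?g * real k * real m / pi"
    have km: "real k * real m \<ge> 1" using k m by (metis mult_mono' mult_1 of_nat_1 of_nat_mono of_nat_0_le_iff zero_le_one)
    have x0: "x > 0" unfolding x_def using k m by simp
    define c where "c j = (if j = L then x else A * x)" for j
    have c: "x \<le> c j" "c j \<le> A * x" "c j > 0" for j using x0 A1 by (auto simp: c_def)
    define d' where "d' j = min (d j) (c j)" for j
    have d': "0 < d' j" "d' j \<le> d j" for j using d0[of j] c(3)[of j] by (auto simp: d'_def)
    have do': "d' a \<le> A * d' b" if "rk a \<le> rk b" for a b
    proof -
      have "A * d' b = min (A * d b) (A * c b)" unfolding d'_def using A1 by (simp add: min_mult_distrib_left)
      moreover have "d' a \<le> A * d b" using do[OF that] d'(2)[of a] by linarith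
      moreover have "d' a \<le> A * c b"
      proof -
        have "d' a \<le> A * x" using c(2)[of a] unfolding d'_def by linarith
        also have "\<dots> \<le> A * c b" using c(1)[of b] A1 by simp
        finally show ?thesis .
      qed
      ultimately show ?thesis by simp
    qed
    have xl: "x \<ge> 1 / 4"
    proof -
      have "1 / 4 \<le> 1 / pi" using pi_less_4 by (intro divide_left_mono) auto
      also have "\<dots> \<le> x" unfolding x_def using g1 km mult_mono[OF g1 km] by (intro divide_right_mono) (auto simp: mult.assoc)
      finally show ?thesis .
    qed
    have comp: "comparable K d' (Q ** diag d' ** transpose Q)"
    proof -
      define e' where "e' i = 1 / d' i" for i
      have e': "e' i > 0" for i using d'(1) by (simp add: e'_def)
      have eo': "e' b \<le> A * e' a" if "rk a \<le> rk b" for a b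
        using do'[OF that] d'(1)[of a] d'(1)[of b] unfolding e'_def by (simp add: field_simps)
      have c1: "comparable K0 e' (transpose P ** diag e' ** P)"
        unfolding K0_def by (rule ldl_comparable[OF P P1 e' A1 eo'])
      have "K0 > 0" unfolding K0_def using A1 g1 by (intro add_pos_nonneg mult_pos_pos zero_less_power) (auto simp: add_pos_nonneg)
      from comparable_inverse[OF pos_def_ldlI[OF P e'] e' c1 this]
      have "comparable K0 d' (Q ** diag d' ** transpose Q)" unfolding inv[OF e'] by (simp add: e'_def)
      then show ?thesis by (rule comparable_mono[OF _ KK(6)]) (use d'(1) pos_def_nonneg[OF pos_def_gram[OF iQ d'(1)]] in \<open>auto simp: less_imp_le\<close>)
    qed
    have good: "good K k m q'" if q': "q' \<in> siegel_jacobi" "im_mat (fst q') = Q ** diag d' ** transpose Q" for q'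
      unfolding good_def
    proof (intro conjI exI[of _ d'] allI impI q'(1))
      fix i
      show "0 < d' i" by (rule d')
      have "1 \<le> K * d i"
      proof -
        have "e i \<le> 2 * A" using eu[of i] by (simp add: A_def)
        then show ?thesis unfolding d_def using KK(4) e[of i] by simp
      qed
      moreover have "1 \<le> K * c i"
        using mult_mono[OF KK(2) order_trans[OF xl c(1)[of i]]] KK(1) by simp
      ultimately show "1 \<le> K * d' i" by (simp add: d'_def min_def)
      have "d' i \<le> A * x" using c(2)[of i] by (simp add: d'_def)
      also have "\<dots> = A * real ?g * (real k * real m) / pi" by (simp add: x_def)
      also have "\<dots> \<le> A * real ?g * (real k * real m) / 1" using A1 pi_ge_two by (intro divide_left_mono) auto
      also have "\<dots> \<le> K * (real k * real m)" using KK(5) by (simp add: mult_right_mono)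
      finally show "d' i \<le> K * real k * real m" by simp
    next
      fix a b :: 'n assume "rk a \<le> rk b"
      from do'[OF this] have "d' a \<le> A * d' b" .
      also have "\<dots> \<le> K * d' b" using KK(3) d'(1)[of b] by simp
      finally show "d' a \<le> K * d' b" .
    next
      show "comparable K d' (im_mat (fst q'))" unfolding q'(2) by (rule comp)
    qed
    define u where "u = max 1 (d L / x)"
    have u: "d j \<le> u * d' j" for j
    proof (cases "d j \<le> c j")
      case True
      then have "d' j = d j" by (simp add: d'_def)
      then show ?thesis using d0[of j] by (simp add: u_def mult_le_cancel_right1)
    next
      case False
      then have e: "d' j = c j" by (simp add: d'_def)
      have "d j \<le> d L / x * c j"
      proof (cases "j = L")
        case True then show ?thesis using x0 by (simp add: c_def)
      next
        case False
        then show ?thesis using do[OF rL[of j]] x0 by (simp add: c_def mult.commute)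
      qed
      also have "\<dots> \<le> u * c j" using c(3)[of j] by (intro mult_right_mono) (auto simp: u_def)
      finally show ?thesis unfolding e .
    qed
    have u2: "u ^ (?g * k) * exp (- pi * (d L - d' L) / real m) \<le> 1"
    proof (cases "d L \<le> x")
      case True
      then have "d' L = d L" "u = 1" using x0 by (auto simp: d'_def c_def u_def)
      then show ?thesis by simp
    next
      case False
      then have dL: "d' L = x" "u = d L / x" using x0 by (auto simp: d'_def c_def u_def)
      then have dLx: "d L = u * x" using x0 by simp
      have "u \<le> exp (u - 1)" using exp_ge_add_one_self[of "u - 1"] by simp
      moreover have "u \<ge> 0" by (simp add: u_def)
      ultimately have "u ^ (?g * k) \<le> exp (u - 1) ^ (?g * k)" by (intro power_mono)
      also have "\<dots> = exp (real (?g * k) * (u - 1))" by (rule exp_of_nat_mult[symmetric])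
      also have "real (?g * k) * (u - 1) = pi * (d L - d' L) / real m"
      proof -
        have "pi * (d L - d' L) / real m = (pi * x / real m) * (u - 1)" unfolding dL(1) dLx by (simp add: algebra_simps)
        also have "pi * x / real m = real (?g * k)" unfolding x_def using m by simp
        finally show ?thesis by simp
      qed
      finally have "u ^ (?g * k) * exp (- pi * (d L - d' L) / real m) \<le> exp (pi * (d L - d' L) / real m) * exp (- pi * (d L - d' L) / real m)"
        by (intro mult_right_mono) auto
      then show ?thesis by (simp add: exp_add[symmetric])
    qed
    have qz: "(fst q, snd q) \<in> siegel_jacobi" using q by simp
    have "petersson_norm_sq k m \<phi> (fst q, snd q) \<le> B"
      by (rule decay_along_line[OF \<phi> m qz iQ QL X d' u u2]) (rule B'[rule_format, OF good])
    then show "petersson_norm_sq k m \<phi> p \<le> B" by (simp add: fq)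
  qed
qed

section \<open>The submean value inequality\<close>

text \<open>
  A perturbation with entries small against \<open>sqrt (d i d j)\<close> changes the form by at most half of it.
\<close>

lemma comparable_perturb:
  fixes A E :: "real^'n::finite^'n"
  assumes A: "pos_def A" and d: "\<And>i. d i > 0" and c: "comparable K d A" and K: "K \<ge> 1"
    and E: "transpose E = E" "\<And>i j. \<bar>E $ i $ j\<bar> \<le> 1 / (2 * real CARD('n) * K) * sqrt (d i) * sqrt (d j)"
  shows "pos_def (A + E)" "comparable (2 * K) d (A + E)"
proof -
  let ?g = "real CARD('n)"
  have g: "?g > 0" by simp
  have bound: "\<bar>qf E v\<bar> \<le> (\<Sum>i\<in>UNIV. d i * (v $ i)\<^sup>2) / (2 * K)" for v
  proof -
    have "\<bar>qf E v\<bar> \<le> (\<Sum>i\<in>UNIV. \<Sum>j\<in>UNIV. \<bar>E $ i $ j * v $ i * v $ j\<bar>)"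
      unfolding qf_sum by (intro order_trans[OF sum_abs] sum_mono sum_abs)
    also have "\<dots> \<le> (\<Sum>i\<in>UNIV. \<Sum>j\<in>UNIV. 1 / (2 * ?g * K) * ((sqrt (d i) * \<bar>v $ i\<bar>) * (sqrt (d j) * \<bar>v $ j\<bar>)))"
    proof (intro sum_mono)
      fix i j :: 'n
      have "\<bar>E $ i $ j\<bar> * (\<bar>v $ i\<bar> * \<bar>v $ j\<bar>) \<le> 1 / (2 * ?g * K) * sqrt (d i) * sqrt (d j) * (\<bar>v $ i\<bar> * \<bar>v $ j\<bar>)"
        by (intro mult_right_mono E(2)) simp
      then show "\<bar>E $ i $ j * v $ i * v $ j\<bar> \<le> 1 / (2 * ?g * K) * ((sqrt (d i) * \<bar>v $ i\<bar>) * (sqrt (d j) * \<bar>v $ j\<bar>))"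
        by (simp add: abs_mult mult_ac)
    qed
    also have "\<dots> = 1 / (2 * ?g * K) * (\<Sum>i\<in>UNIV. sqrt (d i) * \<bar>v $ i\<bar>)\<^sup>2"
      unfolding power2_eq_square sum_product by (simp only: sum_distrib_left)
    also have "\<dots> \<le> 1 / (2 * ?g * K) * ((\<Sum>i\<in>UNIV. (sqrt (d i) * \<bar>v $ i\<bar>)\<^sup>2) * ?g)"
      using K by (intro mult_left_mono sum_squared_le_sum_of_squares) simp
    also have "(\<Sum>i\<in>UNIV. (sqrt (d i) * \<bar>v $ i\<bar>)\<^sup>2) = (\<Sum>i\<in>UNIV. d i * (v $ i)\<^sup>2)"
      using less_imp_le[OF d] by (simp add: power_mult_distrib)
    finally show ?thesis using K g by (simp add: field_simps)
  qed
  have add: "qf (A + E) v = qf A v + qf E v" for v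
    by (simp add: matrix_vector_mult_add_rdistrib inner_add_right)
  have W: "(\<Sum>i\<in>UNIV. d i * (v $ i)\<^sup>2) \<ge> 0" for v :: "real^'n" using less_imp_le[OF d] by (intro sum_nonneg) simp
  have lower: "(\<Sum>i\<in>UNIV. d i * (v $ i)\<^sup>2) \<le> 2 * K * qf (A + E) v" for v
  proof -
    have "(\<Sum>i\<in>UNIV. d i * (v $ i)\<^sup>2) \<le> K * qf A v" using c by (simp add: comparable_def)
    moreover have "2 * K * \<bar>qf E v\<bar> \<le> (\<Sum>i\<in>UNIV. d i * (v $ i)\<^sup>2)" using bound[of v] K by (simp add: field_simps)
    moreover have "2 * K * - \<bar>qf E v\<bar> \<le> 2 * K * qf E v" using K by (intro mult_left_mono) auto
    ultimately show ?thesis unfolding add distrib_left by linarith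
  qed
  show "pos_def (A + E)"
    unfolding pos_def_def
  proof (intro conjI allI impI)
    show "transpose (A + E) = A + E" using E(1) pos_def_sym[OF A] by (simp add: transpose_add)
    fix v :: "real^'n" assume v: "v \<noteq> 0"
    then obtain i where i: "v $ i \<noteq> 0" by (auto simp: vec_eq_iff)
    have "0 < d i * (v $ i)\<^sup>2" using i d[of i] by simp
    also have "\<dots> \<le> (\<Sum>i\<in>UNIV. d i * (v $ i)\<^sup>2)"
      by (rule member_le_sum) (use less_imp_le[OF d] in auto)
    also have "\<dots> \<le> 2 * K * qf (A + E) v" by (rule lower)
    finally show "0 < qf (A + E) v" using K by (simp add: zero_less_mult_iff)
  qed
  show "comparable (2 * K) d (A + E)"
    unfolding comparable_def
  proof (intro allI conjI lower)
    fix v :: "real^'n"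
    have "qf A v \<le> K * (\<Sum>i\<in>UNIV. d i * (v $ i)\<^sup>2)" using c by (simp add: comparable_def)
    moreover have "(\<Sum>i\<in>UNIV. d i * (v $ i)\<^sup>2) / (2 * K) \<le> K * (\<Sum>i\<in>UNIV. d i * (v $ i)\<^sup>2)"
    proof -
      have "1 \<le> K * (2 * K)" using mult_mono[of 1 K 1 "2 * K"] K by simp
      then show ?thesis using mult_right_mono[OF _ W[of v], of 1 "K * (2 * K)"] K by (simp add: field_simps)
    qed
    ultimately show "qf (A + E) v \<le> 2 * K * (\<Sum>i\<in>UNIV. d i * (v $ i)\<^sup>2)"
      unfolding add using bound[of v] by (simp add: mult.assoc)
  qed
qed

text \<open>
  With \<open>R R\<^sup>t = (X + E)\<^sup>-\<^sup>1\<close> apply the bound of a determinant by a trace to \<open>R\<^sup>t X R\<close>.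
\<close>

lemma det_perturb_lower:
  fixes X E :: "real^'n::finite^'n"
  assumes X: "pos_def X" and X': "pos_def (X + E)"
  shows "det X * exp (trace (matrix_inv (X + E) ** E)) \<le> det (X + E)"
proof -
  let ?X' = "X + E" and ?Y = "matrix_inv (X + E)"
  have i': "invertible ?X'" by (rule pos_def_invertible[OF X'])
  obtain R :: "real^'n^'n" where R: "invertible R" "?Y = R ** transpose R" by (rule pos_def_sqrt[OF pos_def_inv[OF X']], rule that)
  have Y: "pos_def (transpose R ** X ** R)" by (rule pos_def_congruence[OF X R(1)])
  have "det (transpose R ** X ** R) = det X * det ?Y" unfolding R(2) by (simp add: det_mul)
  also have "\<dots> = det X / det ?X'" unfolding det_matrix_inv[OF i'] by (simp add: divide_inverse)
  finally have det: "det X / det ?X' \<le> exp (trace (transpose R ** X ** R) - real CARD('n))"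
    using det_le_exp_trace[OF Y] by simp
  have "trace (transpose R ** X ** R) = trace (?Y ** X)"
  proof -
    have "trace (transpose R ** X ** R) = trace (R ** (transpose R ** X))" by (rule trace_mul_sym)
    then show ?thesis unfolding R(2) by (simp add: matrix_mul_assoc)
  qed
  also have "?Y ** X = mat 1 - ?Y ** E"
  proof -
    have "?Y ** (X + E) = mat 1" by (rule matrix_inv_left[OF i'])
    then have "?Y ** X + ?Y ** E = mat 1" by (simp only: matrix_add_ldistrib)
    then show ?thesis by (simp add: algebra_simps)
  qed
  also have "trace (mat 1 - ?Y ** E) = real CARD('n) - trace (?Y ** E)" by (simp add: trace_sub trace_I)
  finally have "det X / det ?X' \<le> exp (- trace (?Y ** E))" using det by simp
  then have "det X \<le> exp (- trace (?Y ** E)) * det ?X'" using pos_def_det_pos[OF X'] by (simp add: pos_divide_le_eq)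
  then have "det X * exp (trace (?Y ** E)) \<le> exp (- trace (?Y ** E)) * det ?X' * exp (trace (?Y ** E))"
    by (intro mult_right_mono) auto
  also have "\<dots> = det ?X'" by (simp add: exp_minus field_simps)
  finally show ?thesis .
qed

text \<open>
  The difference is the trace of \<open>X\<^sup>-\<^sup>1 E (X + E)\<^sup>-\<^sup>1 E\<close>, of second order in \<open>E\<close>. At the scale \<open>s = sqrt k\<close> it is of
  size \<open>1 / k\<close>, which the exponent \<open>k\<close> of the determinant tolerates.
\<close>

lemma trace_inverse_perturb:
  fixes X E :: "real^'n::finite^'n"
  assumes X: "pos_def X" and d: "\<And>i. d i > 0" and c: "comparable K d X" and K: "K \<ge> 1"
    and s: "s \<ge> 1"
    and E: "transpose E = E" "\<And>i j. \<bar>E $ i $ j\<bar> \<le> 1 / (2 * real CARD('n) * K) * sqrt (d i) * sqrt (d j) / s"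
  shows "trace (matrix_inv X ** E) - trace (matrix_inv (X + E) ** E) \<le> (real CARD('n))\<^sup>2 / (2 * s\<^sup>2)"
proof -
  let ?g = "real CARD('n)" let ?X' = "X + E"
  define \<rho> where "\<rho> = 1 / (2 * ?g * K)"
  have \<rho>0: "\<rho> > 0" using K by (simp add: \<rho>_def)
  have E': "\<bar>E $ i $ j\<bar> \<le> 1 / (2 * ?g * K) * sqrt (d i) * sqrt (d j)" for i j
  proof -
    have p: "0 \<le> \<rho> * sqrt (d i) * sqrt (d j)" using \<rho>0 d[of i] d[of j] by simp
    show ?thesis using order_trans[OF E(2)[of i j] divide_left_mono[of 1 s, OF s p[unfolded \<rho>_def]]] s by simp
  qed
  have X': "pos_def ?X'" and c': "comparable (2 * K) d ?X'"
    using comparable_perturb[OF X d c K E(1) E'] by simp_all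
  have entry: "\<bar>(matrix_inv A ** E) $ i $ j\<bar> \<le> ?g * K' * (\<rho> / s) * (sqrt (d j) / sqrt (d i))"
    if A: "pos_def A" and cA: "comparable K' d A" and K': "K' > 0" for A K' i j
  proof -
    have iA: "\<bar>matrix_inv A $ i $ l\<bar> \<le> K' * sqrt (1 / d i) * sqrt (1 / d l)" for l
      by (rule comparable_entry[OF pos_def_inv[OF A] _ comparable_inverse[OF A d cA K']]) (use d in simp)
    have "\<bar>(matrix_inv A ** E) $ i $ j\<bar> \<le> (\<Sum>l\<in>UNIV. \<bar>matrix_inv A $ i $ l\<bar> * \<bar>E $ l $ j\<bar>)"
      unfolding matrix_matrix_mult_def vec_lambda_beta abs_mult[symmetric] by (rule sum_abs)
    also have "\<dots> \<le> (\<Sum>l\<in>(UNIV :: 'n set). K' * (\<rho> / s) * (sqrt (d j) / sqrt (d i)))"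
    proof (rule sum_mono)
      fix l
      have "\<bar>matrix_inv A $ i $ l\<bar> * \<bar>E $ l $ j\<bar> \<le> (K' * sqrt (1 / d i) * sqrt (1 / d l)) * (\<rho> * sqrt (d l) * sqrt (d j) / s)"
        using iA[of l] E(2)[of l j] K' d[of i] d[of l] unfolding \<rho>_def by (intro mult_mono) auto
      also have "\<dots> = K' * (\<rho> / s) * (sqrt (d j) / sqrt (d i))"
        using d[of l] by (simp add: real_sqrt_divide mult_ac)
      finally show "\<bar>matrix_inv A $ i $ l\<bar> * \<bar>E $ l $ j\<bar> \<le> K' * (\<rho> / s) * (sqrt (d j) / sqrt (d i))" .
    qed
    finally show ?thesis by (simp add: mult.assoc)
  qed
  define P where "P = matrix_inv X ** E"
  define Q where "Q = matrix_inv ?X' ** E"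
  have PQ: "P - Q = P ** Q"
  proof -
    have "matrix_inv X ** (?X' - X) ** matrix_inv ?X' = matrix_inv X - matrix_inv ?X'"
    proof -
      have "matrix_inv X ** (?X' - X) ** matrix_inv ?X' = matrix_inv X ** ?X' ** matrix_inv ?X' - matrix_inv X ** X ** matrix_inv ?X'"
        by (simp only: matrix_diff_ldistrib matrix_diff_rdistrib)
      then show ?thesis
        unfolding matrix_mul_assoc[symmetric, of "matrix_inv X" ?X'] matrix_inv_right[OF pos_def_invertible[OF X']] matrix_inv_left[OF pos_def_invertible[OF X]]
        by simp
    qed
    then have "(matrix_inv X - matrix_inv ?X') ** E = matrix_inv X ** E ** matrix_inv ?X' ** E" by simp
    then show ?thesis unfolding P_def Q_def matrix_diff_rdistrib by (simp only: matrix_mul_assoc)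
  qed
  have "trace P - trace Q = trace (P ** Q)" unfolding PQ[symmetric] by (simp add: trace_sub)
  also have "\<dots> = (\<Sum>i\<in>UNIV. \<Sum>j\<in>UNIV. P $ i $ j * Q $ j $ i)"
    unfolding trace_def matrix_matrix_mult_def vec_lambda_beta ..
  also have "\<dots> \<le> (\<Sum>i\<in>(UNIV :: 'n set). \<Sum>j\<in>(UNIV :: 'n set). 1 / (2 * s\<^sup>2))"
  proof (intro sum_mono)
    fix i j :: 'n
    have "P $ i $ j * Q $ j $ i \<le> \<bar>P $ i $ j\<bar> * \<bar>Q $ j $ i\<bar>" unfolding abs_mult[symmetric] by (rule abs_ge_self)
    also have "\<dots> \<le> (?g * K * (\<rho> / s) * (sqrt (d j) / sqrt (d i))) * (?g * (2 * K) * (\<rho> / s) * (sqrt (d i) / sqrt (d j)))"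
      unfolding P_def Q_def using K s \<rho>0 d[of i] d[of j] by (intro mult_mono entry X X' c c') auto
    also have "\<dots> = 1 / (2 * s\<^sup>2)"
      using d[of i] d[of j] K s unfolding \<rho>_def by (simp add: field_simps power2_eq_square)
    finally show "P $ i $ j * Q $ j $ i \<le> 1 / (2 * s\<^sup>2)" .
  qed
  finally show ?thesis unfolding P_def Q_def by (simp add: power2_eq_square)
qed

lemma circle_mean:
  assumes G: "G holomorphic_on cball 0 1"
  shows "ennreal (norm (G 0)) \<le> ennreal (1 / (2 * pi)) * (\<integral>\<^sup>+t. ennreal (norm (G (cis t))) * indicator {0..2 * pi} t \<partial>lborel)"
proof -
  have cG: "continuous_on (cball 0 1) G" by (rule holomorphic_on_imp_continuous_on[OF G])
  have "((\<lambda>u. G u / (u - 0)) has_contour_integral (2 * of_real pi * \<i> * G 0)) (circlepath 0 1)"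
    by (rule Cauchy_integral_circlepath_simple[OF G]) simp
  then have "((\<lambda>t. G (cis t) / (cis t) * \<i> * cis t) has_integral (2 * of_real pi * \<i> * G 0)) {0..2*pi}"
    unfolding circlepath_def by (subst (asm) has_contour_integral_part_circlepath_iff) auto
  then have I: "((\<lambda>t. G (cis t) * \<i>) has_integral (2 * of_real pi * \<i> * G 0)) {0..2*pi}" by simp
  have cont: "continuous_on {0..2*pi} (\<lambda>t. G (cis t))"
    by (rule continuous_on_compose2[OF cG]) (auto intro!: continuous_intros)
  have int: "(\<lambda>t. norm (G (cis t))) integrable_on {0..2*pi}"
    by (intro integrable_continuous_real continuous_intros cont)
  have "norm (integral {0..2*pi} (\<lambda>t. G (cis t) * \<i>)) \<le> integral {0..2*pi} (\<lambda>t. norm (G (cis t)))"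
    using I int by (intro integral_norm_bound_integral) (auto simp: norm_mult)
  then have le: "2 * pi * norm (G 0) \<le> integral {0..2*pi} (\<lambda>t. norm (G (cis t)))"
    unfolding integral_unique[OF I] by (simp add: norm_mult)
  have "ennreal (norm (G 0)) = ennreal (1 / (2 * pi)) * ennreal (2 * pi * norm (G 0))"
    by (subst ennreal_mult[symmetric]) auto
  also have "\<dots> \<le> ennreal (1 / (2 * pi)) * ennreal (integral {0..2*pi} (\<lambda>t. norm (G (cis t))))"
    by (intro mult_left_mono ennreal_leI le) simp
  also have "ennreal (integral {0..2*pi} (\<lambda>t. norm (G (cis t)))) = (\<integral>\<^sup>+t. ennreal (norm (G (cis t))) * indicator {0..2 * pi} t \<partial>lborel)"
    by (rule nn_integral_has_integral_lebesgue'[symmetric]) (use int in auto)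
  finally show ?thesis .
qed

text \<open>
  A polydisc of increments \<open>(S, Z)\<close>, sheared by \<open>S a\<close>, where \<open>a = \<eta>\<^sup>-\<^sup>1 y\<close> at its centre. The radii
  \<open>sqrt (d i d j / k)\<close> and \<open>sqrt (d i / m)\<close> are so small that the Petersson weight is at least a constant times
  the exponential of a real affine function that equals it at the centre. The shear follows the
  minimum of the weight in \<open>z\<close> when \<open>\<tau>\<close> moves.
\<close>

definition pdisc :: "real \<Rightarrow> nat \<Rightarrow> nat \<Rightarrow> ('n \<Rightarrow> real) \<Rightarrow> real^'n \<Rightarrow> 'n::finite jacobi_point set" where
  "pdisc \<rho> k m d a = {q. transpose (fst q) = fst q
     \<and> (\<forall>i j. cmod (fst q $ i $ j) \<le> \<rho> * sqrt (d i) * sqrt (d j) / sqrt (real k))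
     \<and> (\<forall>i. cmod ((snd q - fst q *v cv a) $ i) \<le> \<rho> * sqrt (d i) / sqrt (real m))}"

lemma pdisc_circled:
  assumes q: "q \<in> pdisc \<rho> k m d a" and c: "cmod c \<le> 1"
  shows "jacobi_scale c q \<in> pdisc \<rho> k m d a"
proof -
  obtain S Z where qq: "q = (S, Z)" by (cases q)
  have le: "cmod (c * x) \<le> y" if "cmod x \<le> y" for x y
    using mult_mono[OF c that] by (simp add: norm_mult)
  have "(c *s Z - map_matrix ((*) c) S *v cv a) $ i = c * (Z - S *v cv a) $ i" for i
    unfolding scale_mult_vec by (simp add: algebra_simps)
  then show ?thesis using q unfolding qq pdisc_def jacobi_scale_def mem_Collect_eq prod.case fst_conv snd_conv
    by (auto simp: le transpose_def vec_eq_iff simp del: vector_minus_component)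
qed

lemma pdisc_shift:
  fixes p :: "'n::finite jacobi_point"
  assumes p: "p \<in> siegel_jacobi" and d: "\<And>i. d i > 0" and c: "comparable K d (im_mat (fst p))" and K: "K \<ge> 1"
    and k: "k \<ge> 1" and q: "q \<in> pdisc (1 / (2 * real CARD('n) * K)) k m d a"
  shows "p + q \<in> siegel_jacobi" "comparable (2 * K) d (im_mat (fst (p + q)))"
    "transpose (im_mat (fst q)) = im_mat (fst q)"
    "\<bar>im_mat (fst q) $ i $ j\<bar> \<le> 1 / (2 * real CARD('n) * K) * sqrt (d i) * sqrt (d j) / sqrt (real k)"
proof -
  let ?\<rho> = "1 / (2 * real CARD('n) * K)"
  have \<tau>: "fst p \<in> siegel_space" using p by (auto simp: siegel_jacobi_def)
  have sq: "transpose (fst q) = fst q" and eq: "cmod (fst q $ i $ j) \<le> ?\<rho> * sqrt (d i) * sqrt (d j) / sqrt (real k)" for i j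
    using q by (auto simp: pdisc_def)
  show sE: "transpose (im_mat (fst q)) = im_mat (fst q)"
    using transpose_sym_index[OF sq] by (simp add: vec_eq_iff transpose_def)
  show E: "\<bar>im_mat (fst q) $ i $ j\<bar> \<le> ?\<rho> * sqrt (d i) * sqrt (d j) / sqrt (real k)" for i j
    using order_trans[OF abs_Im_le_cmod eq[of i j]] by simp
  have E': "\<bar>im_mat (fst q) $ i $ j\<bar> \<le> ?\<rho> * sqrt (d i) * sqrt (d j)" for i j
  proof -
    have "?\<rho> * sqrt (d i) * sqrt (d j) / sqrt (real k) \<le> ?\<rho> * sqrt (d i) * sqrt (d j) / 1"
      using k K d[of i] d[of j] by (intro divide_left_mono) auto
    then show ?thesis using E[of i j] by simp
  qed
  have im: "im_mat (fst (p + q)) = im_mat (fst p) + im_mat (fst q)" by (simp add: vec_eq_iff)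
  have "pos_def (im_mat (fst (p + q)))" "comparable (2 * K) d (im_mat (fst (p + q)))"
    unfolding im by (rule comparable_perturb[OF siegelD(2)[OF \<tau>] d c K sE E'])+
  moreover have "transpose (fst (p + q)) = fst (p + q)"
    using sq siegelD(1)[OF \<tau>] by (simp add: transpose_add)
  ultimately show "p + q \<in> siegel_jacobi" "comparable (2 * K) d (im_mat (fst (p + q)))"
    by (auto simp: siegel_jacobi_def siegel_space_def mem_Times_iff)
qed

text \<open>
  A complex linear function whose real part is the first order expansion of the logarithm of the
  weight.
\<close>

definition weight_log :: "nat \<Rightarrow> nat \<Rightarrow> real^'n^'n \<Rightarrow> real^'n \<Rightarrow> 'n::finite jacobi_point \<Rightarrow> complex" where
  "weight_log k m X a q = - \<i> * (of_nat k * trace (cr (matrix_inv X) ** fst q)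
     - 4 * of_real pi * of_nat m * (2 * bidot (cv a) (snd q) - bidot (cv a) (fst q *v cv a)))"

lemma Re_weight_log:
  "Re (weight_log k m X a q) = real k * trace (matrix_inv X ** im_mat (fst q))
     - 4 * pi * real m * (2 * (a \<bullet> im_vec (snd q)) - qf (im_mat (fst q)) a)"
proof -
  have "im_vec (fst q *v cv a) = im_mat (fst q) *v a" using im_vec_affine[of "fst q" a 0] by (simp add: vec_eq_iff)
  then have "Im (bidot (cv a) (fst q *v cv a)) = qf (im_mat (fst q)) a" by (simp add: Im_bidot_cv)
  then show ?thesis by (simp add: weight_log_def trace_im Im_bidot_cv)
qed

lemma weight_log_scale: "weight_log k m X a (jacobi_scale c q) = c * weight_log k m X a q"
proof -
  have 1: "trace (A ** map_matrix ((*) c) S) = c * trace (A ** S)" for A S :: "complex^'a^'a"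
    by (simp add: trace_def matrix_matrix_mult_def sum_distrib_left mult_ac)
  have 2: "bidot v (c *s w) = c * bidot v w" for v w :: "complex^'a" by (simp add: bidot_def sum_distrib_left mult_ac)
  show ?thesis by (cases q) (simp add: weight_log_def jacobi_scale_def 1 scale_mult_vec 2 algebra_simps)
qed

text \<open>
  For the determinant, combine the lower bound by a trace with the second order estimate. The vector
  part of the exponent is linear along the sheared directions up to the form \<open>(\<eta>')\<^sup>-\<^sup>1\<close> at the imaginary part of
  \<open>Z - S a\<close>, which is of size \<open>1 / m\<close> on the polydisc.
\<close>

lemma weight_compare:
  fixes p :: "'n::finite jacobi_point"
  assumes p: "p \<in> siegel_jacobi" and d: "\<And>i. d i > 0" and c: "comparable K d (im_mat (fst p))" and K: "K \<ge> 1"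
    and k: "k \<ge> 1" and m: "m \<ge> 1"
  defines "X \<equiv> im_mat (fst p)"
  defines "a \<equiv> matrix_inv X *v im_vec (snd p)"
  assumes q: "q \<in> pdisc (1 / (2 * real CARD('n) * K)) k m d a"
  shows "petersson_weight k m p * exp (Re (weight_log k m X a q))
     \<le> exp ((real CARD('n))\<^sup>2 / 2 + 2 * pi) * petersson_weight k m (p + q)"
proof -
  let ?g = "real CARD('n)" and ?\<rho> = "1 / (2 * real CARD('n) * K)"
  define E where "E = im_mat (fst q)"
  define \<eta> where "\<eta> = im_vec (snd q) - E *v a"
  have g1: "?g \<ge> 1" by (simp add: Suc_le_eq)
  have \<tau>: "fst p \<in> siegel_space" using p by (auto simp: siegel_jacobi_def)
  note sh = pdisc_shift[OF p d c K k q]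
  have X: "pos_def X" unfolding X_def by (rule siegelD(2)[OF \<tau>])
  have imX: "im_mat (fst (p + q)) = X + E" by (simp add: vec_eq_iff X_def E_def)
  have X': "pos_def (X + E)" using siegelD(2)[of "fst (p + q)"] sh(1) unfolding imX[symmetric] siegel_jacobi_def mem_Times_iff by blast
  have cX': "comparable (2 * K) d (X + E)" using sh(2) unfolding imX .
  have y: "im_vec (snd p) = X *v a" unfolding a_def by (rule mult_matrix_inv_vec[OF pos_def_invertible[OF X], symmetric])
  have y': "im_vec (snd (p + q)) = (X + E) *v a + \<eta>"
    using y by (simp add: vec_eq_iff \<eta>_def matrix_vector_mult_add_rdistrib)
  have qy: "qf (matrix_inv (X + E)) ((X + E) *v a + \<eta>) = qf (X + E) a + 2 * (a \<bullet> \<eta>) + qf (matrix_inv (X + E)) \<eta>"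
  proof -
    have i: "matrix_inv (X + E) *v ((X + E) *v a + \<eta>) = a + matrix_inv (X + E) *v \<eta>"
      by (simp add: matrix_vector_right_distrib matrix_inv_mult_vec[OF pos_def_invertible[OF X']])
    have "((X + E) *v a) \<bullet> (matrix_inv (X + E) *v \<eta>) = a \<bullet> ((X + E) *v (matrix_inv (X + E) *v \<eta>))"
      unfolding inner_matrix_transpose pos_def_sym[OF X'] ..
    then have "((X + E) *v a) \<bullet> (matrix_inv (X + E) *v \<eta>) = a \<bullet> \<eta>"
      unfolding mult_matrix_inv_vec[OF pos_def_invertible[OF X']] .
    then show ?thesis unfolding i inner_add_left inner_add_right by (simp add: inner_commute)
  qed
  have det: "det X ^ k * exp (real k * trace (matrix_inv X ** E)) \<le> exp (?g\<^sup>2 / 2) * det (X + E) ^ k"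
  proof -
    have "trace (matrix_inv X ** E) - trace (matrix_inv (X + E) ** E) \<le> ?g\<^sup>2 / (2 * (sqrt (real k))\<^sup>2)"
      using trace_inverse_perturb[OF X d c[folded X_def] K _ sh(3)[folded E_def] sh(4)[folded E_def]] k by simp
    then have "real k * (trace (matrix_inv X ** E) - trace (matrix_inv (X + E) ** E)) \<le> ?g\<^sup>2 / 2"
      using k by (simp add: field_simps)
    then have "exp (real k * trace (matrix_inv X ** E)) \<le> exp (?g\<^sup>2 / 2 + real k * trace (matrix_inv (X + E) ** E))"
      by (simp add: algebra_simps)
    also have "\<dots> = exp (?g\<^sup>2 / 2) * exp (trace (matrix_inv (X + E) ** E)) ^ k"
      by (simp only: exp_add exp_of_nat_mult)
    finally have "det X ^ k * exp (real k * trace (matrix_inv X ** E)) \<le> det X ^ k * (exp (?g\<^sup>2 / 2) * exp (trace (matrix_inv (X + E) ** E)) ^ k)"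
      using pos_def_det_pos[OF X] by (intro mult_left_mono) auto
    also have "\<dots> = exp (?g\<^sup>2 / 2) * (det X * exp (trace (matrix_inv (X + E) ** E))) ^ k"
      by (simp add: power_mult_distrib)
    also have "\<dots> \<le> exp (?g\<^sup>2 / 2) * det (X + E) ^ k"
      using pos_def_det_pos[OF X] by (intro mult_left_mono power_mono det_perturb_lower[OF X X']) auto
    finally show ?thesis .
  qed
  have eta: "4 * pi * real m * qf (matrix_inv (X + E)) \<eta> \<le> 2 * pi"
  proof -
    have "comparable (2 * K) (\<lambda>i. 1 / d i) (matrix_inv (X + E))"
      by (rule comparable_inverse[OF X' d cX']) (use K in simp)
    then have "qf (matrix_inv (X + E)) \<eta> \<le> 2 * K * (\<Sum>i\<in>UNIV. 1 / d i * (\<eta> $ i)\<^sup>2)" unfolding comparable_def by blast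
    also have "\<dots> \<le> 2 * K * (\<Sum>i\<in>(UNIV :: 'n set). ?\<rho>\<^sup>2 / real m)"
    proof (intro mult_left_mono sum_mono)
      fix i
      have "\<eta> $ i = Im ((snd q - fst q *v cv a) $ i)"
        by (simp add: \<eta>_def E_def matrix_vector_mult_def)
      then have "\<bar>\<eta> $ i\<bar> \<le> ?\<rho> * sqrt (d i) / sqrt (real m)"
        using q order_trans[OF abs_Im_le_cmod] unfolding pdisc_def by (metis (mono_tags, lifting) mem_Collect_eq)
      then have "\<bar>\<eta> $ i\<bar>\<^sup>2 \<le> (?\<rho> * sqrt (d i) / sqrt (real m))\<^sup>2" by (intro power_mono) auto
      also have "\<dots> = ?\<rho>\<^sup>2 / real m * d i" using less_imp_le[OF d[of i]] by (simp add: power_mult_distrib power_divide)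
      finally show "1 / d i * (\<eta> $ i)\<^sup>2 \<le> ?\<rho>\<^sup>2 / real m" using d[of i] by (simp add: field_simps)
    qed (use K in simp)
    also have "\<dots> = 1 / (2 * ?g * K * real m)" using K m by (simp add: power2_eq_square field_simps)
    finally have "4 * pi * real m * qf (matrix_inv (X + E)) \<eta> \<le> 4 * pi * real m * (1 / (2 * ?g * K * real m))"
      by (intro mult_left_mono) auto
    also have "\<dots> = 2 * pi / (?g * K)" using K m by (simp add: field_simps)
    also have "\<dots> \<le> 2 * pi / 1" using mult_mono[OF g1 K] K by (intro divide_left_mono) auto
    finally show ?thesis by simp
  qed
  have W: "petersson_weight k m p = det X ^ k * exp (- 4 * pi * real m * qf X a)"
    unfolding petersson_weight_def case_prod_beta Let_def X_def[symmetric] y qf_inv[OF X] ..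
  have W': "petersson_weight k m (p + q) = det (X + E) ^ k * exp (- 4 * pi * real m * (qf (X + E) a + 2 * (a \<bullet> \<eta>) + qf (matrix_inv (X + E)) \<eta>))"
    unfolding petersson_weight_def case_prod_beta Let_def imX y' qy ..
  define A where "A = - 4 * pi * real m * (qf (X + E) a + 2 * (a \<bullet> \<eta>))"
  have "petersson_weight k m p * exp (Re (weight_log k m X a q)) = (det X ^ k * exp (real k * trace (matrix_inv X ** E))) * exp A"
  proof -
    have "a \<bullet> im_vec (snd q) = a \<bullet> \<eta> + qf E a" by (simp add: \<eta>_def inner_diff_right)
    moreover have "qf (X + E) a = qf X a + qf E a" by (simp add: matrix_vector_mult_add_rdistrib inner_add_right)
    ultimately have "- 4 * pi * real m * qf X a + Re (weight_log k m X a q) = real k * trace (matrix_inv X ** E) + A"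
      unfolding Re_weight_log A_def E_def[symmetric] by (simp add: algebra_simps)
    then have "exp (- 4 * pi * real m * qf X a) * exp (Re (weight_log k m X a q)) = exp (real k * trace (matrix_inv X ** E)) * exp A"
      unfolding exp_add[symmetric] by simp
    then show ?thesis unfolding W by (simp only: mult.assoc)
  qed
  also have "\<dots> \<le> (exp (?g\<^sup>2 / 2) * det (X + E) ^ k) * exp A" by (intro mult_right_mono det) simp
  also have "\<dots> \<le> (exp (?g\<^sup>2 / 2) * det (X + E) ^ k) * exp (2 * pi + (A - 4 * pi * real m * qf (matrix_inv (X + E)) \<eta>))"
    using eta pos_def_det_pos[OF X'] by (intro mult_left_mono) auto
  also have "\<dots> = exp (?g\<^sup>2 / 2 + 2 * pi) * petersson_weight k m (p + q)"
    unfolding W' A_def exp_add by (simp add: exp_add[symmetric] algebra_simps)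
  finally show ?thesis .
qed

text \<open>
  The weight is replaced by the modulus of a holomorphic exponential, so that the mean value
  property on circles applies to the square.
\<close>

lemma line_submean:
  fixes p :: "'n::finite jacobi_point"
  assumes hol: "jacobi_holomorphic \<phi>"
    and line: "\<And>c. cmod c \<le> 1 \<Longrightarrow> p + jacobi_scale c q \<in> siegel_jacobi"
    and H: "\<And>q. H q = (cmod (\<phi> (p + q)))\<^sup>2 * exp (Re (weight_log k m X a q))"
  shows "ennreal ((cmod (\<phi> p))\<^sup>2) \<le> ennreal (1 / (2 * pi)) * (\<integral>\<^sup>+t. ennreal (H (jacobi_scale (cis t) q)) * indicator {0..2 * pi} t \<partial>lborel)"
proof -
  \<comment> \<open>the modulus of \<open>G\<close> on the unit circle is \<open>H\<close>\<close>
  define G where "G c = (\<phi> (p + jacobi_scale c q))\<^sup>2 * exp (c * weight_log k m X a q)" for c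
  have "(\<lambda>c. \<phi> (p + jacobi_scale c q)) holomorphic_on cball 0 1"
    by (rule line_holomorphic[OF hol]) (use line in simp)
  then have G: "G holomorphic_on cball 0 1" unfolding G_def by (intro holomorphic_intros)
  have nG: "norm (G c) = H (jacobi_scale c q)" for c
    by (simp add: G_def H norm_mult norm_power weight_log_scale)
  have "jacobi_scale 0 q = 0"
    by (cases q) (simp add: jacobi_scale_def vec_eq_iff zero_prod_def)
  then have "norm (G 0) = (cmod (\<phi> p))\<^sup>2" by (simp add: G_def norm_power)
  then show ?thesis using circle_mean[OF G] unfolding nG by simp
qed

lemma distr_linear_unimodular:
  fixes f :: "real^'m::{finite,wellorder} \<Rightarrow> real^'m::_"
  assumes f: "linear f" and det: "\<bar>det (matrix f)\<bar> = 1"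
  shows "distr lborel borel f = lborel"
proof (rule lborel_eqI[symmetric])
  have i: "invertible (matrix f)" using det by (auto simp: invertible_det_nz)
  define g where "g = (*v) (matrix_inv (matrix f))"
  have g: "linear g" unfolding g_def by simp
  have fm: "f v = matrix f *v v" for v using fun_cong[OF matrix_vector_mul(2)[OF f], of v] by simp
  have gf: "g (f v) = v" "f (g v) = v" for v
    unfolding g_def fm[of v] fm[of "matrix_inv (matrix f) *v v"] by (rule matrix_inv_mult_vec[OF i], rule mult_matrix_inv_vec[OF i])
  have "det (matrix g) = inverse (det (matrix f))" unfolding g_def by (simp add: det_matrix_inv[OF i])
  then have dg: "\<bar>det (matrix g)\<bar> = 1" using det by simp
  have fb: "f \<in> borel_measurable borel" using f by (intro borel_measurable_continuous_onI linear_continuous_on) (simp add: linear_linear)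
  fix l u :: "real^'m::_" assume lu: "\<And>b. b \<in> Basis \<Longrightarrow> l \<bullet> b \<le> u \<bullet> b"
  have vim: "f -` box l u = g ` box l u" 
  proof (intro set_eqI iffI)
    fix v assume "v \<in> f -` box l u"
    then show "v \<in> g ` box l u" by (intro image_eqI[of _ _ "f v"]) (simp_all only: gf vimage_eq)
  next
    fix v assume "v \<in> g ` box l u"
    then show "v \<in> f -` box l u" by (elim imageE) (simp only: gf vimage_eq)
  qed
  have "f -` box l u \<in> sets borel" using measurable_sets[OF fb, of "box l u"] by simp
  then have "emeasure (distr lborel borel f) (box l u) = emeasure lebesgue (g ` box l u)"
    using fb vim by (simp add: emeasure_distr)
  also have "\<dots> = ennreal (measure lebesgue (g ` box l u))"
    using measurable_linear_image[OF g lmeasurable_box] by (intro emeasure_eq_measure2)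
  also have "\<dots> = ennreal (measure lebesgue (box l u))" by (simp add: measure_linear_image[OF g lmeasurable_box] dg)
  also have "\<dots> = (\<Prod>b\<in>Basis. (u - l) \<bullet> b)" using lu by (simp add: measure_lborel_box_eq)
  finally show "emeasure (distr lborel borel f) (box l u) = (\<Prod>b\<in>Basis. (u - l) \<bullet> b)" .
qed simp

lemma sym_linear_scale: "sym_linear (jacobi_scale c)"
  unfolding sym_linear_def
proof
  show "linear (jacobi_scale c)"
    by (rule linearI) (simp_all add: jacobi_scale_def case_prod_beta vec_eq_iff algebra_simps)
  show "\<forall>p\<in>symsp. jacobi_scale c p \<in> symsp"
    by (auto simp: symsp_def jacobi_scale_def vec_eq_iff transpose_def split: prod.splits)
qed

lemma rotation_preserves:
  assumes c: "cmod c = 1"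
  shows "distr lborel borel (kconj (jacobi_scale c)) = (lborel :: (real^('n::finite jidx)) measure)"
proof (rule distr_linear_unimodular[OF linear_kconj[OF sym_linear_scale]])
  have "norm (c *s v) = norm v" for v :: "complex^'n" using c by (simp add: norm_vec_def norm_mult)
  moreover have "norm (map_matrix ((*) c) S) = norm S" for S :: "complex^'n^'n"
    using c by (simp add: norm_vec_def norm_mult)
  ultimately have "norm (jacobi_scale c p) = norm p" for p :: "'n jacobi_point"
    by (cases p) (simp add: jacobi_scale_def norm_Pair)
  then have "jac (jacobi_scale c :: 'n jacobi_point \<Rightarrow> _) = 1" by (intro jac_isometry sym_linear_scale)
  then show "\<bar>det (matrix (kconj (jacobi_scale c :: 'n jacobi_point \<Rightarrow> _)))\<bar> = 1" by (simp add: jac_def)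
qed

lemma closed_pdisc: "closed (kap -` pdisc \<rho> k m d a)"
proof -
  have 1: "continuous_on UNIV (\<lambda>v. fst (kap v) $ i $ j)" for i j :: 'a by (intro continuous_intros continuous_kap)
  have 2: "continuous_on UNIV (\<lambda>v. snd (kap v) $ i)" for i :: 'a by (intro continuous_intros continuous_kap)
  have "kap -` pdisc \<rho> k m d a = {v. (\<forall>i j. cmod (fst (kap v) $ i $ j) \<le> \<rho> * sqrt (d i) * sqrt (d j) / sqrt (real k))
     \<and> (\<forall>i. cmod (snd (kap v) $ i - (\<Sum>j\<in>UNIV. fst (kap v) $ i $ j * cv a $ j)) \<le> \<rho> * sqrt (d i) / sqrt (real m))}"
    using kap_in by (auto simp: pdisc_def symsp_def matrix_vector_mult_def)
  also have "closed \<dots>"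
    by (intro closed_Collect_conj closed_Collect_all closed_Collect_le continuous_intros 1 2)
  finally show ?thesis .
qed

lemma continuous_weight_log: "continuous_on A (\<lambda>v. weight_log k m X a (kap v))"
proof -
  have 1: "continuous_on A (\<lambda>v. fst (kap v) $ i $ j)" for i j :: 'a by (intro continuous_intros continuous_kap)
  have 2: "continuous_on A (\<lambda>v. snd (kap v) $ i)" for i :: 'a by (intro continuous_intros continuous_kap)
  have 3: "continuous_on A (\<lambda>v. trace (cr Y ** fst (kap v)))" for Y :: "real^'a^'a"
    unfolding trace_def matrix_matrix_mult_def vec_lambda_beta
    by (intro continuous_on_sum continuous_on_mult continuous_on_const 1)
  have 4: "continuous_on A (\<lambda>v. bidot (cv a) (snd (kap v)))"
    unfolding bidot_def by (intro continuous_on_sum continuous_on_mult continuous_on_const 2)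
  have 5: "continuous_on A (\<lambda>v. bidot (cv a) (fst (kap v) *v cv a))"
    unfolding bidot_def matrix_vector_mult_def vec_lambda_beta
    by (intro continuous_on_sum continuous_on_mult continuous_on_const 1)
  show ?thesis unfolding weight_log_def
    by (intro continuous_on_mult continuous_on_diff continuous_on_const 3 4 5)
qed

lemma continuous_jacobi_holomorphic: "jacobi_holomorphic \<phi> \<Longrightarrow> continuous_on siegel_jacobi \<phi>"
  unfolding jacobi_holomorphic_def continuous_on_eq_continuous_within by (meson has_derivative_continuous)

lemma continuous_rotation: "continuous_on UNIV (\<lambda>x. kconj (jacobi_scale (cis (fst x))) (snd x))"
proof -
  have 1: "continuous_on UNIV (\<lambda>x :: real \<times> (real^('a jidx)). fst (kap (snd x)) $ i $ j)" for i j :: 'a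
    by (intro continuous_intros continuous_on_compose2[OF continuous_kap[of UNIV]]) auto
  have 2: "continuous_on UNIV (\<lambda>x :: real \<times> (real^('a jidx)). snd (kap (snd x)) $ i)" for i :: 'a
    by (intro continuous_intros continuous_on_compose2[OF continuous_kap[of UNIV]]) auto
  have "continuous_on UNIV (\<lambda>x :: real \<times> (real^('a jidx)). jacobi_scale (cis (fst x)) (kap (snd x)))"
    unfolding jacobi_scale_def case_prod_beta map_matrix_def vector_scalar_mult_def
    by (intro continuous_intros 1 2)
  from bounded_linear.continuous_on[OF bounded_linear_kinv this] show ?thesis unfolding kconj_def .
qed

text \<open>
  Average the inequality on complex lines over the polydisc. Rotation by a scalar of modulus 1 preserves the
  polydisc and Lebesgue measure, so after exchanging the integrals every angle contributes the same
  amount. The function \<open>h\<close> and the constant \<open>A\<close> allow for the change to the invariant density.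
\<close>

lemma submean_integral:
  fixes p :: "'n::finite jacobi_point"
  assumes hol: "jacobi_holomorphic \<phi>" and p: "p \<in> siegel_jacobi" and d: "\<And>i. d i > 0"
    and c: "comparable K d (im_mat (fst p))" and K: "K \<ge> 1" and k: "k \<ge> 1" and m: "m \<ge> 1"
  defines "X \<equiv> im_mat (fst p)"
  defines "a \<equiv> matrix_inv X *v im_vec (snd p)"
  defines "D \<equiv> kap -` pdisc (1 / (2 * real CARD('n) * K)) k m d a"
  assumes A: "A > 0" "\<And>v. v - kinv p \<in> D \<Longrightarrow> petersson_norm_sq k m \<phi> (kap v) \<le> A * h v"
  shows "ennreal (petersson_norm_sq k m \<phi> p) * emeasure lborel D
    \<le> ennreal (exp ((real CARD('n))\<^sup>2 / 2 + 2 * pi) * A) * (\<integral>\<^sup>+v. ennreal (h v) * indicator {v. v - kinv p \<in> D} v \<partial>lborel)"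
proof -
  define w where "w = petersson_weight k m p"
  have w0: "w > 0" unfolding w_def by (rule petersson_weight_pos[OF p])
  define H where "H q = (cmod (\<phi> (p + q)))\<^sup>2 * exp (Re (weight_log k m X a q))" for q
  define C0 where "C0 = exp ((real CARD('n))\<^sup>2 / 2 + 2 * pi)"
  have C0: "C0 > 0" by (simp add: C0_def)
  let ?R = "\<lambda>t. kconj (jacobi_scale (cis t)) :: real^('n jidx) \<Rightarrow> _"
  define Hd where "Hd v = ennreal (H (kap v)) * indicator D v" for v
  have Db: "D \<in> sets borel" unfolding D_def by (intro borel_closed closed_pdisc)
  have in_D: "p + kap v \<in> siegel_jacobi" if "v \<in> D" for v
    using pdisc_shift(1)[OF p d c K k] that unfolding D_def by blast
  have "continuous_on D (\<lambda>v. H (kap v))"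
    unfolding H_def
    by (intro continuous_intros continuous_on_compose2[OF continuous_jacobi_holomorphic[OF hol]] continuous_weight_log continuous_kap)
       (use in_D in auto)
  then have "(\<lambda>v. indicator D v *\<^sub>R H (kap v)) \<in> borel_measurable borel"
    by (rule borel_measurable_continuous_on_indicator[OF Db])
  moreover have "Hd = (\<lambda>v. ennreal (indicator D v *\<^sub>R H (kap v)))"
    by (auto simp: Hd_def fun_eq_iff indicator_def)
  ultimately have Hm [measurable]: "Hd \<in> borel_measurable borel" by simp
  have rotm: "(\<lambda>x. ?R (fst x) (snd x)) \<in> borel_measurable (borel \<Otimes>\<^sub>M borel)"
    unfolding borel_prod by (rule borel_measurable_continuous_onI[OF continuous_rotation])
  have rotm1: "?R t \<in> borel_measurable borel" for t
    using linear_kconj[OF sym_linear_scale, of "cis t"] by (intro borel_measurable_continuous_onI linear_continuous_on) (simp add: linear_linear)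
  have kR: "kap (?R t v) = jacobi_scale (cis t) (kap v)" for t v by (rule kap_kconj[OF sym_linear_scale])
  have circled: "?R t v \<in> D" if "v \<in> D" for t v
    using pdisc_circled[of "kap v" _ k m d a "cis t"] that unfolding D_def by (simp add: kR)
  define J where "J x = ennreal (1 / (2 * pi)) * (Hd (?R (fst x) (snd x)) * indicator {0..2 * pi} (fst x))" for x
  have Jm: "J \<in> borel_measurable (lborel \<Otimes>\<^sub>M lborel)"
  proof -
    have "(\<lambda>x. Hd (?R (fst x) (snd x))) \<in> borel_measurable (borel \<Otimes>\<^sub>M borel)"
      by (rule measurable_compose[OF rotm Hm])
    moreover have "(\<lambda>x :: real \<times> (real^('n jidx)). indicator {0..2 * pi} (fst x) :: ennreal) \<in> borel_measurable (borel \<Otimes>\<^sub>M borel)"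
      by measurable
    moreover have "sets (lborel \<Otimes>\<^sub>M lborel) = sets ((borel :: real measure) \<Otimes>\<^sub>M (borel :: (real^('n jidx)) measure))"
      by (intro sets_pair_measure_cong) auto
    ultimately show ?thesis unfolding J_def by (subst measurable_cong_sets[OF _ refl]) auto
  qed
  have "ennreal ((cmod (\<phi> p))\<^sup>2) * emeasure lborel D = (\<integral>\<^sup>+v. ennreal ((cmod (\<phi> p))\<^sup>2) * indicator D v \<partial>lborel)"
    using Db by (simp add: nn_integral_cmult_indicator)
  also have "\<dots> \<le> (\<integral>\<^sup>+v. \<integral>\<^sup>+t. J (t, v) \<partial>lborel \<partial>lborel)"
  proof (rule nn_integral_mono)
    fix v :: "real^('n jidx)"
    show "ennreal ((cmod (\<phi> p))\<^sup>2) * indicator D v \<le> (\<integral>\<^sup>+t. J (t, v) \<partial>lborel)"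
    proof (cases "v \<in> D")
      case True
      have line: "p + jacobi_scale c (kap v) \<in> siegel_jacobi" if "cmod c \<le> 1" for c
        using True unfolding D_def by (intro pdisc_shift(1)[OF p d c K k] pdisc_circled that) auto
      have "ennreal ((cmod (\<phi> p))\<^sup>2) \<le> ennreal (1 / (2 * pi)) * (\<integral>\<^sup>+t. ennreal (H (jacobi_scale (cis t) (kap v))) * indicator {0..2 * pi} t \<partial>lborel)"
        by (rule line_submean[OF hol line H_def])
      also have "\<dots> = ennreal (1 / (2 * pi)) * (\<integral>\<^sup>+t. Hd (?R t v) * indicator {0..2 * pi} t \<partial>lborel)"
        unfolding Hd_def kR using circled[OF True] by simp
      also have "\<dots> = (\<integral>\<^sup>+t. J (t, v) \<partial>lborel)"
        unfolding J_def fst_conv snd_conv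
      proof (rule nn_integral_cmult[symmetric])
        have "(\<lambda>t. (t, v)) \<in> borel_measurable borel" by (intro borel_measurable_continuous_onI continuous_intros)
        from measurable_compose[OF this rotm[unfolded borel_prod]]
        have "(\<lambda>t. ?R t v) \<in> borel_measurable borel" unfolding fst_conv snd_conv .
        from measurable_compose[OF this Hm]
        have "(\<lambda>t. Hd (?R t v)) \<in> borel_measurable borel" .
        then show "(\<lambda>t. Hd (?R t v) * indicator {0..2 * pi} t) \<in> borel_measurable lborel" by simp
      qed
      finally show ?thesis using True by simp
    qed simp
  qed
  also have "\<dots> = (\<integral>\<^sup>+t. \<integral>\<^sup>+v. J (t, v) \<partial>lborel \<partial>lborel)" using lborel_pair.Fubini'[where f = "\<lambda>t v. J (t, v)"] Jm by simp
  also have "\<dots> = (\<integral>\<^sup>+t. (\<integral>\<^sup>+v. Hd v \<partial>lborel) * (ennreal (1 / (2 * pi)) * indicator {0..2 * pi} (t :: real)) \<partial>lborel)"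
  proof (rule nn_integral_cong)
    fix t :: real
    have "(\<lambda>v. Hd (?R t v)) \<in> borel_measurable borel" by (rule measurable_compose[OF rotm1 Hm])
    then have "(\<integral>\<^sup>+v. J (t, v) \<partial>lborel) = (\<integral>\<^sup>+v. Hd (?R t v) \<partial>lborel) * (ennreal (1 / (2 * pi)) * indicator {0..2 * pi} t)"
      unfolding J_def fst_conv snd_conv by (subst nn_integral_multc[symmetric]) (simp_all only: mult_ac measurable_lborel2)
    also have "(\<integral>\<^sup>+v. Hd (?R t v) \<partial>lborel) = (\<integral>\<^sup>+v. Hd v \<partial>distr lborel borel (?R t))"
      using rotm1[of t] by (subst nn_integral_distr) auto
    also have "\<dots> = (\<integral>\<^sup>+v. Hd v \<partial>lborel)" by (subst rotation_preserves) auto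
    finally show "(\<integral>\<^sup>+v. J (t, v) \<partial>lborel) = (\<integral>\<^sup>+v. Hd v \<partial>lborel) * (ennreal (1 / (2 * pi)) * indicator {0..2 * pi} t)" .
  qed
  also have "\<dots> = (\<integral>\<^sup>+v. Hd v \<partial>lborel) * (ennreal (1 / (2 * pi)) * ennreal (2 * pi))"
    by (subst nn_integral_cmult, simp, subst nn_integral_cmult_indicator) simp_all
  also have "ennreal (1 / (2 * pi)) * ennreal (2 * pi) = 1" by (subst ennreal_mult[symmetric]) auto
  finally have 1: "ennreal ((cmod (\<phi> p))\<^sup>2) * emeasure lborel D \<le> (\<integral>\<^sup>+v. Hd v \<partial>lborel)" by simp
  have "ennreal (petersson_norm_sq k m \<phi> p) * emeasure lborel D = ennreal w * (ennreal ((cmod (\<phi> p))\<^sup>2) * emeasure lborel D)"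
    using w0 unfolding petersson_norm_sq_def w_def[symmetric] by (simp add: ennreal_mult mult_ac)
  also have "\<dots> \<le> ennreal w * (\<integral>\<^sup>+v. Hd v \<partial>lborel)" by (intro mult_left_mono 1) simp
  also have "(\<integral>\<^sup>+v. Hd v \<partial>lborel) = (\<integral>\<^sup>+v. Hd (v - kinv p) \<partial>lborel)"
  proof -
    have "(\<integral>\<^sup>+v. Hd v \<partial>lborel) = (\<integral>\<^sup>+v. Hd v \<partial>distr lborel borel ((+) (- kinv p)))"
      by (simp only: lborel_distr_plus)
    also have "\<dots> = (\<integral>\<^sup>+v. Hd (v - kinv p) \<partial>lborel)" by (subst nn_integral_distr) simp_all
    finally show ?thesis .
  qed
  also have "ennreal w * (\<integral>\<^sup>+v. Hd (v - kinv p) \<partial>lborel) = ennreal (C0 * A) * (\<integral>\<^sup>+v. ennreal (w / (C0 * A)) * Hd (v - kinv p) \<partial>lborel)"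
    using w0 C0 A(1) by (subst nn_integral_cmult) (simp_all add: mult.assoc[symmetric] ennreal_mult[symmetric])
  also have "\<dots> \<le> ennreal (C0 * A) * (\<integral>\<^sup>+v. ennreal (h v) * indicator {v. v - kinv p \<in> D} v \<partial>lborel)"
  proof (intro mult_left_mono nn_integral_mono)
    fix v :: "real^('n jidx)"
    let ?v = "v - kinv p"
    show "ennreal (w / (C0 * A)) * Hd ?v \<le> ennreal (h v) * indicator {v. v - kinv p \<in> D} v"
    proof (cases "?v \<in> D")
      case True
      have pv: "p + kap ?v = kap v" by (simp add: linear_diff[OF linear_kap] kap_kinv[OF siegel_jacobi_symsp[OF p]])
      have "w * exp (Re (weight_log k m X a (kap ?v))) \<le> C0 * petersson_weight k m (p + kap ?v)"
        using weight_compare[OF p d c K k m] True unfolding w_def X_def a_def D_def C0_def by blast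
      then have "w * H (kap ?v) \<le> C0 * petersson_norm_sq k m \<phi> (kap v)"
        unfolding H_def petersson_norm_sq_def pv
        using mult_left_mono[of "w * exp (Re (weight_log k m X a (kap ?v)))" "C0 * petersson_weight k m (kap v)" "(cmod (\<phi> (kap v)))\<^sup>2"]
        by (simp add: mult_ac)
      also have "\<dots> \<le> C0 * (A * h v)" using A(2)[OF True] C0 by simp
      finally have "w / (C0 * A) * H (kap ?v) \<le> h v" using C0 A(1) by (simp add: field_simps)
      then have "ennreal (w / (C0 * A) * H (kap ?v)) \<le> ennreal (h v)" by (rule ennreal_leI)
      moreover have "ennreal (w / (C0 * A) * H (kap ?v)) = ennreal (w / (C0 * A)) * ennreal (H (kap ?v))"
        by (rule ennreal_mult') (use w0 C0 A(1) in simp)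
      ultimately show ?thesis using True by (simp add: Hd_def)
    qed (simp add: Hd_def)
  qed simp
  finally show ?thesis unfolding C0_def .
qed

lemma ent_scale: "ent (\<lambda>l j. c * F l j) s = c * (ent F s :: real)"
  by (simp add: ent_def case_prod_beta)

text \<open>
  Read off from the exponents of 2 in the product over unordered pairs.
\<close>

lemma card_sym_coords: "2 * card (sym_coords :: 'n::finite set set) = CARD('n) * (CARD('n) + 1)"
proof -
  have "ent (\<lambda>l j :: 'n. 2 * 2 :: real) s = 2 ^ 2" for s by (simp add: ent_def case_prod_beta)
  then have "(2 :: real) ^ (2 * card (sym_coords :: 'n set set)) = 2 ^ (CARD('n) * (CARD('n) + 1))"
    using prod_sym_coords_product[of "\<lambda>_ :: 'n. 2"] by (simp only: prod_constant power_mult)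
  then show ?thesis by simp
qed

text \<open>
  A shear of volume 1 carries a box into the polydisc. Each index occurs \<open>g + 1\<close> times among the
  unordered pairs, which yields the exponent \<open>g + 2\<close> of the invariant measure.
\<close>

lemma pdisc_volume:
  fixes d :: "'n::finite \<Rightarrow> real"
  assumes \<rho>: "\<rho> > 0" and d: "\<And>i. d i > 0" and k: "k \<ge> 1" and m: "m \<ge> 1"
  shows "ennreal ((\<rho>\<^sup>2 / real k) ^ card (sym_coords :: 'n set set) * (\<rho>\<^sup>2 / real m) ^ CARD('n) * (\<Prod>i\<in>UNIV. d i) ^ (CARD('n) + 2))
    \<le> emeasure lborel (kap -` pdisc \<rho> k m d a)"
proof -
  let ?cs = "card (sym_coords :: 'n set set)"
  define F where "F l j = \<rho> / sqrt (real k) * (sqrt (d l) * sqrt (d j))" for l j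
  define G where "G n = \<rho> / sqrt (real m) * sqrt (d n)" for n
  define fac where "fac L = (case L of Inl (Inl s) \<Rightarrow> ent F s | Inl (Inr s) \<Rightarrow> ent F s | Inr (Inl n) \<Rightarrow> G n | Inr (Inr n) \<Rightarrow> G n)" for L :: "'n label"
  define w :: "real^('n jidx)" where "w = (\<chi> c. fac (lab c) / 2)"
  have F0: "F l j > 0" "F l j = F j l" for l j using \<rho> d[of l] d[of j] k by (simp_all add: F_def)
  have G0: "G n > 0" for n using \<rho> d[of n] m by (simp add: G_def)
  have eF: "ent F {l, j} = F l j" for l j by (rule ent_eq) (rule F0)
  have fac0: "fac (lab c) \<ge> 0" for c :: "'n jidx"
    using lab_in[of c] F0(1) G0 by (auto simp: fac_def coord_labels_def sym_coords_def eF less_imp_le split: sum.split)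
  define sh :: "'n jacobi_point \<Rightarrow> 'n jacobi_point" where "sh = (\<lambda>(S, Z). (S, Z + S *v cv a))"
  have lin: "linear (\<lambda>S :: complex^'n^'n. S *v cv a)"
    by (rule linearI) (simp_all add: matrix_vector_mult_add_rdistrib scaleR_matrix_vector)
  have slin: "sym_linear sh"
    unfolding sym_linear_def sh_def
  proof
    show "linear (\<lambda>(S :: complex^'n^'n, Z). (S, Z + S *v cv a))"
      by (rule linearI) (simp_all add: case_prod_beta matrix_vector_mult_add_rdistrib scaleR_matrix_vector algebra_simps)
    show "\<forall>p\<in>symsp. (case p of (S, Z) \<Rightarrow> (S, Z + S *v cv a)) \<in> symsp" by (auto simp: symsp_def)
  qed
  have sub: "kconj sh ` cbox (- w) w \<subseteq> kap -` pdisc \<rho> k m d a"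
  proof
    fix u assume "u \<in> kconj sh ` cbox (- w) w"
    then obtain v where v: "v \<in> cbox (- w) w" and u: "u = kconj sh v" by blast
    have vc: "\<bar>v $ c\<bar> \<le> fac (lab c) / 2" for c
    proof -
      have "- (fac (lab c) / 2) \<le> v $ c" "v $ c \<le> fac (lab c) / 2" using v unfolding mem_box_cart w_def by auto
      then show ?thesis by linarith
    qed
    have Sb: "cmod (fst (kap v) $ i $ j) \<le> F i j" for i j
      using cmod_le[of "fst (kap v) $ i $ j"] vc[of "pos (Inl (Inl {i, j}))"] vc[of "pos (Inl (Inr {i, j}))"]
      by (simp add: kap_def lab_pos fac_def eF)
    have Zb: "cmod (snd (kap v) $ i) \<le> G i" for i
      using cmod_le[of "snd (kap v) $ i"] vc[of "pos (Inr (Inl i))"] vc[of "pos (Inr (Inr i))"]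
      by (simp add: kap_def lab_pos fac_def)
    have "kap u = sh (kap v)" unfolding u by (rule kap_kconj[OF slin])
    then show "u \<in> kap -` pdisc \<rho> k m d a"
      using Sb Zb kap_in[of v] by (simp add: pdisc_def sh_def case_prod_beta symsp_def F_def G_def mult_ac)
  qed
  have det1: "\<bar>det (matrix (kconj sh))\<bar> = 1" using jac_shear[OF lin] unfolding jac_def sh_def .
  have ne: "cbox (- w) w \<noteq> {}" using fac0 by (simp add: interval_ne_empty_cart w_def order_trans[of _ 0])
  have "measure lebesgue (kconj sh ` cbox (- w) w) = measure lebesgue (cbox (- w) w)"
    unfolding measure_linear_image[OF linear_kconj[OF slin] lmeasurable_cbox] det1 by simp
  also have "\<dots> = (\<Prod>c\<in>UNIV. fac (lab c))" using content_cbox_cart[OF ne] by (simp add: w_def)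
  also have "\<dots> = (\<Prod>s\<in>sym_coords. ent F s)\<^sup>2 * (\<Prod>n\<in>UNIV. G n)\<^sup>2"
    unfolding prod_jidx by (simp add: fac_def power2_eq_square)
  also have "(\<Prod>s\<in>(sym_coords :: 'n set set). ent F s) = (\<rho> / sqrt (real k)) ^ ?cs * (\<Prod>i\<in>UNIV. sqrt (d i)) ^ (CARD('n) + 1)"
    unfolding F_def ent_scale prod.distrib prod_sym_coords_product by (simp only: prod_constant)
  also have "(\<Prod>n\<in>UNIV. G n) = (\<rho> / sqrt (real m)) ^ CARD('n) * (\<Prod>i\<in>UNIV. sqrt (d i))"
    unfolding G_def prod.distrib by (simp only: prod_constant)
  also have "((\<rho> / sqrt (real k)) ^ ?cs * (\<Prod>i\<in>UNIV. sqrt (d i)) ^ (CARD('n) + 1))\<^sup>2 * ((\<rho> / sqrt (real m)) ^ CARD('n) * (\<Prod>i\<in>UNIV. sqrt (d i)))\<^sup>2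
    = ((\<rho> / sqrt (real k))\<^sup>2) ^ ?cs * ((\<rho> / sqrt (real m))\<^sup>2) ^ CARD('n) * ((\<Prod>i\<in>UNIV. sqrt (d i))\<^sup>2) ^ (CARD('n) + 2)"
    by (simp add: power_mult_distrib power_mult[symmetric] mult.commute[of _ "2 :: nat"] power_add[symmetric]) (simp add: power2_eq_square power_mult algebra_simps power_add)
  also have "(\<Prod>i\<in>UNIV. sqrt (d i))\<^sup>2 = (\<Prod>i\<in>UNIV. d i)"
    unfolding prod_power_distrib using less_imp_le[OF d] by simp
  finally have m: "measure lebesgue (kconj sh ` cbox (- w) w) = (\<rho>\<^sup>2 / real k) ^ ?cs * (\<rho>\<^sup>2 / real m) ^ CARD('n) * (\<Prod>i\<in>UNIV. d i) ^ (CARD('n) + 2)"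
    by (simp add: power_divide)
  have "emeasure lebesgue (kconj sh ` cbox (- w) w) = ennreal (measure lebesgue (kconj sh ` cbox (- w) w))"
    using measurable_linear_image[OF linear_kconj[OF slin] lmeasurable_cbox] by (intro emeasure_eq_measure2)
  moreover have "emeasure lebesgue (kconj sh ` cbox (- w) w) \<le> emeasure lebesgue (kap -` pdisc \<rho> k m d a)"
    by (rule emeasure_mono[OF sub]) (simp add: closed_pdisc borel_closed)
  ultimately show ?thesis unfolding m by (simp add: closed_pdisc borel_closed)
qed

text \<open>
  The powers of the \<open>d i\<close> in the volume and in the invariant density cancel; only the powers of \<open>k\<close> and \<open>m\<close>
  from the radii remain.
\<close>

lemma submean_bound:
  fixes p :: "'n::finite jacobi_point"
  assumes hol: "jacobi_holomorphic \<phi>" and p: "p \<in> siegel_jacobi" and d: "\<And>i. d i > 0"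
    and c: "comparable K d (im_mat (fst p))" and K: "K \<ge> 1" and k: "k \<ge> 1" and m: "m \<ge> 1"
  defines "\<rho> \<equiv> 1 / (2 * real CARD('n) * K)"
  defines "a \<equiv> matrix_inv (im_mat (fst p)) *v im_vec (snd p)"
  defines "h \<equiv> \<lambda>v. petersson_norm_sq k m \<phi> (kap v) / det (im_mat (fst (kap v))) ^ (CARD('n) + 2)"
  shows "ennreal (petersson_norm_sq k m \<phi> p)
    \<le> ennreal (exp ((real CARD('n))\<^sup>2 / 2 + 2 * pi) * ((2 * K) ^ CARD('n)) ^ (CARD('n) + 2)
         / (\<rho>\<^sup>2) ^ (card (sym_coords :: 'n set set) + CARD('n))
         * (real k ^ card (sym_coords :: 'n set set) * real m ^ CARD('n)))
      * (\<integral>\<^sup>+v. ennreal (h v) * indicator {v. v - kinv p \<in> kap -` pdisc \<rho> k m d a} v \<partial>lborel)"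
proof -
  let ?g = "CARD('n)" and ?cs = "card (sym_coords :: 'n set set)"
  define C0 where "C0 = exp ((real ?g)\<^sup>2 / 2 + 2 * pi)"
  define P where "P = (\<Prod>i\<in>UNIV. d i)"
  define V where "V = (\<rho>\<^sup>2 / real k) ^ ?cs * (\<rho>\<^sup>2 / real m) ^ ?g * P ^ (?g + 2)"
  define A where "A = ((2 * K) ^ ?g * P) ^ (?g + 2)"
  have P0: "P > 0" unfolding P_def using d by (intro prod_pos) auto
  have \<rho>0: "\<rho> > 0" using K by (simp add: \<rho>_def)
  have V0: "V > 0" unfolding V_def using P0 \<rho>0 k m by simp
  have A0: "A > 0" unfolding A_def using K P0 by simp
  have hA: "petersson_norm_sq k m \<phi> (kap v) \<le> A * h v" if v: "v - kinv p \<in> kap -` pdisc \<rho> k m d a" for v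
  proof -
    have pv: "p + kap (v - kinv p) = kap v" by (simp add: linear_diff[OF linear_kap] kap_kinv[OF siegel_jacobi_symsp[OF p]])
    have q: "kap (v - kinv p) \<in> pdisc (1 / (2 * real CARD('n) * K)) k m d a" using v unfolding \<rho>_def by simp
    note sh = pdisc_shift(1,2)[OF p d c K k q, unfolded pv]
    let ?X = "im_mat (fst (kap v))"
    have X: "pos_def ?X" using sh(1) siegelD(2) unfolding siegel_jacobi_def mem_Times_iff by blast
    have "det ?X \<le> (2 * K) ^ ?g * P" unfolding P_def by (rule comparable_det(1)[OF X d sh(2)]) (use K in simp)
    then have "det ?X ^ (?g + 2) \<le> A" unfolding A_def using pos_def_det_pos[OF X] by (intro power_mono) auto
    moreover have "0 \<le> h v" unfolding h_def petersson_norm_sq_def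
      using pos_def_det_pos[OF X] petersson_weight_pos[OF sh(1), of k m] by simp
    ultimately have "det ?X ^ (?g + 2) * h v \<le> A * h v" by (rule mult_right_mono)
    moreover have "det ?X ^ (?g + 2) * h v = petersson_norm_sq k m \<phi> (kap v)"
      unfolding h_def using pos_def_det_pos[OF X] by simp
    ultimately show ?thesis by simp
  qed
  let ?I = "\<integral>\<^sup>+v. ennreal (h v) * indicator {v. v - kinv p \<in> kap -` pdisc \<rho> k m d a} v \<partial>lborel"
  have "ennreal (petersson_norm_sq k m \<phi> p) * ennreal V \<le> ennreal (petersson_norm_sq k m \<phi> p) * emeasure lborel (kap -` pdisc \<rho> k m d a)"
    unfolding V_def P_def by (intro mult_left_mono pdisc_volume \<rho>0 d k m) simp
  also have "\<dots> \<le> ennreal (C0 * A) * ?I"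
    unfolding C0_def \<rho>_def a_def by (rule submean_integral[OF hol p d c K k m A0]) (rule hA[unfolded \<rho>_def a_def])
  finally have le: "ennreal (petersson_norm_sq k m \<phi> p) * ennreal V \<le> ennreal (C0 * A) * ?I" .
  have "ennreal (petersson_norm_sq k m \<phi> p) = ennreal (petersson_norm_sq k m \<phi> p) * ennreal V * ennreal (1 / V)"
    using V0 by (simp add: mult.assoc ennreal_mult[symmetric])
  also have "\<dots> \<le> ennreal (C0 * A) * ?I * ennreal (1 / V)" by (rule mult_right_mono[OF le]) simp
  also have "\<dots> = ennreal (C0 * A / V) * ?I"
  proof -
    have "ennreal (C0 * A / V) = ennreal (C0 * A) * ennreal (1 / V)"
      using V0 A0 by (subst ennreal_mult[symmetric]) (simp_all add: C0_def)
    then show ?thesis by (simp only: mult_ac)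
  qed
  also have "C0 * A / V = C0 * ((2 * K) ^ ?g) ^ (?g + 2) / (\<rho>\<^sup>2) ^ (?cs + ?g) * (real k ^ ?cs * real m ^ ?g)"
    unfolding A_def V_def power_divide power_mult_distrib[of _ P] power_add[of "\<rho>\<^sup>2" ?cs]
    using P0 \<rho>0 k m by (simp add: field_simps)
  finally show ?thesis unfolding C0_def .
qed

section \<open>Counting group elements\<close>

lemma int_spread:
  fixes V :: "int set"
  assumes V: "\<And>a b. a \<in> V \<Longrightarrow> b \<in> V \<Longrightarrow> real_of_int \<bar>a - b\<bar> \<le> R" and R: "R \<ge> 0"
  shows "finite V \<and> real (card V) \<le> R + 1"
proof (cases "V = {}")
  case True then show ?thesis using R by simp
next
  case False
  then obtain a where a: "a \<in> V" by blast
  have fl: "\<bar>x - y\<bar> \<le> \<lfloor>R\<rfloor>" if "x \<in> V" "y \<in> V" for x y using V[OF that] by (simp add: le_floor_iff)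
  have "V \<subseteq> {a - \<lfloor>R\<rfloor>..a + \<lfloor>R\<rfloor>}"
  proof
    fix x assume "x \<in> V"
    from fl[OF a this] show "x \<in> {a - \<lfloor>R\<rfloor>..a + \<lfloor>R\<rfloor>}" unfolding atLeastAtMost_iff by linarith
  qed
  then have fin: "finite V" by (rule finite_subset) simp
  have "V \<subseteq> {Min V..Min V + \<lfloor>R\<rfloor>}"
  proof
    fix x assume x: "x \<in> V"
    from fl[OF this Min_in[OF fin False]] Min_le[OF fin x]
    show "x \<in> {Min V..Min V + \<lfloor>R\<rfloor>}" unfolding atLeastAtMost_iff by linarith
  qed
  then have "card V \<le> card {Min V..Min V + \<lfloor>R\<rfloor>}" by (rule card_mono[rotated]) simp
  then have "real (card V) \<le> real (nat (\<lfloor>R\<rfloor> + 1))" unfolding of_nat_le_iff by simp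
  also have "\<dots> = real_of_int (\<lfloor>R\<rfloor> + 1)" using R by simp
  finally have "real (card V) \<le> real_of_int (\<lfloor>R\<rfloor> + 1)" .
  then show ?thesis using fin by linarith
qed

lemma card_fibers:
  assumes V: "finite (f ` T)" "real (card (f ` T)) \<le> A"
    and fib: "\<And>x. x \<in> T \<Longrightarrow> finite {y \<in> T. f y = f x} \<and> real (card {y \<in> T. f y = f x}) \<le> N" and N: "N \<ge> 0"
  shows "finite T \<and> real (card T) \<le> A * N"
proof
  have T: "T = (\<Union>v\<in>f ` T. {y \<in> T. f y = v})" by auto
  show "finite T" by (subst T, rule finite_UN_I[OF V(1)]) (use fib in auto)
  have "card T \<le> (\<Sum>v\<in>f ` T. card {y \<in> T. f y = v})" by (subst T, rule card_UN_le[OF V(1)])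
  then have "real (card T) \<le> (\<Sum>v\<in>f ` T. real (card {y \<in> T. f y = v}))" by (metis of_nat_le_iff of_nat_sum)
  also have "\<dots> \<le> (\<Sum>v\<in>f ` T. N)" using fib by (intro sum_mono) auto
  also have "\<dots> \<le> A * N" using V(2) N by (simp add: mult_right_mono)
  finally show "real (card T) \<le> A * N" .
qed

text \<open>
  Coordinates in finitely many steps: for each coordinate the values lie in an interval of length
  \<open>R i\<close>. The hypotheses compare two elements at a time, so no base point has to be specified.
\<close>

lemma int_fibers:
  fixes f :: "'x \<Rightarrow> 'i \<Rightarrow> int"
  assumes I: "finite I" and R: "\<And>i. i \<in> I \<Longrightarrow> R i \<ge> 0" and N: "N \<ge> 0"
    and f: "\<And>x y i. x \<in> T \<Longrightarrow> y \<in> T \<Longrightarrow> i \<in> I \<Longrightarrow> real_of_int \<bar>f x i - f y i\<bar> \<le> R i"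
    and fib: "\<And>x. x \<in> T \<Longrightarrow> finite {y \<in> T. \<forall>i\<in>I. f y i = f x i} \<and> real (card {y \<in> T. \<forall>i\<in>I. f y i = f x i}) \<le> N"
  shows "finite T \<and> real (card T) \<le> (\<Prod>i\<in>I. R i + 1) * N"
  using I R f fib
proof (induction I arbitrary: T rule: finite_induct)
  case empty
  then show ?case
  proof (cases "T = {}")
    case False
    then obtain x where "x \<in> T" by blast
    from empty.prems(3)[OF this] show ?thesis by simp
  qed (use N in simp)
next
  case (insert i I)
  have V: "finite ((\<lambda>x. f x i) ` T) \<and> real (card ((\<lambda>x. f x i) ` T)) \<le> R i + 1"
    by (rule int_spread) (use insert.prems(1,2) in auto)
  have F: "finite {y \<in> T. f y i = f x i} \<and> real (card {y \<in> T. f y i = f x i}) \<le> (\<Prod>i\<in>I. R i + 1) * N"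
    if x: "x \<in> T" for x
  proof (rule insert.IH)
    fix x' assume x': "x' \<in> {y \<in> T. f y i = f x i}"
    have "{y \<in> {y \<in> T. f y i = f x i}. \<forall>j\<in>I. f y j = f x' j} = {y \<in> T. \<forall>j\<in>insert i I. f y j = f x' j}"
      using x' by auto
    then show "finite {y \<in> {y \<in> T. f y i = f x i}. \<forall>j\<in>I. f y j = f x' j}
        \<and> real (card {y \<in> {y \<in> T. f y i = f x i}. \<forall>j\<in>I. f y j = f x' j}) \<le> N"
      using insert.prems(3)[of x'] x' by simp
  qed (use insert.prems(1,2) in auto)
  have "0 \<le> (\<Prod>i\<in>I. R i + 1) * N" using insert.prems(1) N by (intro mult_nonneg_nonneg prod_nonneg) force+
  from card_fibers[OF conjunct1[OF V] conjunct2[OF V] F this]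
  have "finite T \<and> real (card T) \<le> (R i + 1) * ((\<Prod>i\<in>I. R i + 1) * N)" .
  then show ?case using insert.hyps by (simp add: mult.assoc)
qed

text \<open>
  Then \<open>L' L\<^sup>-\<^sup>1\<close> has lower rows \<open>(0, 1)\<close>, hence is a translation.
\<close>

lemma symplectic_same_lower_rows:
  fixes L L' :: "int^('n::finite+'n)^('n+'n)"
  assumes L: "L \<in> Sp_int" and L': "L' \<in> Sp_int" and eq: "blk_C L' = blk_C L" "blk_D L' = blk_D L"
    and Li: "Li \<in> Sp_int" "Li ** L = mat 1" "L ** Li = mat 1"
  defines "S \<equiv> blk_B (L' ** Li)"
  shows "transpose S = S" "L' = mkblk (mat 1) S 0 (mat 1) ** L"
    and "\<tau> \<in> siegel_space \<Longrightarrow> siegel_act L' \<tau> = siegel_act L \<tau> + cmat S"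
proof -
  define T where "T = L' ** Li"
  have T: "T \<in> Sp_int" unfolding T_def by (rule Sp_int_mult[OF L' Li(1)])
  have C: "blk_C T = 0"
  proof -
    have "blk_C T = blk_C (L ** Li)" unfolding T_def by (simp only: blk_mult eq)
    then show ?thesis by (simp add: Li(3) blk_mat1)
  qed
  have D: "blk_D T = mat 1"
  proof -
    have "blk_D T = blk_D (L ** Li)" unfolding T_def by (simp only: blk_mult eq)
    then show ?thesis by (simp add: Li(3) blk_mat1)
  qed
  have t0: "transpose (0 :: int^'n^'n) = 0" by (simp add: vec_eq_iff transpose_def)
  have z: "(0 :: int^'n^'n) ** P = 0" for P by (simp add: vec_eq_iff matrix_matrix_mult_def)
  have "transpose (blk_A T) = mat 1"
    using T unfolding Sp_int_iff C D t0 z by simp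
  then have A: "blk_A T = mat 1" by (metis transpose_mat transpose_transpose)
  have B: "blk_B T = S" by (simp add: S_def T_def)
  show sym: "transpose S = S" using T unfolding Sp_int_iff D B by simp
  have TL: "L' = T ** L"
  proof -
    have "T ** L = L' ** (Li ** L)" unfolding T_def by (rule matrix_mul_assoc[symmetric])
    then show ?thesis by (simp add: Li(2))
  qed
  have Tm: "T = mkblk (mat 1) S 0 (mat 1)" by (rule blk_eqI) (simp_all add: A B C D)
  show "L' = mkblk (mat 1) S 0 (mat 1) ** L" using TL unfolding Tm .
  assume \<tau>: "\<tau> \<in> siegel_space"
  have cz: "cmat (0 :: int^'n^'n) = 0" "cmat (mat 1 :: int^'n^'n) = mat 1" by (simp_all add: vec_eq_iff mat_def)
  have zc: "(0 :: complex^'n^'n) ** P = 0" for P by (simp add: vec_eq_iff matrix_matrix_mult_def)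
  have inv1: "matrix_inv (mat 1) = (mat 1 :: complex^'n^'n)" by (rule matrix_inv_unique) (rule matrix_mul_lid)+
  have "siegel_act L' \<tau> = siegel_act T (siegel_act L \<tau>)" unfolding TL by (rule siegel_act_mult[OF T L \<tau>])
  also have "\<dots> = siegel_act L \<tau> + cmat S"
    unfolding siegel_act_def[of T] aut_factor_def A B C D cz zc by (simp add: inv1)
  finally show "siegel_act L' \<tau> = siegel_act L \<tau> + cmat S" .
qed

text \<open>
  A diagonal entry of \<open>(Im (L \<tau>))\<^sup>-\<^sup>1\<close> is at most \<open>K / d i\<close>, and it is a sum of a positive form in the \<open>i\<close>-th row of
  \<open>C\<close> and another in the \<open>i\<close>-th row of \<open>C Re \<tau> + D\<close>.
\<close>

lemma lower_rows_bound:
  fixes L :: "int^('n::finite+'n)^('n+'n)"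
  assumes L: "L \<in> Sp_int" and \<tau>: "\<tau> \<in> siegel_space" and d: "\<And>i. d i > 0" "\<And>i. 1 \<le> K * d i" and K: "K \<ge> 1"
    and c: "comparable K d (im_mat \<tau>)" and c': "comparable K d (im_mat (siegel_act L \<tau>))"
  shows "\<bar>real_of_int (blk_C L $ i $ j)\<bar> \<le> K\<^sup>2"
    and "\<bar>(\<Sum>t\<in>UNIV. re_mat \<tau> $ j $ t * real_of_int (blk_C L $ i $ t)) + real_of_int (blk_D L $ i $ j)\<bar> \<le> K * sqrt (d j / d i)"
proof -
  let ?X = "im_mat \<tau>" and ?X' = "im_mat (siegel_act L \<tau>)"
  have X: "pos_def ?X" by (rule siegelD(2)[OF \<tau>])
  have X': "pos_def ?X'" by (rule siegelD(2)[OF siegel_act_in[OF L \<tau>]])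
  define c1 where "c1 = transpose (ri (blk_C L)) *v axis i 1"
  define v where "v = re_mat \<tau> *v c1 + transpose (ri (blk_D L)) *v axis i 1"
  have c1: "c1 $ t = real_of_int (blk_C L $ i $ t)" for t
    unfolding c1_def by (simp add: matrix_vector_mult_basis column_def transpose_def del: transpose_matrix_vector)
  have v: "v $ t = (\<Sum>s\<in>UNIV. re_mat \<tau> $ t $ s * c1 $ s) + real_of_int (blk_D L $ i $ t)" for t
    unfolding v_def by (simp add: matrix_vector_mult_basis column_def transpose_def matrix_vector_mult_def[of "re_mat \<tau>"] del: transpose_matrix_vector)
  have K0: "K > 0" using K by simp
  have "qf (matrix_inv ?X') (axis i 1) \<le> K * (\<Sum>t\<in>UNIV. 1 / d t * ((axis i 1 :: real^'n) $ t)\<^sup>2)"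
    using comparable_inverse[OF X' d(1) c' K0] unfolding comparable_def by blast
  also have "(\<Sum>t\<in>UNIV. 1 / d t * ((axis i 1 :: real^'n) $ t)\<^sup>2) = (\<Sum>t\<in>UNIV. if t = i then 1 / d i else 0)"
    by (intro sum.cong) (auto simp: axis_def)
  finally have q: "qf (matrix_inv ?X') (axis i 1) \<le> K / d i" by simp
  have eq: "qf (matrix_inv ?X') (axis i 1) = qf ?X c1 + qf (matrix_inv ?X) v"
    unfolding v_def c1_def by (rule qf_inv_im_siegel_act[OF L \<tau>])
  have q1: "qf ?X c1 \<le> K / d i" using q eq pos_def_nonneg[OF pos_def_inv[OF X], of v] by linarith
  have q2: "qf (matrix_inv ?X) v \<le> K / d i" using q eq pos_def_nonneg[OF X, of c1] by linarith
  have "d j * (c1 $ j)\<^sup>2 \<le> (\<Sum>t\<in>UNIV. d t * (c1 $ t)\<^sup>2)" by (rule member_le_sum) (use less_imp_le[OF d(1)] in auto)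
  also have "\<dots> \<le> K * qf ?X c1" using c unfolding comparable_def by blast
  also have "\<dots> \<le> K * (K / d i)" using q1 K0 by (intro mult_left_mono) auto
  finally have "(c1 $ j)\<^sup>2 \<le> K\<^sup>2 * (1 / d i * (1 / d j))" using d(1)[of i] d(1)[of j] by (simp add: field_simps power2_eq_square)
  also have "\<dots> \<le> K\<^sup>2 * (K * K)"
    using d(2)[of i] d(2)[of j] d(1)[of i] d(1)[of j] K0 by (intro mult_left_mono mult_mono) (auto simp: divide_le_eq)
  also have "\<dots> = (K\<^sup>2)\<^sup>2" by (simp add: power2_eq_square)
  finally have "\<bar>c1 $ j\<bar> \<le> K\<^sup>2" using abs_le_square_iff[of "c1 $ j" "K\<^sup>2"] by simp
  then show "\<bar>real_of_int (blk_C L $ i $ j)\<bar> \<le> K\<^sup>2" by (simp add: c1)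
  have "1 / d j * (v $ j)\<^sup>2 \<le> (\<Sum>t\<in>UNIV. 1 / d t * (v $ t)\<^sup>2)" by (rule member_le_sum) (use less_imp_le[OF d(1)] in auto)
  also have "\<dots> \<le> K * qf (matrix_inv ?X) v" using comparable_inverse[OF X d(1) c K0] unfolding comparable_def by blast
  also have "\<dots> \<le> K * (K / d i)" using q2 K0 by (intro mult_left_mono) auto
  finally have "(v $ j)\<^sup>2 \<le> K\<^sup>2 * (d j / d i)" using d(1)[of j] by (simp add: field_simps power2_eq_square)
  also have "\<dots> = (K * sqrt (d j / d i))\<^sup>2" using d(1)[of i] d(1)[of j] by (simp add: power_mult_distrib)
  finally have "\<bar>v $ j\<bar> \<le> K * sqrt (d j / d i)"
    using abs_le_square_iff[of "v $ j" "K * sqrt (d j / d i)"] K0 d(1)[of i] d(1)[of j] by simp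
  then show "\<bar>(\<Sum>t\<in>UNIV. re_mat \<tau> $ j $ t * real_of_int (blk_C L $ i $ t)) + real_of_int (blk_D L $ i $ j)\<bar> \<le> K * sqrt (d j / d i)"
    unfolding v c1 .
qed

text \<open>
  Count \<open>C\<close>, then \<open>D\<close> for given \<open>C\<close>, then the translation for given \<open>(C, D)\<close>, for which the real parts in
  \<open>\<T>\<close> decide.
\<close>

lemma count_symplectic:
  fixes \<T> :: "(complex^'n::finite^'n) set"
  assumes \<tau>: "\<tau> \<in> \<T>" and T: "\<And>\<sigma>. \<sigma> \<in> \<T> \<Longrightarrow> \<sigma> \<in> siegel_space \<and> comparable K d (im_mat \<sigma>)"
    and r: "\<And>\<sigma> \<sigma>' i j. \<sigma> \<in> \<T> \<Longrightarrow> \<sigma>' \<in> \<T> \<Longrightarrow> \<bar>Re (\<sigma> $ i $ j) - Re (\<sigma>' $ i $ j)\<bar> \<le> r i j"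
    and d: "\<And>i. d i > 0" "\<And>i. 1 \<le> K * d i" and K: "K \<ge> 1"
  defines "\<Lambda> \<equiv> {L \<in> Sp_int. siegel_act L \<tau> \<in> \<T>}"
  shows "finite \<Lambda> \<and> real (card \<Lambda>) \<le> (\<Prod>p\<in>(UNIV :: ('n \<times> 'n) set). 2 * K\<^sup>2 + 1)
    * ((\<Prod>p\<in>UNIV. 2 * (K * sqrt (d (snd p) / d (fst p))) + 1) * (\<Prod>p\<in>{p :: 'n \<times> 'n. rk (fst p) \<le> rk (snd p)}. r (fst p) (snd p) + 1))"
proof -
  have \<tau>s: "\<tau> \<in> siegel_space" "comparable K d (im_mat \<tau>)" using T[OF \<tau>] by auto
  have r0: "r i j \<ge> 0" for i j using r[OF \<tau> \<tau>, of i j] by simp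
  note lower = lower_rows_bound[OF _ \<tau>s(1) d K \<tau>s(2)]
  have L\<Lambda>: "L \<in> Sp_int" "siegel_act L \<tau> \<in> \<T>" "comparable K d (im_mat (siegel_act L \<tau>))" if "L \<in> \<Lambda>" for L
    using that T unfolding \<Lambda>_def by auto
  have dd: "0 \<le> 2 * (K * sqrt (d j / d i))" for i j using K d(1)[of i] d(1)[of j] by simp
  have P1: "0 \<le> (\<Prod>p\<in>{p :: 'n \<times> 'n. rk (fst p) \<le> rk (snd p)}. r (fst p) (snd p) + 1)" using r0 by (intro prod_nonneg) (auto simp: add_nonneg_nonneg)
  have P2: "0 \<le> (\<Prod>p\<in>UNIV. 2 * (K * sqrt (d (snd p) / d (fst p))) + 1)" using dd by (intro prod_nonneg) (auto simp: add_nonneg_nonneg)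
  have 3: "finite {L \<in> \<Lambda>. blk_C L = blk_C L0 \<and> blk_D L = blk_D L0}
      \<and> real (card {L \<in> \<Lambda>. blk_C L = blk_C L0 \<and> blk_D L = blk_D L0}) \<le> (\<Prod>p\<in>{p :: 'n \<times> 'n. rk (fst p) \<le> rk (snd p)}. r (fst p) (snd p) + 1) * 1"
    if L0: "L0 \<in> \<Lambda>" for L0
  proof -
    obtain Li where Li: "Li \<in> Sp_int" "Li ** L0 = mat 1" "L0 ** Li = mat 1" by (rule Sp_int_inverse[OF L\<Lambda>(1)[OF L0]], rule that)
    let ?T = "{L \<in> \<Lambda>. blk_C L = blk_C L0 \<and> blk_D L = blk_D L0}"
    define S where "S L = blk_B (L ** Li)" for L
    have S: "transpose (S L) = S L" "L = mkblk (mat 1) (S L) 0 (mat 1) ** L0" "siegel_act L \<tau> = siegel_act L0 \<tau> + cmat (S L)"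
      if "L \<in> ?T" for L
      unfolding S_def using symplectic_same_lower_rows[OF L\<Lambda>(1)[OF L0] L\<Lambda>(1)[of L] _ _ Li] that \<tau>s(1) by auto
    show ?thesis
    proof (rule int_fibers[where f = "\<lambda>L p. S L $ fst p $ snd p" and R = "\<lambda>p. r (fst p) (snd p)"])
      fix L L' :: "int^('n+'n)^('n+'n)" and p :: "'n \<times> 'n" assume L: "L \<in> ?T" and L': "L' \<in> ?T"
      have "Re (siegel_act L \<tau> $ i $ j) - Re (siegel_act L' \<tau> $ i $ j) = real_of_int (S L $ i $ j - S L' $ i $ j)" for i j
        unfolding S(3)[OF L] S(3)[OF L'] by simp
      then show "real_of_int \<bar>S L $ fst p $ snd p - S L' $ fst p $ snd p\<bar> \<le> r (fst p) (snd p)"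
        using r[of "siegel_act L \<tau>" "siegel_act L' \<tau>" "fst p" "snd p"] L\<Lambda>(2) L L' by simp
    next
      fix L assume L: "L \<in> ?T"
      have "{y \<in> ?T. \<forall>p\<in>{p. rk (fst p) \<le> rk (snd p)}. S y $ fst p $ snd p = S L $ fst p $ snd p} \<subseteq> {L}"
      proof
        fix y assume "y \<in> {y \<in> ?T. \<forall>p\<in>{p. rk (fst p) \<le> rk (snd p)}. S y $ fst p $ snd p = S L $ fst p $ snd p}"
        then have y: "y \<in> ?T" and e: "\<And>i j. rk i \<le> rk j \<Longrightarrow> S y $ i $ j = S L $ i $ j" by auto
        have "S y $ i $ j = S L $ i $ j" for i j
        proof (cases "rk i \<le> rk j")
          case False
          then have "S y $ j $ i = S L $ j $ i" by (intro e) simp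
          then show ?thesis using transpose_sym_index[OF S(1)[OF y], of i j] transpose_sym_index[OF S(1)[OF L], of i j] by simp
        qed (rule e)
        then have "S y = S L" by (simp add: vec_eq_iff)
        then show "y \<in> {L}" using S(2)[OF y] S(2)[OF L] by simp
      qed
      from finite_subset[OF this] card_mono[OF _ this]
      show "finite {y \<in> ?T. \<forall>p\<in>{p. rk (fst p) \<le> rk (snd p)}. S y $ fst p $ snd p = S L $ fst p $ snd p}
        \<and> real (card {y \<in> ?T. \<forall>p\<in>{p. rk (fst p) \<le> rk (snd p)}. S y $ fst p $ snd p = S L $ fst p $ snd p}) \<le> 1" by simp
    qed (use r0 in auto)
  qed
  have 2: "finite {L \<in> \<Lambda>. blk_C L = blk_C L0} \<and> real (card {L \<in> \<Lambda>. blk_C L = blk_C L0})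
      \<le> (\<Prod>p\<in>UNIV. 2 * (K * sqrt (d (snd p) / d (fst p))) + 1) * (\<Prod>p\<in>{p :: 'n \<times> 'n. rk (fst p) \<le> rk (snd p)}. r (fst p) (snd p) + 1)"
    if L0: "L0 \<in> \<Lambda>" for L0
  proof (rule int_fibers[where f = "\<lambda>L p. blk_D L $ fst p $ snd p" and R = "\<lambda>p. 2 * (K * sqrt (d (snd p) / d (fst p)))"])
    fix L L' :: "int^('n+'n)^('n+'n)" and p :: "'n \<times> 'n"
    assume L: "L \<in> {L \<in> \<Lambda>. blk_C L = blk_C L0}" and L': "L' \<in> {L \<in> \<Lambda>. blk_C L = blk_C L0}"
    then have LL: "L \<in> \<Lambda>" "L' \<in> \<Lambda>" and C: "blk_C L = blk_C L0" "blk_C L' = blk_C L0" by auto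
    show "real_of_int \<bar>blk_D L $ fst p $ snd p - blk_D L' $ fst p $ snd p\<bar> \<le> 2 * (K * sqrt (d (snd p) / d (fst p)))"
      using lower(2)[OF L\<Lambda>(1)[OF LL(1)] L\<Lambda>(3)[OF LL(1)], of "snd p" "fst p"] lower(2)[OF L\<Lambda>(1)[OF LL(2)] L\<Lambda>(3)[OF LL(2)], of "snd p" "fst p"]
      unfolding C of_int_abs of_int_diff by linarith
  next
    fix L assume "L \<in> {L \<in> \<Lambda>. blk_C L = blk_C L0}"
    then have L: "L \<in> \<Lambda>" "blk_C L = blk_C L0" by auto
    have "{y \<in> {L \<in> \<Lambda>. blk_C L = blk_C L0}. \<forall>p\<in>UNIV. blk_D y $ fst p $ snd p = blk_D L $ fst p $ snd p}
        = {y \<in> \<Lambda>. blk_C y = blk_C L \<and> blk_D y = blk_D L}"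
      using L(2) by (auto simp: vec_eq_iff)
    then show "finite {y \<in> {L \<in> \<Lambda>. blk_C L = blk_C L0}. \<forall>p\<in>UNIV. blk_D y $ fst p $ snd p = blk_D L $ fst p $ snd p}
      \<and> real (card {y \<in> {L \<in> \<Lambda>. blk_C L = blk_C L0}. \<forall>p\<in>UNIV. blk_D y $ fst p $ snd p = blk_D L $ fst p $ snd p})
       \<le> (\<Prod>p\<in>{p. rk (fst p) \<le> rk (snd p)}. r (fst p) (snd p) + 1)"
      using 3[OF L(1)] by simp
  qed (use dd P1 in auto)
  show ?thesis
  proof (rule int_fibers[where f = "\<lambda>L p. blk_C L $ fst p $ snd p" and R = "\<lambda>p. 2 * K\<^sup>2"])
    fix L L' :: "int^('n+'n)^('n+'n)" and p :: "'n \<times> 'n" assume L: "L \<in> \<Lambda>" and L': "L' \<in> \<Lambda>"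
    show "real_of_int \<bar>blk_C L $ fst p $ snd p - blk_C L' $ fst p $ snd p\<bar> \<le> 2 * K\<^sup>2"
      using lower(1)[OF L\<Lambda>(1)[OF L] L\<Lambda>(3)[OF L], of "fst p" "snd p"] lower(1)[OF L\<Lambda>(1)[OF L'] L\<Lambda>(3)[OF L'], of "fst p" "snd p"]
      unfolding of_int_abs of_int_diff by linarith
  next
    fix L assume L: "L \<in> \<Lambda>"
    have "{y \<in> \<Lambda>. \<forall>p\<in>UNIV. blk_C y $ fst p $ snd p = blk_C L $ fst p $ snd p} = {y \<in> \<Lambda>. blk_C y = blk_C L}"
      by (auto simp: vec_eq_iff)
    then show "finite {y \<in> \<Lambda>. \<forall>p\<in>UNIV. blk_C y $ fst p $ snd p = blk_C L $ fst p $ snd p}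
       \<and> real (card {y \<in> \<Lambda>. \<forall>p\<in>UNIV. blk_C y $ fst p $ snd p = blk_C L $ fst p $ snd p})
       \<le> (\<Prod>p\<in>UNIV. 2 * (K * sqrt (d (snd p) / d (fst p))) + 1) * (\<Prod>p\<in>{p. rk (fst p) \<le> rk (snd p)}. r (fst p) (snd p) + 1)"
      using 2[OF L] by simp
  qed (use P1 P2 in auto)
qed


text \<open>
  Two elements that bring points of the polydisc to \<open>y\<close> differ by one that maps a point of it into it, which
  bounds the symplectic parts. For equal symplectic parts the points have the same \<open>\<tau>\<close>, and the
  lattice parts satisfy \<open>\<tau> (l - l') + (u - u') = Z' - Z\<close>: the imaginary part determines the size of \<open>l - l'\<close>,
  and for \<open>l = l'\<close> the real part that of \<open>u - u'\<close>.
\<close>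

lemma count_group:
  fixes p y :: "'n::finite jacobi_point" and a :: "real^'n"
  assumes p: "p \<in> siegel_jacobi" and d: "\<And>i. d i > 0" "\<And>i. 1 \<le> K * d i" and K: "K \<ge> 1"
    and c: "comparable K d (im_mat (fst p))" and k: "k \<ge> 1" and m: "m \<ge> 1"
  defines "D \<equiv> pdisc (1 / (2 * real CARD('n) * K)) k m d a"
  defines "\<Gamma> \<equiv> {(M, l, u). M \<in> Sp_int \<and> (\<exists>q\<in>D. jacobi_act M l u (p + q) = y)}"
  shows "finite \<Gamma> \<and> real (card \<Gamma>) \<le>
    ((\<Prod>p\<in>(UNIV :: ('n \<times> 'n) set). 2 * (2 * K)\<^sup>2 + 1)
      * ((\<Prod>p\<in>UNIV. 2 * (2 * K * sqrt (d (snd p) / d (fst p))) + 1)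
      * (\<Prod>p\<in>{p :: 'n \<times> 'n. rk (fst p) \<le> rk (snd p)}. sqrt (d (fst p)) * sqrt (d (snd p)) / sqrt (real k) + 1)))
    * ((\<Prod>i\<in>(UNIV :: 'n set). 2 * sqrt K + 1) * (\<Prod>i\<in>UNIV. sqrt (d i) / sqrt (real m) + 1))"
proof -
  let ?g = "real CARD('n)" and ?\<rho> = "1 / (2 * real CARD('n) * K)"
  have g1: "?g \<ge> 1" by (simp add: Suc_le_eq)
  have \<rho>: "2 * ?\<rho> \<le> 1" "?\<rho> > 0" using mult_mono[OF g1 K] K by (simp_all add: divide_le_eq)
  have sh: "p + q \<in> siegel_jacobi" "comparable (2 * K) d (im_mat (fst (p + q)))" if "q \<in> D" for q
    using pdisc_shift(1,2)[OF p d(1) c K k that[unfolded D_def]] by auto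
  have shs: "fst (p + q) \<in> siegel_space" if "q \<in> D" for q
    using sh(1)[OF that] unfolding siegel_jacobi_def mem_Times_iff by blast
  have fst_act: "fst (jacobi_act M l u x) = siegel_act M (fst x)" for M l u and x :: "'n jacobi_point"
    by (cases x) (simp add: jacobi_act_def)
  have snd_act: "snd (jacobi_act M l u x) = matrix_inv (transpose (aut_factor M (fst x))) *v lattice_shift l u (fst x) (snd x)" for M l u and x :: "'n jacobi_point"
    by (cases x) (simp add: jacobi_act_def)
  have act_inj: "\<sigma> = \<sigma>'" if M: "M \<in> Sp_int" and "\<sigma> \<in> siegel_space" "\<sigma>' \<in> siegel_space" and e: "siegel_act M \<sigma> = siegel_act M \<sigma>'"
    for M and \<sigma> \<sigma>' :: "complex^'n^'n"
  proof -
    obtain N where N: "N \<in> Sp_int" "N ** M = mat 1" "M ** N = mat 1" by (rule Sp_int_inverse[OF M], rule that)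
    have "siegel_act (N ** M) \<sigma> = siegel_act (N ** M) \<sigma>'"
      unfolding siegel_act_mult[OF N(1) M \<open>\<sigma> \<in> siegel_space\<close>] siegel_act_mult[OF N(1) M \<open>\<sigma>' \<in> siegel_space\<close>] e ..
    then show ?thesis using that(2,3) by (simp add: N(2) siegel_act_one)
  qed
  define \<T> where "\<T> = (\<lambda>q. fst (p + q)) ` D"
  have T: "\<sigma> \<in> siegel_space \<and> comparable (2 * K) d (im_mat \<sigma>)" if "\<sigma> \<in> \<T>" for \<sigma>
    using that sh(2) shs unfolding \<T>_def by auto
  have r: "\<bar>Re (\<sigma> $ i $ j) - Re (\<sigma>' $ i $ j)\<bar> \<le> sqrt (d i) * sqrt (d j) / sqrt (real k)" if \<sigma>: "\<sigma> \<in> \<T>" "\<sigma>' \<in> \<T>" for \<sigma> \<sigma>' i j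
  proof -
    obtain q q' where q: "q \<in> D" "q' \<in> D" "\<sigma> = fst (p + q)" "\<sigma>' = fst (p + q')" using \<sigma> unfolding \<T>_def by blast
    let ?b = "?\<rho> * sqrt (d i) * sqrt (d j) / sqrt (real k)"
    have b: "\<bar>Re (fst q $ i $ j)\<bar> \<le> ?b" if "q \<in> D" for q
    proof -
      have "cmod (fst q $ i $ j) \<le> ?b" using that unfolding D_def pdisc_def by blast
      then show ?thesis using abs_Re_le_cmod[of "fst q $ i $ j"] by linarith
    qed
    have "\<bar>Re (\<sigma> $ i $ j) - Re (\<sigma>' $ i $ j)\<bar> \<le> ?b + ?b"
      using b[OF q(1)] b[OF q(2)] unfolding q(3,4) fst_add vector_add_component plus_complex.sel by linarith
    also have "\<dots> = (2 * ?\<rho>) * (sqrt (d i) * sqrt (d j) / sqrt (real k))" by simp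
    also have "\<dots> \<le> 1 * (sqrt (d i) * sqrt (d j) / sqrt (real k))"
      using d(1)[of i] d(1)[of j] by (intro mult_right_mono[OF \<rho>(1)]) (auto simp: less_imp_le)
    finally show ?thesis by simp
  qed
  have d2: "1 \<le> 2 * K * d i" for i using d(2)[of i] by simp
  have K2: "2 * K \<ge> 1" using K by simp
  note count = count_symplectic[where d = d and K = "2 * K" and r = "\<lambda>i j. sqrt (d i) * sqrt (d j) / sqrt (real k)", OF _ T r d(1) d2 K2]
  define PS where "PS = ((\<Prod>p\<in>(UNIV :: ('n \<times> 'n) set). 2 * (2 * K)\<^sup>2 + 1)
      * ((\<Prod>p\<in>UNIV. 2 * (2 * K * sqrt (d (snd p) / d (fst p))) + 1)
      * (\<Prod>p\<in>{p :: 'n \<times> 'n. rk (fst p) \<le> rk (snd p)}. sqrt (d (fst p)) * sqrt (d (snd p)) / sqrt (real k) + 1)))"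
  have M_count: "finite (fst ` \<Gamma>) \<and> real (card (fst ` \<Gamma>)) \<le> PS"
  proof (cases "\<Gamma> = {}")
    case True
    have "0 \<le> sqrt (d i)" "0 \<le> sqrt (d i / d j)" for i j using d(1)[of i] d(1)[of j] by simp_all
    then have "PS \<ge> 0" unfolding PS_def using K
      by (intro mult_nonneg_nonneg prod_nonneg ballI add_nonneg_nonneg divide_nonneg_nonneg) simp_all
    then show ?thesis using True by simp
  next
    case False
    then obtain M0 l0 u0 q0 where M0: "M0 \<in> Sp_int" and q0: "q0 \<in> D" and y0: "jacobi_act M0 l0 u0 (p + q0) = y"
      unfolding \<Gamma>_def by auto
    obtain N0 where N0: "N0 \<in> Sp_int" "N0 ** M0 = mat 1" "M0 ** N0 = mat 1" by (rule Sp_int_inverse[OF M0], rule that)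
    define \<tau>0 where "\<tau>0 = fst (p + q0)"
    have \<tau>0: "\<tau>0 \<in> \<T>" unfolding \<T>_def \<tau>0_def using q0 by blast
    have "\<exists>J. \<forall>M\<in>(Sp_int :: (int^('n+'n)^('n+'n)) set). J M \<in> Sp_int \<and> J M ** M = mat 1 \<and> M ** J M = mat 1"
    proof (rule bchoice, intro ballI)
      fix M :: "int^('n+'n)^('n+'n)" assume M: "M \<in> Sp_int"
      obtain N where "N \<in> Sp_int" "N ** M = mat 1" "M ** N = mat 1" by (rule Sp_int_inverse[OF M], rule that)
      then show "\<exists>N. N \<in> Sp_int \<and> N ** M = mat 1 \<and> M ** N = mat 1" by blast
    qed
    then obtain J where J: "\<And>M :: int^('n+'n)^('n+'n). M \<in> Sp_int \<Longrightarrow> J M \<in> Sp_int \<and> J M ** M = mat 1 \<and> M ** J M = mat 1"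
      by blast
    define \<Lambda> where "\<Lambda> = {L \<in> Sp_int. siegel_act L \<tau>0 \<in> \<T>}"
    have fin: "finite \<Lambda>" and card: "real (card \<Lambda>) \<le> PS"
      using count[OF \<tau>0] unfolding \<Lambda>_def PS_def by auto
    have sub: "(\<lambda>M. J M ** M0) ` (fst ` \<Gamma>) \<subseteq> \<Lambda>"
    proof (intro subsetI)
      fix L assume "L \<in> (\<lambda>M. J M ** M0) ` (fst ` \<Gamma>)"
      then obtain M l u q where L: "L = J M ** M0" and M: "M \<in> Sp_int" and q: "q \<in> D" and y: "jacobi_act M l u (p + q) = y"
        unfolding \<Gamma>_def by auto
      have "siegel_act M0 \<tau>0 = siegel_act M (fst (p + q))"
        unfolding \<tau>0_def fst_act[of M0 l0 u0, symmetric] fst_act[of M l u, symmetric] y y0 ..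
      then have "siegel_act L \<tau>0 = siegel_act (J M ** M) (fst (p + q))"
        unfolding L using siegel_act_mult[of "J M" M0 \<tau>0] siegel_act_mult[of "J M" M "fst (p + q)"] J[OF M] M M0 T[OF \<tau>0] shs[OF q] by simp
      also have "\<dots> = fst (p + q)" using J[OF M] siegel_act_one[OF shs[OF q]] by simp
      finally have "siegel_act L \<tau>0 \<in> \<T>" unfolding \<T>_def using q by blast
      then show "L \<in> \<Lambda>" unfolding \<Lambda>_def L using Sp_int_mult J[OF M] M0 by blast
    qed
    have inj: "inj_on (\<lambda>M. J M ** M0) (fst ` \<Gamma>)"
    proof (rule inj_onI)
      fix M M' assume "M \<in> fst ` \<Gamma>" "M' \<in> fst ` \<Gamma>" and e: "J M ** M0 = J M' ** M0"
      then have M: "M \<in> Sp_int" "M' \<in> Sp_int" unfolding \<Gamma>_def by auto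
      have "J M = J M ** M0 ** N0" using N0(3) by (simp add: matrix_mul_assoc[symmetric])
      also have "\<dots> = J M'" unfolding e using N0(3) by (simp add: matrix_mul_assoc[symmetric])
      finally have JJ: "J M = J M'" .
      have "M = M ** (J M' ** M')" using J[OF M(2)] by simp
      also have "\<dots> = M ** J M ** M'" unfolding JJ by (rule matrix_mul_assoc)
      finally show "M = M'" using J[OF M(1)] by simp
    qed
    have "finite (fst ` \<Gamma>)" by (rule inj_on_finite[OF inj sub fin])
    moreover have "card (fst ` \<Gamma>) \<le> card \<Lambda>" by (rule card_inj_on_le[OF inj sub fin])
    ultimately show ?thesis using card by (meson of_nat_le_iff order_trans)
  qed
  have same: "im_mat (fst (p + q)) *v map_vector of_int (l - l') = im_vec (snd q' - snd q)
      \<and> (l = l' \<longrightarrow> map_vector of_int (u - u') = re_vec (snd q' - snd q))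
      \<and> (\<forall>i. cmod ((snd q' - snd q) $ i) \<le> 2 * ?\<rho> * sqrt (d i) / sqrt (real m))"
    if M: "M \<in> Sp_int" and q: "q \<in> D" "jacobi_act M l u (p + q) = y" and q': "q' \<in> D" "jacobi_act M l' u' (p + q') = y"
    for M l u l' u' q q'
  proof -
    define \<sigma> where "\<sigma> = fst (p + q)"
    have e: "\<sigma> = fst (p + q')"
      unfolding \<sigma>_def
    proof (rule act_inj[OF M shs[OF q(1)] shs[OF q'(1)]])
      have "siegel_act M (fst (p + q)) = fst y" by (rule fst_act[of M l u "p + q", unfolded q(2), symmetric])
      also have "\<dots> = siegel_act M (fst (p + q'))" by (rule fst_act[of M l' u' "p + q'", unfolded q'(2)])
      finally show "siegel_act M (fst (p + q)) = siegel_act M (fst (p + q'))" .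
    qed
    have qq: "fst q = fst q'" using e unfolding \<sigma>_def by simp
    have iJ: "invertible (matrix_inv (transpose (aut_factor M \<sigma>)))"
      using aut_factor_invertible[OF M shs[OF q(1)]] unfolding \<sigma>_def by (intro invertible_matrix_inv invertible_transpose)
    have "matrix_inv (transpose (aut_factor M \<sigma>)) *v lattice_shift l u \<sigma> (snd (p + q))
        = matrix_inv (transpose (aut_factor M \<sigma>)) *v lattice_shift l' u' \<sigma> (snd (p + q'))"
      using snd_act[of M l u "p + q"] snd_act[of M l' u' "p + q'"] unfolding q(2) q'(2) \<sigma>_def[symmetric] e[symmetric] by simp
    then have "lattice_shift l u \<sigma> (snd (p + q)) = lattice_shift l' u' \<sigma> (snd (p + q'))"
      using matrix_inv_mult_vec[OF iJ] by metis
    then have "\<sigma> *v cvec l + cvec u - (\<sigma> *v cvec l' + cvec u') = snd q' - snd q"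
      unfolding lattice_shift_def by (simp add: algebra_simps)
    moreover have "\<sigma> *v cvec l + cvec u - (\<sigma> *v cvec l' + cvec u') = \<sigma> *v cv (map_vector of_int (l - l')) + cv (map_vector of_int (u - u'))"
    proof -
      have "cvec l = cv (map_vector of_int (l - l')) + cvec l'" "cvec u = cv (map_vector of_int (u - u')) + cvec u'"
        by (simp_all add: vec_eq_iff)
      then show ?thesis by (simp add: matrix_vector_right_distrib)
    qed
    ultimately have eq: "\<sigma> *v cv (map_vector of_int (l - l')) + cv (map_vector of_int (u - u')) = snd q' - snd q" by simp
    have 1: "im_mat \<sigma> *v map_vector of_int (l - l') = im_vec (snd q' - snd q)" using im_vec_affine[of \<sigma>] unfolding eq[symmetric] by simp
    have 2: "l = l' \<longrightarrow> map_vector of_int (u - u') = re_vec (snd q' - snd q)"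
      using re_vec_affine[of \<sigma>] unfolding eq[symmetric] by (simp add: vec_eq_iff matrix_vector_mult_def)
    have "cmod ((snd q' - snd q) $ i) \<le> 2 * ?\<rho> * sqrt (d i) / sqrt (real m)" for i
    proof -
      have b: "cmod ((snd q - fst q *v cv a) $ i) \<le> ?\<rho> * sqrt (d i) / sqrt (real m)" if "q \<in> D" for q
        using that unfolding D_def pdisc_def by blast
      have "(snd q' - snd q) $ i = (snd q' - fst q' *v cv a) $ i - (snd q - fst q *v cv a) $ i" unfolding qq by simp
      then have "cmod ((snd q' - snd q) $ i) \<le> cmod ((snd q' - fst q' *v cv a) $ i) + cmod ((snd q - fst q *v cv a) $ i)"
        by (metis norm_triangle_ineq4)
      then have "cmod ((snd q' - snd q) $ i) \<le> ?\<rho> * sqrt (d i) / sqrt (real m) + ?\<rho> * sqrt (d i) / sqrt (real m)"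
        using b[OF q(1)] b[OF q'(1)] by linarith
      also have "\<dots> = 2 * ?\<rho> * sqrt (d i) / sqrt (real m)" by simp
      finally show ?thesis .
    qed
    then show ?thesis using 1 2 unfolding \<sigma>_def by blast
  qed
  have u_count: "finite {x \<in> \<Gamma>. fst x = M \<and> fst (snd x) = l} \<and> real (card {x \<in> \<Gamma>. fst x = M \<and> fst (snd x) = l})
      \<le> (\<Prod>i\<in>UNIV. sqrt (d i) / sqrt (real m) + 1) * 1" for M l
  proof (rule int_fibers[where f = "\<lambda>x i. snd (snd x) $ i"])
    fix x x' i assume x: "x \<in> {x \<in> \<Gamma>. fst x = M \<and> fst (snd x) = l}" and x': "x' \<in> {x \<in> \<Gamma>. fst x = M \<and> fst (snd x) = l}"
    then obtain u u' q q' where xx: "x = (M, l, u)" "x' = (M, l, u')" and M: "M \<in> Sp_int" and q: "q \<in> D" "jacobi_act M l u (p + q) = y" and q': "q' \<in> D" "jacobi_act M l u' (p + q') = y"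
      unfolding \<Gamma>_def by auto
    have "map_vector of_int (u - u') = re_vec (snd q' - snd q)" using same[OF M q q'] by blast
    from arg_cong[OF this, of "\<lambda>v. v $ i"] have "real_of_int (u $ i - u' $ i) = Re ((snd q' - snd q) $ i)" by simp
    then have "real_of_int \<bar>u $ i - u' $ i\<bar> \<le> cmod ((snd q' - snd q) $ i)" using abs_Re_le_cmod by (metis of_int_abs)
    also have "\<dots> \<le> 2 * ?\<rho> * sqrt (d i) / sqrt (real m)" using same[OF M q q'] by blast
    also have "\<dots> = (2 * ?\<rho>) * (sqrt (d i) / sqrt (real m))" by simp
    also have "\<dots> \<le> 1 * (sqrt (d i) / sqrt (real m))" using \<rho>(1) d(1)[of i] by (intro mult_right_mono) auto
    finally show "real_of_int \<bar>snd (snd x) $ i - snd (snd x') $ i\<bar> \<le> sqrt (d i) / sqrt (real m)" by (simp add: xx)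
  next
    fix x assume x: "x \<in> {x \<in> \<Gamma>. fst x = M \<and> fst (snd x) = l}"
    have "{x' \<in> {x \<in> \<Gamma>. fst x = M \<and> fst (snd x) = l}. \<forall>i\<in>UNIV. snd (snd x') $ i = snd (snd x) $ i} \<subseteq> {x}"
      using x by (auto simp: vec_eq_iff prod_eq_iff)
    from finite_subset[OF this] card_mono[OF _ this]
    show "finite {x' \<in> {x \<in> \<Gamma>. fst x = M \<and> fst (snd x) = l}. \<forall>i\<in>UNIV. snd (snd x') $ i = snd (snd x) $ i}
      \<and> real (card {x' \<in> {x \<in> \<Gamma>. fst x = M \<and> fst (snd x) = l}. \<forall>i\<in>UNIV. snd (snd x') $ i = snd (snd x) $ i}) \<le> 1" by simp
  qed (use d(1) in \<open>auto simp: less_imp_le\<close>)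
  have P0: "0 \<le> (\<Prod>i\<in>UNIV. sqrt (d i) / sqrt (real m) + 1)"
    using d(1) by (intro prod_nonneg ballI add_nonneg_nonneg) (auto simp: less_imp_le)
  have l_count: "finite {x \<in> \<Gamma>. fst x = M} \<and> real (card {x \<in> \<Gamma>. fst x = M})
      \<le> (\<Prod>i\<in>(UNIV :: 'n set). 2 * sqrt K + 1) * (\<Prod>i\<in>UNIV. sqrt (d i) / sqrt (real m) + 1)" for M
  proof (rule int_fibers[where f = "\<lambda>x i. fst (snd x) $ i" and R = "\<lambda>_. 2 * sqrt K"])
    fix x x' i assume x: "x \<in> {x \<in> \<Gamma>. fst x = M}" and x': "x' \<in> {x \<in> \<Gamma>. fst x = M}"
    then obtain l l' u u' q q' where xx: "x = (M, l, u)" "x' = (M, l', u')" and M: "M \<in> Sp_int" and q: "q \<in> D" "jacobi_act M l u (p + q) = y" and q': "q' \<in> D" "jacobi_act M l' u' (p + q') = y"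
      unfolding \<Gamma>_def by auto
    let ?X = "im_mat (fst (p + q))"
    have X: "pos_def ?X" by (rule siegelD(2)[OF shs[OF q(1)]])
    have "map_vector of_int (l - l') = matrix_inv ?X *v im_vec (snd q' - snd q)"
      using same[OF M q q'] matrix_inv_mult_vec[OF pos_def_invertible[OF X]] by metis
    from arg_cong[OF this, of "\<lambda>v. v $ i"] have "real_of_int (l $ i - l' $ i) = (matrix_inv ?X *v im_vec (snd q' - snd q)) $ i"
      by (simp only: map_vector_index vector_minus_component)
    also have "\<dots> = (\<Sum>j\<in>UNIV. matrix_inv ?X $ i $ j * im_vec (snd q' - snd q) $ j)"
      by (simp only: matrix_vector_mult_def vec_lambda_beta)
    finally have "real_of_int \<bar>l $ i - l' $ i\<bar> \<le> (\<Sum>j\<in>UNIV. \<bar>matrix_inv ?X $ i $ j * im_vec (snd q' - snd q) $ j\<bar>)"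
      unfolding of_int_abs by (simp only: sum_abs)
    also have "\<dots> \<le> (\<Sum>j\<in>(UNIV :: 'n set). 4 * K * ?\<rho> * sqrt K)"
    proof (rule sum_mono)
      fix j
      have e1: "\<bar>matrix_inv ?X $ i $ j\<bar> \<le> 2 * K * sqrt (1 / d i) * sqrt (1 / d j)"
        by (rule comparable_entry[OF pos_def_inv[OF X] _ comparable_inverse[OF X d(1) sh(2)[OF q(1)]]]) (use d(1) K in auto)
      have "\<bar>im_vec (snd q' - snd q) $ j\<bar> \<le> cmod ((snd q' - snd q) $ j)" using abs_Im_le_cmod[of "(snd q' - snd q) $ j"] by simp
      also have "\<dots> \<le> 2 * ?\<rho> * sqrt (d j) / sqrt (real m)" using same[OF M q q'] by blast
      also have "\<dots> \<le> 2 * ?\<rho> * sqrt (d j) / 1" 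
      proof (rule divide_left_mono)
        show "0 \<le> 2 * ?\<rho> * sqrt (d j)" by (intro mult_nonneg_nonneg less_imp_le[OF \<rho>(2)] real_sqrt_ge_zero less_imp_le[OF d(1)]) simp
      qed (use m in auto)
      finally have e2: "\<bar>im_vec (snd q' - snd q) $ j\<bar> \<le> 2 * ?\<rho> * sqrt (d j)" by simp
      have "\<bar>matrix_inv ?X $ i $ j * im_vec (snd q' - snd q) $ j\<bar> \<le> (2 * K * sqrt (1 / d i) * sqrt (1 / d j)) * (2 * ?\<rho> * sqrt (d j))"
        unfolding abs_mult using K d(1)[of i] d(1)[of j] by (intro mult_mono e1 e2) (auto simp: less_imp_le)
      also have "\<dots> = 4 * K * ?\<rho> * sqrt (1 / d i)" using d(1)[of j] by (simp add: real_sqrt_divide)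
      also have "\<dots> \<le> 4 * K * ?\<rho> * sqrt K"
        using d(1)[of i] d(2)[of i] K \<rho>(2) by (intro mult_left_mono real_sqrt_le_mono) (auto simp: divide_le_eq)
      finally show "\<bar>matrix_inv ?X $ i $ j * im_vec (snd q' - snd q) $ j\<bar> \<le> 4 * K * ?\<rho> * sqrt K" .
    qed
    also have "\<dots> = 2 * sqrt K" using K by simp
    finally show "real_of_int \<bar>fst (snd x) $ i - fst (snd x') $ i\<bar> \<le> 2 * sqrt K" by (simp add: xx)
  next
    fix x assume x: "x \<in> {x \<in> \<Gamma>. fst x = M}"
    have "{x' \<in> {x \<in> \<Gamma>. fst x = M}. \<forall>i\<in>UNIV. fst (snd x') $ i = fst (snd x) $ i} = {x' \<in> \<Gamma>. fst x' = M \<and> fst (snd x') = fst (snd x)}"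
      by (auto simp: vec_eq_iff)
    then show "finite {x' \<in> {x \<in> \<Gamma>. fst x = M}. \<forall>i\<in>UNIV. fst (snd x') $ i = fst (snd x) $ i}
      \<and> real (card {x' \<in> {x \<in> \<Gamma>. fst x = M}. \<forall>i\<in>UNIV. fst (snd x') $ i = fst (snd x) $ i}) \<le> (\<Prod>i\<in>UNIV. sqrt (d i) / sqrt (real m) + 1)"
      using u_count[of M "fst (snd x)"] by simp
  qed (use P0 K in auto)
  have P1: "0 \<le> (\<Prod>i\<in>(UNIV :: 'n set). 2 * sqrt K + 1) * (\<Prod>i\<in>UNIV. sqrt (d i) / sqrt (real m) + 1)"
    by (intro mult_nonneg_nonneg[OF _ P0] prod_nonneg ballI) (use K in auto)
  show ?thesis
    unfolding PS_def[symmetric] by (rule card_fibers[OF conjunct1[OF M_count] conjunct2[OF M_count] l_count P1])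
qed

text \<open>
  For \<open>rk i \<le> rk j\<close> the row entries contribute at most about \<open>sqrt (d j / d i)\<close> and the translations
  \<open>1 + sqrt (d i d j / k)\<close>. The product is of size \<open>sqrt (d j / d i) + d j / sqrt k\<close>, which is at most a constant times
  \<open>sqrt k * m\<close> for \<open>d\<close> up to \<open>k m\<close>; all other row entries are bounded.
\<close>

lemma count_bound:
  fixes d :: "'n::finite \<Rightarrow> real"
  assumes d: "\<And>i. d i > 0" "\<And>i. d i \<le> K * real k * real m" and o: "\<And>a b. rk a \<le> rk b \<Longrightarrow> d a \<le> K * d b"
    and d1: "\<And>i. 1 \<le> K * d i" and K: "K \<ge> 1" and k: "k \<ge> 1" and m: "m \<ge> 1"
  shows "((\<Prod>p\<in>(UNIV :: ('n \<times> 'n) set). 2 * (2 * K)\<^sup>2 + 1)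
      * ((\<Prod>p\<in>UNIV. 2 * (2 * K * sqrt (d (snd p) / d (fst p))) + 1)
      * (\<Prod>p\<in>{p :: 'n \<times> 'n. rk (fst p) \<le> rk (snd p)}. sqrt (d (fst p)) * sqrt (d (snd p)) / sqrt (real k) + 1)))
    * ((\<Prod>i\<in>(UNIV :: 'n set). 2 * sqrt K + 1) * (\<Prod>i\<in>UNIV. sqrt (d i) / sqrt (real m) + 1))
   \<le> ((2 * (2 * K)\<^sup>2 + 1) ^ CARD('n \<times> 'n) * (5 * K\<^sup>2) ^ CARD('n \<times> 'n) * (2 * K\<^sup>2) ^ card (sym_coords :: 'n set set)
      * (2 * sqrt K + 1) ^ CARD('n) * (2 * K) ^ CARD('n))
      * ((sqrt (real k) * real m) ^ card (sym_coords :: 'n set set) * sqrt (real k) ^ CARD('n))"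
proof -
  let ?P = "{p :: 'n \<times> 'n. rk (fst p) \<le> rk (snd p)}" and ?cs = "card (sym_coords :: 'n set set)"
  let ?g = "CARD('n)" and ?h = "CARD('n \<times> 'n)"
  have kr: "real k \<ge> 1" "real m \<ge> 1" using k m by simp_all
  have sk: "sqrt (real k) \<ge> 1" using kr by simp
  have sK: "1 \<le> sqrt K" "sqrt K \<le> K" using K by (auto intro: real_le_lsqrt simp: power2_eq_square)
  have KK: "K \<le> K\<^sup>2" "1 \<le> K\<^sup>2" using mult_left_mono[OF K, of K] mult_mono[OF K K] K by (simp_all add: power2_eq_square)
  have KsK: "K * sqrt K \<le> K\<^sup>2" using sK K by (simp add: power2_eq_square mult_left_mono)
  \<comment> \<open>the factor \<open>K\<close> under the root makes \<open>t\<close> at least 1\<close>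
  define t where "t p = (if p \<in> ?P then sqrt (K * (d (snd p) / d (fst p))) else 1)" for p :: "'n \<times> 'n"
  have t1: "1 \<le> t p" for p
    using o[of "fst p" "snd p"] d(1)[of "fst p"] by (auto simp: t_def le_divide_eq)
  have card_P: "card ?P = ?cs"
    using bij_betw_same_card[OF bij_sym_coords[where 'n = 'n]] by (simp add: case_prod_beta')
  have a: "2 * (2 * K * sqrt (d (snd p) / d (fst p))) + 1 \<le> 5 * K\<^sup>2 * t p" for p
  proof -
    let ?x = "sqrt (d (snd p) / d (fst p))"
    have x0: "0 \<le> ?x" using d(1)[of "fst p"] d(1)[of "snd p"] by simp
    have xt: "K * ?x \<le> K\<^sup>2 * t p"
    proof (cases "p \<in> ?P")
      case True
      have "?x \<le> sqrt (K * (d (snd p) / d (fst p)))"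
        using mult_right_mono[OF K, of "d (snd p) / d (fst p)"] d(1)[of "fst p"] d(1)[of "snd p"] by (intro real_sqrt_le_mono) simp
      then have "?x \<le> t p" using True by (simp add: t_def)
      then show ?thesis using KK x0 K by (intro mult_mono) auto
    next
      case False
      then have "d (snd p) \<le> K * d (fst p)" by (intro o) simp
      then have "?x \<le> sqrt K" using d(1)[of "fst p"] by (intro real_sqrt_le_mono) (simp add: divide_le_eq)
      then have "K * ?x \<le> K * sqrt K" using K by simp
      also have "\<dots> \<le> K\<^sup>2 * t p" using KsK False by (simp add: t_def)
      finally show ?thesis .
    qed
    have "1 \<le> K\<^sup>2 * t p" using mult_mono[OF KK(2) t1[of p]] by simp
    then show ?thesis using xt by simp
  qed
  have b: "t p * (sqrt (d (fst p)) * sqrt (d (snd p)) / sqrt (real k) + 1) \<le> 2 * K\<^sup>2 * (sqrt (real k) * real m)" if p: "p \<in> ?P" for p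
  proof -
    let ?a = "d (fst p)" and ?b = "d (snd p)"
    have pos: "?a > 0" "?b > 0" using d(1) by auto
    have tp: "t p = sqrt K * (sqrt ?b / sqrt ?a)" using p by (simp add: t_def real_sqrt_mult real_sqrt_divide)
    have "t p * (sqrt ?a * sqrt ?b / sqrt (real k)) = sqrt K * (?b / sqrt (real k))"
      unfolding tp using pos by simp
    also have "\<dots> \<le> sqrt K * (K * (sqrt (real k) * real m))"
    proof (intro mult_left_mono)
      have "?b \<le> K * (sqrt (real k) * real m) * sqrt (real k)"
        using d(2)[of "snd p"] by (simp add: mult_ac)
      then show "?b / sqrt (real k) \<le> K * (sqrt (real k) * real m)" using kr by (simp add: divide_le_eq)
    qed (use K in simp)
    also have "\<dots> = K * sqrt K * (sqrt (real k) * real m)" by simp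
    also have "\<dots> \<le> K\<^sup>2 * (sqrt (real k) * real m)" by (intro mult_right_mono KsK) simp
    finally have 1: "t p * (sqrt ?a * sqrt ?b / sqrt (real k)) \<le> K\<^sup>2 * (sqrt (real k) * real m)" .
    have "K * (?b / ?a) \<le> (K\<^sup>2 * (sqrt (real k) * real m))\<^sup>2"
    proof -
      have "?b / ?a = ?b * (1 / ?a)" by simp
      also have "\<dots> \<le> (K * real k * real m) * K"
        using pos K d(2)[of "snd p"] d1[of "fst p"] by (intro mult_mono) (auto simp: divide_le_eq)
      finally have "?b / ?a \<le> (K * real k * real m) * K" .
      then have "K * (?b / ?a) \<le> K * ((K * real k * real m) * K)" using K by (intro mult_left_mono) auto
      also have "\<dots> = K ^ 3 * real k * real m" by (simp add: power3_eq_cube)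
      also have "\<dots> \<le> K ^ 4 * real k * (real m)\<^sup>2"
        using K kr by (intro mult_mono power_increasing self_le_power) auto
      also have "\<dots> = (K\<^sup>2 * (sqrt (real k) * real m))\<^sup>2" by (simp add: power_mult_distrib)
      finally show ?thesis .
    qed
    then have 2: "t p \<le> K\<^sup>2 * (sqrt (real k) * real m)" using p K by (simp add: t_def real_le_lsqrt)
    show ?thesis using 1 2 by (simp add: distrib_left)
  qed
  have c: "sqrt (d i) / sqrt (real m) + 1 \<le> 2 * K * sqrt (real k)" for i
  proof -
    have "sqrt (d i) \<le> sqrt (K\<^sup>2 * real k * real m)"
    proof (rule real_sqrt_le_mono)
      have "K * real k * real m \<le> K\<^sup>2 * real k * real m" using KK by (intro mult_right_mono) auto
      then show "d i \<le> K\<^sup>2 * real k * real m" using d(2)[of i] by linarith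
    qed
    also have "\<dots> = K * sqrt (real k) * sqrt (real m)" using K by (simp add: real_sqrt_mult)
    finally have "sqrt (d i) / sqrt (real m) \<le> K * sqrt (real k)" using kr by (simp add: divide_le_eq)
    moreover have "1 \<le> K * sqrt (real k)" using mult_mono[OF K sk] K by simp
    ultimately show ?thesis by simp
  qed
  let ?A = "\<Prod>p\<in>(UNIV :: ('n \<times> 'n) set). 2 * (2 * K * sqrt (d (snd p) / d (fst p))) + 1"
  let ?B = "\<Prod>p\<in>?P. sqrt (d (fst p)) * sqrt (d (snd p)) / sqrt (real k) + 1"
  let ?C = "\<Prod>i\<in>(UNIV :: 'n set). sqrt (d i) / sqrt (real m) + 1"
  have nn: "0 \<le> sqrt (d i)" "0 \<le> sqrt (d i / d j)" for i j using d(1)[of i] d(1)[of j] by simp_all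
  have B0: "0 \<le> ?B" using nn by (intro prod_nonneg ballI add_nonneg_nonneg divide_nonneg_nonneg mult_nonneg_nonneg) auto
  have C0: "0 \<le> ?C" using nn by (intro prod_nonneg ballI add_nonneg_nonneg divide_nonneg_nonneg) auto
  have "?A \<le> (\<Prod>p\<in>(UNIV :: ('n \<times> 'n) set). 5 * K\<^sup>2 * t p)"
    using a nn K by (intro prod_mono) (auto intro!: add_nonneg_nonneg mult_nonneg_nonneg)
  also have "\<dots> = (5 * K\<^sup>2) ^ ?h * (\<Prod>p\<in>?P. t p)"
  proof -
    have "(\<Prod>p\<in>(UNIV :: ('n \<times> 'n) set). t p) = (\<Prod>p\<in>?P. t p)"
      by (rule prod.mono_neutral_right) (auto simp: t_def)
    then show ?thesis unfolding prod.distrib[of "\<lambda>_. 5 * K\<^sup>2" t] by (simp only: prod_constant)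
  qed
  finally have "?A * ?B \<le> (5 * K\<^sup>2) ^ ?h * (\<Prod>p\<in>?P. t p) * ?B" by (rule mult_right_mono) (rule B0)
  also have "\<dots> = (5 * K\<^sup>2) ^ ?h * (\<Prod>p\<in>?P. t p * (sqrt (d (fst p)) * sqrt (d (snd p)) / sqrt (real k) + 1))"
    by (simp only: prod.distrib mult.assoc)
  also have "\<dots> \<le> (5 * K\<^sup>2) ^ ?h * (\<Prod>p\<in>?P. 2 * K\<^sup>2 * (sqrt (real k) * real m))"
  proof (intro mult_left_mono prod_mono conjI)
    fix p assume "p \<in> ?P"
    show "0 \<le> t p * (sqrt (d (fst p)) * sqrt (d (snd p)) / sqrt (real k) + 1)"
      using nn t1[of p] by (intro mult_nonneg_nonneg add_nonneg_nonneg divide_nonneg_nonneg) auto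
  qed (use b in auto)
  also have "(\<Prod>p\<in>?P. 2 * K\<^sup>2 * (sqrt (real k) * real m)) = (2 * K\<^sup>2) ^ ?cs * (sqrt (real k) * real m) ^ ?cs"
    by (simp only: prod_constant card_P power_mult_distrib)
  finally have AB: "?A * ?B \<le> (5 * K\<^sup>2) ^ ?h * ((2 * K\<^sup>2) ^ ?cs * (sqrt (real k) * real m) ^ ?cs)" .
  have "?C \<le> (\<Prod>i\<in>(UNIV :: 'n set). 2 * K * sqrt (real k))"
    using c nn by (intro prod_mono) (auto intro!: add_nonneg_nonneg divide_nonneg_nonneg)
  also have "\<dots> = (2 * K) ^ ?g * sqrt (real k) ^ ?g" by (simp only: prod_constant power_mult_distrib)
  finally have C: "?C \<le> (2 * K) ^ ?g * sqrt (real k) ^ ?g" .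
  have "((2 * (2 * K)\<^sup>2 + 1) ^ ?h * (?A * ?B)) * ((2 * sqrt K + 1) ^ ?g * ?C)
    \<le> ((2 * (2 * K)\<^sup>2 + 1) ^ ?h * ((5 * K\<^sup>2) ^ ?h * ((2 * K\<^sup>2) ^ ?cs * (sqrt (real k) * real m) ^ ?cs)))
      * ((2 * sqrt K + 1) ^ ?g * ((2 * K) ^ ?g * sqrt (real k) ^ ?g))"
    using K C0 by (intro mult_mono[OF mult_left_mono[OF AB] mult_left_mono[OF C]]) auto
  then show ?thesis by (simp only: prod_constant mult_ac)
qed

section \<open>Unfolding over a fundamental domain\<close>

lemma differentiable_kconj_act:
  assumes M: "M \<in> Sp_int" and E: "E \<subseteq> coord_siegel"
  shows "kconj (jacobi_act M l u) differentiable_on E"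
  unfolding differentiable_on_def differentiable_def
  using has_derivative_kconj_act[OF M] E by blast

lemma nn_integral_absolutely_integrable:
  fixes h :: "'a::euclidean_space \<Rightarrow> real"
  assumes int: "h absolutely_integrable_on A" and h: "\<And>v. v \<in> A \<Longrightarrow> h v \<ge> 0"
  shows "(\<integral>\<^sup>+v. ennreal (h v) * indicator A v \<partial>lebesgue) = ennreal (integral A h)"
    and "(\<lambda>v. ennreal (h v) * indicator A v) \<in> borel_measurable lebesgue"
proof -
  have "h integrable_on A" using int by (simp add: absolutely_integrable_on_def)
  then have "(h has_integral integral A h) A" by (rule integrable_integral)
  then show "(\<integral>\<^sup>+v. ennreal (h v) * indicator A v \<partial>lebesgue) = ennreal (integral A h)"
    unfolding nn_integral_completion
    using nn_integral_has_integral_lebesgue'[where f = h and \<Omega> = A and I = "integral A h"] h by blast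
  have "(\<lambda>v. indicator A v *\<^sub>R h v) \<in> borel_measurable lebesgue"
    using int unfolding set_integrable_def by (rule borel_measurable_integrable)
  then have "(\<lambda>v. ennreal (indicator A v *\<^sub>R h v)) \<in> borel_measurable lebesgue" by simp
  also have "(\<lambda>v. ennreal (indicator A v *\<^sub>R h v)) = (\<lambda>v. ennreal (h v) * indicator A v)"
    by (auto simp: fun_eq_iff indicator_def)
  finally show "(\<lambda>v. ennreal (h v) * indicator A v) \<in> borel_measurable lebesgue" .
qed

text \<open>
  Almost every point of \<open>B\<close> lies in some \<open>E \<gamma>\<close>, the part that \<open>\<gamma>\<close> moves into \<open>F\<close>. By invariance the integral over \<open>E \<gamma>\<close> is
  that over its image \<open>W \<gamma>\<close>, and no point of \<open>F\<close> lies in more than \<open>N\<close> of the images.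
\<close>

lemma unfolding_bound:
  fixes F :: "'n::finite jacobi_point set" and h :: "real^('n jidx) \<Rightarrow> real"
  assumes F: "jacobi_fundamental_domain F" and B: "B \<in> sets borel" "B \<subseteq> coord_siegel"
    and h0: "\<And>v. v \<in> coord_siegel \<Longrightarrow> h v \<ge> 0"
    and inv: "\<And>M l u v. M \<in> Sp_int \<Longrightarrow> v \<in> coord_siegel \<Longrightarrow>
      h v = (det (im_mat (siegel_act M (fst (kap v)))) / det (im_mat (fst (kap v)))) ^ (CARD('n) + 2) * h (kconj (jacobi_act M l u) v)"
    and int: "h absolutely_integrable_on (kap -` F)"
    and N: "\<And>y. finite {(M, l, u). M \<in> Sp_int \<and> (\<exists>v\<in>B. jacobi_act M l u (kap v) = y)}
      \<and> real (card {(M, l, u). M \<in> Sp_int \<and> (\<exists>v\<in>B. jacobi_act M l u (kap v) = y)}) \<le> N"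
  shows "(\<integral>\<^sup>+v. ennreal (h v) * indicator B v \<partial>lborel) \<le> ennreal N * ennreal (integral (kap -` F) h)"
proof -
  define F' where "F' = kap -` F"
  define G where "G = {\<gamma> :: (int^('n+'n)^('n+'n)) \<times> (int^'n) \<times> (int^'n). fst \<gamma> \<in> Sp_int}"
  define ac where "ac \<gamma> = kconj (jacobi_act (fst \<gamma>) (fst (snd \<gamma>)) (snd (snd \<gamma>)))" for \<gamma> :: "(int^('n+'n)^('n+'n)) \<times> (int^'n) \<times> (int^'n)"
  define E where "E \<gamma> = {v \<in> B. ac \<gamma> v \<in> F'}" for \<gamma>
  define W where "W \<gamma> = ac \<gamma> ` E \<gamma>" for \<gamma>
  have N0: "N \<ge> 0" using N[of undefined] of_nat_0_le_iff order_trans by blast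
  have Fb: "F \<in> sets borel" and Fs: "F \<subseteq> siegel_jacobi"
    and cover: "AE p in jacobi_lebesgue. p \<in> siegel_jacobi \<longrightarrow> (\<exists>M\<in>Sp_int. \<exists>l u. jacobi_act M l u p \<in> F)"
    using F unfolding jacobi_fundamental_domain_def by auto
  have F'b: "F' \<in> sets borel" unfolding F'_def using measurable_sets[OF measurable_kap Fb] by simp
  have F's: "F' \<subseteq> coord_siegel" unfolding F'_def coord_siegel_def using Fs by auto
  have kac: "kap (ac \<gamma> v) = jacobi_act (fst \<gamma>) (fst (snd \<gamma>)) (snd (snd \<gamma>)) (kap v)"
    if "\<gamma> \<in> G" "v \<in> coord_siegel" for \<gamma> v
    using that unfolding ac_def kconj_def G_def coord_siegel_def
    by (simp add: kap_kinv siegel_jacobi_symsp jacobi_act_in)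
  have Eb: "E \<gamma> \<in> sets borel" if "\<gamma> \<in> G" for \<gamma>
  proof -
    have "ac \<gamma> differentiable_on B" unfolding ac_def by (rule differentiable_kconj_act[OF _ B(2)]) (use that G_def in auto)
    then have "ac \<gamma> \<in> borel_measurable (restrict_space borel B)"
      by (intro borel_measurable_continuous_on_restrict differentiable_imp_continuous_on)
    from measurable_sets[OF this F'b] have "ac \<gamma> -` F' \<inter> space (restrict_space borel B) \<in> sets (restrict_space borel B)" .
    also have "ac \<gamma> -` F' \<inter> space (restrict_space borel B) = E \<gamma>" by (auto simp: E_def space_restrict_space)
    finally show ?thesis using B(1) by (simp add: sets_restrict_space_iff)
  qed
  have EB: "E \<gamma> \<subseteq> coord_siegel" for \<gamma> using B(2) by (auto simp: E_def)
  have WF: "W \<gamma> \<subseteq> F'" for \<gamma> by (auto simp: W_def E_def)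
  have Wl: "W \<gamma> \<in> sets lebesgue" if "\<gamma> \<in> G" for \<gamma>
    unfolding W_def
  proof (rule differentiable_image_in_sets_lebesgue)
    show "E \<gamma> \<in> sets lebesgue" using Eb[OF that] by simp
    show "ac \<gamma> differentiable_on E \<gamma>" unfolding ac_def by (rule differentiable_kconj_act[OF _ EB]) (use that G_def in auto)
  qed simp
  have hW: "h absolutely_integrable_on W \<gamma>" if "\<gamma> \<in> G" for \<gamma>
    by (rule set_integrable_subset[OF int[folded F'_def] Wl[OF that] WF])
  have cv: "h absolutely_integrable_on E \<gamma> \<and> integral (E \<gamma>) h = integral (W \<gamma>) h" if \<gamma>: "\<gamma> \<in> G" for \<gamma>
    unfolding W_def ac_def
  proof (rule change_of_variables_jacobi)
    show "fst \<gamma> \<in> Sp_int" using \<gamma> by (simp add: G_def)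
    then show "h v = (det (im_mat (siegel_act (fst \<gamma>) (fst (kap v)))) / det (im_mat (fst (kap v)))) ^ (CARD('n) + 2) * h (kconj (jacobi_act (fst \<gamma>) (fst (snd \<gamma>)) (snd (snd \<gamma>))) v)"
      if "v \<in> E \<gamma>" for v by (rule inv) (use that EB in blast)
    show "E \<gamma> \<in> sets lebesgue" using Eb[OF \<gamma>] by simp
    show "E \<gamma> \<subseteq> coord_siegel" by (rule EB)
    show "h absolutely_integrable_on kconj (jacobi_act (fst \<gamma>) (fst (snd \<gamma>)) (snd (snd \<gamma>))) ` E \<gamma>"
      using hW[OF \<gamma>] unfolding W_def ac_def .
  qed
  have hE0: "h v \<ge> 0" if "v \<in> E \<gamma>" for \<gamma> v by (rule h0) (use that EB in blast)
  have hF0: "h v \<ge> 0" if "v \<in> F'" for v by (rule h0) (use that F's in blast)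
  have hW0: "h v \<ge> 0" if "v \<in> W \<gamma>" for \<gamma> v by (rule hF0) (use that WF in blast)
  have cG: "countable G" by simp
  have "AE v in lborel. kap v \<in> siegel_jacobi \<longrightarrow> (\<exists>M\<in>Sp_int. \<exists>l u. jacobi_act M l u (kap v) \<in> F)"
    by (rule AE_distrD[OF _ cover[unfolded jacobi_lebesgue_eq]]) simp
  then have AE: "AE v in lebesgue. kap v \<in> siegel_jacobi \<longrightarrow> (\<exists>M\<in>Sp_int. \<exists>l u. jacobi_act M l u (kap v) \<in> F)"
    by (rule AE_completion)
  have "(\<integral>\<^sup>+v. ennreal (h v) * indicator B v \<partial>lborel) = (\<integral>\<^sup>+v. ennreal (h v) * indicator B v \<partial>lebesgue)"
    by (rule nn_integral_completion[symmetric])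
  also have "\<dots> \<le> (\<integral>\<^sup>+v. \<integral>\<^sup>+\<gamma>. ennreal (h v) * indicator (E \<gamma>) v \<partial>count_space G \<partial>lebesgue)"
  proof (rule nn_integral_mono_AE)
    show "AE v in lebesgue. ennreal (h v) * indicator B v \<le> (\<integral>\<^sup>+\<gamma>. ennreal (h v) * indicator (E \<gamma>) v \<partial>count_space G)"
      using AE
    proof eventually_elim
      case (elim v)
      show ?case
      proof (cases "v \<in> B")
        case True
        then have v: "v \<in> coord_siegel" using B(2) by blast
        then have "kap v \<in> siegel_jacobi" by (simp add: coord_siegel_def)
        then obtain M l u where M: "M \<in> Sp_int" "jacobi_act M l u (kap v) \<in> F" using elim by blast
        have \<gamma>: "(M, l, u) \<in> G" using M by (simp add: G_def)
        have "v \<in> E (M, l, u)" using True M(2) kac[OF \<gamma> v] by (simp add: E_def F'_def)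
        then have "ennreal (h v) * indicator B v \<le> ennreal (h v) * indicator (E (M, l, u)) v" using True by simp
        also have "\<dots> \<le> (\<integral>\<^sup>+\<gamma>. ennreal (h v) * indicator (E \<gamma>) v \<partial>count_space G)"
          by (rule nn_integral_ge_point[OF \<gamma>])
        finally show ?thesis .
      qed simp
    qed
  qed
  also have "\<dots> = (\<integral>\<^sup>+\<gamma>. \<integral>\<^sup>+v. ennreal (h v) * indicator (E \<gamma>) v \<partial>lebesgue \<partial>count_space G)"
    by (rule nn_integral_count_space_nn_integral[OF cG]) (rule nn_integral_absolutely_integrable(2)[OF conjunct1[OF cv] hE0])
  also have "\<dots> = (\<integral>\<^sup>+\<gamma>. \<integral>\<^sup>+v. ennreal (h v) * indicator (W \<gamma>) v \<partial>lebesgue \<partial>count_space G)"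
  proof (rule nn_integral_cong)
    fix \<gamma> assume "\<gamma> \<in> space (count_space G)"
    then have \<gamma>: "\<gamma> \<in> G" by simp
    have "(\<integral>\<^sup>+v. ennreal (h v) * indicator (E \<gamma>) v \<partial>lebesgue) = ennreal (integral (E \<gamma>) h)"
      by (rule nn_integral_absolutely_integrable(1)[OF conjunct1[OF cv[OF \<gamma>]] hE0])
    also have "\<dots> = ennreal (integral (W \<gamma>) h)" using cv[OF \<gamma>] by simp
    also have "\<dots> = (\<integral>\<^sup>+v. ennreal (h v) * indicator (W \<gamma>) v \<partial>lebesgue)"
      by (rule nn_integral_absolutely_integrable(1)[OF hW[OF \<gamma>] hW0, symmetric])
    finally show "(\<integral>\<^sup>+v. ennreal (h v) * indicator (E \<gamma>) v \<partial>lebesgue) = (\<integral>\<^sup>+v. ennreal (h v) * indicator (W \<gamma>) v \<partial>lebesgue)" .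
  qed
  also have "\<dots> = (\<integral>\<^sup>+v. \<integral>\<^sup>+\<gamma>. ennreal (h v) * indicator (W \<gamma>) v \<partial>count_space G \<partial>lebesgue)"
    by (rule nn_integral_count_space_nn_integral[OF cG, symmetric]) (rule nn_integral_absolutely_integrable(2)[OF hW hW0])
  also have "\<dots> \<le> (\<integral>\<^sup>+v. ennreal N * (ennreal (h v) * indicator F' v) \<partial>lebesgue)"
  proof (rule nn_integral_mono)
    fix y
    let ?\<Gamma> = "{\<gamma> \<in> G. y \<in> W \<gamma>}"
    have "(\<integral>\<^sup>+\<gamma>. ennreal (h y) * indicator (W \<gamma>) y \<partial>count_space G) = (\<integral>\<^sup>+\<gamma>. ennreal (h y) * indicator ?\<Gamma> \<gamma> \<partial>count_space G)"
      by (rule nn_integral_cong) (auto simp: indicator_def)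
    also have "\<dots> = ennreal (h y) * emeasure (count_space G) ?\<Gamma>" by (rule nn_integral_cmult_indicator) simp
    also have "\<dots> \<le> ennreal N * (ennreal (h y) * indicator F' y)"
    proof (cases "y \<in> F'")
      case True
      let ?S = "{(M, l, u). M \<in> Sp_int \<and> (\<exists>v\<in>B. jacobi_act M l u (kap v) = kap y)}"
      have sub: "?\<Gamma> \<subseteq> ?S"
      proof
        fix \<gamma> assume "\<gamma> \<in> ?\<Gamma>"
        then obtain v where \<gamma>: "\<gamma> \<in> G" and v: "v \<in> E \<gamma>" "y = ac \<gamma> v" unfolding W_def by blast
        have "kap y = jacobi_act (fst \<gamma>) (fst (snd \<gamma>)) (snd (snd \<gamma>)) (kap v)"
          unfolding v(2) using kac[OF \<gamma>, of v] v(1) EB by blast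
        then show "\<gamma> \<in> ?S" using \<gamma> v(1) by (cases \<gamma>) (auto simp: G_def E_def)
      qed
      have fin: "finite ?\<Gamma>" using finite_subset[OF sub] N[of "kap y"] by blast
      have "card ?\<Gamma> \<le> card ?S" using card_mono[OF _ sub] N[of "kap y"] by blast
      then have "real (card ?\<Gamma>) \<le> N" using N[of "kap y"] by (meson of_nat_le_iff order_trans)
      then have "ennreal (real (card ?\<Gamma>)) \<le> ennreal N" by (rule ennreal_leI)
      moreover have "emeasure (count_space G) ?\<Gamma> = ennreal (real (card ?\<Gamma>))"
        using fin by (subst emeasure_count_space_finite) (auto simp: ennreal_of_nat_eq_real_of_nat)
      ultimately have "emeasure (count_space G) ?\<Gamma> \<le> ennreal N" by simp
      then have "ennreal (h y) * emeasure (count_space G) ?\<Gamma> \<le> ennreal (h y) * ennreal N" by (rule mult_left_mono) simp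
      then show ?thesis using True by (simp add: mult.commute)
    next
      case False
      then have none: "?\<Gamma> = {}" using WF by blast
      show ?thesis unfolding none by simp
    qed
    finally show "(\<integral>\<^sup>+\<gamma>. ennreal (h y) * indicator (W \<gamma>) y \<partial>count_space G) \<le> ennreal N * (ennreal (h y) * indicator F' y)" .
  qed
  also have "\<dots> = ennreal N * (\<integral>\<^sup>+v. ennreal (h v) * indicator F' v \<partial>lebesgue)"
    by (rule nn_integral_cmult) (rule nn_integral_absolutely_integrable(2)[OF int[folded F'_def] hF0])
  also have "(\<integral>\<^sup>+v. ennreal (h v) * indicator F' v \<partial>lebesgue) = ennreal (integral F' h)"
    by (rule nn_integral_absolutely_integrable(1)[OF int[folded F'_def] hF0])
  finally show ?thesis unfolding F'_def .
qed

text \<open>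
  The Bochner integral of a function that is not integrable is 0 by convention, so the normalization
  contains integrability.
\<close>

lemma petersson_normalized:
  fixes F :: "'n::finite jacobi_point set"
  assumes F: "F \<in> sets borel" and one: "petersson_inner F k m \<phi> \<phi> = 1"
  defines "h \<equiv> \<lambda>v. petersson_norm_sq k m \<phi> (kap v) / det (im_mat (fst (kap v))) ^ (CARD('n) + 2)"
  shows "h absolutely_integrable_on (kap -` F)" "integral (kap -` F) h = 1"
proof -
  define f where "f p = indicator F p *\<^sub>R (\<phi> p * cnj (\<phi> p) * of_real (petersson_weight k m p / det (im_mat (fst p)) ^ (CARD('n) + 2)))" for p
  have one': "integral\<^sup>L jacobi_lebesgue f = 1" using one unfolding petersson_inner_def set_lebesgue_integral_def f_def .
  have int: "integrable jacobi_lebesgue f" using not_integrable_integral_eq[of jacobi_lebesgue f] one' by fastforce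
  then have fm: "f \<in> borel_measurable borel"
    using borel_measurable_integrable[OF int] unfolding jacobi_lebesgue_eq by simp
  have fk: "f (kap v) = complex_of_real (indicator (kap -` F) v *\<^sub>R h v)" for v
    by (simp add: f_def h_def petersson_norm_sq_def complex_norm_square[symmetric] indicator_def)
  have kapm: "kap \<in> measurable lborel borel" by simp
  have i1: "integrable lborel (\<lambda>v. f (kap v))"
    using int unfolding jacobi_lebesgue_eq integrable_distr_eq[OF kapm fm] .
  have i2: "integral\<^sup>L lborel (\<lambda>v. f (kap v)) = 1"
    using one' unfolding jacobi_lebesgue_eq integral_distr[OF kapm fm] .
  have r1: "integrable lborel (\<lambda>v. indicator (kap -` F) v *\<^sub>R h v)"
    using i1 unfolding fk complex_of_real_integrable_eq .
  have r2: "integral\<^sup>L lborel (\<lambda>v. indicator (kap -` F) v *\<^sub>R h v) = 1"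
    using i2 unfolding fk integral_complex_of_real by (simp only: of_real_eq_1_iff)
  show ai: "h absolutely_integrable_on (kap -` F)"
    unfolding set_integrable_def using integrable_completion[OF borel_measurable_integrable[OF r1]] r1 by simp
  have "integral (kap -` F) h = (LINT v : kap -` F | lebesgue. h v)" by (rule set_lebesgue_integral_eq_integral(2)[OF ai, symmetric])
  also have "\<dots> = integral\<^sup>L lborel (\<lambda>v. indicator (kap -` F) v *\<^sub>R h v)"
    unfolding set_lebesgue_integral_def by (rule integral_completion[OF borel_measurable_integrable[OF r1]])
  finally show "integral (kap -` F) h = 1" using r2 by simp
qed

theorem theorem3p3:
  fixes \<epsilon> :: real
  assumes "\<epsilon> > 0"
  shows "\<exists>C>0. \<forall>(k::nat) (m::nat). k \<ge> CARD('n::finite) + 1 \<longrightarrow> m \<ge> 1 \<longrightarrow>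
    (\<forall>(F :: 'n jacobi_point set) \<phi>.
       jacobi_fundamental_domain F \<longrightarrow>
       \<phi> \<in> jacobi_cusp_forms k m \<longrightarrow>
       petersson_inner F k m \<phi> \<phi> = 1 \<longrightarrow>
       sup_norm_sq k m \<phi>
         \<le> ennreal (C * real k powr ((3 * real CARD('n) ^ 2 + 5 * real CARD('n)) / 4)
                      * real m powr (2 * real CARD('n) ^ 2 + 5 * real CARD('n) / 2 + \<epsilon>)))"
proof -
  let ?g = "CARD('n)" and ?cs = "card (sym_coords :: 'n set set)"
  obtain K :: real where K: "K \<ge> 1" and decay:
    "\<And>k m (\<phi> :: 'n jacobi_point \<Rightarrow> complex) B p. \<lbrakk>k \<ge> 1; m \<ge> 1; \<phi> \<in> jacobi_cusp_forms k m;
       \<forall>q. good K k m q \<longrightarrow> petersson_norm_sq k m \<phi> q \<le> B; p \<in> siegel_jacobi\<rbrakk> \<Longrightarrow> petersson_norm_sq k m \<phi> p \<le> B"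
    by (rule decay[where 'n = 'n], rule that)
  define \<rho> where "\<rho> = 1 / (2 * real ?g * K)"
  define C1 where "C1 = exp ((real ?g)\<^sup>2 / 2 + 2 * pi) * ((2 * K) ^ ?g) ^ (?g + 2) / (\<rho>\<^sup>2) ^ (?cs + ?g)"
  define C2 where "C2 = (2 * (2 * K)\<^sup>2 + 1) ^ CARD('n \<times> 'n) * (5 * K\<^sup>2) ^ CARD('n \<times> 'n) * (2 * K\<^sup>2) ^ ?cs
      * (2 * sqrt K + 1) ^ ?g * (2 * K) ^ ?g"
  have \<rho>0: "\<rho> > 0" using K by (simp add: \<rho>_def)
  have C10: "C1 > 0" unfolding C1_def using K \<rho>0 by simp
  have K21: "2 * (2 * K)\<^sup>2 + 1 > 0" "2 * sqrt K + 1 > 0" using K by (auto intro!: add_nonneg_pos)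
  have C20: "C2 > 0" unfolding C2_def using K K21 by simp
  show ?thesis
  proof (intro exI[of _ "C1 * C2"] conjI allI impI)
    show "C1 * C2 > 0" using C10 C20 by simp
    fix k m :: nat and F :: "'n jacobi_point set" and \<phi> :: "'n jacobi_point \<Rightarrow> complex"
    assume kg: "k \<ge> ?g + 1" and m: "m \<ge> 1" and F: "jacobi_fundamental_domain F"
      and \<phi>: "\<phi> \<in> jacobi_cusp_forms k m" and one: "petersson_inner F k m \<phi> \<phi> = 1"
    have k: "k \<ge> 1" using kg by simp
    have hol: "jacobi_holomorphic \<phi>" and inv: "jacobi_invariant k m \<phi>" using \<phi> by (auto simp: jacobi_cusp_forms_def)
    have kr: "real k \<ge> 1" "real m \<ge> 1" using k m by simp_all
    define X where "X = real k ^ ?cs * real m ^ ?g"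
    define Y where "Y = (sqrt (real k) * real m) ^ ?cs * sqrt (real k) ^ ?g"
    define h where "h v = petersson_norm_sq k m \<phi> (kap v) / det (im_mat (fst (kap v))) ^ (?g + 2)" for v
    have Fb: "F \<in> sets borel" using F by (simp add: jacobi_fundamental_domain_def)
    note norm = petersson_normalized[OF Fb one, folded h_def]
    have good: "petersson_norm_sq k m \<phi> p \<le> C1 * X * (C2 * Y)" if p: "good K k m p" for p
    proof -
      obtain d where d: "\<And>i. 0 < d i" "\<And>i. 1 \<le> K * d i" "\<And>i. d i \<le> K * real k * real m"
        and o: "\<And>a b. rk a \<le> rk b \<Longrightarrow> d a \<le> K * d b" and c: "comparable K d (im_mat (fst p))" and ps: "p \<in> siegel_jacobi"
        using p unfolding good_def by blast
      define a where "a = matrix_inv (im_mat (fst p)) *v im_vec (snd p)"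
      define B where "B = {v. v - kinv p \<in> kap -` pdisc \<rho> k m d a}"
      have pv: "p + kap (v - kinv p) = kap v" for v by (simp add: linear_diff[OF linear_kap] kap_kinv[OF siegel_jacobi_symsp[OF ps]])
      have "closed B"
      proof -
        have "B = (+) (kinv p) ` (kap -` pdisc \<rho> k m d a)"
          by (auto simp: B_def image_iff intro!: bexI[of _ "_ - kinv p"])
        then show ?thesis by (simp add: closed_translation closed_pdisc)
      qed
      then have Bb: "B \<in> sets borel" by simp
      have Bs: "B \<subseteq> coord_siegel"
      proof
        fix v assume "v \<in> B"
        then have "kap (v - kinv p) \<in> pdisc (1 / (2 * real ?g * K)) k m d a" by (simp add: B_def \<rho>_def)
        from pdisc_shift(1)[OF ps d(1) c K k this] show "v \<in> coord_siegel" unfolding pv coord_siegel_def by simp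
      qed
      have pd: "pos_def (im_mat (fst (kap v)))" if "v \<in> coord_siegel" for v :: "real^('n jidx)"
        using that siegelD(2) unfolding coord_siegel_def siegel_jacobi_def mem_Times_iff mem_Collect_eq by blast
      have h0: "h v \<ge> 0" if "v \<in> coord_siegel" for v
        using pos_def_det_pos[OF pd[OF that]] petersson_weight_pos[of "kap v" k m] that
        unfolding h_def petersson_norm_sq_def coord_siegel_def by simp
      have hinv: "h v = (det (im_mat (siegel_act M (fst (kap v)))) / det (im_mat (fst (kap v)))) ^ (?g + 2) * h (kconj (jacobi_act M l u) v)"
        if M: "M \<in> Sp_int" and v: "v \<in> coord_siegel" for M l u v
      proof -
        have vs: "kap v \<in> siegel_jacobi" using v by (simp add: coord_siegel_def)
        have kv: "kap (kconj (jacobi_act M l u) v) = jacobi_act M l u (kap v)"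
          unfolding kconj_def by (rule kap_kinv[OF siegel_jacobi_symsp[OF jacobi_act_in[OF M vs]]])
        have f1: "fst (jacobi_act M l u (kap v)) = siegel_act M (fst (kap v))" by (simp add: jacobi_act_def case_prod_beta)
        have "fst (kap v) \<in> siegel_space" using vs unfolding siegel_jacobi_def mem_Times_iff by blast
        then have "det (im_mat (siegel_act M (fst (kap v)))) > 0" by (intro pos_def_det_pos siegelD(2) siegel_act_in M)
        then show ?thesis
          unfolding h_def kv f1 petersson_norm_sq_invariant[OF inv M vs] by (simp add: power_divide)
      qed
      let ?N = "C2 * Y"
      have cnt: "finite {(M, l, u). M \<in> Sp_int \<and> (\<exists>v\<in>B. jacobi_act M l u (kap v) = y)}
        \<and> real (card {(M, l, u). M \<in> Sp_int \<and> (\<exists>v\<in>B. jacobi_act M l u (kap v) = y)}) \<le> ?N" for y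
      proof -
        let ?S = "{(M, l, u). M \<in> Sp_int \<and> (\<exists>v\<in>B. jacobi_act M l u (kap v) = y)}"
        let ?S' = "{(M, l, u). M \<in> Sp_int \<and> (\<exists>q\<in>pdisc (1 / (2 * real ?g * K)) k m d a. jacobi_act M l u (p + q) = y)}"
        have sub: "?S \<subseteq> ?S'"
        proof clarify
          fix M :: "int^('n+'n)^('n+'n)" and l u :: "int^'n" and v assume M: "M \<in> Sp_int" and v: "v \<in> B"
          show "\<exists>q\<in>pdisc (1 / (2 * real ?g * K)) k m d a. jacobi_act M l u (p + q) = jacobi_act M l u (kap v)"
            using v by (intro bexI[of _ "kap (v - kinv p)"]) (simp_all only: pv B_def \<rho>_def mem_Collect_eq vimage_eq)
        qed
        note cg = count_group[OF ps d(1,2) K c k m, where a = a and y = y]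
        have S'N: "real (card ?S') \<le> ?N"
          by (rule order_trans[OF conjunct2[OF cg]], unfold C2_def Y_def, rule count_bound[OF d(1,3) o d(2) K k m])
        have "card ?S \<le> card ?S'" by (rule card_mono[OF conjunct1[OF cg] sub])
        then show ?thesis using S'N finite_subset[OF sub conjunct1[OF cg]] by (meson of_nat_le_iff order_trans)
      qed
      have "ennreal (petersson_norm_sq k m \<phi> p) \<le> ennreal (C1 * X) * (\<integral>\<^sup>+v. ennreal (h v) * indicator B v \<partial>lborel)"
        using submean_bound[OF hol ps d(1) c K k m] unfolding C1_def X_def h_def B_def \<rho>_def a_def by simp
      also have "\<dots> \<le> ennreal (C1 * X) * (ennreal ?N * ennreal (integral (kap -` F) h))"
        by (rule mult_left_mono, rule unfolding_bound[OF F Bb Bs h0 hinv norm(1) cnt], simp_all)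
      also have "\<dots> = ennreal (C1 * X * ?N)"
        unfolding norm(2) using C10 by (simp add: ennreal_mult'[symmetric] X_def)
      finally show ?thesis
        using C10 C20 by (subst (asm) ennreal_le_iff) (auto simp: X_def Y_def)
    qed
    have cs: "real ?cs = real ?g * (real ?g + 1) / 2"
    proof -
      have "real (2 * ?cs) = real (?g * (?g + 1))" by (simp only: card_sym_coords)
      then show ?thesis by (simp add: field_simps)
    qed
    have XY: "C1 * X * (C2 * Y) \<le> C1 * C2 * real k powr ((3 * real ?g ^ 2 + 5 * real ?g) / 4)
                      * real m powr (2 * real ?g ^ 2 + 5 * real ?g / 2 + \<epsilon>)"
    proof -
      have pk: "real k ^ n = real k powr real n" "real m ^ n = real m powr real n" "sqrt (real k) ^ n = real k powr (real n / 2)" for n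
      proof -
        show "real k ^ n = real k powr real n" "real m ^ n = real m powr real n" using kr by (simp_all add: powr_realpow)
        have "sqrt (real k) ^ n = (real k powr (1 / 2)) powr real n" using kr by (simp add: powr_realpow powr_half_sqrt)
        then show "sqrt (real k) ^ n = real k powr (real n / 2)" by (simp add: powr_powr)
      qed
      have "X * Y = (real k ^ ?cs * (sqrt (real k) ^ ?cs * sqrt (real k) ^ ?g)) * (real m ^ ?g * real m ^ ?cs)"
        unfolding X_def Y_def by (simp add: power_mult_distrib)
      also have "\<dots> = real k powr (real ?cs + (real ?cs / 2 + real ?g / 2)) * real m powr (real ?g + real ?cs)"
        unfolding pk powr_add ..
      also have "real ?cs + (real ?cs / 2 + real ?g / 2) = (3 * real ?g ^ 2 + 5 * real ?g) / 4"
        unfolding cs by (simp add: field_simps power2_eq_square)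
      also have "real m powr (real ?g + real ?cs) \<le> real m powr (2 * real ?g ^ 2 + 5 * real ?g / 2 + \<epsilon>)"
      proof (rule powr_mono[OF _ kr(2)])
        have "x + (y + x) / 2 \<le> 2 * y + 5 * x / 2 + \<epsilon>" if "0 \<le> x" "0 \<le> y" for x y :: real
          using that assms by (simp add: field_simps)
        from this[of "real ?g" "real ?g * real ?g"]
        have "real ?g + (real ?g * real ?g + real ?g) / 2 \<le> 2 * (real ?g * real ?g) + 5 * real ?g / 2 + \<epsilon>" by simp
        then show "real ?g + real ?cs \<le> 2 * real ?g ^ 2 + 5 * real ?g / 2 + \<epsilon>"
          unfolding cs by (simp add: algebra_simps power2_eq_square)
      qed
      finally have "X * Y \<le> real k powr ((3 * real ?g ^ 2 + 5 * real ?g) / 4) * real m powr (2 * real ?g ^ 2 + 5 * real ?g / 2 + \<epsilon>)"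
        by (simp add: mult_left_mono)
      from mult_left_mono[OF this, of "C1 * C2"] C10 C20 show ?thesis by (simp add: mult_ac)
    qed
    have "petersson_norm_sq k m \<phi> p \<le> C1 * C2 * real k powr ((3 * real ?g ^ 2 + 5 * real ?g) / 4)
                      * real m powr (2 * real ?g ^ 2 + 5 * real ?g / 2 + \<epsilon>)" if "p \<in> siegel_jacobi" for p
      using decay[OF k m \<phi> _ that] good XY by (meson order_trans)
    then show "sup_norm_sq k m \<phi>
         \<le> ennreal (C1 * C2 * real k powr ((3 * real ?g ^ 2 + 5 * real ?g) / 4)
                      * real m powr (2 * real ?g ^ 2 + 5 * real ?g / 2 + \<epsilon>))"
      unfolding sup_norm_sq_def by (intro SUP_least ennreal_leI)
  qed
qed

end
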